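(* Under the random design setting and assumptions described in the context, let $\tau^{cv}$ be the thresholding level chosen by $L$-fold cross-validation for the truncated NCT estimator and $\tau^{oracle}$ its oracle counterpart, as defined in the context. Then, with probability at least $1-\delta$, $$\frac1L\sum_{l=1}^L\mathsf{PE}(\widehat{\boldsymbol\beta}^{(l)}_{\tau^{cv}})\lesssim\frac1L\sum_{l=1}^L\mathsf{PE}(\widehat{\boldsymbol\beta}^{(l)}_{\tau^{oracle}})+\left(\|\mathbf\Sigma\|\|\boldsymbol\beta\|_2^2+\sigma^2(\log(2r/\delta))^{2/\alpha}\right)\left(\sqrt{\frac{L\log(Lr/\delta)}{n}}+\frac{L(\log(Lr/\delta))^{2/\alpha}}{n}\right).$$
   Context: Random design linear regression: $y_i=\mathbf x_i^\top\boldsymbol\beta+\varepsilon_i$, $i\in[n]=\{1,\dots,n\}$, where $\boldsymbol\beta\in\mathbb R^d$ is unknown and $\mathbf x_i$ are independent copies of a mean zero vector $\mathbf x\in\mathbb R^d$ with covariance $\mathbf\Sigma=\mathbb E[\mathbf x\mathbf x^\top]$ having eigenvalues $\lambda_1\ge\dots\ge\lambda_d$. The noise variables $\varepsilon_i$ are i.i.d. with mean zero. $\mathbb X\in\mathbb R^{n\times d}$ has rows $\mathbf x_i^\top$, $\mathbb Y=(y_i)$, $\boldsymbol\varepsilon=(\varepsilon_i)$, so $\mathbb Y=\mathbb X\boldsymbol\beta+\boldsymbol\varepsilon$. $(\mathbf x,y)$ denotes a fresh independent pair from the same model. $\mathsf{r^{eff}}[\mathbf\Sigma]=\mathrm{Tr}[\mathbf\Sigma]/\|\mathbf\Sigma\|$,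 with $\|\cdot\|$ the spectral norm. Assume $\boldsymbol\beta^\top\mathbf\Sigma\boldsymbol\beta>0$. Assumptions. 1. (Sub-Weibull noise) $\boldsymbol\varepsilon$ is independent of $\mathbb X$, and there are $0<\alpha\le2$, $0<\sigma<\infty$ with $\sup_{\|\mathbf w\|_2=1}\|\mathbf w^\top\boldsymbol\varepsilon\|_{\psi_\alpha}\le\sigma$, where $\|X\|_{\psi_\alpha}=\inf\{s>0:\mathbb E[e^{(|X|/s)^\alpha}-1]\le1\}$. 2. (Sub-Gaussian covariates) $\mathbf\Sigma^{-1/2}\mathbf x$ is sub-Gaussian (its sub-Gaussian norm is treated as an absolute constant). 3. (Convex decay) There is a convex decreasing function $\lambda(\cdot)$ with $\lambda_j=\lambda(j)$ for $j\in[d]$; the eigenvalues are thus simple. 4. (Technical) $\mathsf{r^{eff}}[\mathbf\Sigma]\le n$, and $\delta\in(0,1)$ is such that $\epsilon=\sqrt{\log(d/\delta)/n}\le c$ for a suitable (sufficiently small) absolute constant $c>0$. Put $k^*=(\epsilon\log(1/\epsilon))^{-2/3}$. Let $\widehat{\mathbf\Sigma}=n^{-1}\mathbb X^\top\mathbb X$, $r=\mathrm{rank}(\widehat{\mathbf\Sigma})$, and $\widehat{\mathbf\Sigma}=\widehat{\mathbf U}\widehat{\mathbf\Lambda}^2\widehat{\mathbf U}^\top$, with $\widehat{\mathbf\Lambda}$ the $r\times r$ diagonal matrix of square roots of the nonzero eigenvalues in non-increasing order and $\widehat{\mathbf U}\in\mathbb R^{d\times r}$ the corresponding orthonormal eigenvectors.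 $\widehat{\mathbf\Lambda}_{\le k}$ is the leading $k\times k$ submatrix of $\widehat{\mathbf\Lambda}$ and $\widehat{\mathbf U}_{\le k}$ the first $k$ columns of $\widehat{\mathbf U}$ ($k^*$ is read as an integer index, with no truncation when it exceeds the rank). Truncated NCT estimator: $\widehat{\boldsymbol\beta}_\tau=\widehat{\mathbf U}_{\le k^*}\widehat{\mathbf\Lambda}_{\le k^*}^{-1}\,\mathsf{SOFT}_\tau\!\left[\widehat{\mathbf\Lambda}_{\le k^*}^{-1}\widehat{\mathbf U}_{\le k^*}^\top\frac{\mathbb X^\top\mathbb Y}{n}\right]$, with $\mathsf{SOFT}_\tau[z]=z\max(1-\tau/|z|,0)$ applied componentwise. Cross-validation: $\{\mathcal B_l\}_{l=1}^L$ is a partition of $[n]$ into $L$ disjoint blocks with $\lfloor n/L\rfloor\le|\mathcal B_l|\le\lfloor n/L\rfloor+1$. $\widehat{\boldsymbol\beta}^{(l)}_\tau$ is the truncated NCT estimator with thresholding level $\tau$ computed (including its sample covariance, eigenvalues and eigenvectors) on the subsample $\{(\mathbf x_i,y_i)\}_{i\in[n]\setminus\mathcal B_l}$. Define $$\tau^{cv}=\arg\min_{\tau\ge0}\frac1L\sum_{l=1}^L\frac1{|\mathcal B_l|}\sum_{i\in\mathcal B_l}\left(y_i-\mathbf x_i^\top\widehat{\boldsymbol\beta}^{(l)}_\tau\right)^2,\qquad \tau^{oracle}=\arg\min_{\tau\ge0}\frac1L\sum_{l=1}^L\mathbb E\left[\left(y-\mathbf x^\top\widehat{\boldsymbol\beta}^{(l)}_\tau\right)^2\right],$$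 where the expectation is over the fresh pair $(\mathbf x,y)$ only; equivalently $\tau^{oracle}$ minimizes $\frac1L\sum_{l}\mathsf{PE}(\widehat{\boldsymbol\beta}^{(l)}_\tau)$. $\mathsf{PE}(\widetilde{\boldsymbol\beta})=(\widetilde{\boldsymbol\beta}-\boldsymbol\beta)^\top\mathbf\Sigma(\widetilde{\boldsymbol\beta}-\boldsymbol\beta)$. $a\lesssim b$ means $a\le C'b$ for a constant $C'>0$, where $\alpha$ and the sub-Gaussian norm are regarded as absolute constants. *)

theory Defs
  imports
    "HOL-Probability.Probability"
    "Jordan_Normal_Form.Char_Poly"
    "Jordan_Normal_Form.DL_Rank"
begin

unbundle no inner_syntax
unbundle no vec_syntax

text \<open>
  Vectors and matrices are those of \<^theory>\<open>Jordan_Normal_Form.Matrix\<close>, so that the dimension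
  \<open>d\<close> is a term and constants can be quantified before it. Their indices start at \<open>0\<close>.
\<close>

subsection \<open>Linear algebra\<close>

definition l2norm :: "real vec \<Rightarrow> real" where
  "l2norm v = sqrt (v \<bullet> v)"

definition spectral_norm :: "real mat \<Rightarrow> real" where
  "spectral_norm A = (SUP v\<in>{v \<in> carrier_vec (dim_col A). l2norm v = 1}. l2norm (A *\<^sub>v v))"

definition mat_trace :: "real mat \<Rightarrow> real" where
  "mat_trace A = sum_list (diag_mat A)"

definition eff_rank :: "real mat \<Rightarrow> real" where
  "eff_rank A = mat_trace A / spectral_norm A"

definition psd_mat :: "nat \<Rightarrow> real mat \<Rightarrow> bool" where
  "psd_mat d A \<longleftrightarrow> A \<in> carrier_mat d d \<and> A\<^sup>T = A \<and> (\<forall>v\<in>carrier_vec d. v \<bullet> (A *\<^sub>v v) \<ge> 0)"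

text \<open>\<open>W\<close> is the matrix $S^{-1/2}$; its existence entails that \<open>S\<close> is invertible.\<close>

definition is_inv_sqrt_mat :: "nat \<Rightarrow> real mat \<Rightarrow> real mat \<Rightarrow> bool" where
  "is_inv_sqrt_mat d S W \<longleftrightarrow> psd_mat d W \<and> W * W * S = 1\<^sub>m d"

text \<open>
  The \<open>d\<close> eigenvalues, with multiplicity, are the values at \<open>1, \<dots>, d\<close> of a convex, strictly
  decreasing function.
\<close>

definition convex_decay :: "nat \<Rightarrow> real mat \<Rightarrow> bool" where
  "convex_decay d S \<longleftrightarrow> (\<exists>lam :: real \<Rightarrow> real.
     convex_on {1..real d} lam \<and> strict_antimono_on {1..real d} lam \<and>
     char_poly S = (\<Prod>j=1..d. [:- lam (real j), 1:]))"

subsection \<open>Random vectors\<close>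

definition borel_vec :: "nat \<Rightarrow> real vec measure" where
  "borel_vec d =
     vimage_algebra (carrier_vec d) (\<lambda>v. \<lambda>j\<in>{..<d}. v $ j) (PiM {..<d} (\<lambda>_. borel))"

definition borel_mat :: "nat \<Rightarrow> nat \<Rightarrow> real mat measure" where
  "borel_mat nr nc =
     vimage_algebra (carrier_mat nr nc) (\<lambda>A. \<lambda>ij\<in>{..<nr} \<times> {..<nc}. A $$ ij)
       (PiM ({..<nr} \<times> {..<nc}) (\<lambda>_. borel))"

text \<open>The value is \<open>\<infinity>\<close> if no \<open>s\<close> is admissible.\<close>

definition psi_norm :: "'w measure \<Rightarrow> real \<Rightarrow> ('w \<Rightarrow> real) \<Rightarrow> ennreal" where
  "psi_norm M a Z = Inf {ennreal s | s. s > 0 \<and>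
     (\<integral>\<^sup>+ \<omega>. ennreal (exp ((\<bar>Z \<omega>\<bar> / s) powr a) - 1) \<partial>M) \<le> 1}"

definition vec_psi_norm :: "'w measure \<Rightarrow> real \<Rightarrow> nat \<Rightarrow> ('w \<Rightarrow> real vec) \<Rightarrow> ennreal" where
  "vec_psi_norm M a m Z =
     (SUP w\<in>{w \<in> carrier_vec m. l2norm w = 1}. psi_norm M a (\<lambda>\<omega>. w \<bullet> Z \<omega>))"

definition covariance_mat :: "'w measure \<Rightarrow> nat \<Rightarrow> ('w \<Rightarrow> real vec) \<Rightarrow> real mat" where
  "covariance_mat M d x =
     Matrix.mat d d (\<lambda>(j, k). prob_space.expectation M (\<lambda>\<omega>. x \<omega> $ j * x \<omega> $ k))"

text \<open>
  The observations have the indices \<open>1, \<dots>, n\<close>. Index \<open>0\<close> is the generic (fresh) observation,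
  independent of them and with the same law.
\<close>

definition random_design_model ::
  "'w measure \<Rightarrow> nat \<Rightarrow> nat \<Rightarrow> real vec \<Rightarrow> (nat \<Rightarrow> 'w \<Rightarrow> real vec) \<Rightarrow> (nat \<Rightarrow> 'w \<Rightarrow> real)
     \<Rightarrow> (nat \<Rightarrow> 'w \<Rightarrow> real) \<Rightarrow> bool" where
  "random_design_model M n d \<beta> x e y \<longleftrightarrow>
     prob_space M \<and> \<beta> \<in> carrier_vec d \<and>
     prob_space.indep_vars M (\<lambda>_. borel_vec d) x {0..n} \<and>
     (\<forall>i\<in>{0..n}. distr M (borel_vec d) (x i) = distr M (borel_vec d) (x 0)) \<and>
     (\<forall>j<d. integrable M (\<lambda>\<omega>. (x 0 \<omega> $ j)\<^sup>2) \<and> prob_space.expectation M (\<lambda>\<omega>. x 0 \<omega> $ j) = 0) \<and>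
     prob_space.indep_vars M (\<lambda>_. borel) e {0..n} \<and>
     (\<forall>i\<in>{0..n}. distr M borel (e i) = distr M borel (e 0)) \<and>
     integrable M (e 0) \<and> prob_space.expectation M (e 0) = 0 \<and>
     prob_space.indep_set M
       (sets (vimage_algebra (space M) (\<lambda>\<omega>. \<lambda>i\<in>{0..n}. x i \<omega>) (PiM {0..n} (\<lambda>_. borel_vec d))))
       (sets (vimage_algebra (space M) (\<lambda>\<omega>. \<lambda>i\<in>{0..n}. e i \<omega>) (PiM {0..n} (\<lambda>_. borel)))) \<and>
     (\<forall>i\<in>{0..n}. \<forall>\<omega>\<in>space M. y i \<omega> = x i \<omega> \<bullet> \<beta> + e i \<omega>)"

definition pred_error :: "real mat \<Rightarrow> real vec \<Rightarrow> real vec \<Rightarrow> real" where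
  "pred_error S \<beta> b = (b - \<beta>) \<bullet> (S *\<^sub>v (b - \<beta>))"

subsection \<open>The truncated NCT estimator\<close>

definition stack :: "nat set \<Rightarrow> (nat \<Rightarrow> real) \<Rightarrow> real vec" where
  "stack I z = vec_of_list (map z (sorted_list_of_set I))"

definition design_mat :: "nat \<Rightarrow> nat set \<Rightarrow> (nat \<Rightarrow> real vec) \<Rightarrow> real mat" where
  "design_mat d I x = mat_of_rows d (map x (sorted_list_of_set I))"

definition sample_cov :: "nat \<Rightarrow> nat set \<Rightarrow> (nat \<Rightarrow> real vec) \<Rightarrow> real mat" where
  "sample_cov d I x = (1 / real (card I)) \<cdot>\<^sub>m ((design_mat d I x)\<^sup>T * design_mat d I x)"

text \<open>
  $S = U \Lambda^2 U^T$ with \<open>r = rank S\<close> orthonormal columns in \<open>U\<close> and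
  $\Lambda = \mathrm{diag}(s_0, \dots, s_{r-1})$.
\<close>

definition is_eigen_decomp :: "nat \<Rightarrow> real mat \<Rightarrow> real mat \<Rightarrow> (nat \<Rightarrow> real) \<Rightarrow> bool" where
  "is_eigen_decomp d S U s \<longleftrightarrow> (let r = vec_space.rank d S in
     U \<in> carrier_mat d r \<and> U\<^sup>T * U = 1\<^sub>m r \<and>
     (\<forall>i<r. s i > 0) \<and> (\<forall>i j. i \<le> j \<longrightarrow> j < r \<longrightarrow> s j \<le> s i) \<and>
     S = U * (mat_diag r s * mat_diag r s) * U\<^sup>T)"

text \<open>
  Eigenvectors are unique only up to sign, and not even that when a sample eigenvalue is repeated.
  The estimator therefore depends on a rule \<open>S \<mapsto> (U S, s S)\<close>, which can be any measurable one;
  entries of \<open>U S\<close> outside its \<open>rank S\<close> columns are read as \<open>0\<close>.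
\<close>

definition eigen_rule :: "nat \<Rightarrow> (real mat \<Rightarrow> real mat) \<Rightarrow> (real mat \<Rightarrow> nat \<Rightarrow> real) \<Rightarrow> bool" where
  "eigen_rule d U s \<longleftrightarrow>
     (\<forall>S. psd_mat d S \<longrightarrow> is_eigen_decomp d S (U S) (s S)) \<and>
     (\<forall>i<d. \<forall>j<d. (\<lambda>S. if j < vec_space.rank d S then U S $$ (i, j) else 0)
        \<in> borel_measurable (restrict_space (borel_mat d d) {S. psd_mat d S}))"

definition soft :: "real \<Rightarrow> real \<Rightarrow> real" where
  "soft t z = z * max (1 - t / \<bar>z\<bar>) 0"

definition left_cols :: "nat \<Rightarrow> real mat \<Rightarrow> real mat" where
  "left_cols k A = Matrix.mat (dim_row A) k (\<lambda>(i, j). A $$ (i, j))"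

text \<open>
  The estimator computed from the observations with indices in \<open>I\<close>, keeping the first \<open>k\<close>
  eigenvectors, or all of them if the rank is smaller than \<open>k\<close>.
\<close>

definition trunc_nct ::
  "nat \<Rightarrow> (real mat \<Rightarrow> real mat) \<Rightarrow> (real mat \<Rightarrow> nat \<Rightarrow> real) \<Rightarrow> nat \<Rightarrow> nat set
     \<Rightarrow> (nat \<Rightarrow> real vec) \<Rightarrow> (nat \<Rightarrow> real) \<Rightarrow> real \<Rightarrow> real vec" where
  "trunc_nct d U s k I x y t =
     (let S = sample_cov d I x;
          m = min k (vec_space.rank d S);
          Um = left_cols m (U S);
          Lm_inv = mat_diag m (\<lambda>j. 1 / s S j);
          XY = (1 / real (card I)) \<cdot>\<^sub>v ((design_mat d I x)\<^sup>T *\<^sub>v stack I y)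
      in Um *\<^sub>v (Lm_inv *\<^sub>v map_vec (soft t) (Lm_inv *\<^sub>v (Um\<^sup>T *\<^sub>v XY))))"

definition trunc_level :: "real \<Rightarrow> nat" where
  "trunc_level eps = nat \<lfloor>(eps * ln (1 / eps)) powr (- 2 / 3)\<rfloor>"

subsection \<open>Cross-validation\<close>

definition cv_blocks :: "nat \<Rightarrow> nat \<Rightarrow> (nat \<Rightarrow> nat set) \<Rightarrow> bool" where
  "cv_blocks n L B \<longleftrightarrow>
     disjoint_family_on B {1..L} \<and> (\<Union>l\<in>{1..L}. B l) = {1..n} \<and>
     (\<forall>l\<in>{1..L}. B l \<noteq> {} \<and> n div L \<le> card (B l) \<and> card (B l) \<le> n div L + 1)"

definition fold_avg :: "nat \<Rightarrow> (nat \<Rightarrow> real) \<Rightarrow> real" where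
  "fold_avg L f = (1 / real L) * (\<Sum>l=1..L. f l)"

definition cv_loss :: "nat set \<Rightarrow> (nat \<Rightarrow> real vec) \<Rightarrow> (nat \<Rightarrow> real) \<Rightarrow> real vec \<Rightarrow> real" where
  "cv_loss I x y b = (1 / real (card I)) * (\<Sum>i\<in>I. (y i - x i \<bullet> b)\<^sup>2)"

text \<open>Only the generic pair is integrated out; \<open>b\<close> is held fixed.\<close>

definition fresh_risk ::
  "'w measure \<Rightarrow> (nat \<Rightarrow> 'w \<Rightarrow> real vec) \<Rightarrow> (nat \<Rightarrow> 'w \<Rightarrow> real) \<Rightarrow> real vec \<Rightarrow> real" where
  "fresh_risk M x y b = prob_space.expectation M (\<lambda>\<omega>. (y 0 \<omega> - x 0 \<omega> \<bullet> b)\<^sup>2)"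

end

theory Submission
  imports Defs "HOL-Real_Asymp.Real_Asymp"
begin

text \<open>
  On the span of the leading sample eigenvectors of a training set the population form is bounded by
  the empirical one. On the first $\min(8k, d)$ population directions the two forms agree up to a
  factor; on the remaining ones the empirical form is at most a constant times
  $\lambda_{p+1} + n^{-1} \sum_{j>p} \lambda_j$, and a trace argument shows that the $k$-th sample
  eigenvalue is at least of that order. By Bessel's inequality the empirical energy of every estimator
  on the path is at most the mean of the squared responses, so all prediction errors are
  bounded by a multiple of $V = \beta^T \Sigma \beta + \sigma^2 (\log(2/\delta))^{2/\alpha}$.
  The path $t \mapsto \widehat\beta_t$ is piecewise linear with at most $\min(k,d)+1$ breakpoints,
  which depend on the training set and the noise only. Conditionally on these, Bernstein's inequality
  at the sums of pairs of breakpoints controls the hold-out loss along the whole path, and the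
  regret of cross-validation is $V$ times the relative deviation, whose size is
  $\sqrt{L \log(Lr/\delta)/n}$. For bounded $n$ the hypothesis on $\epsilon$ forces $d = 1$ and
  $\delta$ close to one, and an event of small positive probability suffices.
\<close>

text \<open>The logarithms in the claim contain \<open>L\<close>, \<open>r\<close> and \<delta>, but
  neither \<open>n\<close> nor \<open>d\<close>, and this dictates the tools. Bounding the largest
  noise variable would cost ln n; Markov's inequality for the empirical mean of
  \<open>exp ((|e i| / \<sigma>) powr \<alpha>)\<close> bounds the mean square instead. The number
  of hold-out tests is tied to the rank: the isometry on the head shows
  \<open>min k d \<le> 3 * r\<close>. The design event may use ln d, because \<epsilon> pays for it:
  \<open>k\<close> is at most \<open>\<epsilon> powr (- 2 / 3)\<close>, so entrywise control of the
  \<open>p\<close> by \<open>p\<close> head Gram matrix, which loses a factor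
  \<open>p \<le> 8 * k\<close>, is still precise enough. The factor 8 makes the whitened head trace,
  at least \<open>4 * k\<close>, exceed the \<open>3 * k / 2\<close> that \<open>k\<close> sample
  eigenvectors can carry. In the tail the operator norm is tested at integer points: a sum of
  squares is convex in each coordinate, so rounding to a suitable neighbouring integer does not
  decrease it and no approximation error arises. All deviations are relative to the population form,
  so a radius valid on the whole path is what turns them into an additive regret.\<close>

section \<open>Moment generating functions, Chernoff bounds and sections of independent
  pairs\<close>

lemma exp_le_quadratic_remainder:
  fixes x :: real
  shows "exp x \<le> 1 + x + x\<^sup>2 * exp \<bar>x\<bar>"
proof -
  have "exp x \<le> 1 + x + \<bar>x\<bar>\<^sup>2 / 2 * exp \<bar>x\<bar>"
  proof (cases "x = 0")
    case False
    obtain t where t: "\<bar>t\<bar> \<le> \<bar>x\<bar>" "exp x = (\<Sum>m<2. x ^ m / fact m) + exp t / fact 2 * x ^ 2"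
      using Maclaurin_exp_le[of x 2] by blast
    have "exp t \<le> exp \<bar>x\<bar>" using t by simp
    then have "exp t / 2 * x\<^sup>2 \<le> exp \<bar>x\<bar> / 2 * x\<^sup>2"
      by (intro mult_right_mono) auto
    with t show ?thesis by (simp add: numeral_2_eq_2 field_simps)
  qed simp
  also have "\<dots> \<le> 1 + x + x\<^sup>2 * exp \<bar>x\<bar>"
    by (auto intro: mult_right_mono)
  finally show ?thesis .
qed

text \<open>For a centred variable the linear term integrates to zero and only the exponential of
  the square is left, which is exactly what a sub-Gaussian hypothesis controls.\<close>

lemma exp_le_self_plus_exp_square:
  fixes x :: real
  shows "exp x \<le> x + exp (x\<^sup>2)"
proof -
  consider "x > 1" | "x < -1" | "0 \<le> x \<and> x \<le> 1" | "-1 \<le> x \<and> x < 0" by linarith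
  then show ?thesis
  proof cases
    case 1
    then have "x \<le> x\<^sup>2" by (simp add: power2_eq_square)
    then have "exp x \<le> exp (x\<^sup>2)" by simp
    with 1 show ?thesis by linarith
  next
    case 2
    have "0 \<le> (-x) * (-x - 1)" using 2 by (intro mult_nonneg_nonneg) auto
    then have "-x \<le> x\<^sup>2" by (simp add: power2_eq_square algebra_simps)
    moreover have "1 + x\<^sup>2 \<le> exp (x\<^sup>2)" by (rule exp_ge_add_one_self)
    moreover have "exp x \<le> 1" using 2 by simp
    ultimately show ?thesis by linarith
  next
    case 3
    then have "exp x \<le> 1 + x + x\<^sup>2" by (simp add: exp_bound)
    moreover have "1 + x\<^sup>2 \<le> exp (x\<^sup>2)" by (rule exp_ge_add_one_self)
    ultimately show ?thesis by linarith
  next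
    case 4
    obtain t where t: "\<bar>t\<bar> \<le> \<bar>x\<bar>" "exp x = (\<Sum>m<3. x ^ m / fact m) + exp t / fact 3 * x ^ 3"
      using Maclaurin_exp_le[of x 3] by blast
    have "x ^ 3 \<le> 0" using 4 by (simp add: power3_eq_cube mult_nonneg_nonpos2 mult_nonpos_nonneg mult_le_0_iff)
    then have "exp t / fact 3 * x ^ 3 \<le> 0" by (intro mult_nonneg_nonpos) auto
    with t have "exp x \<le> 1 + x + x\<^sup>2 / 2" by (simp add: numeral_3_eq_3 numeral_2_eq_2)
    moreover have "1 + x\<^sup>2 \<le> exp (x\<^sup>2)" by (rule exp_ge_add_one_self)
    moreover have "0 \<le> x\<^sup>2" by simp
    ultimately show ?thesis by linarith
  qed
qed

lemma square_le_two_exp: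
  fixes u :: real
  assumes "0 \<le> u"
  shows "u\<^sup>2 \<le> 2 * exp u"
proof -
  obtain t where t: "\<bar>t\<bar> \<le> \<bar>u\<bar>" "exp u = (\<Sum>m<3. u ^ m / fact m) + exp t / fact 3 * u ^ 3"
    using Maclaurin_exp_le[of u 3] by blast
  have "0 \<le> exp t / fact 3 * u ^ 3" using assms by (intro mult_nonneg_nonneg) auto
  with t assms show ?thesis by (simp add: numeral_3_eq_3 numeral_2_eq_2)
qed

context prob_space
begin

lemma integrable_exp_of_nn_integral_le:
  assumes [measurable]: "g \<in> borel_measurable M"
    and le: "(\<integral>\<^sup>+\<omega>. ennreal (exp (g \<omega>)) \<partial>M) \<le> ennreal c" and "0 \<le> c"
  shows "integrable M (\<lambda>\<omega>. exp (g \<omega>))" "expectation (\<lambda>\<omega>. exp (g \<omega>)) \<le> c"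
proof -
  show int: "integrable M (\<lambda>\<omega>. exp (g \<omega>))"
  proof (rule integrableI_nonneg)
    show "(\<integral>\<^sup>+\<omega>. ennreal (exp (g \<omega>)) \<partial>M) < \<infinity>"
      using le by (rule le_less_trans) simp
  qed auto
  show "expectation (\<lambda>\<omega>. exp (g \<omega>)) \<le> c"
    using le \<open>0 \<le> c\<close> by (subst (asm) nn_integral_eq_integral[OF int]) auto
qed

lemma prob_le_of_emeasure_le:
  assumes "emeasure M A \<le> ennreal c" "0 \<le> c"
  shows "prob A \<le> c"
  using assms unfolding emeasure_eq_measure by simp

text \<open>Stated with the nonnegative integral, so that neither here nor in the factorisation over
  independent summands is integrability an issue.\<close>

lemma prob_ge_le_exp_moment:
  assumes [measurable]: "Z \<in> borel_measurable M"
    and le: "(\<integral>\<^sup>+\<omega>. ennreal (exp (s * Z \<omega>)) \<partial>M) \<le> ennreal (exp c)"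
    and "0 < s"
  shows "prob {\<omega>\<in>space M. a \<le> Z \<omega>} \<le> exp (c - s * a)"
proof (rule prob_le_of_emeasure_le)
  have "emeasure M {\<omega>\<in>space M. a \<le> Z \<omega>} \<le> ennreal (exp (- s * a)) * (\<integral>\<^sup>+\<omega>\<in>space M. ennreal (exp (s * Z \<omega>)) \<partial>M)"
    by (rule Chernoff_ineq_nn_integral_ge) (use \<open>0 < s\<close> in auto)
  also have "(\<integral>\<^sup>+\<omega>\<in>space M. ennreal (exp (s * Z \<omega>)) \<partial>M) = (\<integral>\<^sup>+\<omega>. ennreal (exp (s * Z \<omega>)) \<partial>M)"
    by (intro nn_integral_cong) auto
  also have "ennreal (exp (- s * a)) * \<dots> \<le> ennreal (exp (- s * a)) * ennreal (exp c)"
    by (intro mult_left_mono le) auto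
  also have "\<dots> = ennreal (exp (c - s * a))"
    by (subst ennreal_mult[symmetric]) (auto simp: exp_add[symmetric])
  finally show "emeasure M {\<omega>\<in>space M. a \<le> Z \<omega>} \<le> ennreal (exp (c - s * a))" .
qed auto

lemma nn_integral_exp_sum_le:
  assumes "finite I" "indep_vars (\<lambda>_. borel) Z I"
    and "\<And>i. i \<in> I \<Longrightarrow> (\<integral>\<^sup>+\<omega>. ennreal (exp (Z i \<omega>)) \<partial>M) \<le> ennreal (exp (c i))"
  shows "(\<integral>\<^sup>+\<omega>. ennreal (exp (\<Sum>i\<in>I. Z i \<omega>)) \<partial>M) \<le> ennreal (exp (\<Sum>i\<in>I. c i))"
proof -
  have "(\<integral>\<^sup>+\<omega>. ennreal (exp (\<Sum>i\<in>I. Z i \<omega>)) \<partial>M) = (\<integral>\<^sup>+\<omega>. (\<Prod>i\<in>I. ennreal (exp (Z i \<omega>))) \<partial>M)"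
    using \<open>finite I\<close> by (simp add: exp_sum prod_ennreal)
  also have "\<dots> = (\<Prod>i\<in>I. \<integral>\<^sup>+\<omega>. ennreal (exp (Z i \<omega>)) \<partial>M)"
    using assms(1,2) by (intro indep_vars_nn_integral indep_vars_compose2[OF assms(2)]) auto
  also have "\<dots> \<le> (\<Prod>i\<in>I. ennreal (exp (c i)))"
    by (intro prod_mono_ennreal assms(3))
  also have "\<dots> = ennreal (exp (\<Sum>i\<in>I. c i))"
    using \<open>finite I\<close> by (simp add: exp_sum prod_ennreal)
  finally show ?thesis .
qed

text \<open>Two regimes. For small \<open>s\<close> the linear term vanishes in expectation; for
  large \<open>s\<close> Young's inequality is enough, and the factor 3/2 that it leaves is absorbed
  because \<open>s\<^sup>2 * \<kappa> > 1\<close>. The bound carries no factor in front of the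
  exponential, so it can be multiplied over many observations.\<close>

lemma subgaussian_mgf:
  assumes [measurable]: "g \<in> borel_measurable M"
    and psi: "(\<integral>\<^sup>+\<omega>. ennreal (exp ((g \<omega>)\<^sup>2 / \<kappa>)) \<partial>M) \<le> 2" and "0 < \<kappa>"
    and mean: "expectation g = 0"
  shows "(\<integral>\<^sup>+\<omega>. ennreal (exp (s * g \<omega>)) \<partial>M) \<le> ennreal (exp (s\<^sup>2 * \<kappa>))"
proof -
  have int: "integrable M (\<lambda>\<omega>. exp ((g \<omega>)\<^sup>2 / \<kappa>))" and le2: "expectation (\<lambda>\<omega>. exp ((g \<omega>)\<^sup>2 / \<kappa>)) \<le> 2"
    using integrable_exp_of_nn_integral_le[of "\<lambda>\<omega>. (g \<omega>)\<^sup>2 / \<kappa>" 2] psi by auto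
  have powr_le: "integrable M (\<lambda>\<omega>. exp (a * ((g \<omega>)\<^sup>2 / \<kappa>)))"
    "expectation (\<lambda>\<omega>. exp (a * ((g \<omega>)\<^sup>2 / \<kappa>))) \<le> 1 + a" if "0 \<le> a" "a \<le> 1" for a
  proof -
    \<comment> \<open>Convexity of exp on the segment from 0 to \<open>y\<close>. After integration
      the excess over 1 is linear in \<open>a\<close>, hence again dominated by
      \<open>exp a\<close>.\<close>
    have pt: "exp (a * y) \<le> (1 - a) + a * exp y" for y :: real
    proof -
      have "exp ((1 - a) *\<^sub>R 0 + a *\<^sub>R y) \<le> (1 - a) * exp 0 + a * exp y"
        using that by (intro convex_onD[OF exp_convex]) auto
      then show ?thesis by simp
    qed
    show i: "integrable M (\<lambda>\<omega>. exp (a * ((g \<omega>)\<^sup>2 / \<kappa>)))"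
    proof (rule Bochner_Integration.integrable_bound[where f = "\<lambda>\<omega>. (1 - a) + a * exp ((g \<omega>)\<^sup>2 / \<kappa>)"])
      show "AE \<omega> in M. norm (exp (a * ((g \<omega>)\<^sup>2 / \<kappa>))) \<le> norm ((1 - a) + a * exp ((g \<omega>)\<^sup>2 / \<kappa>))"
      proof (rule AE_I2)
        fix \<omega>
        show "norm (exp (a * ((g \<omega>)\<^sup>2 / \<kappa>))) \<le> norm ((1 - a) + a * exp ((g \<omega>)\<^sup>2 / \<kappa>))"
          using pt[of "(g \<omega>)\<^sup>2 / \<kappa>"] unfolding real_norm_def abs_exp_cancel by linarith
      qed
    qed (use int in auto)
    have "expectation (\<lambda>\<omega>. exp (a * ((g \<omega>)\<^sup>2 / \<kappa>))) \<le> expectation (\<lambda>\<omega>. (1 - a) + a * exp ((g \<omega>)\<^sup>2 / \<kappa>))"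
      using i int by (intro integral_mono pt) auto
    also have "\<dots> = (1 - a) + a * expectation (\<lambda>\<omega>. exp ((g \<omega>)\<^sup>2 / \<kappa>))"
      using int by (simp add: prob_space)
    also have "\<dots> \<le> 1 + a" using mult_left_mono[OF le2 \<open>0 \<le> a\<close>] by simp
    finally show "expectation (\<lambda>\<omega>. exp (a * ((g \<omega>)\<^sup>2 / \<kappa>))) \<le> 1 + a" .
  qed
  have g_int: "integrable M g"
  proof (rule Bochner_Integration.integrable_bound[where f = "\<lambda>\<omega>. (\<kappa> + 1) * exp ((g \<omega>)\<^sup>2 / \<kappa>)"])
    show "AE \<omega> in M. norm (g \<omega>) \<le> norm ((\<kappa> + 1) * exp ((g \<omega>)\<^sup>2 / \<kappa>))"
    proof (rule AE_I2)
      fix \<omega>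
      have "1 + (g \<omega>)\<^sup>2 / \<kappa> \<le> exp ((g \<omega>)\<^sup>2 / \<kappa>)" by (rule exp_ge_add_one_self)
      then have "(\<kappa> + 1) * (1 + (g \<omega>)\<^sup>2 / \<kappa>) \<le> (\<kappa> + 1) * exp ((g \<omega>)\<^sup>2 / \<kappa>)"
        using \<open>0 < \<kappa>\<close> by (intro mult_left_mono) auto
      moreover have "(\<kappa> + 1) * (1 + (g \<omega>)\<^sup>2 / \<kappa>) = \<kappa> + 1 + (g \<omega>)\<^sup>2 + (g \<omega>)\<^sup>2 / \<kappa>"
        using \<open>0 < \<kappa>\<close> by (simp add: field_simps)
      moreover have "0 \<le> (g \<omega>)\<^sup>2 / \<kappa>" using \<open>0 < \<kappa>\<close> by simp
      moreover have "\<bar>g \<omega>\<bar> \<le> 1 + (g \<omega>)\<^sup>2"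
        using zero_le_power2[of "\<bar>g \<omega>\<bar> - 1"] zero_le_power2[of "\<bar>g \<omega>\<bar> + 1"]
        by (simp add: power2_eq_square algebra_simps)
      ultimately have "\<bar>g \<omega>\<bar> \<le> (\<kappa> + 1) * exp ((g \<omega>)\<^sup>2 / \<kappa>)" using \<open>0 < \<kappa>\<close> by linarith
      then show "norm (g \<omega>) \<le> norm ((\<kappa> + 1) * exp ((g \<omega>)\<^sup>2 / \<kappa>))" by simp
    qed
  qed (use int in auto)
  show ?thesis
  proof (cases "s\<^sup>2 * \<kappa> \<le> 1")
    case True
    let ?a = "s\<^sup>2 * \<kappa>"
    have eq: "(s * g \<omega>)\<^sup>2 = ?a * ((g \<omega>)\<^sup>2 / \<kappa>)" for \<omega>
      using \<open>0 < \<kappa>\<close> by (simp add: power_mult_distrib)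
    have a: "0 \<le> ?a" "?a \<le> 1" using True \<open>0 < \<kappa>\<close> by auto
    have pt: "exp (s * g \<omega>) \<le> s * g \<omega> + exp (?a * ((g \<omega>)\<^sup>2 / \<kappa>))" for \<omega>
      using exp_le_self_plus_exp_square[of "s * g \<omega>"] unfolding eq .
    have i: "integrable M (\<lambda>\<omega>. s * g \<omega> + exp (?a * ((g \<omega>)\<^sup>2 / \<kappa>)))"
      using g_int powr_le(1)[OF a] by auto
    have "(\<integral>\<^sup>+\<omega>. ennreal (exp (s * g \<omega>)) \<partial>M) \<le> (\<integral>\<^sup>+\<omega>. ennreal (s * g \<omega> + exp (?a * ((g \<omega>)\<^sup>2 / \<kappa>))) \<partial>M)"
      by (intro nn_integral_mono ennreal_leI pt)
    also have "\<dots> = ennreal (expectation (\<lambda>\<omega>. s * g \<omega> + exp (?a * ((g \<omega>)\<^sup>2 / \<kappa>))))"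
      using i by (intro nn_integral_eq_integral AE_I2 order.trans[OF exp_ge_zero pt])
    also have "expectation (\<lambda>\<omega>. s * g \<omega> + exp (?a * ((g \<omega>)\<^sup>2 / \<kappa>))) = expectation (\<lambda>\<omega>. exp (?a * ((g \<omega>)\<^sup>2 / \<kappa>)))"
      using g_int powr_le(1)[OF a] mean by (subst Bochner_Integration.integral_add) auto
    also have "ennreal \<dots> \<le> ennreal (1 + ?a)" by (intro ennreal_leI powr_le(2) a)
    also have "\<dots> \<le> ennreal (exp ?a)" by (intro ennreal_leI exp_ge_add_one_self)
    finally show ?thesis .
  next
    case False
    let ?a = "s\<^sup>2 * \<kappa>"
    \<comment> \<open>Young's inequality in the form
      \<open>2 * s * g \<le> s\<^sup>2 * \<kappa> + g\<^sup>2 / \<kappa>\<close>, read off from a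
      square.\<close>
    have pt: "exp (s * g \<omega>) \<le> exp (?a / 2) * exp (1/2 * ((g \<omega>)\<^sup>2 / \<kappa>))" for \<omega>
    proof -
      have "0 \<le> (s * \<kappa> - g \<omega>)\<^sup>2 / \<kappa>" using \<open>0 < \<kappa>\<close> by simp
      also have "\<dots> = ?a + (g \<omega>)\<^sup>2 / \<kappa> - 2 * (s * g \<omega>)"
        using \<open>0 < \<kappa>\<close> by (simp add: field_simps power2_eq_square)
      finally show ?thesis by (simp add: exp_add[symmetric])
    qed
    have i: "integrable M (\<lambda>\<omega>. exp (?a / 2) * exp (1/2 * ((g \<omega>)\<^sup>2 / \<kappa>)))"
      using powr_le(1)[of "1/2"] by auto
    have "(\<integral>\<^sup>+\<omega>. ennreal (exp (s * g \<omega>)) \<partial>M) \<le> (\<integral>\<^sup>+\<omega>. ennreal (exp (?a / 2) * exp (1/2 * ((g \<omega>)\<^sup>2 / \<kappa>))) \<partial>M)"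
      by (intro nn_integral_mono ennreal_leI pt)
    also have "\<dots> = ennreal (expectation (\<lambda>\<omega>. exp (?a / 2) * exp (1/2 * ((g \<omega>)\<^sup>2 / \<kappa>))))"
      using i by (intro nn_integral_eq_integral) auto
    also have "expectation (\<lambda>\<omega>. exp (?a / 2) * exp (1/2 * ((g \<omega>)\<^sup>2 / \<kappa>))) \<le> exp (?a / 2) * (1 + 1/2)"
      using powr_le(2)[of "1/2"] by simp
    also have "\<dots> \<le> exp (?a / 2) * exp (1/2)"
      by (intro mult_left_mono exp_ge_add_one_self) auto
    also have "\<dots> = exp (?a / 2 + 1/2)" by (simp add: exp_add)
    also have "\<dots> \<le> exp ?a" using False by simp
    finally show ?thesis by (simp add: ennreal_leI)
  qed
qed

text \<open>\<open>Q\<close> is dominated by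
  \<open>\<kappa> * exp (Q / \<kappa>) - \<kappa>\<close>, whose mean is at most
  \<open>2 * \<kappa> - \<kappa>\<close>; the subtracted \<kappa> is what makes the mean bound as
  small as \<kappa>.\<close>

lemma subexponential_moments:
  assumes [measurable]: "Q \<in> borel_measurable M" and nonneg: "\<And>\<omega>. \<omega> \<in> space M \<Longrightarrow> 0 \<le> Q \<omega>"
    and psi: "(\<integral>\<^sup>+\<omega>. ennreal (exp (Q \<omega> / \<kappa>)) \<partial>M) \<le> 2" and "0 < \<kappa>"
  shows "integrable M Q" "integrable M (\<lambda>\<omega>. exp (Q \<omega> / \<kappa>))"
    "expectation (\<lambda>\<omega>. exp (Q \<omega> / \<kappa>)) \<le> 2" "0 \<le> expectation Q" "expectation Q \<le> \<kappa>"
    "integrable M (\<lambda>\<omega>. (Q \<omega>)\<^sup>2)" "expectation (\<lambda>\<omega>. (Q \<omega>)\<^sup>2) \<le> 4 * \<kappa>\<^sup>2"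
proof -
  show int: "integrable M (\<lambda>\<omega>. exp (Q \<omega> / \<kappa>))" and le2: "expectation (\<lambda>\<omega>. exp (Q \<omega> / \<kappa>)) \<le> 2"
    using integrable_exp_of_nn_integral_le[of "\<lambda>\<omega>. Q \<omega> / \<kappa>" 2] psi by auto
  have pt: "Q \<omega> \<le> \<kappa> * exp (Q \<omega> / \<kappa>) - \<kappa>" for \<omega>
  proof -
    have "\<kappa> * (1 + Q \<omega> / \<kappa>) \<le> \<kappa> * exp (Q \<omega> / \<kappa>)"
      using \<open>0 < \<kappa>\<close> by (intro mult_left_mono exp_ge_add_one_self) auto
    moreover have "\<kappa> * (1 + Q \<omega> / \<kappa>) = \<kappa> + Q \<omega>" using \<open>0 < \<kappa>\<close> by (simp add: field_simps)
    ultimately show ?thesis by linarith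
  qed
  show iQ: "integrable M Q"
    by (rule Bochner_Integration.integrable_bound[where f = "\<lambda>\<omega>. \<kappa> * exp (Q \<omega> / \<kappa>)"])
       (use int nonneg pt \<open>0 < \<kappa>\<close> in \<open>auto simp: abs_mult intro!: AE_I2 order.trans[OF pt]\<close>)
  show "0 \<le> expectation Q" using nonneg by (intro integral_nonneg_AE AE_I2) auto
  have "expectation Q \<le> expectation (\<lambda>\<omega>. \<kappa> * exp (Q \<omega> / \<kappa>) - \<kappa>)"
    using int iQ pt by (intro integral_mono) auto
  also have "\<dots> \<le> \<kappa>" using int mult_left_mono[OF le2, of \<kappa>] \<open>0 < \<kappa>\<close> by (simp add: prob_space)
  finally show "expectation Q \<le> \<kappa>" .
  have pt2: "(Q \<omega>)\<^sup>2 \<le> 2 * \<kappa>\<^sup>2 * exp (Q \<omega> / \<kappa>)" if "\<omega> \<in> space M" for \<omega>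
  proof -
    have "(Q \<omega> / \<kappa>)\<^sup>2 \<le> 2 * exp (Q \<omega> / \<kappa>)"
      using nonneg[OF that] \<open>0 < \<kappa>\<close> by (intro square_le_two_exp) auto
    then show ?thesis using \<open>0 < \<kappa>\<close> by (simp add: power_divide field_simps)
  qed
  show iQ2: "integrable M (\<lambda>\<omega>. (Q \<omega>)\<^sup>2)"
    by (rule Bochner_Integration.integrable_bound[where f = "\<lambda>\<omega>. 2 * \<kappa>\<^sup>2 * exp (Q \<omega> / \<kappa>)"])
       (use int pt2 in auto)
  have "expectation (\<lambda>\<omega>. (Q \<omega>)\<^sup>2) \<le> expectation (\<lambda>\<omega>. 2 * \<kappa>\<^sup>2 * exp (Q \<omega> / \<kappa>))"
    using int iQ2 pt2 by (intro integral_mono) auto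
  also have "\<dots> \<le> 4 * \<kappa>\<^sup>2" using mult_left_mono[OF le2, of "2 * \<kappa>\<^sup>2"] by simp
  finally show "expectation (\<lambda>\<omega>. (Q \<omega>)\<^sup>2) \<le> 4 * \<kappa>\<^sup>2" .
qed

text \<open>The range of \<open>s\<close> is chosen so that half of the available exponent suffices:
  one factor \<open>exp (|z| / (4 * \<kappa>))\<close> pays for \<open>z\<^sup>2\<close>, another
  for \<open>exp |s * z|\<close>, where \<open>z\<close> is the centred variable. The remainder then
  costs \<open>64 * \<kappa>\<^sup>2 * exp (Q / \<kappa>)\<close>, with mean at most
  \<open>128 * \<kappa>\<^sup>2\<close>.\<close>

lemma subexponential_mgf:
  assumes [measurable]: "Q \<in> borel_measurable M" and nonneg: "\<And>\<omega>. \<omega> \<in> space M \<Longrightarrow> 0 \<le> Q \<omega>"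
    and psi: "(\<integral>\<^sup>+\<omega>. ennreal (exp (Q \<omega> / \<kappa>)) \<partial>M) \<le> 2" and "0 < \<kappa>"
    and s: "\<bar>s\<bar> \<le> 1 / (4 * \<kappa>)"
  shows "(\<integral>\<^sup>+\<omega>. ennreal (exp (s * (Q \<omega> - expectation Q))) \<partial>M) \<le> ennreal (exp (128 * s\<^sup>2 * \<kappa>\<^sup>2))"
proof -
  note mom = subexponential_moments[OF assms(1-4)]
  let ?\<mu> = "expectation Q"
  have pt: "exp (s * (Q \<omega> - ?\<mu>)) \<le> 1 + s * (Q \<omega> - ?\<mu>) + s\<^sup>2 * 64 * \<kappa>\<^sup>2 * exp (Q \<omega> / \<kappa>)"
    if w: "\<omega> \<in> space M" for \<omega>
  proof -
    let ?z = "Q \<omega> - ?\<mu>"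
    have z: "\<bar>?z\<bar> \<le> Q \<omega> + \<kappa>" using nonneg[OF w] mom(4,5) by linarith
    have "(?z / (4 * \<kappa>))\<^sup>2 = (\<bar>?z\<bar> / (4 * \<kappa>))\<^sup>2" by (simp add: power_divide)
    also have "\<dots> \<le> 2 * exp (\<bar>?z\<bar> / (4 * \<kappa>))"
      using \<open>0 < \<kappa>\<close> by (intro square_le_two_exp) auto
    finally have "?z\<^sup>2 \<le> 32 * \<kappa>\<^sup>2 * exp (\<bar>?z\<bar> / (4 * \<kappa>))"
      using \<open>0 < \<kappa>\<close> by (simp add: power_divide field_simps)
    moreover have "exp \<bar>s * ?z\<bar> \<le> exp (\<bar>?z\<bar> / (4 * \<kappa>))"
      using mult_right_mono[OF s, of "\<bar>?z\<bar>"] by (simp add: abs_mult)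
    ultimately have "?z\<^sup>2 * exp \<bar>s * ?z\<bar> \<le> (32 * \<kappa>\<^sup>2 * exp (\<bar>?z\<bar> / (4 * \<kappa>))) * exp (\<bar>?z\<bar> / (4 * \<kappa>))"
      by (intro mult_mono) auto
    also have "\<dots> = 32 * \<kappa>\<^sup>2 * exp (\<bar>?z\<bar> / (2 * \<kappa>))"
      by (simp add: exp_add[symmetric] field_simps)
    also have "\<dots> \<le> 32 * \<kappa>\<^sup>2 * (exp (1/2) * exp (Q \<omega> / \<kappa>))"
    proof (intro mult_left_mono)
      have "\<bar>?z\<bar> / (2 * \<kappa>) \<le> (Q \<omega> + \<kappa>) / (2 * \<kappa>)" using z \<open>0 < \<kappa>\<close> by (intro divide_right_mono) auto
      also have "\<dots> = 1/2 + Q \<omega> / \<kappa> / 2" using \<open>0 < \<kappa>\<close> by (simp add: field_simps)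
      also have "\<dots> \<le> 1/2 + Q \<omega> / \<kappa>" using nonneg[OF w] \<open>0 < \<kappa>\<close> by (simp add: field_simps)
      finally show "exp (\<bar>?z\<bar> / (2 * \<kappa>)) \<le> exp (1/2) * exp (Q \<omega> / \<kappa>)"
        by (simp add: exp_add[symmetric])
    qed auto
    also have "\<dots> \<le> 32 * \<kappa>\<^sup>2 * (2 * exp (Q \<omega> / \<kappa>))"
    proof (intro mult_left_mono mult_right_mono)
      have "exp (1/2 :: real) \<le> 1 + 1/2 + (1/2)\<^sup>2" by (rule exp_bound) auto
      then show "exp (1/2 :: real) \<le> 2" by (simp add: power2_eq_square)
    qed auto
    finally have "?z\<^sup>2 * exp \<bar>s * ?z\<bar> \<le> 64 * \<kappa>\<^sup>2 * exp (Q \<omega> / \<kappa>)" by simp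
    then have "s\<^sup>2 * (?z\<^sup>2 * exp \<bar>s * ?z\<bar>) \<le> s\<^sup>2 * (64 * \<kappa>\<^sup>2 * exp (Q \<omega> / \<kappa>))"
      by (intro mult_left_mono) auto
    moreover have "exp (s * ?z) \<le> 1 + s * ?z + (s * ?z)\<^sup>2 * exp \<bar>s * ?z\<bar>"
      by (rule exp_le_quadratic_remainder)
    ultimately show ?thesis by (simp add: power_mult_distrib mult.assoc)
  qed
  have i: "integrable M (\<lambda>\<omega>. 1 + s * (Q \<omega> - ?\<mu>) + s\<^sup>2 * 64 * \<kappa>\<^sup>2 * exp (Q \<omega> / \<kappa>))"
    using mom by auto
  have "(\<integral>\<^sup>+\<omega>. ennreal (exp (s * (Q \<omega> - ?\<mu>))) \<partial>M)
      \<le> (\<integral>\<^sup>+\<omega>. ennreal (1 + s * (Q \<omega> - ?\<mu>) + s\<^sup>2 * 64 * \<kappa>\<^sup>2 * exp (Q \<omega> / \<kappa>)) \<partial>M)"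
    by (intro nn_integral_mono ennreal_leI pt)
  also have "\<dots> = ennreal (expectation (\<lambda>\<omega>. 1 + s * (Q \<omega> - ?\<mu>) + s\<^sup>2 * 64 * \<kappa>\<^sup>2 * exp (Q \<omega> / \<kappa>)))"
    using i by (intro nn_integral_eq_integral AE_I2) (auto intro: order.trans[OF exp_ge_zero pt])
  also have "expectation (\<lambda>\<omega>. 1 + s * (Q \<omega> - ?\<mu>) + s\<^sup>2 * 64 * \<kappa>\<^sup>2 * exp (Q \<omega> / \<kappa>))
      = 1 + s\<^sup>2 * 64 * \<kappa>\<^sup>2 * expectation (\<lambda>\<omega>. exp (Q \<omega> / \<kappa>))"
    using mom(1,2) by (simp add: prob_space)
  also have "\<dots> \<le> 1 + s\<^sup>2 * 64 * \<kappa>\<^sup>2 * 2"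
    using mom(3) by (intro add_left_mono mult_left_mono) auto
  also have "\<dots> \<le> exp (128 * s\<^sup>2 * \<kappa>\<^sup>2)"
    using exp_ge_add_one_self[of "128 * s\<^sup>2 * \<kappa>\<^sup>2"] by (simp add: mult_ac)
  finally show ?thesis by (simp add: ennreal_leI)
qed

lemma subexponential_deviation:
  assumes fin: "finite I" and ne: "I \<noteq> {}" and ind: "indep_vars (\<lambda>_. borel) Q I"
    and nonneg: "\<And>i \<omega>. i \<in> I \<Longrightarrow> \<omega> \<in> space M \<Longrightarrow> 0 \<le> Q i \<omega>"
    and psi: "\<And>i. i \<in> I \<Longrightarrow> (\<integral>\<^sup>+\<omega>. ennreal (exp (Q i \<omega> / \<kappa>)) \<partial>M) \<le> 2" and "0 < \<kappa>"
    and mean: "\<And>i. i \<in> I \<Longrightarrow> expectation (Q i) = \<mu>"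
    and t: "0 < t" "t \<le> real (card I)"
  shows "prob {\<omega>\<in>space M. 36 * \<kappa> * sqrt (t / card I) \<le> \<bar>(\<Sum>i\<in>I. Q i \<omega>) / card I - \<mu>\<bar>} \<le> 2 * exp (- t)"
proof -
  define m where "m = real (card I)"
  have m: "0 < m" using fin ne by (simp add: m_def card_gt_0_iff)
  have [measurable]: "i \<in> I \<Longrightarrow> Q i \<in> borel_measurable M" for i
    using ind by (auto simp: indep_vars_def2)
  \<comment> \<open>With this \<open>s\<close> the moment generating function costs
    \<open>8 * t\<close> in the exponent and the threshold with its factor 36 gains
    \<open>9 * t\<close>. The condition \<open>t \<le> card I\<close> keeps \<open>s\<close> in the
    admissible range.\<close>
  define s where "s = sqrt (t / m) / (4 * \<kappa>)"
  have s0: "0 < s" using t m \<open>0 < \<kappa>\<close> by (simp add: s_def)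
  have "sqrt (t / m) \<le> 1" using t m by (simp add: m_def)
  then have s1: "s \<le> 1 / (4 * \<kappa>)" unfolding s_def using \<open>0 < \<kappa>\<close> by (intro divide_right_mono) auto
  have ms: "m * (128 * (s\<^sup>2 * \<kappa>\<^sup>2)) = 8 * t"
    using m t \<open>0 < \<kappa>\<close> by (simp add: s_def power_divide power_mult_distrib)
  have one: "prob {\<omega>\<in>space M. 36 * \<kappa> * sqrt (t / m) * m \<le> (\<Sum>i\<in>I. \<epsilon> * (Q i \<omega> - \<mu>))} \<le> exp (- t)"
    if "\<epsilon> = 1 \<or> \<epsilon> = -1" for \<epsilon> :: real
  proof -
    have eps2: "\<epsilon>\<^sup>2 = 1" and epsa: "\<bar>\<epsilon>\<bar> = 1" using that by auto
    have iv: "indep_vars (\<lambda>_. borel) (\<lambda>i \<omega>. s * \<epsilon> * (Q i \<omega> - \<mu>)) I"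
      using indep_vars_compose2[OF ind, where Y = "\<lambda>i x. s * \<epsilon> * (x - \<mu>)" and N = "\<lambda>_. borel"] by simp
    have "(\<integral>\<^sup>+\<omega>. ennreal (exp (\<Sum>i\<in>I. s * \<epsilon> * (Q i \<omega> - \<mu>))) \<partial>M) \<le> ennreal (exp (\<Sum>i\<in>I. 128 * s\<^sup>2 * \<kappa>\<^sup>2))"
    proof (rule nn_integral_exp_sum_le[OF fin iv])
      fix i assume i: "i \<in> I"
      show "(\<integral>\<^sup>+\<omega>. ennreal (exp (s * \<epsilon> * (Q i \<omega> - \<mu>))) \<partial>M) \<le> ennreal (exp (128 * s\<^sup>2 * \<kappa>\<^sup>2))"
        using subexponential_mgf[of "Q i" \<kappa> "s * \<epsilon>"] psi[OF i] nonneg[OF i] mean[OF i] \<open>0 < \<kappa>\<close> s0 s1 eps2 epsa i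
        by (simp add: power_mult_distrib abs_mult)
    qed
    then have "(\<integral>\<^sup>+\<omega>. ennreal (exp (s * (\<Sum>i\<in>I. \<epsilon> * (Q i \<omega> - \<mu>)))) \<partial>M) \<le> ennreal (exp (8 * t))"
      by (simp add: sum_distrib_left mult.assoc ms m_def[symmetric])
    then have "prob {\<omega>\<in>space M. 36 * \<kappa> * sqrt (t / m) * m \<le> (\<Sum>i\<in>I. \<epsilon> * (Q i \<omega> - \<mu>))}
        \<le> exp (8 * t - s * (36 * \<kappa> * sqrt (t / m) * m))"
      using s0 by (intro prob_ge_le_exp_moment) auto
    also have "s * (36 * \<kappa> * sqrt (t / m) * m) = 9 * (sqrt (t / m) * sqrt (t / m)) * m"
      using \<open>0 < \<kappa>\<close> by (simp add: s_def field_simps del: real_sqrt_mult_self)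
    also have "\<dots> = 9 * t" using m t by simp
    finally show ?thesis by simp
  qed
  have "prob {\<omega>\<in>space M. 36 * \<kappa> * sqrt (t / m) \<le> \<bar>(\<Sum>i\<in>I. Q i \<omega>) / m - \<mu>\<bar>}
      \<le> prob ({\<omega>\<in>space M. 36 * \<kappa> * sqrt (t / m) * m \<le> (\<Sum>i\<in>I. 1 * (Q i \<omega> - \<mu>))}
          \<union> {\<omega>\<in>space M. 36 * \<kappa> * sqrt (t / m) * m \<le> (\<Sum>i\<in>I. (-1) * (Q i \<omega> - \<mu>))})"
  proof (rule finite_measure_mono)
    show "{\<omega>\<in>space M. 36 * \<kappa> * sqrt (t / m) \<le> \<bar>(\<Sum>i\<in>I. Q i \<omega>) / m - \<mu>\<bar>}
       \<subseteq> {\<omega>\<in>space M. 36 * \<kappa> * sqrt (t / m) * m \<le> (\<Sum>i\<in>I. 1 * (Q i \<omega> - \<mu>))}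
          \<union> {\<omega>\<in>space M. 36 * \<kappa> * sqrt (t / m) * m \<le> (\<Sum>i\<in>I. (-1) * (Q i \<omega> - \<mu>))}"
    proof (intro subsetI)
      fix \<omega> assume "\<omega> \<in> {\<omega>\<in>space M. 36 * \<kappa> * sqrt (t / m) \<le> \<bar>(\<Sum>i\<in>I. Q i \<omega>) / m - \<mu>\<bar>}"
      then have w: "\<omega> \<in> space M" and a: "36 * \<kappa> * sqrt (t / m) \<le> \<bar>(\<Sum>i\<in>I. Q i \<omega>) / m - \<mu>\<bar>" by auto
      have "36 * \<kappa> * sqrt (t / m) * m \<le> \<bar>(\<Sum>i\<in>I. Q i \<omega>) / m - \<mu>\<bar> * m"
        using a m by (intro mult_right_mono) auto
      also have "\<dots> = \<bar>((\<Sum>i\<in>I. Q i \<omega>) / m - \<mu>) * m\<bar>" using m by (simp add: abs_mult)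
      also have "((\<Sum>i\<in>I. Q i \<omega>) / m - \<mu>) * m = (\<Sum>i\<in>I. Q i \<omega> - \<mu>)"
        using m by (simp add: sum_subtractf m_def left_diff_distrib)
      finally have "36 * \<kappa> * sqrt (t / m) * m \<le> \<bar>\<Sum>i\<in>I. Q i \<omega> - \<mu>\<bar>" .
      then show "\<omega> \<in> {\<omega>\<in>space M. 36 * \<kappa> * sqrt (t / m) * m \<le> (\<Sum>i\<in>I. 1 * (Q i \<omega> - \<mu>))}
          \<union> {\<omega>\<in>space M. 36 * \<kappa> * sqrt (t / m) * m \<le> (\<Sum>i\<in>I. (-1) * (Q i \<omega> - \<mu>))}"
        using w by (auto simp: sum_negf abs_le_iff le_max_iff_disj abs_if split: if_splits simp flip: sum_negf)
    qed
  qed measurable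
  also have "\<dots> \<le> exp (- t) + exp (- t)"
    by (intro order.trans[OF measure_Un_le] add_mono one) measurable
  finally show ?thesis by (simp add: m_def)
qed

text \<open>Fubini for an independent pair. The product rule is demanded on rectangles only, which
  is how it is supplied both for two disjoint groups of observations and for the pair of noise and
  design.\<close>

lemma prob_le_by_indep_sections:
  assumes X[measurable]: "X \<in> M \<rightarrow>\<^sub>M N1" and Y[measurable]: "Y \<in> M \<rightarrow>\<^sub>M N2"
    and ind: "\<And>A B. A \<in> sets N1 \<Longrightarrow> B \<in> sets N2 \<Longrightarrow>
      prob ((\<lambda>\<omega>. (X \<omega>, Y \<omega>)) -` (A \<times> B) \<inter> space M) = prob (X -` A \<inter> space M) * prob (Y -` B \<inter> space M)"
    and Bad[measurable]: "Bad \<in> sets (N1 \<Otimes>\<^sub>M N2)"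
    and sec: "\<And>a. a \<in> space N1 \<Longrightarrow> prob {\<omega>\<in>space M. (a, Y \<omega>) \<in> Bad} \<le> p" and "0 \<le> p"
  shows "prob {\<omega>\<in>space M. (X \<omega>, Y \<omega>) \<in> Bad} \<le> p"
proof (rule prob_le_of_emeasure_le)
  interpret D1: prob_space "distr M N1 X" by (rule prob_space_distr) fact
  interpret D2: prob_space "distr M N2 Y" by (rule prob_space_distr) fact
  have eq: "distr M N1 X \<Otimes>\<^sub>M distr M N2 Y = distr M (N1 \<Otimes>\<^sub>M N2) (\<lambda>\<omega>. (X \<omega>, Y \<omega>))"
  proof (rule pair_measure_eqI)
    show "sets (distr M N1 X \<Otimes>\<^sub>M distr M N2 Y) = sets (distr M (N1 \<Otimes>\<^sub>M N2) (\<lambda>\<omega>. (X \<omega>, Y \<omega>)))"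
      by (simp cong: sets_pair_measure_cong)
    fix A B assume "A \<in> sets (distr M N1 X)" "B \<in> sets (distr M N2 Y)"
    then have AB: "A \<in> sets N1" "B \<in> sets N2" by auto
    show "emeasure (distr M N1 X) A * emeasure (distr M N2 Y) B
        = emeasure (distr M (N1 \<Otimes>\<^sub>M N2) (\<lambda>\<omega>. (X \<omega>, Y \<omega>))) (A \<times> B)"
      using AB ind[OF AB] by (simp add: emeasure_distr emeasure_eq_measure ennreal_mult[symmetric])
  qed (rule D1.sigma_finite_measure_axioms D2.sigma_finite_measure_axioms)+
  have "emeasure M {\<omega>\<in>space M. (X \<omega>, Y \<omega>) \<in> Bad} = emeasure (distr M (N1 \<Otimes>\<^sub>M N2) (\<lambda>\<omega>. (X \<omega>, Y \<omega>))) Bad"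
    by (subst emeasure_distr) (auto intro!: arg_cong[where f = "emeasure M"])
  also have "\<dots> = (\<integral>\<^sup>+a. emeasure (distr M N2 Y) (Pair a -` Bad) \<partial>distr M N1 X)"
    unfolding eq[symmetric] by (subst D2.emeasure_pair_measure_alt) auto
  also have "\<dots> \<le> (\<integral>\<^sup>+a. ennreal p \<partial>distr M N1 X)"
  proof (rule nn_integral_mono)
    fix a assume "a \<in> space (distr M N1 X)"
    then have a: "a \<in> space N1" by simp
    have "emeasure (distr M N2 Y) (Pair a -` Bad) = emeasure M {\<omega>\<in>space M. (a, Y \<omega>) \<in> Bad}"
      by (subst emeasure_distr) (auto intro!: arg_cong[where f = "emeasure M"] sets_Pair1)
    also have "\<dots> \<le> ennreal p" using sec[OF a] by (simp add: emeasure_eq_measure ennreal_leI)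
    finally show "emeasure (distr M N2 Y) (Pair a -` Bad) \<le> ennreal p" .
  qed
  also have "\<dots> = ennreal p" using D1.emeasure_space_1 by simp
  finally show "emeasure M {\<omega>\<in>space M. (X \<omega>, Y \<omega>) \<in> Bad} \<le> ennreal p" .
qed fact

end

section \<open>Inner products, sample forms and the spectrum of a sample covariance\<close>

text \<open>Vectors are functions on an index set, so that one inner product and one Bessel
  inequality serve for coordinates and for sample indices.\<close>

definition ip :: "'i set \<Rightarrow> ('i \<Rightarrow> real) \<Rightarrow> ('i \<Rightarrow> real) \<Rightarrow> real" where
  "ip D v w = (\<Sum>j\<in>D. v j * w j)"

definition lincomb_fun :: "'a set \<Rightarrow> ('a \<Rightarrow> real) \<Rightarrow> ('a \<Rightarrow> 'i \<Rightarrow> real) \<Rightarrow> 'i \<Rightarrow> real" where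
  "lincomb_fun A c u j = (\<Sum>a\<in>A. c a * u a j)"

definition orthonormal_on :: "'i set \<Rightarrow> ('a \<Rightarrow> 'i \<Rightarrow> real) \<Rightarrow> 'a set \<Rightarrow> bool" where
  "orthonormal_on D u A \<longleftrightarrow> (\<forall>a\<in>A. \<forall>b\<in>A. ip D (u a) (u b) = (if a = b then 1 else 0))"

lemma ip_commute: "ip D v w = ip D w v"
  by (simp add: ip_def mult.commute)

lemma ip_self_nonneg: "0 \<le> ip D v v"
  by (simp add: ip_def sum_nonneg)

lemma ip_add_left: "ip D (\<lambda>j. v j + v' j) w = ip D v w + ip D v' w"
  by (simp add: ip_def sum.distrib algebra_simps)

lemma ip_diff_left: "ip D (\<lambda>j. v j - v' j) w = ip D v w - ip D v' w"
  by (simp add: ip_def sum_subtractf algebra_simps)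

lemma ip_scale_left: "ip D (\<lambda>j. c * v j) w = c * ip D v w"
  by (simp add: ip_def sum_distrib_left mult.assoc)

lemma ip_lincomb_left: "ip D (lincomb_fun A c u) w = (\<Sum>a\<in>A. c a * ip D (u a) w)"
  unfolding ip_def lincomb_fun_def sum_distrib_left sum_distrib_right
  by (subst sum.swap) (simp add: mult.assoc)

lemma ip_add_right: "ip D w (\<lambda>j. v j + v' j) = ip D w v + ip D w v'"
  using ip_add_left ip_commute by metis

lemma ip_diff_right: "ip D w (\<lambda>j. v j - v' j) = ip D w v - ip D w v'"
  using ip_diff_left ip_commute by metis

lemma ip_scale_right: "ip D w (\<lambda>j. c * v j) = c * ip D w v"
  using ip_scale_left ip_commute by metis

lemma ip_lincomb_right: "ip D w (lincomb_fun A c u) = (\<Sum>a\<in>A. c a * ip D w (u a))"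
  by (subst (1 2) ip_commute) (rule ip_lincomb_left)

lemma ip_square_le: "(ip D v w)\<^sup>2 \<le> ip D v v * ip D w w"
  using Cauchy_Schwarz_ineq_sum[of v w D] by (simp add: ip_def power2_eq_square)

lemma orthonormal_on_subset: "orthonormal_on D u A \<Longrightarrow> B \<subseteq> A \<Longrightarrow> orthonormal_on D u B"
  unfolding orthonormal_on_def by blast

lemma orthonormal_onD:
  "orthonormal_on D u A \<Longrightarrow> a \<in> A \<Longrightarrow> b \<in> A \<Longrightarrow> ip D (u a) (u b) = (if a = b then 1 else 0)"
  unfolding orthonormal_on_def by blast

lemma ip_lincomb_orthonormal:
  assumes "orthonormal_on D u A" "finite A" "a \<in> A"
  shows "ip D (u a) (lincomb_fun A c u) = c a"
proof -
  have "ip D (u a) (lincomb_fun A c u) = (\<Sum>b\<in>A. if b = a then c b else 0)"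
    unfolding ip_lincomb_right using assms by (intro sum.cong) (auto simp: orthonormal_onD)
  then show ?thesis using assms by simp
qed

lemma norm_lincomb_orthonormal:
  assumes "orthonormal_on D u A" "finite A"
  shows "ip D (lincomb_fun A c u) (lincomb_fun A c u) = (\<Sum>a\<in>A. (c a)\<^sup>2)"
  by (subst ip_lincomb_left) (use assms in \<open>simp add: ip_lincomb_orthonormal power2_eq_square\<close>)

lemma bessel_inequality:
  assumes "orthonormal_on D u A" "finite A"
  shows "(\<Sum>a\<in>A. (ip D (u a) v)\<^sup>2) \<le> ip D v v"
proof -
  let ?p = "lincomb_fun A (\<lambda>a. ip D (u a) v) u"
  have "0 \<le> ip D (\<lambda>j. v j - ?p j) (\<lambda>j. v j - ?p j)" by (rule ip_self_nonneg)
  also have "\<dots> = ip D v v - 2 * ip D ?p v + ip D ?p ?p"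
    unfolding ip_diff_left ip_diff_right ip_commute[of D v ?p] by simp
  also have "ip D ?p v = (\<Sum>a\<in>A. (ip D (u a) v)\<^sup>2)"
    by (simp add: ip_lincomb_left power2_eq_square)
  finally show ?thesis using assms by (simp add: norm_lincomb_orthonormal)
qed

text \<open>The bilinear form of the sample covariance, written through the observations so that
  passing to another index set involves no matrices.\<close>

definition qf :: "'s set \<Rightarrow> 'i set \<Rightarrow> ('s \<Rightarrow> 'i \<Rightarrow> real) \<Rightarrow> ('i \<Rightarrow> real) \<Rightarrow> ('i \<Rightarrow> real) \<Rightarrow> real" where
  "qf I D X v w = (\<Sum>i\<in>I. ip D (X i) v * ip D (X i) w) / card I"

lemma qf_commute: "qf I D X v w = qf I D X w v"
  by (simp add: qf_def mult.commute)

lemma qf_self_nonneg: "0 \<le> qf I D X v v"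
  by (simp add: qf_def sum_nonneg)

lemma qf_add_left: "qf I D X (\<lambda>j. v j + v' j) w = qf I D X v w + qf I D X v' w"
  by (simp add: qf_def ip_add_right sum.distrib algebra_simps add_divide_distrib)

lemma qf_add_right: "qf I D X w (\<lambda>j. v j + v' j) = qf I D X w v + qf I D X w v'"
  using qf_add_left qf_commute by metis

lemma qf_lincomb_left: "qf I D X (lincomb_fun A c u) w = (\<Sum>a\<in>A. c a * qf I D X (u a) w)"
  unfolding qf_def ip_lincomb_right
  by (simp add: sum_distrib_left sum_distrib_right sum_divide_distrib mult.assoc)
     (subst sum.swap, simp)

lemma qf_lincomb_right: "qf I D X w (lincomb_fun A c u) = (\<Sum>a\<in>A. c a * qf I D X w (u a))"
  by (subst (1 2) qf_commute) (rule qf_lincomb_left)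

lemma qf_square_le: "(qf I D X v w)\<^sup>2 \<le> qf I D X v v * qf I D X w w"
proof -
  have "(\<Sum>i\<in>I. ip D (X i) v * ip D (X i) w)\<^sup>2 \<le> (\<Sum>i\<in>I. (ip D (X i) v)\<^sup>2) * (\<Sum>i\<in>I. (ip D (X i) w)\<^sup>2)"
    by (rule Cauchy_Schwarz_ineq_sum)
  then have "(\<Sum>i\<in>I. ip D (X i) v * ip D (X i) w)\<^sup>2 / (real (card I))\<^sup>2
     \<le> (\<Sum>i\<in>I. (ip D (X i) v)\<^sup>2) * (\<Sum>i\<in>I. (ip D (X i) w)\<^sup>2) / (real (card I))\<^sup>2"
    by (intro divide_right_mono) auto
  then show ?thesis by (simp add: qf_def power_divide power2_eq_square)
qed

lemma qf_add_self_le: "qf I D X (\<lambda>j. v j + w j) (\<lambda>j. v j + w j) \<le> 2 * qf I D X v v + 2 * qf I D X w w"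
proof -
  have "qf I D X (\<lambda>j. v j + w j) (\<lambda>j. v j + w j) = (\<Sum>i\<in>I. (ip D (X i) v + ip D (X i) w)\<^sup>2) / card I"
    by (simp add: qf_def ip_add_right power2_eq_square)
  also have "\<dots> \<le> (\<Sum>i\<in>I. 2 * (ip D (X i) v)\<^sup>2 + 2 * (ip D (X i) w)\<^sup>2) / card I"
  proof (intro divide_right_mono sum_mono)
    fix i
    show "(ip D (X i) v + ip D (X i) w)\<^sup>2 \<le> 2 * (ip D (X i) v)\<^sup>2 + 2 * (ip D (X i) w)\<^sup>2"
      using zero_le_power2[of "ip D (X i) v - ip D (X i) w"] by (simp add: power2_sum power2_diff)
  qed simp
  also have "\<dots> = 2 * qf I D X v v + 2 * qf I D X w w"
    by (simp add: qf_def sum.distrib sum_distrib_left power2_eq_square add_divide_distrib)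
  finally show ?thesis .
qed

lemma qf_minus_self: "qf I D X (\<lambda>j. - v j) (\<lambda>j. - v j) = qf I D X v v"
  by (simp add: qf_def ip_def sum_negf)

text \<open>Discarded observations contribute nonnegative terms, so only the normalisation changes.
  This lets one tail bound for the full sample serve all training sets at once.\<close>

lemma qf_mono_sample:
  fixes c :: real
  assumes "finite I" "J \<subseteq> I" "real (card I) \<le> c * real (card J)" "J \<noteq> {}"
  shows "qf J D X v v \<le> c * qf I D X v v"
proof -
  have J: "0 < card J" and I: "0 < card I"
    using assms by (auto simp: card_gt_0_iff intro: finite_subset)
  have s0: "0 \<le> (\<Sum>i\<in>I. ip D (X i) v * ip D (X i) v)" by (simp add: sum_nonneg)
  have "(\<Sum>i\<in>J. ip D (X i) v * ip D (X i) v) \<le> (\<Sum>i\<in>I. ip D (X i) v * ip D (X i) v)"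
    using assms by (intro sum_mono2) auto
  then have "qf J D X v v \<le> (\<Sum>i\<in>I. ip D (X i) v * ip D (X i) v) / card J"
    unfolding qf_def by (rule divide_right_mono) simp
  also have "\<dots> \<le> c * qf I D X v v"
  proof -
    have "real (card I) \<le> c * real (card J)" using assms(3) .
    then have "1 / real (card J) \<le> c / real (card I)" using I J by (simp add: field_simps)
    from mult_left_mono[OF this s0] show ?thesis by (simp add: qf_def mult.commute)
  qed
  finally show ?thesis .
qed

text \<open>The \<open>R\<close> vectors span the range of the sample covariance only and need not
  be complete. \<open>mu\<close> are the eigenvalues, that is, the squares of the entries of
  \<Lambda>.\<close>

locale sample_spectrum =
  fixes D :: "'i set" and I :: "'s set" and X :: "'s \<Rightarrow> 'i \<Rightarrow> real"
    and R :: nat and w :: "nat \<Rightarrow> 'i \<Rightarrow> real" and mu :: "nat \<Rightarrow> real"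
  assumes finite_I: "finite I" and finite_D: "finite D" and I_nonempty: "I \<noteq> {}"
    and orthonormal: "orthonormal_on D w {..<R}"
    and mu_pos: "a < R \<Longrightarrow> 0 < mu a"
    and mu_antimono: "a \<le> b \<Longrightarrow> b < R \<Longrightarrow> mu b \<le> mu a"
    and spectral: "qf I D X v v' = (\<Sum>a<R. mu a * (ip D (w a) v * ip D (w a) v'))"
begin

lemma card_I_pos: "0 < card I"
  using finite_I I_nonempty by (simp add: card_gt_0_iff)

lemma qf_eigenvector:
  assumes "a < R"
  shows "qf I D X (w a) v = mu a * ip D (w a) v"
proof -
  have "qf I D X (w a) v = (\<Sum>b<R. if b = a then mu a * ip D (w a) v else 0)"
    unfolding spectral using assms
    by (intro sum.cong) (auto simp: orthonormal_onD[OF orthonormal])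
  then show ?thesis using assms by simp
qed

text \<open>The left singular vectors of the design matrix, an orthonormal system indexed by
  observations.\<close>

definition left_vec :: "nat \<Rightarrow> 's \<Rightarrow> real" where
  "left_vec a i = ip D (X i) (w a) / sqrt (card I * mu a)"

lemma orthonormal_left: "orthonormal_on I left_vec {..<R}"
  unfolding orthonormal_on_def
proof (intro ballI)
  fix a b assume ab: "a \<in> {..<R}" "b \<in> {..<R}"
  have "ip I (left_vec a) (left_vec b) = qf I D X (w a) (w b) / (sqrt (mu a) * sqrt (mu b))"
  proof -
    have "left_vec a i * left_vec b i = ip D (X i) (w a) * ip D (X i) (w b) / card I / (sqrt (mu a) * sqrt (mu b))" for i
    proof -
      have "sqrt (card I * mu a) * sqrt (card I * mu b) = (sqrt (card I) * sqrt (card I)) * (sqrt (mu a) * sqrt (mu b))"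
        unfolding real_sqrt_mult by (simp only: mult_ac)
      then show ?thesis unfolding left_vec_def times_divide_times_eq by simp
    qed
    then show ?thesis unfolding ip_def[of I] qf_def by (simp add: sum_divide_distrib)
  qed
  also have "qf I D X (w a) (w b) = (if a = b then mu a else 0)"
    using ab by (simp add: qf_eigenvector orthonormal_onD[OF orthonormal])
  finally show "ip I (left_vec a) (left_vec b) = (if a = b then 1 else 0)"
    using mu_pos[of a] ab by (cases "a = b") simp_all
qed

text \<open>Double counting of squared entries of the left singular vectors: each vector has norm
  one, and Bessel's inequality at a coordinate vector bounds the entries that belong to one
  observation.\<close>

lemma rank_le_card: "R \<le> card I"
proof -
  have "real R = (\<Sum>a<R. ip I (left_vec a) (left_vec a))"
    by (simp add: orthonormal_onD[OF orthonormal_left])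
  also have "\<dots> = (\<Sum>i\<in>I. \<Sum>a<R. (left_vec a i)\<^sup>2)"
    unfolding ip_def by (subst sum.swap) (simp add: power2_eq_square)
  also have "\<dots> \<le> (\<Sum>i\<in>I. 1)"
  proof (rule sum_mono)
    fix i assume i: "i \<in> I"
    let ?e = "\<lambda>j. if j = i then 1 else 0 :: real"
    have e: "ip I v ?e = v i" for v
    proof -
      have "ip I v ?e = (\<Sum>j\<in>I. if j = i then v j else 0)"
        unfolding ip_def by (intro sum.cong) auto
      then show ?thesis using i finite_I by simp
    qed
    show "(\<Sum>a<R. (left_vec a i)\<^sup>2) \<le> 1"
      using bessel_inequality[OF orthonormal_left, of ?e] by (simp only: e finite_lessThan) simp
  qed
  finally show ?thesis unfolding sum_constant mult_1_right of_nat_le_iff .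
qed

text \<open>Up to the factor \<open>1 / sqrt (card I)\<close> the whitened coefficients are the
  coefficients of the responses along the left singular vectors. Hence no eigenvalue appears in the
  bound, however small it may be.\<close>

lemma coefficient_energy_le:
  assumes "m \<le> R"
  shows "(\<Sum>a<m. ((\<Sum>i\<in>I. y i * ip D (X i) (w a)) / card I / sqrt (mu a))\<^sup>2) \<le> (\<Sum>i\<in>I. (y i)\<^sup>2) / card I"
proof -
  have "((\<Sum>i\<in>I. y i * ip D (X i) (w a)) / card I / sqrt (mu a))\<^sup>2 = (ip I (left_vec a) y)\<^sup>2 / card I"
    if "a < m" for a
  proof -
    have "0 < mu a" using that assms mu_pos by simp
    have "ip I (left_vec a) y = (\<Sum>i\<in>I. y i * ip D (X i) (w a)) / (sqrt (card I) * sqrt (mu a))"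
      unfolding ip_def[of I] left_vec_def by (simp add: sum_divide_distrib real_sqrt_mult mult.commute)
    then have "(ip I (left_vec a) y)\<^sup>2 = (\<Sum>i\<in>I. y i * ip D (X i) (w a))\<^sup>2 / (card I * mu a)"
      using \<open>0 < mu a\<close> by (simp add: power_divide power_mult_distrib)
    moreover have "((\<Sum>i\<in>I. y i * ip D (X i) (w a)) / card I / sqrt (mu a))\<^sup>2
        = (\<Sum>i\<in>I. y i * ip D (X i) (w a))\<^sup>2 / (card I * mu a) / card I"
    proof -
      have "(z / c / sqrt m)\<^sup>2 = z\<^sup>2 / (c * m) / c" if "0 < m" for z c m :: real
        using that by (simp add: power_divide) (simp add: power2_eq_square)
      then show ?thesis using \<open>0 < mu a\<close> by blast
    qed
    ultimately show ?thesis by simp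
  qed
  then have "(\<Sum>a<m. ((\<Sum>i\<in>I. y i * ip D (X i) (w a)) / card I / sqrt (mu a))\<^sup>2)
      = (\<Sum>a<m. (ip I (left_vec a) y)\<^sup>2) / card I"
    by (simp add: sum_divide_distrib)
  also have "\<dots> \<le> ip I y y / card I"
    using assms
    by (intro divide_right_mono bessel_inequality) (auto intro: orthonormal_on_subset[OF orthonormal_left])
  finally show ?thesis by (simp add: ip_def power2_eq_square)
qed

lemma qf_lincomb_eigenvectors:
  assumes "m \<le> R"
  shows "qf I D X (lincomb_fun {..<m} c w) (lincomb_fun {..<m} c w) = (\<Sum>a<m. mu a * (c a)\<^sup>2)"
proof -
  have "orthonormal_on D w {..<m}" using orthonormal assms by (auto intro: orthonormal_on_subset)
  then have ipm: "ip D (w a) (lincomb_fun {..<m} c w) = c a" if "a < m" for a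
    using that by (intro ip_lincomb_orthonormal) auto
  have "qf I D X (lincomb_fun {..<m} c w) (lincomb_fun {..<m} c w)
      = (\<Sum>a<m. c a * (mu a * ip D (w a) (lincomb_fun {..<m} c w)))"
    unfolding qf_lincomb_left using assms by (intro sum.cong) (auto simp: qf_eigenvector)
  also have "\<dots> = (\<Sum>a<m. mu a * (c a)\<^sup>2)"
    by (intro sum.cong) (auto simp: ipm power2_eq_square)
  finally show ?thesis .
qed

text \<open>
  Cauchy--Schwarz for the sample form, applied to an eigenvector \<open>w a\<close> and to its image under
  \<open>\<Sum>j\<in>J. g j (u j) (u j)\<^sup>T\<close>.
\<close>

lemma eigenvector_weight_le:
  fixes CU :: real
  assumes J: "finite J" and g: "\<And>j. j \<in> J \<Longrightarrow> 0 < g j" and "0 \<le> CU"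
    and upper: "\<And>c. qf I D X (lincomb_fun J c u) (lincomb_fun J c u) \<le> CU * (\<Sum>j\<in>J. (c j)\<^sup>2 / g j)"
    and a: "a < R"
  shows "mu a * (\<Sum>j\<in>J. g j * (ip D (u j) (w a))\<^sup>2) \<le> CU"
proof -
  let ?N = "\<Sum>j\<in>J. g j * (ip D (u j) (w a))\<^sup>2"
  let ?c = "\<lambda>j. g j * ip D (u j) (w a)"
  let ?v = "lincomb_fun J ?c u"
  have N0: "0 \<le> ?N" using g by (intro sum_nonneg mult_nonneg_nonneg) (auto simp: less_imp_le)
  have m: "0 < mu a" using mu_pos a .
  have "ip D (w a) ?v = ?N"
    unfolding ip_lincomb_right ip_commute[of D "w a" "u _"] by (simp add: power2_eq_square mult.assoc)
  then have "qf I D X (w a) ?v = mu a * ?N" using qf_eigenvector[OF a] by simp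
  moreover have "qf I D X (w a) (w a) = mu a"
    using qf_eigenvector[OF a] a by (simp add: orthonormal_onD[OF orthonormal])
  ultimately have "(mu a * ?N)\<^sup>2 \<le> mu a * qf I D X ?v ?v"
    using qf_square_le[of I D X "w a" ?v] by simp
  also have "\<dots> \<le> mu a * (CU * (\<Sum>j\<in>J. (?c j)\<^sup>2 / g j))"
    using m by (intro mult_left_mono upper) auto
  also have "(\<Sum>j\<in>J. (?c j)\<^sup>2 / g j) = ?N"
  proof (intro sum.cong refl)
    fix j assume "j \<in> J"
    then have "0 < g j" by (rule g)
    then show "(?c j)\<^sup>2 / g j = g j * (ip D (u j) (w a))\<^sup>2"
      by (simp add: power_mult_distrib power2_eq_square[of "g j"])
  qed
  finally have "(mu a * ?N) * (mu a * ?N) \<le> CU * (mu a * ?N)"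
    by (simp add: power2_eq_square mult_ac)
  moreover have "0 \<le> mu a * ?N" using N0 m by simp
  ultimately have *: "(mu a * ?N) * (mu a * ?N) \<le> CU * (mu a * ?N) \<and> 0 \<le> mu a * ?N" by blast
  show ?thesis
  proof -
    have "x \<le> CU" if "x * x \<le> CU * x" "0 \<le> x" for x :: real
      using that \<open>0 \<le> CU\<close> by (cases "x = 0") (auto simp: mult_le_cancel_right)
    then show "mu a * ?N \<le> CU" using * by blast
  qed
qed

text \<open>The trace is expanded in sample eigenvectors and cut at \<open>k\<close>: each leading
  eigenvector contributes at most \<open>CU\<close> by the weight bound, the others have eigenvalue
  at most \<open>ml\<close>. Read backwards, a large trace forces a large \<open>ml\<close>.\<close>

lemma weighted_trace_le:
  fixes CU :: real
  assumes J: "finite J" and g: "\<And>j. j \<in> J \<Longrightarrow> 0 < g j" and "0 \<le> CU"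
    and upper: "\<And>c. qf I D X (lincomb_fun J c u) (lincomb_fun J c u) \<le> CU * (\<Sum>j\<in>J. (c j)\<^sup>2 / g j)"
    and ml: "\<And>a. k \<le> a \<Longrightarrow> a < R \<Longrightarrow> mu a \<le> ml" and "0 \<le> ml"
    and G: "(\<Sum>a\<in>{k..<R}. \<Sum>j\<in>J. g j * (ip D (u j) (w a))\<^sup>2) \<le> G"
  shows "(\<Sum>j\<in>J. g j * qf I D X (u j) (u j)) \<le> min k R * CU + ml * G"
proof -
  let ?N = "\<lambda>a. \<Sum>j\<in>J. g j * (ip D (u j) (w a))\<^sup>2"
  have N0: "0 \<le> ?N a" for a using g by (intro sum_nonneg mult_nonneg_nonneg) (auto simp: less_imp_le)
  have "(\<Sum>j\<in>J. g j * qf I D X (u j) (u j)) = (\<Sum>a<R. mu a * ?N a)"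
    unfolding spectral sum_distrib_left
  proof (subst sum.swap, intro sum.cong refl)
    fix a j
    show "g j * (mu a * (ip D (w a) (u j) * ip D (w a) (u j))) = mu a * (g j * (ip D (u j) (w a))\<^sup>2)"
      unfolding ip_commute[of D "w a" "u j"] by (simp add: power2_eq_square)
  qed
  also have "{..<R} = {..<min k R} \<union> {k..<R}" by auto
  also have "(\<Sum>a\<in>{..<min k R} \<union> {k..<R}. mu a * ?N a) = (\<Sum>a<min k R. mu a * ?N a) + (\<Sum>a\<in>{k..<R}. mu a * ?N a)"
    by (rule sum.union_disjoint) auto
  also have "\<dots> \<le> (\<Sum>a<min k R. CU) + (\<Sum>a\<in>{k..<R}. ml * ?N a)"
  proof (intro add_mono sum_mono mult_right_mono N0)
    fix a assume "a \<in> {..<min k R}"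
    then show "mu a * ?N a \<le> CU" by (intro eigenvector_weight_le J g \<open>0 \<le> CU\<close> upper) auto
  qed (use ml in auto)
  also have "(\<Sum>a\<in>{k..<R}. ml * ?N a) \<le> ml * G"
    unfolding sum_distrib_left[symmetric] using G \<open>0 \<le> ml\<close> by (rule mult_left_mono)
  finally show ?thesis by simp
qed

end

section \<open>Population form against sample form on the leading sample eigenvectors\<close>

lemma qf_cong:
  assumes "\<And>j. j \<in> D \<Longrightarrow> v j = v' j" "\<And>j. j \<in> D \<Longrightarrow> w j = w' j"
  shows "qf I D X v w = qf I D X v' w'"
proof -
  have "ip D (X i) v = ip D (X i) v'" "ip D (X i) w = ip D (X i) w'" for i
    unfolding ip_def using assms by (auto intro!: sum.cong)
  then show ?thesis by (simp add: qf_def)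
qed

lemma lincomb_fun_indicator:
  assumes "finite A" "a \<in> A"
  shows "lincomb_fun A (\<lambda>b. if b = a then 1 else 0) u = u a"
proof
  fix j
  have "lincomb_fun A (\<lambda>b. if b = a then 1 else 0) u j = (\<Sum>b\<in>A. if b = a then u b j else 0)"
    unfolding lincomb_fun_def by (intro sum.cong) auto
  then show "lincomb_fun A (\<lambda>b. if b = a then 1 else 0) u j = u a j" using assms by simp
qed

definition popS :: "nat \<Rightarrow> (nat \<Rightarrow> nat \<Rightarrow> real) \<Rightarrow> (nat \<Rightarrow> real) \<Rightarrow> (nat \<Rightarrow> real) \<Rightarrow> real" where
  "popS d u lam v = (\<Sum>j<d. lam j * (ip {..<d} (u j) v)\<^sup>2)"

text \<open>The deterministic content of the good design event. Indices start at 0, so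
  \<open>lam p\<close> is the first eigenvalue after a head of size \<open>p\<close>. \<Gamma> is
  the constant of the tail operator bound; \<open>16 * \<Gamma> * k \<le> n\<close> limits the part
  of the tail trace that \<open>k\<close> sample eigenvectors can carry.\<close>

locale spectral_comparison = sample_spectrum "{..<d}" I X R w mu
  for d :: nat and I :: "'s set" and X :: "'s \<Rightarrow> nat \<Rightarrow> real"
    and R :: nat and w :: "nat \<Rightarrow> nat \<Rightarrow> real" and mu :: "nat \<Rightarrow> real" +
  fixes u :: "nat \<Rightarrow> nat \<Rightarrow> real" and lam :: "nat \<Rightarrow> real" and n k p :: nat and \<Gamma> :: real
  assumes u_orthonormal: "orthonormal_on {..<d} u {..<d}"
    and u_complete: "i < d \<Longrightarrow> v i = lincomb_fun {..<d} (\<lambda>j. ip {..<d} (u j) v) u i"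
    and lam_pos: "j < d \<Longrightarrow> 0 < lam j"
    and lam_antimono: "i \<le> j \<Longrightarrow> j < d \<Longrightarrow> lam j \<le> lam i"
    and p_def: "p = min (8 * k) d" and k_pos: "0 < k" and d_pos: "0 < d"
    and head_lower: "(\<Sum>j<p. lam j * (c j)\<^sup>2) / 2 \<le> qf I {..<d} X (lincomb_fun {..<p} c u) (lincomb_fun {..<p} c u)"
    and head_upper: "qf I {..<d} X (lincomb_fun {..<p} c u) (lincomb_fun {..<p} c u) \<le> 3 / 2 * (\<Sum>j<p. lam j * (c j)\<^sup>2)"
    and card_le: "card I \<le> n" and \<Gamma>: "1 \<le> \<Gamma>" "16 * \<Gamma> * k \<le> n"
    and tail_upper: "p < d \<Longrightarrow> qf I {..<d} X (lincomb_fun {p..<d} c u) (lincomb_fun {p..<d} c u)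
      \<le> \<Gamma> * (lam p + (\<Sum>j=p..<d. lam j) / n) * (\<Sum>j=p..<d. (c j)\<^sup>2)"
    and tail_trace: "p < d \<Longrightarrow> (\<Sum>j=p..<d. lam j) / 2 \<le> (\<Sum>j=p..<d. qf I {..<d} X (u j) (u j))"
begin

abbreviation "Q \<equiv> qf I {..<d} X"

lemma p_bounds: "p \<le> d" "0 < p" "p \<le> 8 * k"
  using p_def k_pos d_pos by auto

lemma head_trace: "p / 2 \<le> (\<Sum>j<p. 1 / lam j * Q (u j) (u j))"
proof -
  have "p / 2 = (\<Sum>j<p. 1 / 2)" by simp
  also have "\<dots> \<le> (\<Sum>j<p. 1 / lam j * Q (u j) (u j))"
  proof (rule sum_mono)
    fix j assume j: "j \<in> {..<p}"
    then have l: "0 < lam j" using lam_pos p_bounds by auto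
    have "(\<Sum>i<p. lam i * (if i = j then 1 else 0)\<^sup>2) = (\<Sum>i<p. if i = j then lam i else 0)"
      by (intro sum.cong) auto
    also have "\<dots> = lam j" using j by simp
    finally have "lam j / 2 \<le> Q (u j) (u j)"
      using head_lower[of "\<lambda>i. if i = j then 1 else 0"] lincomb_fun_indicator[of "{..<p}" j u] j by simp
    then show "1 / 2 \<le> 1 / lam j * Q (u j) (u j)" using l by (simp add: field_simps)
  qed
  finally show ?thesis .
qed

lemma head_upper': "Q (lincomb_fun {..<p} c u) (lincomb_fun {..<p} c u) \<le> 3 / 2 * (\<Sum>j<p. (c j)\<^sup>2 / (1 / lam j))"
  using head_upper[of c] by (simp add: mult.commute)

lemma head_weight_pos: "j \<in> {..<p} \<Longrightarrow> 0 < 1 / lam j"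
  using lam_pos p_bounds by simp

text \<open>Makes the number of breakpoints, at most \<open>min k d + 1\<close>, comparable with the
  rank, the quantity allowed in the final logarithm.\<close>

lemma rank_ge: "p \<le> 3 * R"
proof -
  \<comment> \<open>Cutting at \<open>k = R\<close> leaves no eigenvector in the second group, so 0
    can be taken for both \<open>ml\<close> and \<open>G\<close>.\<close>
  have "(\<Sum>j<p. 1 / lam j * Q (u j) (u j)) \<le> min R R * (3 / 2) + 0 * 0"
    by (rule weighted_trace_le[where k = R]) (use head_upper' head_weight_pos in auto)
  then have "real p \<le> 3 * real R" using head_trace by simp
  then show ?thesis by linarith
qed

lemma comparison_low_dim:
  assumes "p = d"
  shows "popS d u lam b \<le> 2 * Q b b"
proof -
  have "Q b b = Q (lincomb_fun {..<d} (\<lambda>j. ip {..<d} (u j) b) u) (lincomb_fun {..<d} (\<lambda>j. ip {..<d} (u j) b) u)"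
    using u_complete by (intro qf_cong) auto
  then show ?thesis
    using head_lower[of "\<lambda>j. ip {..<d} (u j) b"] assms by (simp add: popS_def)
qed

text \<open>
  Comparing traces forces the \<open>k\<close>-th sample eigenvalue to be large: the first \<open>k\<close> sample
  eigenvectors can only account for a small part of the trace.
\<close>

lemma eigenvalue_ge:
  assumes pd: "p < d"
  shows "k \<le> R" "(lam p + (\<Sum>j=p..<d. lam j) / n) / 8 \<le> mu (k - 1)"
proof -
  define T where "T = (\<Sum>j=p..<d. lam j) / n"
  define ml where "ml = mu (k - 1)"
  have p8: "p = 8 * k" using pd p_def by auto
  show kR: "k \<le> R" using rank_ge p8 by linarith
  have ml0: "0 < ml" unfolding ml_def using mu_pos[of "k - 1"] kR k_pos by simp
  have ml: "mu a \<le> ml" if "k \<le> a" "a < R" for a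
    unfolding ml_def using that k_pos by (intro mu_antimono) auto
  have n0: "0 < n" using card_I_pos card_le by simp
  have T0: "0 \<le> T" unfolding T_def using lam_pos by (intro divide_nonneg_nonneg sum_nonneg) (auto simp: less_imp_le)
  have l0: "0 < lam p" using lam_pos pd by simp
  \<comment> \<open>Whitened head: the trace is at least \<open>p / 2 = 4 * k\<close>, the
    \<open>k\<close> leading eigenvectors carry at most \<open>3 * k / 2\<close>, and the remaining
    \<open>5 * k / 2\<close> must come from eigenvalues that are at most \<open>ml\<close>.\<close>
  have "(\<Sum>j<p. 1 / lam j * Q (u j) (u j)) \<le> min k R * (3 / 2) + ml * (p / lam p)"
  proof (rule weighted_trace_le)
    have "(\<Sum>a\<in>{k..<R}. \<Sum>j\<in>{..<p}. 1 / lam j * (ip {..<d} (u j) (w a))\<^sup>2)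
        = (\<Sum>j\<in>{..<p}. 1 / lam j * (\<Sum>a\<in>{k..<R}. (ip {..<d} (w a) (u j))\<^sup>2))"
      unfolding sum_distrib_left ip_commute[of "{..<d}" "u _" "w _"] by (rule sum.swap)
    also have "\<dots> \<le> (\<Sum>j\<in>{..<p}. 1 / lam p * 1)"
    proof (intro sum_mono mult_mono)
      fix j assume j: "j \<in> {..<p}"
      show "1 / lam j \<le> 1 / lam p"
        using j pd lam_pos[of j] lam_antimono[of j p] l0 by (intro divide_left_mono) auto
      have "(\<Sum>a\<in>{k..<R}. (ip {..<d} (w a) (u j))\<^sup>2) \<le> ip {..<d} (u j) (u j)"
        by (intro bessel_inequality orthonormal_on_subset[OF orthonormal]) auto
      then show "(\<Sum>a\<in>{k..<R}. (ip {..<d} (w a) (u j))\<^sup>2) \<le> 1"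
        using j pd orthonormal_onD[OF u_orthonormal, of j j] by simp
    qed (use l0 in \<open>auto intro: sum_nonneg\<close>)
    finally show "(\<Sum>a\<in>{k..<R}. \<Sum>j\<in>{..<p}. 1 / lam j * (ip {..<d} (u j) (w a))\<^sup>2) \<le> p / lam p" by simp
  qed (use head_upper' head_weight_pos ml ml0 in auto)
  then have "8 * real k / 2 \<le> real k * (3 / 2) + ml * (8 * real k / lam p)"
    using head_trace kR p8 by simp
  then have "real k * (5 / 2) \<le> real k * (8 * ml / lam p)" by (simp add: field_simps)
  then have "5 / 2 \<le> 8 * ml / lam p" using k_pos by (simp only: mult_le_cancel_left_pos of_nat_0_less_iff)
  then have ml1: "5 / 16 * lam p \<le> ml" using l0 by (simp add: field_simps)
  have th0: "0 < \<Gamma> * (lam p + T)" using \<Gamma> l0 T0 by (intro mult_pos_pos) auto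
  \<comment> \<open>Unweighted tail: the trace is at least \<open>n * T / 2\<close>, and because of
    \<open>16 * \<Gamma> * k \<le> n\<close> the leading eigenvectors carry at most
    \<open>n / 16 * (lam p + T)\<close> of it.\<close>
  have "(\<Sum>j=p..<d. 1 * Q (u j) (u j)) \<le> min k R * (\<Gamma> * (lam p + T)) + ml * card I"
  proof (rule weighted_trace_le)
    have "(\<Sum>a\<in>{k..<R}. \<Sum>j\<in>{p..<d}. 1 * (ip {..<d} (u j) (w a))\<^sup>2) \<le> (\<Sum>a\<in>{k..<R}. 1)"
    proof (rule sum_mono)
      fix a assume a: "a \<in> {k..<R}"
      have "(\<Sum>j\<in>{p..<d}. (ip {..<d} (u j) (w a))\<^sup>2) \<le> ip {..<d} (w a) (w a)"
        by (intro bessel_inequality orthonormal_on_subset[OF u_orthonormal]) auto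
      then show "(\<Sum>j\<in>{p..<d}. 1 * (ip {..<d} (u j) (w a))\<^sup>2) \<le> 1"
        using a orthonormal_onD[OF orthonormal, of a a] by simp
    qed
    also have "\<dots> \<le> real (card I)" using rank_le_card by simp
    finally show "(\<Sum>a\<in>{k..<R}. \<Sum>j\<in>{p..<d}. 1 * (ip {..<d} (u j) (w a))\<^sup>2) \<le> card I" .
    show "Q (lincomb_fun {p..<d} c u) (lincomb_fun {p..<d} c u) \<le> \<Gamma> * (lam p + T) * (\<Sum>j=p..<d. (c j)\<^sup>2 / 1)" for c
      using tail_upper[OF pd, of c] by (simp add: T_def)
  qed (use ml ml0 th0 in auto)
  moreover have "(\<Sum>j=p..<d. lam j) = n * T" using n0 by (simp add: T_def)
  ultimately have "n * T / 2 \<le> k * (\<Gamma> * (lam p + T)) + ml * card I"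
    using tail_trace[OF pd] kR by simp
  also have "\<dots> \<le> n / 16 * (lam p + T) + ml * n"
  proof (intro add_mono mult_left_mono)
    have "(16 * \<Gamma> * k) * (lam p + T) \<le> n * (lam p + T)" using \<Gamma>(2) l0 T0 by (intro mult_right_mono) auto
    then show "k * (\<Gamma> * (lam p + T)) \<le> n / 16 * (lam p + T)" by (simp add: algebra_simps)
  qed (use card_le ml0 in auto)
  finally have "n * (T / 2) \<le> n * ((lam p + T) / 16 + ml)" by (simp add: algebra_simps)
  then have ml2: "T / 2 \<le> (lam p + T) / 16 + ml" using n0 by (simp add: mult_le_cancel_left)
  \<comment> \<open>The head bound decides when \<open>lam p\<close> dominates. Otherwise
    \<open>3/16 * (lam p + T) \<le> 3/8 * T\<close>, and the tail bound decides.\<close>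
  have "(lam p + T) / 8 \<le> ml"
  proof (cases "T \<le> lam p")
    case True
    then have "(lam p + T) / 8 \<le> 5 / 16 * lam p" using l0 by simp
    with ml1 show ?thesis by (rule order.trans[rotated])
  next
    case False
    then have "(lam p + T) / 8 \<le> T / 2 - (lam p + T) / 16" using T0 by (simp add: field_simps)
    also have "\<dots> \<le> ml" using ml2 by (simp only: diff_le_eq add.commute)
    finally show ?thesis .
  qed
  then show "(lam p + (\<Sum>j=p..<d. lam j) / n) / 8 \<le> mu (k - 1)"
    unfolding T_def ml_def .
qed

text \<open>On the span of the leading sample eigenvectors the Euclidean norm is controlled by the
  sample energy. This bounds the tail part of \<open>b\<close> in both forms; the head is then
  recovered as \<open>b\<close> minus the tail, so cross terms between head and tail never have to
  be estimated.\<close>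

lemma comparison_high_dim:
  fixes c :: "nat \<Rightarrow> real"
  assumes pd: "p < d" and m: "m \<le> k" "m \<le> R"
  defines "b \<equiv> lincomb_fun {..<m} c w"
  shows "popS d u lam b \<le> (12 + 32 * \<Gamma>) * Q b b"
proof -
  define \<theta> where "\<theta> = lam p + (\<Sum>j=p..<d. lam j) / n"
  let ?c = "\<lambda>j. ip {..<d} (u j) b"
  let ?h = "lincomb_fun {..<p} ?c u" and ?t = "lincomb_fun {p..<d} ?c u"
  have l0: "0 < lam p" using lam_pos pd by simp
  have sl: "0 \<le> (\<Sum>j=p..<d. lam j) / n" using lam_pos by (intro divide_nonneg_nonneg sum_nonneg) (auto simp: less_imp_le)
  have th: "0 < \<theta>" "lam p \<le> \<theta>" unfolding \<theta>_def using l0 sl by auto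
  have split: "{..<d} = {..<p} \<union> {p..<d}" "{..<p} \<inter> {p..<d} = {}" using pd by auto
  have sumsplit: "(\<Sum>j<d. f j) = (\<Sum>j<p. f j) + (\<Sum>j=p..<d. f j)" for f :: "nat \<Rightarrow> real"
    unfolding split(1) by (rule sum.union_disjoint) auto
  have om: "orthonormal_on {..<d} w {..<m}" using m by (intro orthonormal_on_subset[OF orthonormal]) auto
  have nb: "ip {..<d} b b = (\<Sum>a<m. (c a)\<^sup>2)"
    unfolding b_def by (rule norm_lincomb_orthonormal[OF om]) simp
  have Qb: "Q b b = (\<Sum>a<m. mu a * (c a)\<^sup>2)"
    unfolding b_def by (rule qf_lincomb_eigenvectors[OF m(2)])
  \<comment> \<open>The sample energy weights the squared coefficients by \<open>mu\<close>, and
    since \<open>m \<le> k\<close> every weight is at least the \<open>k\<close>-th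
    eigenvalue.\<close>
  have "\<theta> / 8 * ip {..<d} b b \<le> Q b b"
    unfolding nb Qb sum_distrib_left
  proof (intro sum_mono mult_right_mono)
    fix a assume a: "a \<in> {..<m}"
    have "\<theta> / 8 \<le> mu (k - 1)" using eigenvalue_ge[OF pd] by (simp add: \<theta>_def)
    also have "\<dots> \<le> mu a" using a m eigenvalue_ge(1)[OF pd] k_pos by (intro mu_antimono) auto
    finally show "\<theta> / 8 \<le> mu a" .
  qed simp
  then have b8: "\<theta> * ip {..<d} b b \<le> 8 * Q b b" by simp
  have tb: "(\<Sum>j=p..<d. (?c j)\<^sup>2) \<le> ip {..<d} b b"
    by (intro bessel_inequality orthonormal_on_subset[OF u_orthonormal]) auto
  have b_eq: "b i = ?h i + ?t i" if "i < d" for i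
    using u_complete[OF that, of b] by (simp add: lincomb_fun_def sumsplit)
  have h_eq: "?h i = b i + - ?t i" if "i < d" for i
    using b_eq[OF that] by simp
  have "Q ?t ?t \<le> \<Gamma> * \<theta> * (\<Sum>j=p..<d. (?c j)\<^sup>2)" using tail_upper[OF pd] by (simp add: \<theta>_def)
  also have "\<dots> \<le> \<Gamma> * \<theta> * ip {..<d} b b" using \<Gamma> th tb by (intro mult_left_mono) auto
  also have "\<dots> \<le> \<Gamma> * (8 * Q b b)" using b8 \<Gamma> by (simp add: mult.assoc mult_left_mono)
  finally have Qt: "Q ?t ?t \<le> 8 * \<Gamma> * Q b b" by simp
  have "Q ?h ?h = Q (\<lambda>i. b i + - ?t i) (\<lambda>i. b i + - ?t i)" using h_eq by (intro qf_cong) auto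
  also have "\<dots> \<le> 2 * Q b b + 2 * Q (\<lambda>i. - ?t i) (\<lambda>i. - ?t i)" by (rule qf_add_self_le)
  also have "Q (\<lambda>i. - ?t i) (\<lambda>i. - ?t i) = Q ?t ?t" by (rule qf_minus_self)
  finally have Qh: "Q ?h ?h \<le> 2 * Q b b + 16 * \<Gamma> * Q b b" using Qt by simp
  have "(\<Sum>j<p. lam j * (?c j)\<^sup>2) \<le> 2 * Q ?h ?h" using head_lower[of ?c] by simp
  moreover have "(\<Sum>j=p..<d. lam j * (?c j)\<^sup>2) \<le> 8 * Q b b"
  proof -
    have "(\<Sum>j=p..<d. lam j * (?c j)\<^sup>2) \<le> (\<Sum>j=p..<d. \<theta> * (?c j)\<^sup>2)"
    proof (intro sum_mono mult_right_mono)
      fix j assume "j \<in> {p..<d}"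
      then have "lam j \<le> lam p" by (intro lam_antimono) auto
      then show "lam j \<le> \<theta>" using th by simp
    qed simp
    also have "\<dots> \<le> \<theta> * ip {..<d} b b"
      unfolding sum_distrib_left[symmetric] using tb th by (intro mult_left_mono) auto
    finally show ?thesis using b8 by simp
  qed
  ultimately have "popS d u lam b \<le> 2 * Q ?h ?h + 8 * Q b b"
    unfolding popS_def sumsplit by (rule add_mono)
  also have "\<dots> \<le> 2 * (2 * Q b b + 16 * \<Gamma> * Q b b) + 8 * Q b b"
    using Qh by (intro add_right_mono mult_left_mono) auto
  finally have "popS d u lam b \<le> 2 * (2 * Q b b + 16 * \<Gamma> * Q b b) + 8 * Q b b" .
  then show ?thesis by (simp add: algebra_simps)
qed

lemma comparison:
  assumes "m \<le> k" "m \<le> R"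
  shows "popS d u lam (lincomb_fun {..<m} c w)
    \<le> (12 + 32 * \<Gamma>) * Q (lincomb_fun {..<m} c w) (lincomb_fun {..<m} c w)"
proof (cases "p < d")
  case False
  then have "popS d u lam (lincomb_fun {..<m} c w) \<le> 2 * Q (lincomb_fun {..<m} c w) (lincomb_fun {..<m} c w)"
    using p_bounds by (intro comparison_low_dim) auto
  also have "\<dots> \<le> (12 + 32 * \<Gamma>) * Q (lincomb_fun {..<m} c w) (lincomb_fun {..<m} c w)"
    using \<Gamma> by (intro mult_right_mono qf_self_nonneg) auto
  finally show ?thesis .
qed (use comparison_high_dim assms in blast)

end

section \<open>Rounding to the integer lattice\<close>

text \<open>On each coordinate line a value between two points is at most the larger end value, so
  coordinates can be moved one after the other to a neighbouring integer without lowering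
  \<open>f\<close>. Integer points thus act as a net without approximation error.\<close>

lemma coordinatewise_rounding:
  fixes f :: "('i \<Rightarrow> real) \<Rightarrow> real"
  assumes "finite J"
    and conv: "\<And>i y a b s. 0 \<le> s \<Longrightarrow> s \<le> 1 \<Longrightarrow>
      f (y(i := (1 - s) * a + s * b)) \<le> max (f (y(i := a))) (f (y(i := b)))"
    and bound: "\<And>z. (\<forall>i\<in>J. z i \<in> \<int> \<and> \<bar>z i - y i\<bar> \<le> 1) \<Longrightarrow> (\<forall>i. i \<notin> J \<longrightarrow> z i = y i) \<Longrightarrow> f z \<le> B"
  shows "f y \<le> B"
  using assms(1) bound
proof (induction J arbitrary: y rule: finite_induct)
  case empty
  show ?case by (rule empty) simp_all
next
  case (insert i J)
  let ?a = "of_int \<lfloor>y i\<rfloor> :: real"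
  let ?s = "y i - ?a"
  have s: "0 \<le> ?s" "?s \<le> 1" by linarith+
  have "(1 - ?s) * ?a + ?s * (?a + 1) = y i" by (simp add: algebra_simps)
  then have "y = y(i := (1 - ?s) * ?a + ?s * (?a + 1))" by simp
  then have "f y \<le> max (f (y(i := ?a))) (f (y(i := ?a + 1)))"
    using conv[OF s, of y i ?a "?a + 1"] by simp
  moreover have "f (y(i := v)) \<le> B" if v: "v \<in> \<int>" "\<bar>v - y i\<bar> \<le> 1" for v
  proof (rule insert.IH)
    fix z assume z: "\<forall>j\<in>J. z j \<in> \<int> \<and> \<bar>z j - (y(i := v)) j\<bar> \<le> 1" "\<forall>j. j \<notin> J \<longrightarrow> z j = (y(i := v)) j"
    show "f z \<le> B"
    proof (rule insert.prems)
      have zi: "z i = v" using z(2) insert.hyps(2) by auto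
      show "\<forall>j\<in>insert i J. z j \<in> \<int> \<and> \<bar>z j - y j\<bar> \<le> 1"
      proof
        fix j assume "j \<in> insert i J"
        then show "z j \<in> \<int> \<and> \<bar>z j - y j\<bar> \<le> 1"
          using z(1) zi v insert.hyps(2) by (cases "j = i") auto
      qed
      show "\<forall>j. j \<notin> insert i J \<longrightarrow> z j = y j" using z(2) by auto
    qed
  qed
  moreover have "\<bar>?a - y i\<bar> \<le> 1" "\<bar>?a + 1 - y i\<bar> \<le> 1" using s by linarith+
  moreover have "?a \<in> \<int>" "?a + 1 \<in> \<int>" by auto
  ultimately have "f y \<le> max (f (y(i := ?a))) (f (y(i := ?a + 1)))" "f (y(i := ?a)) \<le> B" "f (y(i := ?a + 1)) \<le> B"
    by blast+
  then show ?case by simp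
qed

lemma abs_le_square_int: "\<bar>k\<bar> \<le> k\<^sup>2" for k :: int
proof (cases "k = 0")
  case False
  then have "1 * \<bar>k\<bar> \<le> \<bar>k\<bar> * \<bar>k\<bar>" by (intro mult_right_mono) auto
  then show ?thesis by (simp only: abs_mult_self_eq power2_eq_square mult_1)
qed simp

lemma square_sum_convex_coordinate:
  fixes A :: "'i \<Rightarrow> 'j \<Rightarrow> real" and I :: "'i set" and J :: "'j set"
  assumes "0 \<le> s" "s \<le> 1"
  defines "f \<equiv> \<lambda>y. \<Sum>j\<in>J. (\<Sum>i\<in>I. y i * A i j)\<^sup>2"
  shows "f (y(i := (1 - s) * a + s * b)) \<le> max (f (y(i := a))) (f (y(i := b)))"
proof -
  let ?L = "\<lambda>y j. \<Sum>i\<in>I. y i * A i j"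
  have lin: "?L (y(i := (1 - s) * a + s * b)) j = (1 - s) * ?L (y(i := a)) j + s * ?L (y(i := b)) j" for j
    unfolding sum_distrib_left sum.distrib[symmetric] by (intro sum.cong) (auto simp: algebra_simps)
  have sq: "((1 - s) * p + s * q)\<^sup>2 \<le> (1 - s) * p\<^sup>2 + s * q\<^sup>2" for p q :: real
  proof -
    have "0 \<le> s * (1 - s) * (p - q)\<^sup>2" using assms by auto
    also have "\<dots> = (1 - s) * p\<^sup>2 + s * q\<^sup>2 - ((1 - s) * p + s * q)\<^sup>2"
      by (simp add: power2_eq_square algebra_simps)
    finally show ?thesis by simp
  qed
  have "f (y(i := (1 - s) * a + s * b)) \<le> (\<Sum>j\<in>J. (1 - s) * (?L (y(i := a)) j)\<^sup>2 + s * (?L (y(i := b)) j)\<^sup>2)"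
    unfolding f_def lin by (intro sum_mono sq)
  also have "\<dots> = (1 - s) * f (y(i := a)) + s * f (y(i := b))"
    by (simp add: f_def sum.distrib sum_distrib_left)
  also have "\<dots> \<le> (1 - s) * max (f (y(i := a))) (f (y(i := b))) + s * max (f (y(i := a))) (f (y(i := b)))"
    using assms(1,2) by (intro add_mono mult_left_mono) auto
  finally show ?thesis by (simp add: algebra_simps)
qed

lemma sum_exp_neg_abs_le: "(\<Sum>k\<in>{- int N..int N}. exp (- real_of_int \<bar>k\<bar>)) \<le> 3"
proof -
  \<comment> \<open>\<open>exp (-1)\<close> is replaced by the larger 1/2, for which the sum has a
    closed form that suits induction.\<close>
  have "(\<Sum>k\<in>{- int N..int N}. (1/2) ^ nat \<bar>k\<bar>) \<le> 3 - 2 * (1/2 :: real) ^ N"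
  proof (induction N)
    case (Suc N)
    have "{- int (Suc N)..int (Suc N)} = insert (- int (Suc N)) (insert (int (Suc N)) {- int N..int N})" by auto
    then have "(\<Sum>k\<in>{- int (Suc N)..int (Suc N)}. (1/2) ^ nat \<bar>k\<bar>)
        = (1/2) ^ Suc N + ((1/2) ^ Suc N + (\<Sum>k\<in>{- int N..int N}. (1/2 :: real) ^ nat \<bar>k\<bar>))"
      by (simp add: nat_add_distrib)
    with Suc show ?case by simp
  qed simp
  moreover have "exp (- real_of_int \<bar>k\<bar>) \<le> (1/2) ^ nat \<bar>k\<bar>" for k
  proof -
    have "exp (- real_of_int \<bar>k\<bar>) = exp (-1) ^ nat \<bar>k\<bar>"
      by (simp add: exp_of_nat_mult[symmetric])
    also have "\<dots> \<le> (1/2) ^ nat \<bar>k\<bar>"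
      using exp_ge_add_one_self[of 1] by (intro power_mono) (auto simp: exp_minus field_simps)
    finally show ?thesis .
  qed
  then have "(\<Sum>k\<in>{- int N..int N}. exp (- real_of_int \<bar>k\<bar>)) \<le> (\<Sum>k\<in>{- int N..int N}. (1/2) ^ nat \<bar>k\<bar>)"
    by (rule sum_mono)
  moreover have "0 \<le> (1/2 :: real) ^ N" by simp
  ultimately show ?thesis by linarith
qed

text \<open>Rounding a vector of squared norm \<open>card I\<close> moves each coordinate by at most
  1, which gives squared norm at most \<open>4 * card I\<close>. The box follows from the ball for
  integer points and makes finiteness visible.\<close>

definition lattice_ball :: "'i set \<Rightarrow> ('i \<Rightarrow> int) set" where
  "lattice_ball I = {z \<in> PiE I (\<lambda>_. {- int (4 * card I)..int (4 * card I)}). (\<Sum>i\<in>I. (z i)\<^sup>2) \<le> int (4 * card I)}"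

lemma finite_lattice_ball: "finite I \<Longrightarrow> finite (lattice_ball I)"
  unfolding lattice_ball_def by (rule finite_subset[of _ "PiE I (\<lambda>_. {- int (4 * card I)..int (4 * card I)})"])
    (auto intro: finite_PiE)

text \<open>Exponential weights: on the ball the sum of absolute values is at most the sum of
  squares, so each point weighs at least \<open>exp (- 4 * card I)\<close>, while the total weight
  over the box factorises into factors at most 3.\<close>

lemma card_lattice_ball_le:
  assumes "finite I"
  shows "card (lattice_ball I) \<le> exp (6 * real (card I))"
proof -
  define n where "n = card I"
  let ?P = "PiE I (\<lambda>_. {- int (4 * n)..int (4 * n)})"
  have "real (card (lattice_ball I)) = (\<Sum>z\<in>lattice_ball I. 1)" by simp
  also have "\<dots> \<le> (\<Sum>z\<in>lattice_ball I. exp (4 * n) * (\<Prod>i\<in>I. exp (- real_of_int \<bar>z i\<bar>)))"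
  proof (rule sum_mono)
    fix z assume z: "z \<in> lattice_ball I"
    have "(\<Sum>i\<in>I. \<bar>z i\<bar>) \<le> (\<Sum>i\<in>I. (z i)\<^sup>2)" by (intro sum_mono abs_le_square_int)
    also have "\<dots> \<le> int (4 * n)" using z by (simp add: lattice_ball_def n_def)
    finally have "real_of_int (\<Sum>i\<in>I. \<bar>z i\<bar>) \<le> 4 * real n" by linarith
    then have "1 \<le> exp (4 * real n + (\<Sum>i\<in>I. - real_of_int \<bar>z i\<bar>))"
      by (simp add: sum_negf)
    then show "1 \<le> exp (4 * n) * (\<Prod>i\<in>I. exp (- real_of_int \<bar>z i\<bar>))"
      using assms by (simp add: exp_add exp_sum)
  qed
  also have "\<dots> \<le> (\<Sum>z\<in>?P. exp (4 * n) * (\<Prod>i\<in>I. exp (- real_of_int \<bar>z i\<bar>)))"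
    using assms by (intro sum_mono2) (auto simp: lattice_ball_def n_def prod_nonneg intro: finite_PiE)
  also have "\<dots> = exp (4 * n) * (\<Prod>i\<in>I. \<Sum>k\<in>{- int (4 * n)..int (4 * n)}. exp (- real_of_int \<bar>k\<bar>))"
    unfolding sum_distrib_left[symmetric] using assms by (subst prod_sum_PiE) auto
  also have "\<dots> \<le> exp (4 * n) * (\<Prod>i\<in>I. exp 2)"
  proof (intro mult_left_mono prod_mono conjI)
    fix i
    have "(3 :: real) \<le> exp 2" using exp_ge_add_one_self[of 2] by simp
    then show "(\<Sum>k\<in>{- int (4 * n)..int (4 * n)}. exp (- real_of_int \<bar>k\<bar>)) \<le> exp 2"
      using sum_exp_neg_abs_le[of "4 * n"] by linarith
  qed (auto intro: sum_nonneg)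
  also have "\<dots> = exp (6 * real n)"
    by (simp add: exp_of_nat_mult[symmetric] exp_add[symmetric] n_def)
  finally show ?thesis by (simp add: n_def)
qed

text \<open>Duality: the vector of the values \<open>\<Sum>j\<in>J. c j * A i j\<close> is tested
  against its own direction, rescaled to squared norm \<open>card I\<close> and rounded.
  Cauchy-Schwarz in \<open>j\<close> then turns the bounds at finitely many lattice points, chosen
  before \<open>c\<close>, into one for all \<open>c\<close>.\<close>

lemma operator_bound_from_lattice:
  fixes A :: "'i \<Rightarrow> 'j \<Rightarrow> real"
  assumes "finite I" "I \<noteq> {}"
    and lat: "\<And>z. z \<in> lattice_ball I \<Longrightarrow> (\<Sum>j\<in>J. (\<Sum>i\<in>I. of_int (z i) * A i j)\<^sup>2) \<le> B * (real (card I))\<^sup>2"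
  shows "(\<Sum>i\<in>I. (\<Sum>j\<in>J. c j * A i j)\<^sup>2) / card I \<le> B * (\<Sum>j\<in>J. (c j)\<^sup>2)"
proof -
  define n where "n = real (card I)"
  have n: "0 < n" using assms by (simp add: n_def card_gt_0_iff)
  define q where "q i = (\<Sum>j\<in>J. c j * A i j)" for i
  define N where "N = (\<Sum>i\<in>I. (q i)\<^sup>2)"
  have N0: "0 \<le> N" by (simp add: N_def sum_nonneg)
  define f where "f y = (\<Sum>j\<in>J. (\<Sum>i\<in>I. y i * A i j)\<^sup>2)" for y
  have Bnn: "0 \<le> B"
  proof -
    have "(\<lambda>i\<in>I. 0) \<in> lattice_ball I" by (auto simp: lattice_ball_def)
    from lat[OF this] show ?thesis using n by (simp add: n_def[symmetric] zero_le_mult_iff)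
  qed
  show ?thesis
  proof (cases "N = 0")
    case True
    then show ?thesis using Bnn by (simp add: N_def q_def[symmetric] sum_nonneg)
  next
    case False
    then have Np: "0 < N" using N0 by simp
    define y where "y i = sqrt (n / N) * q i" for i
    have y2: "(\<Sum>i\<in>I. (y i)\<^sup>2) = n"
    proof -
      have "(\<Sum>i\<in>I. (y i)\<^sup>2) = (\<Sum>i\<in>I. n / N * (q i)\<^sup>2)"
        using n Np by (intro sum.cong) (simp_all add: y_def power_mult_distrib)
      also have "\<dots> = n / N * N" by (simp only: sum_distrib_left N_def)
      finally show ?thesis using Np by simp
    qed
    have "f y \<le> B * n\<^sup>2"
    proof (rule coordinatewise_rounding[where f = f and y = y, OF \<open>finite I\<close>])
      show "f (y(i := (1 - s) * a + s * b)) \<le> max (f (y(i := a))) (f (y(i := b)))"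
        if "0 \<le> s" "s \<le> 1" for i y a b s
        unfolding f_def by (rule square_sum_convex_coordinate[OF that])
      fix z assume z: "\<forall>i\<in>I. z i \<in> \<int> \<and> \<bar>z i - y i\<bar> \<le> 1"
      define zi where "zi = (\<lambda>i\<in>I. \<lfloor>z i\<rfloor>)"
      have zi: "of_int (zi i) = z i" if "i \<in> I" for i
        using z that by (auto simp: zi_def Ints_def)
      have "(\<Sum>i\<in>I. (z i)\<^sup>2) \<le> (\<Sum>i\<in>I. 2 * (y i)\<^sup>2 + 2)"
      proof (rule sum_mono)
        fix i assume "i \<in> I"
        then have "(z i - y i)\<^sup>2 \<le> 1" using z by (simp add: abs_square_le_1)
        moreover have "0 \<le> (z i - 2 * y i)\<^sup>2" by simp
        ultimately show "(z i)\<^sup>2 \<le> 2 * (y i)\<^sup>2 + 2" by (simp add: power2_eq_square algebra_simps)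
      qed
      also have "\<dots> = 4 * n" by (simp add: sum.distrib sum_distrib_left[symmetric] y2 n_def)
      finally have "real_of_int (\<Sum>i\<in>I. (zi i)\<^sup>2) \<le> 4 * n" by (simp add: zi)
      then have zs: "(\<Sum>i\<in>I. (zi i)\<^sup>2) \<le> int (4 * card I)" unfolding n_def by linarith
      have "zi \<in> lattice_ball I"
        unfolding lattice_ball_def
      proof (intro CollectI conjI zs PiE_I)
        fix i assume i: "i \<in> I"
        have "(zi i)\<^sup>2 \<le> (\<Sum>i\<in>I. (zi i)\<^sup>2)" using \<open>finite I\<close> i by (intro member_le_sum) auto
        then have "\<bar>zi i\<bar> \<le> int (4 * card I)"
          using zs abs_le_square_int[of "zi i"] by (meson order.trans)
        then show "zi i \<in> {- int (4 * card I)..int (4 * card I)}" by auto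
      qed (simp add: zi_def)
      from lat[OF this] show "f z \<le> B * n\<^sup>2" by (simp add: f_def zi n_def)
    qed
    moreover have "n * N \<le> (\<Sum>j\<in>J. (c j)\<^sup>2) * f y"
    proof -
      have "(\<Sum>j\<in>J. c j * (\<Sum>i\<in>I. y i * A i j)) = (\<Sum>i\<in>I. y i * q i)"
        unfolding q_def sum_distrib_left by (subst sum.swap) (simp add: mult.left_commute)
      also have "\<dots> = sqrt (n / N) * N"
        by (simp add: y_def N_def power2_eq_square sum_distrib_left mult.assoc)
      finally have "(sqrt (n / N) * N)\<^sup>2 \<le> (\<Sum>j\<in>J. (c j)\<^sup>2) * f y"
        unfolding f_def by (metis Cauchy_Schwarz_ineq_sum)
      moreover have "(sqrt (n / N) * N)\<^sup>2 = n * N"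
      proof -
        have "(sqrt (n / N))\<^sup>2 = n / N" using n Np by (intro real_sqrt_pow2) auto
        then have "(sqrt (n / N) * N)\<^sup>2 = n / N * N\<^sup>2" by (simp only: power_mult_distrib)
        then show ?thesis using Np by (simp add: power2_eq_square)
      qed
      ultimately show ?thesis by simp
    qed
    ultimately have "n * N \<le> (\<Sum>j\<in>J. (c j)\<^sup>2) * (B * n\<^sup>2)"
      by (meson mult_left_mono order.trans sum_nonneg zero_le_power2)
    then have "N / n \<le> B * (\<Sum>j\<in>J. (c j)\<^sup>2)" using n by (simp add: field_simps power2_eq_square)
    then show ?thesis by (simp add: N_def q_def n_def)
  qed
qed

section \<open>Exponential moments of sums of squares and the tail operator bound\<close>

lemma nn_integral_normal_density:
  assumes "0 < s"
  shows "(\<integral>\<^sup>+y. ennreal (normal_density m s y) \<partial>lborel) = 1"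
proof -
  interpret P: prob_space "density lborel (normal_density m s)" by (rule prob_space_normal_density[OF assms])
  show ?thesis using P.emeasure_space_1 by (simp add: emeasure_density)
qed

text \<open>Completing the square: the integrand is a constant times a normal density of precision
  \<open>1 - 4 * \<eta> * A\<close>, and the smallness condition keeps this precision at least
  1/2.\<close>

lemma nn_integral_gaussian_quadratic:
  assumes A: "0 \<le> A" "0 \<le> \<eta>" "4 * \<eta> * A \<le> 1/2"
  shows "(\<integral>\<^sup>+y. ennreal (std_normal_density y * exp (A * (w + sqrt (2 * \<eta>) * y)\<^sup>2)) \<partial>lborel)
    \<le> ennreal (exp (4 * \<eta> * A + 2 * A * w\<^sup>2))"
proof -
  define x where "x = 4 * \<eta> * A"
  define v where "v = 1 - x"
  have x: "0 \<le> x" "x \<le> 1/2" using A by (auto simp: x_def)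
  have v: "1/2 \<le> v" "0 < v" using x by (auto simp: v_def)
  define b where "b = 2 * A * w * sqrt (2 * \<eta>)"
  define C where "C = exp (A * w\<^sup>2 + b\<^sup>2 / (2 * v)) / sqrt v"
  have eq: "std_normal_density y * exp (A * (w + sqrt (2 * \<eta>) * y)\<^sup>2) = C * normal_density (b / v) (1 / sqrt v) y" for y
  proof -
    have e: "- y\<^sup>2 / 2 + A * (w + sqrt (2 * \<eta>) * y)\<^sup>2
        = (A * w\<^sup>2 + b\<^sup>2 / (2 * v)) + - (y - b / v)\<^sup>2 / (2 * (1 / sqrt v)\<^sup>2)"
    proof -
      have "- (y - b / v)\<^sup>2 / (2 * (1 / sqrt v)\<^sup>2) = - (v * y\<^sup>2 / 2) + b * y - b\<^sup>2 / (2 * v)"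
        using v by (simp add: power_divide power2_diff field_simps power2_eq_square)
      moreover have "A * (w + sqrt (2 * \<eta>) * y)\<^sup>2 = A * w\<^sup>2 + b * y + x / 2 * y\<^sup>2"
        using A by (simp add: power2_sum power_mult_distrib b_def x_def algebra_simps)
      moreover have "v * y\<^sup>2 / 2 = y\<^sup>2 / 2 - x * y\<^sup>2 / 2" by (simp add: v_def left_diff_distrib diff_divide_distrib)
      ultimately show ?thesis by simp
    qed
    have "std_normal_density y * exp (A * (w + sqrt (2 * \<eta>) * y)\<^sup>2)
        = 1 / sqrt (2 * pi) * exp (- y\<^sup>2 / 2 + A * (w + sqrt (2 * \<eta>) * y)\<^sup>2)"
      by (simp only: std_normal_density_def exp_add mult.assoc)
    also have "\<dots> = C * normal_density (b / v) (1 / sqrt v) y"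
      unfolding e exp_add normal_density_def C_def using v
      by (simp add: real_sqrt_divide real_sqrt_mult power_divide)
    finally show ?thesis .
  qed
  have C0: "0 \<le> C" using v by (simp add: C_def)
  have "(\<integral>\<^sup>+y. ennreal (std_normal_density y * exp (A * (w + sqrt (2 * \<eta>) * y)\<^sup>2)) \<partial>lborel)
      = (\<integral>\<^sup>+y. ennreal C * ennreal (normal_density (b / v) (1 / sqrt v) y) \<partial>lborel)"
    unfolding eq using C0 by (simp add: ennreal_mult')
  also have "\<dots> = ennreal C"
    using v by (subst nn_integral_cmult) (auto simp: nn_integral_normal_density)
  also have "C \<le> exp (4 * \<eta> * A + 2 * A * w\<^sup>2)"
  proof -
    have "b\<^sup>2 / (2 * v) \<le> b\<^sup>2 / 1" using v by (intro divide_left_mono) auto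
    also have "b\<^sup>2 / 1 = 2 * x * (A * w\<^sup>2)" using A by (simp add: b_def x_def power_mult_distrib power2_eq_square)
    also have "\<dots> \<le> 1 * (A * w\<^sup>2)" using A x by (intro mult_right_mono) auto
    finally have 1: "exp (A * w\<^sup>2 + b\<^sup>2 / (2 * v)) \<le> exp (2 * A * w\<^sup>2)" by simp
    \<comment> \<open>Valid for \<open>0 \<le> x \<le> 1/2\<close>; it yields
      \<open>1 / sqrt (1 - x) \<le> exp x\<close>, the price of the changed normalisation.\<close>
    have "1 \<le> (1 - x) * (1 + 2 * x)"
    proof -
      have "0 \<le> x * (1 - 2 * x)" using x by (intro mult_nonneg_nonneg) auto
      then show ?thesis by (simp add: algebra_simps)
    qed
    also have "\<dots> \<le> v * exp (2 * x)"
      unfolding v_def using x by (intro mult_left_mono exp_ge_add_one_self) auto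
    also have "\<dots> = (sqrt v * exp x)\<^sup>2" using v by (simp add: power_mult_distrib exp_double)
    finally have "1 \<le> sqrt v * exp x" using v by (intro power2_le_imp_le[of 1 "sqrt v * exp x"]) auto
    then have 2: "1 / sqrt v \<le> exp x" using v by (simp add: field_simps)
    have "C \<le> exp (2 * A * w\<^sup>2) * exp x"
      unfolding C_def using mult_mono[OF 1 2] v by simp
    then show ?thesis by (simp add: exp_add[symmetric] x_def add.commute)
  qed
  finally show ?thesis by (simp add: ennreal_leI)
qed

text \<open>The moment generating function of a standard normal variable read backwards, known as
  the Hubbard-Stratonovich transformation.\<close>

lemma exp_half_square_as_gaussian:
  "ennreal (exp (\<eta> * a\<^sup>2)) = (\<integral>\<^sup>+y. ennreal (std_normal_density y * exp (sqrt (2 * \<eta>) * a * y)) \<partial>lborel)"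
  if "0 \<le> \<eta>"
proof -
  let ?b = "sqrt (2 * \<eta>) * a"
  have b2: "?b\<^sup>2 / 2 = \<eta> * a\<^sup>2" using that by (simp add: power_mult_distrib)
  have "std_normal_density y * exp (?b * y) = exp (\<eta> * a\<^sup>2) * normal_density ?b 1 y" for y
    unfolding b2[symmetric] std_normal_density_def normal_density_def
    by (simp add: exp_add[symmetric] power2_diff field_simps)
  then have "(\<integral>\<^sup>+y. ennreal (std_normal_density y * exp (?b * y)) \<partial>lborel)
      = (\<integral>\<^sup>+y. ennreal (exp (\<eta> * a\<^sup>2)) * ennreal (normal_density ?b 1 y) \<partial>lborel)"
    by (simp add: ennreal_mult')
  also have "\<dots> = ennreal (exp (\<eta> * a\<^sup>2))"
    by (subst nn_integral_cmult) (auto simp: nn_integral_normal_density)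
  finally show ?thesis by simp
qed

context prob_space
begin

text \<open>
  Each square in the exponent is linearised by an auxiliary Gaussian variable, which is then
  integrated out after the linear moment generating function has been used.
\<close>

lemma exp_moment_sum_squares_le:
  assumes "finite J" and [measurable]: "\<And>j. j \<in> J \<Longrightarrow> a j \<in> borel_measurable M"
    and mgf: "\<And>w. (\<integral>\<^sup>+\<omega>. ennreal (exp (\<Sum>j\<in>J. w j * a j \<omega>)) \<partial>M) \<le> ennreal (exp (\<Sum>j\<in>J. A j * (w j)\<^sup>2))"
    and A: "\<And>j. j \<in> J \<Longrightarrow> 0 \<le> A j" "\<And>j. j \<in> J \<Longrightarrow> 4 * \<eta> * A j \<le> 1/2" and "0 \<le> \<eta>"
  shows "(\<integral>\<^sup>+\<omega>. ennreal (exp (\<eta> * (\<Sum>j\<in>J. (a j \<omega>)\<^sup>2))) \<partial>M) \<le> ennreal (exp (4 * \<eta> * (\<Sum>j\<in>J. A j)))"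
proof -
  \<comment> \<open>\<open>J'\<close> are the coordinates whose squares have been dealt with. The
    linear term \<open>w\<close> is carried along because each auxiliary variable shifts it, and
    integrating that variable out doubles the weight of \<open>w i\<close>; hence the factor 2 on
    \<open>J'\<close>.\<close>
  have gen: "(\<integral>\<^sup>+\<omega>. ennreal (exp (\<eta> * (\<Sum>j\<in>J'. (a j \<omega>)\<^sup>2) + (\<Sum>j\<in>J. w j * a j \<omega>))) \<partial>M)
      \<le> ennreal (exp (4 * \<eta> * (\<Sum>j\<in>J'. A j) + (\<Sum>j\<in>J. (if j \<in> J' then 2 else 1) * A j * (w j)\<^sup>2)))"
    if "J' \<subseteq> J" for J' w
    using finite_subset[OF that \<open>finite J\<close>] that
  proof (induction J' arbitrary: w rule: finite_induct)
    case empty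
    then show ?case using mgf[of w] by simp
  next
    case (insert i J')
    have iJ: "i \<in> J" and sub: "J' \<subseteq> J" using insert.prems by auto
    note [measurable] = assms(2)[OF iJ]
    have mJ'[measurable]: "j \<in> J' \<Longrightarrow> a j \<in> borel_measurable M" for j using sub by auto
    let ?E = "\<lambda>J' w \<omega>. \<eta> * (\<Sum>j\<in>J'. (a j \<omega>)\<^sup>2) + (\<Sum>j\<in>J. w j * a j \<omega>)"
    let ?w = "\<lambda>y. w(i := w i + sqrt (2 * \<eta>) * y)"
    let ?K = "\<lambda>w. 4 * \<eta> * (\<Sum>j\<in>J'. A j) + (\<Sum>j\<in>J. (if j \<in> J' then 2 else 1) * A j * (w j)\<^sup>2)"
    let ?rest = "4 * \<eta> * (\<Sum>j\<in>J'. A j) + (\<Sum>j\<in>J - {i}. (if j \<in> J' then 2 else 1) * A j * (w j)\<^sup>2)"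
    have split: "(\<Sum>j\<in>J. f j) = f i + (\<Sum>j\<in>J - {i}. f j)" for f :: "'b \<Rightarrow> real"
      using \<open>finite J\<close> iJ by (rule sum.remove)
    have mE[measurable]: "?E J' v \<in> borel_measurable M" for v
      using assms(2) mJ' by (intro borel_measurable_add borel_measurable_times borel_measurable_sum borel_measurable_power) auto
    define F where "F = ?E J' w"
    have Fm[measurable]: "F \<in> borel_measurable M" unfolding F_def by (rule mE)
    have FE: "F \<omega> + sqrt (2 * \<eta>) * a i \<omega> * y = ?E J' (?w y) \<omega>" for \<omega> y
      unfolding F_def split[of "\<lambda>j. ?w y j * a j \<omega>"] split[of "\<lambda>j. w j * a j \<omega>"] by (simp add: algebra_simps)
    have "(\<integral>\<^sup>+\<omega>. ennreal (exp (?E (insert i J') w \<omega>)) \<partial>M)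
        = (\<integral>\<^sup>+\<omega>. ennreal (exp (?E J' w \<omega>)) * ennreal (exp (\<eta> * (a i \<omega>)\<^sup>2)) \<partial>M)"
      using insert.hyps by (intro nn_integral_cong) (simp add: ennreal_mult[symmetric] exp_add[symmetric] algebra_simps)
    also have "\<dots> = (\<integral>\<^sup>+\<omega>. (\<integral>\<^sup>+y. ennreal (std_normal_density y) * ennreal (exp (F \<omega> + sqrt (2 * \<eta>) * a i \<omega> * y)) \<partial>lborel) \<partial>M)"
    proof (intro nn_integral_cong)
      fix \<omega>
      have "ennreal (exp (F \<omega>)) * ennreal (std_normal_density y * exp (sqrt (2 * \<eta>) * a i \<omega> * y))
          = ennreal (std_normal_density y) * ennreal (exp (F \<omega> + sqrt (2 * \<eta>) * a i \<omega> * y))" for y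
        by (simp add: ennreal_mult[symmetric] exp_add mult.left_commute)
      then show "ennreal (exp (?E J' w \<omega>)) * ennreal (exp (\<eta> * (a i \<omega>)\<^sup>2))
          = (\<integral>\<^sup>+y. ennreal (std_normal_density y) * ennreal (exp (F \<omega> + sqrt (2 * \<eta>) * a i \<omega> * y)) \<partial>lborel)"
        unfolding exp_half_square_as_gaussian[OF \<open>0 \<le> \<eta>\<close>] fun_cong[OF F_def, of \<omega>, symmetric]
        by (subst nn_integral_cmult[symmetric]) auto
    qed
    also have "\<dots> = (\<integral>\<^sup>+y. (\<integral>\<^sup>+\<omega>. ennreal (std_normal_density y) * ennreal (exp (F \<omega> + sqrt (2 * \<eta>) * a i \<omega> * y)) \<partial>M) \<partial>lborel)"
    proof -
      interpret P: pair_sigma_finite M lborel ..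
      show ?thesis by (rule P.Fubini'[symmetric]) measurable
    qed
    also have "\<dots> = (\<integral>\<^sup>+y. (\<integral>\<^sup>+\<omega>. ennreal (std_normal_density y) * ennreal (exp (?E J' (?w y) \<omega>)) \<partial>M) \<partial>lborel)"
      unfolding FE ..
    also have "\<dots> \<le> (\<integral>\<^sup>+y. ennreal (exp ?rest) * ennreal (std_normal_density y * exp (A i * (w i + sqrt (2 * \<eta>) * y)\<^sup>2)) \<partial>lborel)"
    proof (intro nn_integral_mono)
      fix y
      have "(\<integral>\<^sup>+\<omega>. ennreal (std_normal_density y) * ennreal (exp (?E J' (?w y) \<omega>)) \<partial>M)
          = ennreal (std_normal_density y) * (\<integral>\<^sup>+\<omega>. ennreal (exp (?E J' (?w y) \<omega>)) \<partial>M)"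
        using mE by (intro nn_integral_cmult) auto
      also have "\<dots> \<le> ennreal (std_normal_density y) * ennreal (exp (?K (?w y)))"
        by (intro mult_left_mono insert.IH sub) auto
      also have "?K (?w y) = ?rest + A i * (w i + sqrt (2 * \<eta>) * y)\<^sup>2"
        unfolding split[of "\<lambda>j. (if j \<in> J' then 2 else 1) * A j * (?w y j)\<^sup>2"] using insert.hyps(2) by simp
      finally show "(\<integral>\<^sup>+\<omega>. ennreal (std_normal_density y) * ennreal (exp (?E J' (?w y) \<omega>)) \<partial>M)
          \<le> ennreal (exp ?rest) * ennreal (std_normal_density y * exp (A i * (w i + sqrt (2 * \<eta>) * y)\<^sup>2))"
        by (simp add: ennreal_mult[symmetric] exp_add mult_ac)
    qed
    also have "\<dots> = ennreal (exp ?rest) * (\<integral>\<^sup>+y. ennreal (std_normal_density y * exp (A i * (w i + sqrt (2 * \<eta>) * y)\<^sup>2)) \<partial>lborel)"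
      by (rule nn_integral_cmult) auto
    also have "\<dots> \<le> ennreal (exp ?rest) * ennreal (exp (4 * \<eta> * A i + 2 * A i * (w i)\<^sup>2))"
      using A iJ \<open>0 \<le> \<eta>\<close> by (intro mult_left_mono nn_integral_gaussian_quadratic) auto
    also have "\<dots> = ennreal (exp (?rest + (4 * \<eta> * A i + 2 * A i * (w i)\<^sup>2)))"
      by (simp add: ennreal_mult[symmetric] exp_add)
    also have "?rest + (4 * \<eta> * A i + 2 * A i * (w i)\<^sup>2)
        = 4 * \<eta> * (\<Sum>j\<in>insert i J'. A j) + (\<Sum>j\<in>J. (if j \<in> insert i J' then 2 else 1) * A j * (w j)\<^sup>2)"
    proof -
      have "(\<Sum>j\<in>J - {i}. (if j \<in> insert i J' then 2 else 1) * A j * (w j)\<^sup>2)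
          = (\<Sum>j\<in>J - {i}. (if j \<in> J' then 2 else 1) * A j * (w j)\<^sup>2)"
        by (intro sum.cong) auto
      then show ?thesis
        unfolding split[of "\<lambda>j. (if j \<in> insert i J' then 2 else 1) * A j * (w j)\<^sup>2"]
        using insert.hyps by (simp add: algebra_simps)
    qed
    finally show ?case .
  qed
  show ?thesis using gen[of J "\<lambda>_. 0"] by simp
qed

text \<open>A Chernoff bound at each lattice point and a union over at most
  \<open>exp (6 * card I)\<close> points. The weights enter through their maximum and their sum
  only, so the number of directions in \<open>J\<close> does not appear.\<close>

lemma tail_operator_bound:
  fixes lam :: "'j \<Rightarrow> real" and \<theta> \<kappa> :: real
  assumes fin: "finite I" "I \<noteq> {}" "finite J"
    and [measurable]: "\<And>i j. i \<in> I \<Longrightarrow> j \<in> J \<Longrightarrow> a i j \<in> borel_measurable M"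
    and mgf: "\<And>z w. (\<integral>\<^sup>+\<omega>. ennreal (exp (\<Sum>j\<in>J. w j * (\<Sum>i\<in>I. z i * a i j \<omega>))) \<partial>M)
        \<le> ennreal (exp (\<Sum>j\<in>J. \<kappa> * (\<Sum>i\<in>I. (z i)\<^sup>2) * lam j * (w j)\<^sup>2))"
    and lam: "\<And>j. j \<in> J \<Longrightarrow> 0 \<le> lam j" "\<And>j. j \<in> J \<Longrightarrow> lam j \<le> \<theta>" "(\<Sum>j\<in>J. lam j) \<le> card I * \<theta>"
    and "0 < \<theta>" "0 < \<kappa>"
  shows "\<exists>N\<in>events. prob N \<le> exp (- real (card I)) \<and>
    (\<forall>\<omega>\<in>space M - N. \<forall>c. (\<Sum>i\<in>I. (\<Sum>j\<in>J. c j * a i j \<omega>)\<^sup>2) / card I \<le> 256 * \<kappa> * \<theta> * (\<Sum>j\<in>J. (c j)\<^sup>2))"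
proof -
  define n where "n = real (card I)"
  have n: "0 < n" using fin by (simp add: n_def card_gt_0_iff)
  \<comment> \<open>Chosen so that \<open>4 * \<eta> * \<kappa> * q * lam j \<le> 1/2\<close> for
    all \<open>q \<le> 4 * n\<close> and \<open>lam j \<le> \<theta>\<close>. It costs
    \<open>n / 2\<close> in the exponent and turns the threshold into \<open>8 * n\<close>, which
    leaves room for the union over \<open>exp (6 * n)\<close> points.\<close>
  define \<eta> where "\<eta> = 1 / (32 * \<kappa> * n * \<theta>)"
  have eta: "0 < \<eta>" using n assms by (simp add: \<eta>_def)
  let ?f = "\<lambda>z \<omega>. \<Sum>j\<in>J. (\<Sum>i\<in>I. of_int (z i) * a i j \<omega>)\<^sup>2"
  let ?N = "\<lambda>z. {\<omega>\<in>space M. 256 * \<kappa> * \<theta> * n\<^sup>2 \<le> ?f z \<omega>}"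
  let ?Z = "lattice_ball I"
  have Nz: "prob (?N z) \<le> exp (- (15/2) * n)" if z: "z \<in> ?Z" for z
  proof -
    define q where "q = (\<Sum>i\<in>I. (real_of_int (z i))\<^sup>2)"
    have "real_of_int (\<Sum>i\<in>I. (z i)\<^sup>2) \<le> 4 * n"
      using z unfolding lattice_ball_def n_def by (simp add: of_int_le_iff[where ?'a = real, symmetric] del: of_int_le_iff)
    then have q: "0 \<le> q" "q \<le> 4 * n" by (auto simp: q_def sum_nonneg)
    have "(\<integral>\<^sup>+\<omega>. ennreal (exp (\<eta> * ?f z \<omega>)) \<partial>M) \<le> ennreal (exp (4 * \<eta> * (\<Sum>j\<in>J. \<kappa> * q * lam j)))"
    proof (rule exp_moment_sum_squares_le)
      show "(\<integral>\<^sup>+\<omega>. ennreal (exp (\<Sum>j\<in>J. w j * (\<Sum>i\<in>I. of_int (z i) * a i j \<omega>))) \<partial>M)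
          \<le> ennreal (exp (\<Sum>j\<in>J. \<kappa> * q * lam j * (w j)\<^sup>2))" for w
        unfolding q_def by (rule mgf)
      fix j assume j: "j \<in> J"
      have "q * lam j \<le> 4 * n * \<theta>" using q n lam j by (intro mult_mono) auto
      then show "4 * \<eta> * (\<kappa> * q * lam j) \<le> 1/2"
        using assms n by (simp add: \<eta>_def field_simps)
    qed (use fin eta q lam assms in auto)
    also have "\<dots> \<le> ennreal (exp (n / 2))"
    proof (intro ennreal_leI, simp only: exp_le_cancel_iff)
      have "q * (\<Sum>j\<in>J. lam j) \<le> (4 * n) * (n * \<theta>)"
        using q lam by (intro mult_mono) (auto simp: n_def sum_nonneg)
      then have "4 * \<eta> * \<kappa> * (q * (\<Sum>j\<in>J. lam j)) \<le> 4 * \<eta> * \<kappa> * ((4 * n) * (n * \<theta>))"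
        using eta assms by (intro mult_left_mono) auto
      also have "\<dots> = n / 2" using assms n by (simp add: \<eta>_def field_simps)
      finally show "4 * \<eta> * (\<Sum>j\<in>J. \<kappa> * q * lam j) \<le> n / 2"
        by (simp add: sum_distrib_left mult_ac)
    qed
    finally have "prob (?N z) \<le> exp (n / 2 - \<eta> * (256 * \<kappa> * \<theta> * n\<^sup>2))"
      using eta by (intro prob_ge_le_exp_moment) auto
    also have "n / 2 - \<eta> * (256 * \<kappa> * \<theta> * n\<^sup>2) = - (15/2) * n"
      using assms n by (simp add: \<eta>_def field_simps power2_eq_square)
    finally show ?thesis .
  qed
  have finZ: "finite ?Z" using fin by (simp add: finite_lattice_ball)
  let ?U = "\<Union>z\<in>?Z. ?N z"
  have meas: "?N z \<in> events" for z by measurable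
  have U: "?U \<in> events" using finZ meas by auto
  have "prob ?U \<le> (\<Sum>z\<in>?Z. prob (?N z))"
    using finZ meas by (intro finite_measure_subadditive_finite) auto
  also have "\<dots> \<le> (\<Sum>z\<in>?Z. exp (- (15/2) * n))" by (intro sum_mono Nz)
  also have "\<dots> = card ?Z * exp (- (15/2) * n)" by simp
  also have "\<dots> \<le> exp (6 * n) * exp (- (15/2) * n)"
    using card_lattice_ball_le[OF fin(1)] by (intro mult_right_mono) (auto simp: n_def)
  also have "\<dots> \<le> exp (- n)" using n by (simp add: exp_add[symmetric])
  finally have pU: "prob ?U \<le> exp (- n)" .
  show ?thesis
  proof (intro bexI[of _ ?U] conjI ballI allI)
    fix \<omega> c assume w: "\<omega> \<in> space M - ?U"
    show "(\<Sum>i\<in>I. (\<Sum>j\<in>J. c j * a i j \<omega>)\<^sup>2) / card I \<le> 256 * \<kappa> * \<theta> * (\<Sum>j\<in>J. (c j)\<^sup>2)"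
    proof (rule operator_bound_from_lattice)
      fix z assume "z \<in> ?Z"
      then have "\<not> 256 * \<kappa> * \<theta> * n\<^sup>2 \<le> ?f z \<omega>" using w by auto
      then show "?f z \<omega> \<le> 256 * \<kappa> * \<theta> * (real (card I))\<^sup>2" by (simp add: n_def)
    qed (use fin in auto)
  qed (use U pU in \<open>auto simp: n_def\<close>)
qed

end

section \<open>The estimator and the soft-thresholding path in coordinates\<close>

lemma sum_sorted_list_of_set:
  assumes "finite I"
  shows "(\<Sum>i<card I. f (sorted_list_of_set I ! i)) = (\<Sum>i\<in>I. f i)"
  by (rule sum.reindex_bij_betw[OF bij_betw_nth]) (use assms in auto)

lemma scalar_prod_eq_ip: "w \<in> carrier_vec d \<Longrightarrow> v \<bullet> w = ip {..<d} (vec_index v) (vec_index w)"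
  by (simp add: scalar_prod_def ip_def lessThan_atLeast0)

definition entry_form :: "nat \<Rightarrow> real mat \<Rightarrow> (nat \<Rightarrow> real) \<Rightarrow> (nat \<Rightarrow> real) \<Rightarrow> real" where
  "entry_form d S v w = (\<Sum>a<d. \<Sum>b<d. v a * S $$ (a, b) * w b)"

lemma mult_mat_vec_form:
  assumes "S \<in> carrier_mat d d" "v \<in> carrier_vec d" "w \<in> carrier_vec d"
  shows "v \<bullet> (S *\<^sub>v w) = entry_form d S (vec_index v) (vec_index w)"
proof -
  have "v \<bullet> (S *\<^sub>v w) = (\<Sum>a<d. v $ a * (S *\<^sub>v w) $ a)"
    using assms by (simp add: scalar_prod_def lessThan_atLeast0)
  also have "\<dots> = (\<Sum>a<d. \<Sum>b<d. v $ a * S $$ (a, b) * w $ b)"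
    using assms by (intro sum.cong) (auto simp: scalar_prod_def lessThan_atLeast0 sum_distrib_left mult.assoc)
  finally show ?thesis by (simp add: entry_form_def)
qed

lemma design_mat_carrier: "finite I \<Longrightarrow> design_mat d I x \<in> carrier_mat (card I) d"
  by (simp add: design_mat_def carrier_matI)

lemma design_mat_index:
  assumes "finite I" "i < card I" "j < d"
  shows "design_mat d I x $$ (i, j) = x (sorted_list_of_set I ! i) $ j"
  using assms by (simp add: design_mat_def mat_of_rows_def)

lemma sample_cov_carrier: "finite I \<Longrightarrow> sample_cov d I x \<in> carrier_mat d d"
  using design_mat_carrier[of I d x] by (simp add: sample_cov_def)

lemma sample_cov_index:
  assumes "finite I" "a < d" "b < d"
  shows "sample_cov d I x $$ (a, b) = (\<Sum>i\<in>I. x i $ a * x i $ b) / card I"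
proof -
  let ?A = "design_mat d I x"
  note A = design_mat_carrier[OF assms(1), of d x]
  have "(?A\<^sup>T * ?A) $$ (a, b) = (\<Sum>i<card I. ?A $$ (i, a) * ?A $$ (i, b))"
    using A assms by (simp add: scalar_prod_def lessThan_atLeast0)
  also have "\<dots> = (\<Sum>i<card I. x (sorted_list_of_set I ! i) $ a * x (sorted_list_of_set I ! i) $ b)"
    using assms by (intro sum.cong) (auto simp: design_mat_index)
  also have "\<dots> = (\<Sum>i\<in>I. x i $ a * x i $ b)"
    using assms by (intro sum_sorted_list_of_set)
  finally show ?thesis using A assms by (simp add: sample_cov_def)
qed

lemma cross_moment_index:
  assumes "finite I" "j < d"
  shows "((1 / real (card I)) \<cdot>\<^sub>v ((design_mat d I x)\<^sup>T *\<^sub>v stack I y)) $ j = (\<Sum>i\<in>I. x i $ j * y i) / card I"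
proof -
  let ?A = "design_mat d I x"
  note A = design_mat_carrier[OF assms(1), of d x]
  have st: "stack I y \<in> carrier_vec (card I)" "i < card I \<Longrightarrow> stack I y $ i = y (sorted_list_of_set I ! i)" for i
    using assms by (auto simp: stack_def vec_of_list_index intro!: carrier_vecI)
  have "(?A\<^sup>T *\<^sub>v stack I y) $ j = (\<Sum>i<card I. ?A $$ (i, j) * stack I y $ i)"
    using A assms st by (simp add: scalar_prod_def lessThan_atLeast0)
  also have "\<dots> = (\<Sum>i<card I. x (sorted_list_of_set I ! i) $ j * y (sorted_list_of_set I ! i))"
    using assms st by (intro sum.cong) (auto simp: design_mat_index)
  also have "\<dots> = (\<Sum>i\<in>I. x i $ j * y i)"
    using assms by (intro sum_sorted_list_of_set)
  finally show ?thesis using A assms by simp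
qed

lemma entry_form_sample_cov:
  assumes "finite I"
  shows "entry_form d (sample_cov d I x) v w = qf I {..<d} (\<lambda>i. vec_index (x i)) v w"
proof -
  have "entry_form d (sample_cov d I x) v w
      = (\<Sum>a<d. \<Sum>b<d. \<Sum>i\<in>I. (x i $ a * v a) * (x i $ b * w b) / card I)"
    unfolding entry_form_def using assms
    by (intro sum.cong refl) (simp add: sample_cov_index sum_distrib_left sum_distrib_right sum_divide_distrib mult_ac)
  also have "\<dots> = (\<Sum>i\<in>I. \<Sum>a<d. \<Sum>b<d. (x i $ a * v a) * (x i $ b * w b) / card I)"
    by (subst (2) sum.swap, subst sum.swap) (rule refl)
  also have "\<dots> = qf I {..<d} (\<lambda>i. vec_index (x i)) v w"
    unfolding qf_def ip_def by (simp add: sum_product sum_divide_distrib)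
  finally show ?thesis .
qed

lemma psd_sample_cov:
  assumes "finite I"
  shows "psd_mat d (sample_cov d I x)"
  unfolding psd_mat_def
proof (intro conjI ballI)
  show c: "sample_cov d I x \<in> carrier_mat d d" by (rule sample_cov_carrier[OF assms])
  show "(sample_cov d I x)\<^sup>T = sample_cov d I x"
    by (rule eq_matI) (use c assms in \<open>auto simp: sample_cov_index mult.commute\<close>)
  fix v :: "real Matrix.vec" assume "v \<in> carrier_vec d"
  then show "0 \<le> v \<bullet> (sample_cov d I x *\<^sub>v v)"
    using mult_mat_vec_form[OF c] entry_form_sample_cov[OF assms] qf_self_nonneg by simp
qed

text \<open>Zero beyond the rank, in agreement with the measurability clause of
  \<open>eigen_rule\<close>; sums over eigenvectors can then run over a range that does not depend
  on the sample.\<close>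

definition eigvec :: "nat \<Rightarrow> (real mat \<Rightarrow> real mat) \<Rightarrow> real mat \<Rightarrow> nat \<Rightarrow> nat \<Rightarrow> real" where
  "eigvec d U S a j = (if a < vec_space.rank d S then U S $$ (j, a) else 0)"

lemma eigen_decomp_form:
  assumes dec: "is_eigen_decomp d S (U S) (s S)" and S: "S \<in> carrier_mat d d"
  defines "r \<equiv> vec_space.rank d S"
  shows "orthonormal_on {..<d} (eigvec d U S) {..<r}"
    and "entry_form d S v w = (\<Sum>a<r. (s S a)\<^sup>2 * (ip {..<d} (eigvec d U S a) v * ip {..<d} (eigvec d U S a) w))"
    and "a < r \<Longrightarrow> 0 < s S a" and "a \<le> b \<Longrightarrow> b < r \<Longrightarrow> s S b \<le> s S a"
proof -
  have U: "U S \<in> carrier_mat d r" and orth: "(U S)\<^sup>T * U S = 1\<^sub>m r"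
    and spec: "S = U S * (mat_diag r (s S) * mat_diag r (s S)) * (U S)\<^sup>T"
    using dec by (auto simp: is_eigen_decomp_def Let_def r_def)
  show "a < r \<Longrightarrow> 0 < s S a" "a \<le> b \<Longrightarrow> b < r \<Longrightarrow> s S b \<le> s S a"
    using dec by (auto simp: is_eigen_decomp_def Let_def r_def)
  show "orthonormal_on {..<d} (eigvec d U S) {..<r}"
    unfolding orthonormal_on_def
  proof (intro ballI)
    fix a b assume ab: "a \<in> {..<r}" "b \<in> {..<r}"
    have "ip {..<d} (eigvec d U S a) (eigvec d U S b) = ((U S)\<^sup>T * U S) $$ (a, b)"
      using U ab by (simp add: ip_def eigvec_def scalar_prod_def lessThan_atLeast0 r_def)
    then show "ip {..<d} (eigvec d U S a) (eigvec d U S b) = (if a = b then 1 else 0)"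
      using ab by (simp add: orth)
  qed
  have entry: "S $$ (i, j) = (\<Sum>a<r. (s S a)\<^sup>2 * eigvec d U S a i * eigvec d U S a j)" if ij: "i < d" "j < d" for i j
  proof -
    have D: "U S * (mat_diag r (s S) * mat_diag r (s S)) = Matrix.mat d r (\<lambda>(i, a). U S $$ (i, a) * (s S a * s S a))"
      unfolding mat_diag_diag by (rule mat_diag_mult_right[OF U])
    have "S $$ (i, j) = (Matrix.mat d r (\<lambda>(i, a). U S $$ (i, a) * (s S a * s S a)) * (U S)\<^sup>T) $$ (i, j)"
      using arg_cong[OF spec, of "\<lambda>A. A $$ (i, j)"] unfolding D .
    also have "\<dots> = (\<Sum>a<r. (s S a)\<^sup>2 * eigvec d U S a i * eigvec d U S a j)"
      using U ij by (simp add: scalar_prod_def lessThan_atLeast0 eigvec_def r_def power2_eq_square mult_ac)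
    finally show ?thesis .
  qed
  have "entry_form d S v w
      = (\<Sum>i<d. \<Sum>j<d. \<Sum>a<r. (s S a)\<^sup>2 * ((eigvec d U S a i * v i) * (eigvec d U S a j * w j)))"
    unfolding entry_form_def
    by (intro sum.cong refl) (simp add: entry sum_distrib_left sum_distrib_right mult_ac)
  also have "\<dots> = (\<Sum>a<r. \<Sum>i<d. \<Sum>j<d. (s S a)\<^sup>2 * ((eigvec d U S a i * v i) * (eigvec d U S a j * w j)))"
    by (subst (2) sum.swap, subst sum.swap) (rule refl)
  also have "\<dots> = (\<Sum>a<r. (s S a)\<^sup>2 * (ip {..<d} (eigvec d U S a) v * ip {..<d} (eigvec d U S a) w))"
    unfolding ip_def sum_product by (simp only: sum_distrib_left)
  finally show "entry_form d S v w = (\<Sum>a<r. (s S a)\<^sup>2 * (ip {..<d} (eigvec d U S a) v * ip {..<d} (eigvec d U S a) w))" .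
qed

lemma sample_spectrum_of_rule:
  assumes "eigen_rule d U s" "finite I" "I \<noteq> {}"
  shows "sample_spectrum {..<d} I (\<lambda>i. vec_index (x i)) (vec_space.rank d (sample_cov d I x))
    (eigvec d U (sample_cov d I x)) (\<lambda>a. (s (sample_cov d I x) a)\<^sup>2)"
proof -
  let ?S = "sample_cov d I x"
  have dec: "is_eigen_decomp d ?S (U ?S) (s ?S)"
    using assms psd_sample_cov by (auto simp: eigen_rule_def)
  note form = eigen_decomp_form[where U = U and s = s and S = ?S, OF dec sample_cov_carrier[OF assms(2)]]
  show ?thesis
  proof unfold_locales
    show "orthonormal_on {..<d} (eigvec d U ?S) {..<vec_space.rank d ?S}" by (rule form(1))
    show "0 < (s ?S a)\<^sup>2" if "a < vec_space.rank d ?S" for a using form(3)[OF that] by simp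
    show "(s ?S b)\<^sup>2 \<le> (s ?S a)\<^sup>2" if "a \<le> b" "b < vec_space.rank d ?S" for a b
      using form(3,4) that by (intro power_mono) (auto simp: less_imp_le)
    show "qf I {..<d} (\<lambda>i. vec_index (x i)) v v' = (\<Sum>a<vec_space.rank d ?S. (s ?S a)\<^sup>2 *
        (ip {..<d} (eigvec d U ?S a) v * ip {..<d} (eigvec d U ?S a) v'))" for v v'
      using form(2) entry_form_sample_cov[OF assms(2)] by simp
  qed (use assms in auto)
qed

text \<open>Entry \<open>a\<close> of the vector to which soft thresholding is applied.\<close>

definition whitened_coeff ::
  "nat \<Rightarrow> (real mat \<Rightarrow> real mat) \<Rightarrow> (real mat \<Rightarrow> nat \<Rightarrow> real) \<Rightarrow> nat set
     \<Rightarrow> (nat \<Rightarrow> real vec) \<Rightarrow> (nat \<Rightarrow> real) \<Rightarrow> nat \<Rightarrow> real" where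
  "whitened_coeff d U s I x y a =
     (\<Sum>i\<in>I. y i * ip {..<d} (vec_index (x i)) (eigvec d U (sample_cov d I x) a)) / card I / s (sample_cov d I x) a"

lemma mat_diag_mult_vec_index:
  fixes f :: "nat \<Rightarrow> real"
  assumes "i < m" "v \<in> carrier_vec m"
  shows "(mat_diag m f *\<^sub>v v) $ i = f i * v $ i"
proof -
  have "(mat_diag m f *\<^sub>v v) $ i = (\<Sum>j\<in>{0..<m}. (if i = j then f j else 0) * v $ j)"
    using assms by (simp add: mat_diag_def scalar_prod_def)
  also have "\<dots> = (\<Sum>j\<in>{0..<m}. (if j = i then f j * v $ j else 0))"
    by (intro sum.cong) auto
  finally show ?thesis using assms by simp
qed

lemma trunc_nct_eq_lincomb:
  fixes d k :: nat and I :: "nat set" and x :: "nat \<Rightarrow> real vec"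
  assumes rule: "eigen_rule d U s" and I: "finite I"
  defines "S \<equiv> sample_cov d I x"
  defines "m \<equiv> min k (vec_space.rank d S)"
  shows "trunc_nct d U s k I x y t \<in> carrier_vec d"
    and "j < d \<Longrightarrow> trunc_nct d U s k I x y t $ j
      = lincomb_fun {..<m} (\<lambda>a. soft t (whitened_coeff d U s I x y a) / s S a) (eigvec d U S) j"
proof -
  define r where "r = vec_space.rank d S"
  have dec: "is_eigen_decomp d S (U S) (s S)"
    using rule psd_sample_cov[OF I] by (auto simp: eigen_rule_def S_def)
  then have U: "U S \<in> carrier_mat d r" by (auto simp: is_eigen_decomp_def Let_def r_def)
  let ?Um = "left_cols m (U S)" and ?L = "mat_diag m (\<lambda>j. 1 / s S j)"
  let ?XY = "(1 / real (card I)) \<cdot>\<^sub>v ((design_mat d I x)\<^sup>T *\<^sub>v stack I y)"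
  have Um: "?Um \<in> carrier_mat d m" using U by (simp add: left_cols_def)
  have Umi: "?Um $$ (i, a) = eigvec d U S a i" if "i < d" "a < m" for i a
    using that U by (simp add: left_cols_def eigvec_def m_def)
  let ?z = "?L *\<^sub>v (?Um\<^sup>T *\<^sub>v ?XY)"
  have z: "?z \<in> carrier_vec m" by (simp add: mat_diag_def carrier_vecI)
  have XYd: "dim_vec ?XY = d" using design_mat_carrier[OF I, of d x] by simp
  have zi: "?z $ a = whitened_coeff d U s I x y a" if a: "a < m" for a
  proof -
    have "(?Um\<^sup>T *\<^sub>v ?XY) $ a = (\<Sum>j<d. eigvec d U S a j * ?XY $ j)"
      using Um a XYd by (auto simp: scalar_prod_def lessThan_atLeast0 Umi intro!: sum.cong)
    also have "\<dots> = (\<Sum>j<d. \<Sum>i\<in>I. y i * (x i $ j * eigvec d U S a j) / card I)"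
      using I by (intro sum.cong refl) (simp only: cross_moment_index lessThan_iff sum_distrib_left sum_divide_distrib times_divide_eq_right mult_ac)
    also have "\<dots> = (\<Sum>i\<in>I. y i * ip {..<d} (vec_index (x i)) (eigvec d U S a)) / card I"
      unfolding ip_def by (subst sum.swap) (simp add: sum_distrib_left sum_divide_distrib)
    finally show ?thesis
      using a Um by (subst mat_diag_mult_vec_index) (auto simp: whitened_coeff_def S_def intro!: carrier_vecI)
  qed
  have eq: "trunc_nct d U s k I x y t = ?Um *\<^sub>v (?L *\<^sub>v map_vec (soft t) ?z)"
    unfolding trunc_nct_def Let_def S_def[symmetric] m_def[symmetric] ..
  show "trunc_nct d U s k I x y t \<in> carrier_vec d"
    unfolding eq using Um by (auto intro!: carrier_vecI)
  have sv: "(?L *\<^sub>v map_vec (soft t) ?z) $ a = soft t (whitened_coeff d U s I x y a) / s S a" if "a < m" for a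
  proof -
    have "map_vec (soft t) ?z $ a = soft t (?z $ a)"
      by (rule index_map_vec(1)) (simp only: carrier_vecD[OF z] that)
    moreover have "map_vec (soft t) ?z \<in> carrier_vec m"
      by (rule carrier_vecI) (simp only: index_map_vec(2) carrier_vecD[OF z])
    ultimately show ?thesis using that by (subst mat_diag_mult_vec_index) (simp_all only: zi, simp)
  qed
  have dv: "dim_vec (?L *\<^sub>v map_vec (soft t) ?z) = m" by (simp add: mat_diag_def)
  show "trunc_nct d U s k I x y t $ j
      = lincomb_fun {..<m} (\<lambda>a. soft t (whitened_coeff d U s I x y a) / s S a) (eigvec d U S) j" if "j < d"
  proof -
    have "trunc_nct d U s k I x y t $ j = row ?Um j \<bullet> (?L *\<^sub>v map_vec (soft t) ?z)"
      unfolding eq using Um that by (intro index_mult_mat_vec) auto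
    also have "\<dots> = (\<Sum>a<m. row ?Um j $ a * (?L *\<^sub>v map_vec (soft t) ?z) $ a)"
      unfolding scalar_prod_def dv lessThan_atLeast0 ..
    also have "\<dots> = (\<Sum>a<m. eigvec d U S a j * (soft t (whitened_coeff d U s I x y a) / s S a))"
      using Um that by (intro sum.cong refl) (simp only: lessThan_iff sv index_row carrier_matD Umi)
    finally show ?thesis by (simp add: lincomb_fun_def mult.commute)
  qed
qed

text \<open>At \<open>z = 0\<close> the definition divides by zero; the factor \<open>z\<close>
  makes the value 0 all the same.\<close>

lemma soft_eq:
  assumes "0 \<le> t"
  shows "soft t z = (if \<bar>z\<bar> \<le> t then 0 else z - t * sgn z)"
proof (cases "z = 0")
  case False
  have "z * (1 - t / \<bar>z\<bar>) = z - t * sgn z" using False by (simp add: sgn_if field_simps)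
  moreover have "1 - t / \<bar>z\<bar> \<le> 0 \<longleftrightarrow> \<bar>z\<bar> \<le> t" using False by (simp add: le_divide_eq)
  ultimately show ?thesis by (auto simp: soft_def max_def)
qed (use assms in \<open>simp add: soft_def\<close>)

lemma abs_soft_le: "0 \<le> t \<Longrightarrow> \<bar>soft t z\<bar> \<le> \<bar>z\<bar>"
  by (auto simp: soft_eq sgn_if)

text \<open>Indices from \<open>m\<close> on stand for the threshold 0, so \<open>{..m}\<close>
  numbers all coefficients together with the left end of the path.\<close>

definition breakpoint :: "nat \<Rightarrow> (nat \<Rightarrow> real) \<Rightarrow> nat \<Rightarrow> real" where
  "breakpoint m z i = (if i < m then \<bar>z i\<bar> else 0)"

lemma breakpoint_nonneg: "0 \<le> breakpoint m z i"
  by (simp add: breakpoint_def)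

text \<open>No \<open>\<bar>z a\<bar>\<close> lies strictly between two adjacent breakpoints, so on
  that interval each coordinate is either identically zero or affine in \<open>t\<close>, and one
  weight \<open>c\<close> serves all coordinates.\<close>

lemma soft_path_interpolation:
  assumes "0 \<le> t"
  shows "\<exists>i\<le>m. \<exists>j\<le>m. \<exists>c. 0 \<le> c \<and> c \<le> 1 \<and>
    (\<forall>a<m. soft t (z a) = (1 - c) * soft (breakpoint m z i) (z a) + c * soft (breakpoint m z j) (z a))"
proof -
  define T where "T = breakpoint m z ` {..m}"
  have T: "finite T" "0 \<in> T" by (auto simp: T_def breakpoint_def intro!: image_eqI[of _ _ m])
  define lo where "lo = Max {\<tau>\<in>T. \<tau> \<le> t}"
  have loT: "lo \<in> {\<tau>\<in>T. \<tau> \<le> t}" unfolding lo_def using T assms by (intro Max_in) auto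
  have lo_max: "\<tau> \<le> lo" if "\<tau> \<in> T" "\<tau> \<le> t" for \<tau>
    unfolding lo_def using T that by (intro Max_ge) auto
  have zT: "\<bar>z a\<bar> \<in> T" if "a < m" for a
    using that by (auto simp: T_def breakpoint_def intro!: image_eqI[of _ _ a])
  have lo0: "0 \<le> lo" using lo_max[of 0] T assms by auto
  obtain i where i: "i \<le> m" "lo = breakpoint m z i" using loT by (auto simp: T_def)
  show ?thesis
  proof (cases "\<exists>\<tau>\<in>T. t \<le> \<tau>")
    \<comment> \<open>Past the largest breakpoint every coordinate is zero, as it already is at
      \<open>lo\<close>.\<close>
    case False
    then have "\<bar>z a\<bar> \<le> lo" if "a < m" for a using zT[OF that] lo_max by force
    moreover have "lo \<le> t" using loT by simp
    ultimately have "soft t (z a) = (1 - 0) * soft lo (z a) + 0 * soft lo (z a)" if "a < m" for a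
      using that assms lo0 by (fastforce simp: soft_eq)
    then show ?thesis using i by (intro exI[of _ i] conjI exI[of _ 0]) auto
  next
    case True
    define hi where "hi = Min {\<tau>\<in>T. t \<le> \<tau>}"
    have hiT: "hi \<in> {\<tau>\<in>T. t \<le> \<tau>}" unfolding hi_def using T True by (intro Min_in) auto
    have hi_min: "hi \<le> \<tau>" if "\<tau> \<in> T" "t \<le> \<tau>" for \<tau>
      unfolding hi_def using T that by (intro Min_le) auto
    obtain j where j: "j \<le> m" "hi = breakpoint m z j" using hiT by (auto simp: T_def)
    have lt: "lo \<le> t" "t \<le> hi" using loT hiT by auto
    define c where "c = (if lo = hi then 0 else (t - lo) / (hi - lo))"
    have c: "0 \<le> c" "c \<le> 1" "t = (1 - c) * lo + c * hi"
    proof -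
      show "0 \<le> c" "c \<le> 1" using lt by (auto simp: c_def divide_le_eq_1)
      show "t = (1 - c) * lo + c * hi"
      proof (cases "lo = hi")
        case False
        then have "c * (hi - lo) = t - lo" by (simp add: c_def)
        then show ?thesis by (simp add: algebra_simps)
      qed (use lt in \<open>simp add: c_def\<close>)
    qed
    have "soft t (z a) = (1 - c) * soft lo (z a) + c * soft hi (z a)" if a: "a < m" for a
    proof -
      consider "\<bar>z a\<bar> \<le> lo" | "hi \<le> \<bar>z a\<bar>"
        using lo_max[OF zT[OF a]] hi_min[OF zT[OF a]] by linarith
      then show ?thesis
      proof cases
        case 1
        then show ?thesis using lt lo0 assms by (simp add: soft_eq)
      next
        case 2
        have affine: "soft \<tau> (z a) = z a - \<tau> * sgn (z a)" if "0 \<le> \<tau>" "\<tau> \<le> hi" for \<tau>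
          using that 2 by (auto simp: soft_eq sgn_if abs_if split: if_splits)
        have "soft t (z a) = z a - t * sgn (z a)" using lt assms by (intro affine)
        also have "\<dots> = (1 - c) * (z a - lo * sgn (z a)) + c * (z a - hi * sgn (z a))"
          by (subst c(3)) (simp add: algebra_simps)
        also have "\<dots> = (1 - c) * soft lo (z a) + c * soft hi (z a)"
          using affine[of lo] affine[of hi] lt lo0 by simp
        finally show ?thesis .
      qed
    qed
    then show ?thesis using i j c by blast
  qed
qed

context sample_spectrum
begin

text \<open>An eigenvector of the smaller sample lies in the range of the larger sample covariance:
  its residual is orthogonal to all observations, hence to the eigenvector itself. Summing the
  squared inner products of the two systems in both orders compares the ranks. This links the rank
  of a training set with \<open>r\<close>, which belongs to the full sample.\<close>

lemma rank_mono:
  assumes "sample_spectrum D J X R' w' mu'" "I \<subseteq> J"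
  shows "R \<le> R'"
proof -
  interpret J: sample_spectrum D J X R' w' mu' by fact
  have unit: "(\<Sum>b<R'. (ip D (w' b) (w a))\<^sup>2) = 1" if a: "a < R" for a
  proof -
    let ?p = "lincomb_fun {..<R'} (\<lambda>b. ip D (w' b) (w a)) w'"
    let ?res = "\<lambda>j. w a j - ?p j"
    have "ip D (w' b) ?res = 0" if "b < R'" for b
      using that by (simp add: ip_diff_right ip_lincomb_orthonormal[OF J.orthonormal])
    then have "qf J D X ?res ?res = 0" unfolding J.spectral by simp
    then have "(\<Sum>i\<in>J. ip D (X i) ?res * ip D (X i) ?res) = 0"
      using J.card_I_pos by (simp add: qf_def)
    then have z: "ip D (X i) ?res = 0" if "i \<in> J" for i
      using that J.finite_I by (subst (asm) sum_nonneg_eq_0_iff) auto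
    have "qf I D X (w a) ?res = (\<Sum>i\<in>I. 0) / card I"
      unfolding qf_def using z assms(2) by (intro arg_cong2[where f = "(/)"] sum.cong) auto
    then have "mu a * ip D (w a) ?res = 0" using qf_eigenvector[OF a] by simp
    then have "ip D (w a) ?res = 0" using mu_pos[OF a] by simp
    then have "ip D (w a) (w a) = ip D (w a) ?p" by (simp add: ip_diff_right)
    also have "\<dots> = (\<Sum>b<R'. (ip D (w' b) (w a))\<^sup>2)"
      unfolding ip_lincomb_right by (intro sum.cong refl) (simp add: power2_eq_square ip_commute[of D "w a"])
    finally show ?thesis using orthonormal_onD[OF orthonormal, of a a] a by simp
  qed
  have "real R = (\<Sum>a<R. \<Sum>b<R'. (ip D (w' b) (w a))\<^sup>2)" using unit by simp
  also have "\<dots> = (\<Sum>b<R'. \<Sum>a<R. (ip D (w a) (w' b))\<^sup>2)"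
    by (subst sum.swap) (intro sum.cong refl, simp only: ip_commute[of D "w' _"])
  also have "\<dots> \<le> (\<Sum>b<R'. 1)"
  proof (rule sum_mono)
    fix b assume "b \<in> {..<R'}"
    then show "(\<Sum>a<R. (ip D (w a) (w' b))\<^sup>2) \<le> 1"
      using bessel_inequality[OF orthonormal, of "w' b"] orthonormal_onD[OF J.orthonormal, of b b] by simp
  qed
  finally show ?thesis by simp
qed

text \<open>The factors \<open>1 / sqrt (mu a)\<close> cancel the eigenvalues in the sample form,
  and shrinking the coefficients only lowers the energy; the bound is therefore the same at every
  threshold.\<close>

lemma fitted_energy_le:
  assumes "m \<le> R"
    and v: "\<And>a. a < m \<Longrightarrow> \<bar>v a\<bar> \<le> \<bar>(\<Sum>i\<in>I. y i * ip D (X i) (w a)) / card I / sqrt (mu a)\<bar>"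
  shows "qf I D X (lincomb_fun {..<m} (\<lambda>a. v a / sqrt (mu a)) w) (lincomb_fun {..<m} (\<lambda>a. v a / sqrt (mu a)) w)
    \<le> (\<Sum>i\<in>I. (y i)\<^sup>2) / card I"
proof -
  have "(\<Sum>a<m. mu a * (v a / sqrt (mu a))\<^sup>2) = (\<Sum>a<m. (v a)\<^sup>2)"
  proof (intro sum.cong refl)
    fix a assume "a \<in> {..<m}"
    then have "0 < mu a" using mu_pos[of a] assms(1) by auto
    then show "mu a * (v a / sqrt (mu a))\<^sup>2 = (v a)\<^sup>2" by (simp add: power_divide)
  qed
  also have "\<dots> \<le> (\<Sum>a<m. ((\<Sum>i\<in>I. y i * ip D (X i) (w a)) / card I / sqrt (mu a))\<^sup>2)"
  proof (rule sum_mono)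
    fix a assume "a \<in> {..<m}"
    then show "(v a)\<^sup>2 \<le> ((\<Sum>i\<in>I. y i * ip D (X i) (w a)) / card I / sqrt (mu a))\<^sup>2"
      using v[of a] unfolding abs_le_square_iff by simp
  qed
  also have "\<dots> \<le> (\<Sum>i\<in>I. (y i)\<^sup>2) / card I" by (rule coefficient_energy_le[OF assms(1)])
  finally show ?thesis unfolding qf_lincomb_eigenvectors[OF assms(1)] .
qed

end

section \<open>Forms along the path and the basic inequality of cross-validation\<close>

text \<open>Common shape of both forms: weights \<open>1 / card I\<close> with the observations give
  the sample form, weights \<open>lam\<close> with the population eigenvectors the population
  form.\<close>

definition wsq :: "'i set \<Rightarrow> 's set \<Rightarrow> ('s \<Rightarrow> real) \<Rightarrow> ('s \<Rightarrow> 'i \<Rightarrow> real) \<Rightarrow> ('i \<Rightarrow> real) \<Rightarrow> real" where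
  "wsq D I c X v = (\<Sum>i\<in>I. c i * (ip D (X i) v)\<^sup>2)"

lemma qf_eq_wsq: "qf I D X v v = wsq D I (\<lambda>_. 1 / card I) X v"
  by (simp add: qf_def wsq_def power2_eq_square sum_divide_distrib)

lemma popS_eq_wsq: "popS d u lam v = wsq {..<d} {..<d} lam u v"
  by (simp add: popS_def wsq_def)

text \<open>On the line through \<open>a\<close> and \<open>b\<close> a quadratic form is determined
  by its values at \<open>a\<close>, \<open>b\<close> and \<open>a + b\<close>. Tests at sums of
  pairs are therefore enough; a pair of equal vectors covers a single point up to the factor
  4.\<close>

lemma wsq_interpolate:
  "wsq D I c X (\<lambda>j. (1 - s) * a j + s * b j)
    = (1 - s) * (1 - 2 * s) * wsq D I c X a + s * (2 * s - 1) * wsq D I c X b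
      + s * (1 - s) * wsq D I c X (\<lambda>j. a j + b j)"
  unfolding wsq_def ip_add_right ip_scale_right sum_distrib_left sum.distrib[symmetric]
  by (intro sum.cong refl) (simp add: power2_eq_square algebra_simps)

lemma wsq_double: "wsq D I c X (\<lambda>j. a j + a j) = 4 * wsq D I c X a"
  unfolding wsq_def ip_add_right sum_distrib_left
  by (intro sum.cong refl) (simp add: power2_eq_square)

lemma wsq_add_le:
  assumes "\<And>i. i \<in> I \<Longrightarrow> 0 \<le> c i"
  shows "wsq D I c X (\<lambda>j. a j + b j) \<le> 2 * wsq D I c X a + 2 * wsq D I c X b"
  unfolding wsq_def ip_add_right sum_distrib_left sum.distrib[symmetric]
proof (rule sum_mono)
  fix i assume "i \<in> I"
  then have "0 \<le> c i" by (rule assms)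
  moreover have "(ip D (X i) a + ip D (X i) b)\<^sup>2 \<le> 2 * (ip D (X i) a)\<^sup>2 + 2 * (ip D (X i) b)\<^sup>2"
    using zero_le_power2[of "ip D (X i) a - ip D (X i) b"] by (simp add: power2_sum power2_diff)
  ultimately have "c i * (ip D (X i) a + ip D (X i) b)\<^sup>2 \<le> c i * (2 * (ip D (X i) a)\<^sup>2 + 2 * (ip D (X i) b)\<^sup>2)"
    by (rule mult_left_mono[rotated])
  then show "c i * (ip D (X i) a + ip D (X i) b)\<^sup>2 \<le> 2 * (c i * (ip D (X i) a)\<^sup>2) + 2 * (c i * (ip D (X i) b)\<^sup>2)"
    by (simp add: algebra_simps)
qed

text \<open>The first two coefficients are at most \<open>1 - s\<close> and \<open>s\<close> in
  absolute value; the third is at most 1/4, which balances the bound \<open>4 * \<rho>\<close> for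
  the sum.\<close>

lemma interpolated_deviation_le:
  fixes Da Db Dab s \<rho> :: real
  assumes "0 \<le> s" "s \<le> 1" "\<bar>Da\<bar> \<le> \<rho>" "\<bar>Db\<bar> \<le> \<rho>" "\<bar>Dab\<bar> \<le> 4 * \<rho>"
  shows "\<bar>(1 - s) * (1 - 2 * s) * Da + s * (2 * s - 1) * Db + s * (1 - s) * Dab\<bar> \<le> 2 * \<rho>"
proof -
  have gen: "\<bar>x + y + z\<bar> \<le> 2 * \<rho>"
    if "\<bar>x\<bar> \<le> p" "\<bar>y\<bar> \<le> q" "\<bar>z\<bar> \<le> \<rho>" "p + q = \<rho>" for x y z p q :: real
    using that by linarith
  have h: "\<bar>1 - 2 * s\<bar> \<le> 1" "\<bar>2 * s - 1\<bar> \<le> 1" using assms(1,2) by (auto simp: abs_le_iff)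
  show ?thesis
  proof (rule gen)
    show "\<bar>(1 - s) * (1 - 2 * s) * Da\<bar> \<le> (1 - s) * 1 * \<rho>"
      unfolding abs_mult using assms(1-3) h by (intro mult_mono) auto
    show "\<bar>s * (2 * s - 1) * Db\<bar> \<le> s * 1 * \<rho>"
      unfolding abs_mult using assms(1,2,4) h by (intro mult_mono) auto
    have "0 \<le> (2 * s - 1)\<^sup>2" by simp
    then have "s * (1 - s) \<le> 1/4" by (simp add: power2_eq_square algebra_simps)
    moreover have "0 \<le> s * (1 - s)" using assms(1,2) by simp
    ultimately have "\<bar>s * (1 - s) * Dab\<bar> \<le> 1/4 * (4 * \<rho>)"
      unfolding abs_mult[of "s * (1 - s)"] using assms(5) by (intro mult_mono) auto
    then show "\<bar>s * (1 - s) * Dab\<bar> \<le> \<rho>" by simp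
    show "(1 - s) * 1 * \<rho> + s * 1 * \<rho> = \<rho>" by (simp add: algebra_simps)
  qed
qed

text \<open>
  Between two adjacent thresholds the estimator is a convex combination, so two-sided control
  of the quadratic forms at sums of pairs of breakpoints suffices.
\<close>

lemma path_deviation_le:
  assumes c: "\<And>i. i \<in> I \<Longrightarrow> 0 \<le> c i" and c': "\<And>i. i \<in> I' \<Longrightarrow> 0 \<le> c' i"
    and s: "0 \<le> s" "s \<le> 1" and "0 \<le> \<rho>"
    and R: "wsq D I c X a \<le> R" "wsq D I c X b \<le> R"
    and dev: "\<And>v w. v \<in> {a, b} \<Longrightarrow> w \<in> {a, b} \<Longrightarrow>
      \<bar>wsq D I' c' X' (\<lambda>j. v j + w j) - wsq D I c X (\<lambda>j. v j + w j)\<bar> \<le> \<rho> * wsq D I c X (\<lambda>j. v j + w j)"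
  shows "\<bar>wsq D I' c' X' (\<lambda>j. (1 - s) * a j + s * b j) - wsq D I c X (\<lambda>j. (1 - s) * a j + s * b j)\<bar> \<le> 2 * (\<rho> * R)"
proof -
  let ?A = "wsq D I' c' X'" and ?P = "wsq D I c X"
  have one: "\<bar>?A v - ?P v\<bar> \<le> \<rho> * R" if v: "v \<in> {a, b}" for v
  proof -
    have four: "\<bar>4 * x - 4 * y\<bar> = 4 * \<bar>x - y\<bar>" for x y :: real
      by (simp only: right_diff_distrib[symmetric] abs_mult abs_numeral)
    have "4 * \<bar>?A v - ?P v\<bar> \<le> \<rho> * (4 * ?P v)"
      using dev[OF v v] unfolding wsq_double four .
    also have "\<dots> \<le> \<rho> * (4 * R)" using v R \<open>0 \<le> \<rho>\<close> by (intro mult_left_mono) auto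
    finally show ?thesis by simp
  qed
  have "?P (\<lambda>j. a j + b j) \<le> 2 * ?P a + 2 * ?P b" by (rule wsq_add_le) (rule c)
  also have "\<dots> \<le> 2 * R + 2 * R" using R by (intro add_mono mult_left_mono) auto
  finally have "?P (\<lambda>j. a j + b j) \<le> 4 * R" by simp
  then have "\<rho> * ?P (\<lambda>j. a j + b j) \<le> \<rho> * (4 * R)" using \<open>0 \<le> \<rho>\<close> by (rule mult_left_mono)
  with dev[of a b] have two: "\<bar>?A (\<lambda>j. a j + b j) - ?P (\<lambda>j. a j + b j)\<bar> \<le> 4 * (\<rho> * R)" by simp
  have "?A (\<lambda>j. (1 - s) * a j + s * b j) - ?P (\<lambda>j. (1 - s) * a j + s * b j)
      = (1 - s) * (1 - 2 * s) * (?A a - ?P a) + s * (2 * s - 1) * (?A b - ?P b)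
        + s * (1 - s) * (?A (\<lambda>j. a j + b j) - ?P (\<lambda>j. a j + b j))"
    unfolding wsq_interpolate by (simp add: algebra_simps)
  then show ?thesis using interpolated_deviation_le[OF s one[of a] one[of b] two] by simp
qed

text \<open>The hypothesis has doubled vectors because tests are made at sums of pairs only.\<close>

lemma path_linear_le:
  assumes s: "0 \<le> s" "s \<le> 1"
    and lin: "\<And>v. v \<in> {a, b} \<Longrightarrow> \<bar>\<Sum>i\<in>I. e i * ip D (X i) (\<lambda>j. v j + v j)\<bar> \<le> 2 * \<rho>"
  shows "\<bar>\<Sum>i\<in>I. e i * ip D (X i) (\<lambda>j. (1 - s) * a j + s * b j)\<bar> \<le> \<rho>"
proof -
  let ?l = "\<lambda>v. \<Sum>i\<in>I. e i * ip D (X i) v"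
  have dbl: "?l (\<lambda>j. v j + v j) = 2 * ?l v" for v
    unfolding ip_add_right sum_distrib_left by (intro sum.cong refl) (simp add: distrib_left)
  have ab: "\<bar>?l v\<bar> \<le> \<rho>" if "v \<in> {a, b}" for v
    using lin[OF that] unfolding dbl by (simp add: abs_mult)
  have "?l (\<lambda>j. (1 - s) * a j + s * b j) = (1 - s) * ?l a + s * ?l b"
    unfolding ip_add_right ip_scale_right sum_distrib_left sum.distrib[symmetric]
    by (intro sum.cong refl) (simp add: algebra_simps)
  also have "\<bar>\<dots>\<bar> \<le> \<bar>(1 - s) * ?l a\<bar> + \<bar>s * ?l b\<bar>" by (rule abs_triangle_ineq)
  also have "\<dots> \<le> (1 - s) * \<rho> + s * \<rho>"
    unfolding abs_mult using s ab by (intro add_mono mult_mono) auto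
  finally show ?thesis by (simp add: algebra_simps)
qed

lemma fold_avg_mono: "(\<And>l. l \<in> {1..L} \<Longrightarrow> f l \<le> g l) \<Longrightarrow> fold_avg L f \<le> fold_avg L g"
  unfolding fold_avg_def by (intro mult_left_mono sum_mono) auto

lemma fold_avg_add: "fold_avg L (\<lambda>l. f l + g l) = fold_avg L f + fold_avg L g"
  by (simp add: fold_avg_def sum.distrib distrib_left)

lemma fold_avg_cmult: "fold_avg L (\<lambda>l. c * f l) = c * fold_avg L f"
  by (simp add: fold_avg_def sum_distrib_left)

lemma fold_avg_const: "0 < L \<Longrightarrow> fold_avg L (\<lambda>l. c) = c"
  by (simp add: fold_avg_def)

lemma fold_avg_sqrt_le:
  assumes "\<And>l. l \<in> {1..L} \<Longrightarrow> 0 \<le> f l"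
  shows "fold_avg L (\<lambda>l. sqrt (f l)) \<le> sqrt (fold_avg L f)"
proof (cases "L = 0")
  case False
  have "(\<Sum>l=1..L. 1 * sqrt (f l))\<^sup>2 \<le> (\<Sum>l=1..L. 1\<^sup>2) * (\<Sum>l=1..L. (sqrt (f l))\<^sup>2)"
    by (rule Cauchy_Schwarz_ineq_sum)
  also have "(\<Sum>l=1..L. (sqrt (f l))\<^sup>2) = (\<Sum>l=1..L. f l)"
    using assms by (intro sum.cong) auto
  finally have "(\<Sum>l=1..L. sqrt (f l))\<^sup>2 \<le> real L * (\<Sum>l=1..L. f l)" by simp
  then have "(\<Sum>l=1..L. sqrt (f l))\<^sup>2 / (real L)\<^sup>2 \<le> real L * (\<Sum>l=1..L. f l) / (real L)\<^sup>2"
    by (intro divide_right_mono) auto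
  then have "(fold_avg L (\<lambda>l. sqrt (f l)))\<^sup>2 \<le> fold_avg L f"
    using False by (simp add: fold_avg_def power_mult_distrib power_divide) (simp add: power2_eq_square)
  then show ?thesis by (rule real_le_rsqrt)
qed (simp add: fold_avg_def)

text \<open>The basic inequality of empirical risk minimisation. \<open>N\<close> is the noise
  energy of a block, \<open>C\<close> its cross term with the error, \<open>A\<close> and
  \<open>P\<close> are the hold-out and the population form. The noise energy is common to both
  thresholds and cancels.\<close>

lemma cv_basic_inequality:
  fixes P P' A A' C C' N a b :: "nat \<Rightarrow> real"
  assumes opt: "fold_avg L (\<lambda>l. N l - 2 * C l + A l) \<le> fold_avg L (\<lambda>l. N l - 2 * C' l + A' l)"
    and "\<And>l. l \<in> {1..L} \<Longrightarrow> \<bar>A l - P l\<bar> \<le> a l" "\<And>l. l \<in> {1..L} \<Longrightarrow> \<bar>A' l - P' l\<bar> \<le> a l"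
    and "\<And>l. l \<in> {1..L} \<Longrightarrow> \<bar>C l\<bar> \<le> b l" "\<And>l. l \<in> {1..L} \<Longrightarrow> \<bar>C' l\<bar> \<le> b l"
  shows "fold_avg L P \<le> fold_avg L P' + fold_avg L (\<lambda>l. 2 * a l + 4 * b l)"
proof -
  have "fold_avg L (\<lambda>l. P l + N l) \<le> fold_avg L (\<lambda>l. (N l - 2 * C l + A l) + (a l + 2 * b l))"
  proof (rule fold_avg_mono)
    fix l assume "l \<in> {1..L}"
    then have "\<bar>A l - P l\<bar> \<le> a l" "\<bar>C l\<bar> \<le> b l" using assms by auto
    then show "P l + N l \<le> (N l - 2 * C l + A l) + (a l + 2 * b l)" by linarith
  qed
  moreover have "fold_avg L (\<lambda>l. (N l - 2 * C' l + A' l)) \<le> fold_avg L (\<lambda>l. (P' l + N l) + (a l + 2 * b l))"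
  proof (rule fold_avg_mono)
    fix l assume "l \<in> {1..L}"
    then have "\<bar>A' l - P' l\<bar> \<le> a l" "\<bar>C' l\<bar> \<le> b l" using assms by auto
    then show "N l - 2 * C' l + A' l \<le> (P' l + N l) + (a l + 2 * b l)" by linarith
  qed
  ultimately show ?thesis using opt unfolding fold_avg_add fold_avg_cmult by linarith
qed

section \<open>Measurability of the fit\<close>

lemma space_borel_vec: "space (borel_vec d) = carrier_vec d"
  by (simp add: borel_vec_def)

lemma measurable_vec_index[measurable]:
  assumes "j < d"
  shows "(\<lambda>v. v $ j) \<in> borel_measurable (borel_vec d)"
proof -
  have 1: "(\<lambda>v. \<lambda>j\<in>{..<d}. v $ j) \<in> borel_vec d \<rightarrow>\<^sub>M PiM {..<d} (\<lambda>_. borel)"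
    unfolding borel_vec_def by (rule measurable_vimage_algebra1) (auto simp: space_PiM)
  have 2: "(\<lambda>f. f j) \<in> PiM {..<d} (\<lambda>_. borel) \<rightarrow>\<^sub>M (borel :: real measure)"
    using assms by (intro measurable_component_singleton) auto
  show ?thesis using measurable_compose[OF 1 2] assms by simp
qed

lemma measurable_ip_vec[measurable]:
  "(\<lambda>v. ip {..<d} (vec_index v) w) \<in> borel_measurable (borel_vec d)"
  unfolding ip_def by (intro borel_measurable_sum borel_measurable_times measurable_vec_index) auto

text \<open>The target is restricted to positive semidefinite matrices because
  \<open>eigen_rule\<close> gives measurability on them.\<close>

lemma measurable_sample_cov:
  assumes "finite I" and meas: "\<And>i. i \<in> I \<Longrightarrow> (\<lambda>a. X a i) \<in> N \<rightarrow>\<^sub>M borel_vec d"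
  shows "(\<lambda>a. sample_cov d I (X a)) \<in> N \<rightarrow>\<^sub>M restrict_space (borel_mat d d) {S. psd_mat d S}"
proof (rule measurable_restrict_space2)
  show "(\<lambda>a. sample_cov d I (X a)) \<in> space N \<rightarrow> {S. psd_mat d S}"
    using psd_sample_cov[OF assms(1)] by auto
  show "(\<lambda>a. sample_cov d I (X a)) \<in> N \<rightarrow>\<^sub>M borel_mat d d"
    unfolding borel_mat_def
  proof (rule measurable_vimage_algebra2)
    show "(\<lambda>a. sample_cov d I (X a)) \<in> space N \<rightarrow> carrier_mat d d"
      using sample_cov_carrier[OF assms(1)] by auto
    show "(\<lambda>a. \<lambda>ij\<in>{..<d} \<times> {..<d}. sample_cov d I (X a) $$ ij) \<in> N \<rightarrow>\<^sub>M PiM ({..<d} \<times> {..<d}) (\<lambda>_. borel)"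
    proof (rule measurable_restrict)
      fix ij assume ij: "ij \<in> {..<d} \<times> {..<d}"
      obtain a b where ab: "ij = (a, b)" "a < d" "b < d" using ij by auto
      have c: "(\<lambda>z. X z i $ a) \<in> borel_measurable N" "(\<lambda>z. X z i $ b) \<in> borel_measurable N" if "i \<in> I" for i
        using measurable_compose[OF meas[OF that] measurable_vec_index] ab by auto
      have "(\<lambda>z. (\<Sum>i\<in>I. X z i $ a * X z i $ b) / card I) \<in> borel_measurable N"
        using c by (intro borel_measurable_divide borel_measurable_sum borel_measurable_times) auto
      then show "(\<lambda>z. sample_cov d I (X z) $$ ij) \<in> borel_measurable N"
        using ab assms(1) by (simp add: sample_cov_index)
    qed
  qed
qed

lemma measurable_eigvec:
  assumes "eigen_rule d U s" "a < d" "j < d"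
    and "finite I" "\<And>i. i \<in> I \<Longrightarrow> (\<lambda>z. X z i) \<in> N \<rightarrow>\<^sub>M borel_vec d"
  shows "(\<lambda>z. eigvec d U (sample_cov d I (X z)) a j) \<in> borel_measurable N"
proof -
  have "(\<lambda>S. eigvec d U S a j) \<in> borel_measurable (restrict_space (borel_mat d d) {S. psd_mat d S})"
    using assms(1-3) unfolding eigen_rule_def eigvec_def by blast
  from measurable_compose[OF measurable_sample_cov[OF assms(4,5)] this] show ?thesis by simp
qed

text \<open>
  The scales \<open>s S a\<close> are not assumed measurable, but they are determined by the eigenvectors;
  for \<open>a\<close> beyond the rank the right-hand side is \<open>0\<close>.
\<close>

definition eig_scale :: "nat \<Rightarrow> (real mat \<Rightarrow> real mat) \<Rightarrow> nat set \<Rightarrow> (nat \<Rightarrow> real vec) \<Rightarrow> nat \<Rightarrow> real" where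
  "eig_scale d U I x a = sqrt (qf I {..<d} (\<lambda>i. vec_index (x i)) (eigvec d U (sample_cov d I x) a) (eigvec d U (sample_cov d I x) a))"

lemma eig_scale_eq:
  assumes "eigen_rule d U s" "finite I" "I \<noteq> {}" "a < vec_space.rank d (sample_cov d I x)"
  shows "eig_scale d U I x a = s (sample_cov d I x) a"
proof -
  interpret sample_spectrum "{..<d}" I "\<lambda>i. vec_index (x i)" "vec_space.rank d (sample_cov d I x)"
    "eigvec d U (sample_cov d I x)" "\<lambda>a. (s (sample_cov d I x) a)\<^sup>2"
    by (rule sample_spectrum_of_rule[OF assms(1-3)])
  have "0 < s (sample_cov d I x) a"
  proof -
    have "is_eigen_decomp d (sample_cov d I x) (U (sample_cov d I x)) (s (sample_cov d I x))"
      using assms psd_sample_cov by (auto simp: eigen_rule_def)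
    then show ?thesis using assms(4) by (auto simp: is_eigen_decomp_def Let_def)
  qed
  then show ?thesis
    using qf_eigenvector[OF assms(4)] orthonormal_onD[OF orthonormal, of a a] assms(4)
    by (simp add: eig_scale_def)
qed

text \<open>The estimator with a summation range that does not depend on the sample. Terms between
  the rank and \<open>min k d\<close> vanish because \<open>eigvec\<close> is zero there.\<close>

definition fit_coord ::
  "nat \<Rightarrow> (real mat \<Rightarrow> real mat) \<Rightarrow> nat \<Rightarrow> nat set \<Rightarrow> (nat \<Rightarrow> real vec) \<Rightarrow> (nat \<Rightarrow> real) \<Rightarrow> real \<Rightarrow> nat \<Rightarrow> real" where
  "fit_coord d U k I x y t j = (\<Sum>a<min k d.
     soft t ((\<Sum>i\<in>I. y i * ip {..<d} (vec_index (x i)) (eigvec d U (sample_cov d I x) a)) / card I / eig_scale d U I x a)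
       / eig_scale d U I x a * eigvec d U (sample_cov d I x) a j)"

definition coeff_at :: "nat \<Rightarrow> (real mat \<Rightarrow> real mat) \<Rightarrow> nat set \<Rightarrow> (nat \<Rightarrow> real vec) \<Rightarrow> (nat \<Rightarrow> real) \<Rightarrow> nat \<Rightarrow> real" where
  "coeff_at d U I x y a = (\<Sum>i\<in>I. y i * ip {..<d} (vec_index (x i)) (eigvec d U (sample_cov d I x) a)) / card I / eig_scale d U I x a"

lemma rank_le_dim: "eigen_rule d U s \<Longrightarrow> finite I \<Longrightarrow> vec_space.rank d (sample_cov d I x) \<le> d"
  using vec_space.rank_le_nc[OF sample_cov_carrier] by blast

lemma trunc_nct_eq_fit_coord:
  assumes rule: "eigen_rule d U s" and I: "finite I" "I \<noteq> {}" and j: "j < d"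
  shows "trunc_nct d U s k I x y t $ j = fit_coord d U k I x y t j"
proof -
  let ?S = "sample_cov d I x"
  let ?r = "vec_space.rank d ?S"
  have sc: "eig_scale d U I x a = s ?S a" if "a < ?r" for a by (rule eig_scale_eq[OF rule I that])
  have "trunc_nct d U s k I x y t $ j = (\<Sum>a<min k ?r. soft t (whitened_coeff d U s I x y a) / s ?S a * eigvec d U ?S a j)"
    unfolding trunc_nct_eq_lincomb(2)[OF rule I(1) j] lincomb_fun_def ..
  also have "\<dots> = (\<Sum>a<min k ?r. soft t ((\<Sum>i\<in>I. y i * ip {..<d} (vec_index (x i)) (eigvec d U ?S a)) / card I / eig_scale d U I x a)
       / eig_scale d U I x a * eigvec d U ?S a j)"
    by (intro sum.cong refl) (auto simp: sc whitened_coeff_def)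
  also have "\<dots> = fit_coord d U k I x y t j"
    unfolding fit_coord_def
  proof (rule sum.mono_neutral_left)
    show "{..<min k ?r} \<subseteq> {..<min k d}" using rank_le_dim[OF rule I(1), of x] by auto
  qed (auto simp: eigvec_def)
  finally show ?thesis .
qed

lemma measurable_soft[measurable]:
  assumes [measurable]: "f \<in> borel_measurable N" "g \<in> borel_measurable N"
  shows "(\<lambda>z. soft (f z) (g z)) \<in> borel_measurable N"
  unfolding soft_def by measurable

context
  fixes d :: nat and U :: "real mat \<Rightarrow> real mat" and s :: "real mat \<Rightarrow> nat \<Rightarrow> real" and I :: "nat set"
    and N :: "'z measure" and X :: "'z \<Rightarrow> nat \<Rightarrow> real vec" and Y :: "'z \<Rightarrow> nat \<Rightarrow> real"
  assumes rule: "eigen_rule d U s" and fin: "finite I"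
    and X: "\<And>i. i \<in> I \<Longrightarrow> (\<lambda>z. X z i) \<in> N \<rightarrow>\<^sub>M borel_vec d"
    and Y: "\<And>i. i \<in> I \<Longrightarrow> (\<lambda>z. Y z i) \<in> borel_measurable N"
begin

lemma measurable_ip_eigvec:
  assumes "a < d" "i \<in> I"
  shows "(\<lambda>z. ip {..<d} (vec_index (X z i)) (eigvec d U (sample_cov d I (X z)) a)) \<in> borel_measurable N"
  unfolding ip_def
proof (intro borel_measurable_sum borel_measurable_times)
  fix j assume j: "j \<in> {..<d}"
  show "(\<lambda>z. X z i $ j) \<in> borel_measurable N"
    using measurable_compose[OF X[OF assms(2)] measurable_vec_index] j by auto
  show "(\<lambda>z. eigvec d U (sample_cov d I (X z)) a j) \<in> borel_measurable N"
    using measurable_eigvec[OF rule assms(1) _ fin X] j by auto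
qed

lemma measurable_eig_scale:
  assumes "a < d"
  shows "(\<lambda>z. eig_scale d U I (X z) a) \<in> borel_measurable N"
  unfolding eig_scale_def qf_def
  using measurable_ip_eigvec[OF assms]
  by (intro borel_measurable_sqrt[THEN measurable_compose[rotated]] borel_measurable_divide borel_measurable_sum borel_measurable_times) auto

lemma measurable_coeff_at:
  assumes "a < d"
  shows "(\<lambda>z. coeff_at d U I (X z) (Y z) a) \<in> borel_measurable N"
  unfolding coeff_at_def
  using measurable_ip_eigvec[OF assms] measurable_eig_scale[OF assms] Y
  by (intro borel_measurable_divide borel_measurable_sum borel_measurable_times) auto

lemma measurable_fit_coord:
  assumes "j < d" "t \<in> borel_measurable N"
  shows "(\<lambda>z. fit_coord d U k I (X z) (Y z) (t z) j) \<in> borel_measurable N"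
  unfolding fit_coord_def coeff_at_def[symmetric]
proof (intro borel_measurable_sum borel_measurable_times borel_measurable_divide measurable_soft assms(2))
  fix a assume "a \<in> {..<min k d}"
  then have a: "a < d" by simp
  show "(\<lambda>z. coeff_at d U I (X z) (Y z) a) \<in> borel_measurable N" by (rule measurable_coeff_at[OF a])
  show "(\<lambda>z. eig_scale d U I (X z) a) \<in> borel_measurable N" by (rule measurable_eig_scale[OF a])
  show "(\<lambda>z. eigvec d U (sample_cov d I (X z)) a j) \<in> borel_measurable N"
    by (rule measurable_eigvec[OF rule a assms(1) fin X])
qed

lemma measurable_breakpoint:
  "(\<lambda>z. breakpoint (min k d) (coeff_at d U I (X z) (Y z)) i) \<in> borel_measurable N"
  unfolding breakpoint_def using measurable_coeff_at by (cases "i < min k d") auto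

end

section \<open>Orlicz norms, the spectral norm and a power bound\<close>

text \<open>The norm is an infimum of admissible scales, and admissibility at the infimum would need
  a limit argument. Some admissible scale lies below \<open>2 * s\<close>, and the exponential
  moment decreases in the scale.\<close>

lemma psi_norm_exp_moment:
  assumes [measurable]: "Z \<in> borel_measurable M" and "prob_space M"
    and le: "psi_norm M a Z \<le> ennreal s" and "0 < s" "0 < a"
  shows "(\<integral>\<^sup>+\<omega>. ennreal (exp ((\<bar>Z \<omega>\<bar> / (2 * s)) powr a)) \<partial>M) \<le> 2"
proof -
  interpret prob_space M by fact
  have "psi_norm M a Z < ennreal (2 * s)"
    using le \<open>0 < s\<close> by (auto intro: le_less_trans simp: ennreal_less_iff)
  then obtain t where t: "0 < t" "t < 2 * s"
    "(\<integral>\<^sup>+ \<omega>. ennreal (exp ((\<bar>Z \<omega>\<bar> / t) powr a) - 1) \<partial>M) \<le> 1"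
    unfolding psi_norm_def Inf_less_iff by (auto simp: ennreal_less_iff)
  have "(\<integral>\<^sup>+\<omega>. ennreal (exp ((\<bar>Z \<omega>\<bar> / (2 * s)) powr a)) \<partial>M)
      \<le> (\<integral>\<^sup>+\<omega>. ennreal (exp ((\<bar>Z \<omega>\<bar> / t) powr a) - 1) + 1 \<partial>M)"
  proof (rule nn_integral_mono)
    fix \<omega>
    have "(\<bar>Z \<omega>\<bar> / (2 * s)) powr a \<le> (\<bar>Z \<omega>\<bar> / t) powr a"
      using t \<open>0 < a\<close> \<open>0 < s\<close> by (intro powr_mono2 divide_left_mono) auto
    then have "exp ((\<bar>Z \<omega>\<bar> / (2 * s)) powr a) \<le> (exp ((\<bar>Z \<omega>\<bar> / t) powr a) - 1) + 1" by simp
    then have "ennreal (exp ((\<bar>Z \<omega>\<bar> / (2 * s)) powr a)) \<le> ennreal ((exp ((\<bar>Z \<omega>\<bar> / t) powr a) - 1) + 1)"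
      by (rule ennreal_leI)
    also have "\<dots> = ennreal (exp ((\<bar>Z \<omega>\<bar> / t) powr a) - 1) + 1"
      by (subst ennreal_plus) auto
    finally show "ennreal (exp ((\<bar>Z \<omega>\<bar> / (2 * s)) powr a)) \<le> ennreal (exp ((\<bar>Z \<omega>\<bar> / t) powr a) - 1) + 1" .
  qed
  also have "\<dots> = (\<integral>\<^sup>+\<omega>. ennreal (exp ((\<bar>Z \<omega>\<bar> / t) powr a) - 1) \<partial>M) + (\<integral>\<^sup>+\<omega>. 1 \<partial>M)"
    by (rule nn_integral_add) auto
  also have "\<dots> \<le> 1 + 1" using t(3) by (intro add_mono) (auto simp: emeasure_space_1)
  finally show ?thesis by simp
qed

lemma psi_norm_le_vec_psi_norm:
  assumes "w \<in> carrier_vec m" "l2norm w = 1"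
  shows "psi_norm M a (\<lambda>\<omega>. w \<bullet> Z \<omega>) \<le> vec_psi_norm M a m Z"
  unfolding vec_psi_norm_def using assms by (intro SUP_upper) auto

lemma quadratic_form_le_spectral_norm:
  assumes S: "S \<in> carrier_mat d d" and b: "b \<in> carrier_vec d"
  shows "b \<bullet> (S *\<^sub>v b) \<le> spectral_norm S * (l2norm b)\<^sup>2"
proof -
  have nn: "0 \<le> v \<bullet> v" for v :: "real Matrix.vec" by (simp add: scalar_prod_def sum_nonneg)
  have l2: "(l2norm v)\<^sup>2 = v \<bullet> v" "0 \<le> l2norm v" for v unfolding l2norm_def using nn[of v] by auto
  have cs: "v \<bullet> w \<le> l2norm v * l2norm w" if "v \<in> carrier_vec d" "w \<in> carrier_vec d" for v w
  proof -
    have "(v \<bullet> w)\<^sup>2 \<le> (l2norm v)\<^sup>2 * (l2norm w)\<^sup>2"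
      unfolding l2 using ip_square_le[of "{..<d}" "vec_index v" "vec_index w"] that by (simp add: scalar_prod_eq_ip)
    then have "\<bar>v \<bullet> w\<bar> \<le> \<bar>l2norm v * l2norm w\<bar>"
      unfolding abs_le_square_iff power_mult_distrib .
    moreover have "0 \<le> l2norm v * l2norm w" by (rule mult_nonneg_nonneg[OF l2(2) l2(2)])
    ultimately show ?thesis by linarith
  qed
  let ?V = "{v \<in> carrier_vec (dim_col S). l2norm v = 1}"
  \<comment> \<open>A real supremum bounds the members of its set only if the set is bounded;
    Cauchy-Schwarz in each row gives the Frobenius norm as a bound.\<close>
  have bdd: "bdd_above ((\<lambda>v. l2norm (S *\<^sub>v v)) ` ?V)"
  proof (rule bdd_aboveI2)
    fix v assume "v \<in> ?V"
    then have v: "v \<in> carrier_vec d" "v \<bullet> v = 1" using S l2(1)[of v] by auto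
    have "(S *\<^sub>v v) \<bullet> (S *\<^sub>v v) = (\<Sum>i<d. (ip {..<d} (\<lambda>j. S $$ (i, j)) (vec_index v))\<^sup>2)"
      using S v by (simp add: scalar_prod_def lessThan_atLeast0 ip_def power2_eq_square)
    also have "\<dots> \<le> (\<Sum>i<d. ip {..<d} (\<lambda>j. S $$ (i, j)) (\<lambda>j. S $$ (i, j)) * 1)"
      using ip_square_le[of "{..<d}" _ "vec_index v"] v by (intro sum_mono) (simp add: scalar_prod_eq_ip)
    finally show "l2norm (S *\<^sub>v v) \<le> sqrt (\<Sum>i<d. ip {..<d} (\<lambda>j. S $$ (i, j)) (\<lambda>j. S $$ (i, j)) * 1)"
      unfolding l2norm_def by (rule real_sqrt_le_mono)
  qed
  show ?thesis
  proof (cases "l2norm b = 0")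
    case True
    then show ?thesis using cs[of b "S *\<^sub>v b"] S b by simp
  next
    case False
    then have bp: "0 < l2norm b" using l2(2)[of b] by simp
    let ?v = "(1 / l2norm b) \<cdot>\<^sub>v b"
    have v: "?v \<in> carrier_vec d" using b by simp
    have vn: "l2norm ?v = 1"
    proof -
      have "?v \<bullet> ?v = (1 / l2norm b) * (1 / l2norm b) * (b \<bullet> b)" using b by simp
      then have "?v \<bullet> ?v = 1" using bp by (simp add: l2(1)[symmetric] power2_eq_square)
      then show ?thesis by (simp add: l2norm_def)
    qed
    have "l2norm (S *\<^sub>v ?v) \<le> spectral_norm S"
      unfolding spectral_norm_def using bdd v vn S by (intro cSUP_upper) auto
    moreover have "?v \<bullet> (S *\<^sub>v ?v) \<le> l2norm ?v * l2norm (S *\<^sub>v ?v)" using S v by (intro cs) auto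
    ultimately have "?v \<bullet> (S *\<^sub>v ?v) \<le> spectral_norm S" using vn by simp
    moreover have "?v \<bullet> (S *\<^sub>v ?v) = (b \<bullet> (S *\<^sub>v b)) / (l2norm b)\<^sup>2"
      using S b by (simp add: mult_mat_vec power2_eq_square)
    ultimately show ?thesis using bp by (simp add: divide_le_eq)
  qed
qed

text \<open>\<open>y powr a * exp (- y)\<close> decreases beyond \<open>y = a\<close>, hence beyond
  \<open>l\<close>. The added 1 covers the values of \<open>y\<close> up to
  \<open>l\<close>.\<close>

lemma powr_le_exp_excess:
  fixes y l a :: real
  assumes "0 \<le> y" "0 < l" "a \<le> l" "0 \<le> a"
  shows "y powr a \<le> l powr a * (1 + exp (y - l))"
proof (cases "y \<le> l")
  case True
  then have "y powr a \<le> l powr a * 1" using assms by (simp add: powr_mono2)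
  also have "\<dots> \<le> l powr a * (1 + exp (y - l))" by (intro mult_left_mono) auto
  finally show ?thesis .
next
  case False
  then have y: "l < y" "0 < y" using assms by auto
  have "a * ln (y / l) \<le> a * (y / l - 1)"
    using y assms by (intro mult_left_mono ln_le_minus_one) auto
  also have "\<dots> \<le> l * (y / l - 1)" using y assms by (intro mult_right_mono) auto
  also have "\<dots> = y - l" using assms by (simp add: right_diff_distrib)
  finally have "(y / l) powr a \<le> exp (y - l)" using y assms by (simp add: powr_def)
  then have "l powr a * (y / l) powr a \<le> l powr a * exp (y - l)" by (intro mult_left_mono) auto
  also have "l powr a * (y / l) powr a = y powr a" using y assms by (simp add: powr_mult[symmetric])
  also have "l powr a * exp (y - l) \<le> l powr a * (1 + exp (y - l))" by (intro mult_left_mono) auto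
  finally show ?thesis .
qed

section \<open>Concentration for the random design in the eigenbasis of the covariance\<close>

text \<open>The model in coordinates: \<open>popS d u lam\<close> is the population form and
  \<kappa> a squared sub-Gaussian scale. The sub-Gaussian condition is stated for every positive
  \<open>q\<close> above the population form, so that vectors of zero variance fit in without
  division by zero.\<close>

locale random_design = prob_space M for M :: "'w measure" +
  fixes n d :: nat and x :: "nat \<Rightarrow> 'w \<Rightarrow> real Matrix.vec" and e :: "nat \<Rightarrow> 'w \<Rightarrow> real"
    and \<kappa> :: real and u :: "nat \<Rightarrow> nat \<Rightarrow> real" and lam :: "nat \<Rightarrow> real" and \<sigma> \<alpha> :: real
  assumes n_pos: "0 < n" and d_pos: "0 < d" and \<kappa>_pos: "0 < \<kappa>" and \<sigma>_pos: "0 < \<sigma>" and \<alpha>_pos: "0 < \<alpha>"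
    and x_indep: "indep_vars (\<lambda>_. borel_vec d) x {1..n}"
    and e_meas: "i \<in> {1..n} \<Longrightarrow> e i \<in> borel_measurable M"
    and e_x_indep: "A \<in> sets (PiM {1..n} (\<lambda>_. borel)) \<Longrightarrow> A' \<in> sets (PiM {1..n} (\<lambda>_. borel_vec d)) \<Longrightarrow>
      prob ((\<lambda>\<omega>. (\<lambda>i\<in>{1..n}. e i \<omega>, \<lambda>i\<in>{1..n}. x i \<omega>)) -` (A \<times> A') \<inter> space M)
        = prob ((\<lambda>\<omega>. \<lambda>i\<in>{1..n}. e i \<omega>) -` A \<inter> space M) * prob ((\<lambda>\<omega>. \<lambda>i\<in>{1..n}. x i \<omega>) -` A' \<inter> space M)"
    and u_orthonormal: "orthonormal_on {..<d} u {..<d}"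
    and u_complete: "i < d \<Longrightarrow> v i = lincomb_fun {..<d} (\<lambda>j. ip {..<d} (u j) v) u i"
    and lam_pos: "j < d \<Longrightarrow> 0 < lam j"
    and lam_antimono: "i \<le> j \<Longrightarrow> j < d \<Longrightarrow> lam j \<le> lam i"
    and subgaussian: "i \<in> {1..n} \<Longrightarrow> 0 < q \<Longrightarrow> popS d u lam v \<le> q \<Longrightarrow>
        (\<integral>\<^sup>+\<omega>. ennreal (exp ((ip {..<d} (vec_index (x i \<omega>)) v)\<^sup>2 / (\<kappa> * q))) \<partial>M) \<le> 2"
    and mean_zero: "i \<in> {1..n} \<Longrightarrow> expectation (\<lambda>\<omega>. ip {..<d} (vec_index (x i \<omega>)) v) = 0"
    and second_moment: "i \<in> {1..n} \<Longrightarrow> expectation (\<lambda>\<omega>. (ip {..<d} (vec_index (x i \<omega>)) v)\<^sup>2) = popS d u lam v"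
    and noise: "i \<in> {1..n} \<Longrightarrow> (\<integral>\<^sup>+\<omega>. ennreal (exp ((\<bar>e i \<omega>\<bar> / \<sigma>) powr \<alpha>)) \<partial>M) \<le> 2"
begin

abbreviation g :: "nat \<Rightarrow> (nat \<Rightarrow> real) \<Rightarrow> 'w \<Rightarrow> real" where
  "g i v \<omega> \<equiv> ip {..<d} (vec_index (x i \<omega>)) v"

abbreviation pop :: "(nat \<Rightarrow> real) \<Rightarrow> real" where
  "pop \<equiv> popS d u lam"

abbreviation smp :: "nat set \<Rightarrow> 'w \<Rightarrow> (nat \<Rightarrow> real) \<Rightarrow> real" where
  "smp I \<omega> v \<equiv> qf I {..<d} (\<lambda>i. vec_index (x i \<omega>)) v v"

lemma x_meas: "i \<in> {1..n} \<Longrightarrow> x i \<in> M \<rightarrow>\<^sub>M borel_vec d"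
  using x_indep by (auto simp: indep_vars_def2)

lemma g_meas: "i \<in> {1..n} \<Longrightarrow> g i v \<in> borel_measurable M"
  using measurable_compose[OF x_meas measurable_ip_vec] by simp

lemma pop_nonneg: "0 \<le> pop v"
  unfolding popS_def using lam_pos by (intro sum_nonneg mult_nonneg_nonneg) (auto simp: less_imp_le)

lemma pop_zero_imp_ip_zero:
  assumes "pop v = 0"
  shows "ip {..<d} w v = 0"
proof -
  have "ip {..<d} (u j) v = 0" if "j < d" for j
  proof -
    have "lam j * (ip {..<d} (u j) v)\<^sup>2 = 0"
      using assms that unfolding popS_def
      by (subst (asm) sum_nonneg_eq_0_iff) (auto simp: less_imp_le lam_pos)
    then show ?thesis using lam_pos[OF that] by simp
  qed
  then have "v i = 0" if "i < d" for i
    using u_complete[OF that, of v] by (simp add: lincomb_fun_def)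
  then show ?thesis by (simp add: ip_def)
qed

lemma pop_lincomb:
  assumes "J \<subseteq> {..<d}"
  shows "pop (lincomb_fun J c u) = (\<Sum>j\<in>J. lam j * (c j)\<^sup>2)"
proof -
  have fJ: "finite J" by (rule finite_subset[OF assms]) simp
  have "ip {..<d} (u j) (lincomb_fun J c u) = (if j \<in> J then c j else 0)" if "j < d" for j
  proof (cases "j \<in> J")
    case True
    then show ?thesis using fJ by (simp add: ip_lincomb_orthonormal[OF orthonormal_on_subset[OF u_orthonormal assms]])
  next
    case False
    have "(\<Sum>b\<in>J. c b * ip {..<d} (u j) (u b)) = (\<Sum>b\<in>J. 0)"
    proof (intro sum.cong refl)
      fix b assume "b \<in> J"
      then have "b \<in> {..<d}" "j \<noteq> b" using assms False by auto
      then show "c b * ip {..<d} (u j) (u b) = 0"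
        using orthonormal_onD[OF u_orthonormal, of j b] that by simp
    qed
    then show ?thesis using False by (simp add: ip_lincomb_right)
  qed
  then have "pop (lincomb_fun J c u) = (\<Sum>j<d. if j \<in> J then lam j * (c j)\<^sup>2 else 0)"
    unfolding popS_def by (intro sum.cong) auto
  also have "\<dots> = (\<Sum>j\<in>J. lam j * (c j)\<^sup>2)"
    using assms fJ by (subst sum.inter_restrict[symmetric]) (auto intro: sum.cong simp: Int_absorb1)
  finally show ?thesis .
qed

lemma mgf_linear:
  assumes "i \<in> {1..n}"
  shows "(\<integral>\<^sup>+\<omega>. ennreal (exp (s * g i v \<omega>)) \<partial>M) \<le> ennreal (exp (s\<^sup>2 * (\<kappa> * pop v)))"
proof (cases "pop v = 0")
  case True
  then show ?thesis by (simp add: pop_zero_imp_ip_zero emeasure_space_1)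
next
  case False
  then have p: "0 < pop v" using pop_nonneg[of v] by simp
  show ?thesis
    using subgaussian[OF assms p order.refl] mean_zero[OF assms] \<kappa>_pos p
    by (intro subgaussian_mgf g_meas[OF assms]) auto
qed

lemma indep_linear: "I \<subseteq> {1..n} \<Longrightarrow> indep_vars (\<lambda>_. borel) (\<lambda>i \<omega>. c i * g i v \<omega>) I"
  using indep_vars_compose2[OF indep_vars_subset[OF x_indep], of I "\<lambda>i z. c i * ip {..<d} (vec_index z) v" "\<lambda>_. borel"]
  by simp

text \<open>At zero variance the strict inequality makes the event empty. Otherwise the squares have
  sub-exponential scale \<open>\<kappa> * pop v\<close>, which makes the deviation relative to the
  population form.\<close>

lemma quadratic_deviation:
  assumes I: "I \<subseteq> {1..n}" "I \<noteq> {}" and t: "0 < t" "t \<le> real (card I)"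
  shows "prob {\<omega>\<in>space M. 36 * \<kappa> * sqrt (t / card I) * pop v < \<bar>smp I \<omega> v - pop v\<bar>} \<le> 2 * exp (- t)"
proof (cases "pop v = 0")
  case True
  then have "{\<omega>\<in>space M. 36 * \<kappa> * sqrt (t / card I) * pop v < \<bar>smp I \<omega> v - pop v\<bar>} = {}"
    by (simp add: qf_def pop_zero_imp_ip_zero)
  then have "prob {\<omega>\<in>space M. 36 * \<kappa> * sqrt (t / card I) * pop v < \<bar>smp I \<omega> v - pop v\<bar>} = 0"
    by (simp only: measure_empty)
  then show ?thesis by simp
next
  case False
  then have p: "0 < pop v" using pop_nonneg[of v] by simp
  have fin: "finite I" by (rule finite_subset[OF I(1)]) simp
  have ind: "indep_vars (\<lambda>_. borel) (\<lambda>i \<omega>. (g i v \<omega>)\<^sup>2) I"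
    using indep_vars_compose2[OF indep_vars_subset[OF x_indep I(1)], of "\<lambda>i z. (ip {..<d} (vec_index z) v)\<^sup>2" "\<lambda>_. borel"]
    by simp
  have "prob {\<omega>\<in>space M. 36 * (\<kappa> * pop v) * sqrt (t / card I) \<le> \<bar>(\<Sum>i\<in>I. (g i v \<omega>)\<^sup>2) / card I - pop v\<bar>} \<le> 2 * exp (- t)"
    using subgaussian[OF _ p order.refl] second_moment \<kappa>_pos p t I
    by (intro subexponential_deviation[OF fin I(2) ind]) auto
  moreover have "prob {\<omega>\<in>space M. 36 * \<kappa> * sqrt (t / card I) * pop v < \<bar>smp I \<omega> v - pop v\<bar>}
      \<le> prob {\<omega>\<in>space M. 36 * (\<kappa> * pop v) * sqrt (t / card I) \<le> \<bar>(\<Sum>i\<in>I. (g i v \<omega>)\<^sup>2) / card I - pop v\<bar>}"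
  proof (rule finite_measure_mono)
    have [measurable]: "i \<in> I \<Longrightarrow> g i v \<in> borel_measurable M" for i using g_meas I by auto
    show "{\<omega>\<in>space M. 36 * (\<kappa> * pop v) * sqrt (t / card I) \<le> \<bar>(\<Sum>i\<in>I. (g i v \<omega>)\<^sup>2) / card I - pop v\<bar>} \<in> events"
      by measurable
  qed (auto simp: qf_def power2_eq_square mult_ac)
  ultimately show ?thesis by simp
qed

text \<open>For fixed coefficients the sum is sub-Gaussian with proxy \<open>W\<close>. Later the
  coefficients are the noise held fixed, so only the design is random and the sub-Weibull tails do
  not enter.\<close>

lemma linear_deviation:
  assumes I: "I \<subseteq> {1..n}" and "0 < t"
  shows "prob {\<omega>\<in>space M. 2 * sqrt (\<kappa> * pop v * t) * sqrt (\<Sum>i\<in>I. (c i)\<^sup>2) < \<bar>\<Sum>i\<in>I. c i * g i v \<omega>\<bar>} \<le> 2 * exp (- t)"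
proof -
  define W where "W = \<kappa> * pop v * (\<Sum>i\<in>I. (c i)\<^sup>2)"
  have fin: "finite I" by (rule finite_subset[OF I]) simp
  have W0: "0 \<le> W" unfolding W_def using \<kappa>_pos pop_nonneg by (simp add: sum_nonneg)
  have thr: "2 * sqrt (\<kappa> * pop v * t) * sqrt (\<Sum>i\<in>I. (c i)\<^sup>2) = 2 * sqrt (W * t)"
    by (simp add: W_def real_sqrt_mult mult_ac)
  have [measurable]: "i \<in> I \<Longrightarrow> g i v \<in> borel_measurable M" for i using g_meas I by auto
  show ?thesis
  proof (cases "W = 0")
    case True
    then have "pop v = 0 \<or> (\<forall>i\<in>I. c i = 0)"
      using \<kappa>_pos fin by (auto simp: W_def sum_nonneg_eq_0_iff)
    then have "(\<Sum>i\<in>I. c i * g i v \<omega>) = 0" for \<omega>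
      by (auto simp: pop_zero_imp_ip_zero)
    then show ?thesis unfolding thr True by simp
  next
    case False
    then have Wp: "0 < W" using W0 by simp
    \<comment> \<open>Minimises the Chernoff exponent
      \<open>s\<^sup>2 * W - 2 * s * sqrt (W * t)\<close>, which becomes \<open>- t\<close>.\<close>
    define s where "s = sqrt (t / W)"
    have s: "0 < s" using Wp \<open>0 < t\<close> by (simp add: s_def)
    have one: "prob {\<omega>\<in>space M. 2 * sqrt (W * t) \<le> (\<Sum>i\<in>I. (\<epsilon> * c i) * g i v \<omega>)} \<le> exp (- t)"
      if "\<epsilon> = 1 \<or> \<epsilon> = -1" for \<epsilon> :: real
    proof -
      have "(\<integral>\<^sup>+\<omega>. ennreal (exp (\<Sum>i\<in>I. (s * (\<epsilon> * c i)) * g i v \<omega>)) \<partial>M)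
          \<le> ennreal (exp (\<Sum>i\<in>I. (s * (\<epsilon> * c i))\<^sup>2 * (\<kappa> * pop v)))"
        using I by (intro nn_integral_exp_sum_le fin indep_linear mgf_linear) auto
      also have "(\<Sum>i\<in>I. (s * (\<epsilon> * c i))\<^sup>2 * (\<kappa> * pop v)) = s\<^sup>2 * W"
        using that unfolding W_def sum_distrib_left
        by (intro sum.cong refl) (auto simp: power_mult_distrib mult_ac)
      also have "s\<^sup>2 * W = t" using Wp \<open>0 < t\<close> by (simp add: s_def)
      finally have "(\<integral>\<^sup>+\<omega>. ennreal (exp (s * (\<Sum>i\<in>I. (\<epsilon> * c i) * g i v \<omega>))) \<partial>M) \<le> ennreal (exp t)"
        by (simp add: sum_distrib_left mult.assoc)
      then have "prob {\<omega>\<in>space M. 2 * sqrt (W * t) \<le> (\<Sum>i\<in>I. (\<epsilon> * c i) * g i v \<omega>)} \<le> exp (t - s * (2 * sqrt (W * t)))"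
        using s by (intro prob_ge_le_exp_moment) auto
      also have "s * (2 * sqrt (W * t)) = 2 * t"
      proof -
        have "sqrt (t / W) * sqrt (W * t) = sqrt (t\<^sup>2)"
          using Wp by (simp add: real_sqrt_mult[symmetric] power2_eq_square)
        then show ?thesis using \<open>0 < t\<close> by (simp add: s_def)
      qed
      finally show ?thesis by simp
    qed
    have "prob {\<omega>\<in>space M. 2 * sqrt (W * t) < \<bar>\<Sum>i\<in>I. c i * g i v \<omega>\<bar>}
       \<le> prob ({\<omega>\<in>space M. 2 * sqrt (W * t) \<le> (\<Sum>i\<in>I. (1 * c i) * g i v \<omega>)}
         \<union> {\<omega>\<in>space M. 2 * sqrt (W * t) \<le> (\<Sum>i\<in>I. (-1 * c i) * g i v \<omega>)})"
    proof (rule finite_measure_mono)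
      show "{\<omega>\<in>space M. 2 * sqrt (W * t) < \<bar>\<Sum>i\<in>I. c i * g i v \<omega>\<bar>}
       \<subseteq> {\<omega>\<in>space M. 2 * sqrt (W * t) \<le> (\<Sum>i\<in>I. (1 * c i) * g i v \<omega>)}
         \<union> {\<omega>\<in>space M. 2 * sqrt (W * t) \<le> (\<Sum>i\<in>I. (-1 * c i) * g i v \<omega>)}"
      proof
        fix \<omega> assume "\<omega> \<in> {\<omega>\<in>space M. 2 * sqrt (W * t) < \<bar>\<Sum>i\<in>I. c i * g i v \<omega>\<bar>}"
        then have w: "\<omega> \<in> space M" "2 * sqrt (W * t) < \<bar>\<Sum>i\<in>I. c i * g i v \<omega>\<bar>" by auto
        have neg: "(\<Sum>i\<in>I. (-1 * c i) * g i v \<omega>) = - (\<Sum>i\<in>I. c i * g i v \<omega>)" by (simp add: sum_negf)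
        have pos: "(\<Sum>i\<in>I. (1 * c i) * g i v \<omega>) = (\<Sum>i\<in>I. c i * g i v \<omega>)" by simp
        show "\<omega> \<in> {\<omega>\<in>space M. 2 * sqrt (W * t) \<le> (\<Sum>i\<in>I. (1 * c i) * g i v \<omega>)}
         \<union> {\<omega>\<in>space M. 2 * sqrt (W * t) \<le> (\<Sum>i\<in>I. (-1 * c i) * g i v \<omega>)}"
          unfolding Un_iff mem_Collect_eq neg pos using w by linarith
      qed
    qed measurable
    also have "\<dots> \<le> exp (- t) + exp (- t)"
      by (intro order.trans[OF measure_Un_le] add_mono one) measurable
    finally show ?thesis unfolding thr by simp
  qed
qed

text \<open>With weights \<open>lam j / \<tau>\<close> the exponent is a convex combination of the
  exponents of single directions, so Jensen's inequality gives the sum the scale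
  \<open>\<kappa> * \<tau>\<close>, whatever the number of directions.\<close>

lemma trace_deviation:
  assumes I: "I \<subseteq> {1..n}" "I \<noteq> {}" and J: "J \<subseteq> {..<d}" "J \<noteq> {}" and t: "0 < t" "t \<le> real (card I)"
  defines "\<tau> \<equiv> \<Sum>j\<in>J. lam j"
  shows "prob {\<omega>\<in>space M. 36 * (\<kappa> * \<tau>) * sqrt (t / card I) \<le> \<bar>(\<Sum>j\<in>J. smp I \<omega> (u j)) - \<tau>\<bar>} \<le> 2 * exp (- t)"
proof -
  have fin: "finite I" "finite J"
    by (rule finite_subset[OF I(1)], simp, rule finite_subset[OF J(1)], simp)
  have tau: "0 < \<tau>" unfolding \<tau>_def using J fin lam_pos by (intro sum_pos) auto
  have popu: "pop (u j) = lam j" if "j \<in> J" for j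
  proof -
    have "pop (u j) = (\<Sum>i<d. if i = j then lam i else 0)"
      unfolding popS_def using that J
      by (intro sum.cong refl) (auto simp: orthonormal_onD[OF u_orthonormal])
    then show ?thesis using that J by auto
  qed
  let ?Q = "\<lambda>i \<omega>. \<Sum>j\<in>J. (g i (u j) \<omega>)\<^sup>2"
  have gm[measurable]: "i \<in> I \<Longrightarrow> g i v \<in> borel_measurable M" for i v using g_meas I by auto
  have ind: "indep_vars (\<lambda>_. borel) ?Q I"
    using indep_vars_compose2[OF indep_vars_subset[OF x_indep I(1)], of "\<lambda>i z. \<Sum>j\<in>J. (ip {..<d} (vec_index z) (u j))\<^sup>2" "\<lambda>_. borel"]
    by simp
  have psi: "(\<integral>\<^sup>+\<omega>. ennreal (exp (?Q i \<omega> / (\<kappa> * \<tau>))) \<partial>M) \<le> 2" if i: "i \<in> I" for i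
  proof -
    let ?y = "\<lambda>j \<omega>. (g i (u j) \<omega>)\<^sup>2 / (\<kappa> * lam j)"
    have l: "0 < lam j" if "j \<in> J" for j using that J lam_pos by auto
    have wsum: "(\<Sum>j\<in>J. lam j / \<tau>) = 1" using tau by (simp add: sum_divide_distrib[symmetric] \<tau>_def)
    have pt: "exp (?Q i \<omega> / (\<kappa> * \<tau>)) \<le> (\<Sum>j\<in>J. lam j / \<tau> * exp (?y j \<omega>))" for \<omega>
    proof -
      have "?Q i \<omega> / (\<kappa> * \<tau>) = (\<Sum>j\<in>J. (lam j / \<tau>) *\<^sub>R ?y j \<omega>)"
        unfolding sum_divide_distrib
      proof (intro sum.cong refl)
        fix j assume "j \<in> J"
        then have "lam j \<noteq> 0" using l[of j] by simp
        then show "(g i (u j) \<omega>)\<^sup>2 / (\<kappa> * \<tau>) = (lam j / \<tau>) *\<^sub>R ?y j \<omega>" using \<kappa>_pos tau by (simp add: field_simps)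
      qed
      also have "exp \<dots> \<le> (\<Sum>j\<in>J. lam j / \<tau> * exp (?y j \<omega>))"
        using fin J wsum l tau by (intro convex_on_sum[OF _ _ exp_convex]) (auto simp: less_imp_le)
      finally show ?thesis .
    qed
    have "(\<integral>\<^sup>+\<omega>. ennreal (exp (?Q i \<omega> / (\<kappa> * \<tau>))) \<partial>M) \<le> (\<integral>\<^sup>+\<omega>. (\<Sum>j\<in>J. ennreal (lam j / \<tau>) * ennreal (exp (?y j \<omega>))) \<partial>M)"
    proof (rule nn_integral_mono)
      fix \<omega>
      have "ennreal (exp (?Q i \<omega> / (\<kappa> * \<tau>))) \<le> ennreal (\<Sum>j\<in>J. lam j / \<tau> * exp (?y j \<omega>))" by (intro ennreal_leI pt)
      also have "\<dots> = (\<Sum>j\<in>J. ennreal (lam j / \<tau> * exp (?y j \<omega>)))"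
        using l tau by (intro sum_ennreal[symmetric]) (auto simp: less_imp_le)
      also have "\<dots> = (\<Sum>j\<in>J. ennreal (lam j / \<tau>) * ennreal (exp (?y j \<omega>)))"
        using l tau by (intro sum.cong refl ennreal_mult) (auto simp: less_imp_le)
      finally show "ennreal (exp (?Q i \<omega> / (\<kappa> * \<tau>))) \<le> (\<Sum>j\<in>J. ennreal (lam j / \<tau>) * ennreal (exp (?y j \<omega>)))" .
    qed
    also have "\<dots> = (\<Sum>j\<in>J. ennreal (lam j / \<tau>) * (\<integral>\<^sup>+\<omega>. ennreal (exp (?y j \<omega>)) \<partial>M))"
      using i by (subst nn_integral_sum) (auto intro!: sum.cong nn_integral_cmult)
    also have "\<dots> \<le> (\<Sum>j\<in>J. ennreal (lam j / \<tau>) * 2)"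
    proof (intro sum_mono mult_left_mono)
      fix j assume j: "j \<in> J"
      show "(\<integral>\<^sup>+\<omega>. ennreal (exp (?y j \<omega>)) \<partial>M) \<le> 2"
        using i I l[OF j] popu[OF j] by (intro subgaussian) auto
    qed auto
    also have "\<dots> = 2"
    proof -
      have "(\<Sum>j\<in>J. ennreal (lam j / \<tau>)) = ennreal 1"
        unfolding wsum[symmetric] using l tau by (intro sum_ennreal) (auto simp: less_imp_le)
      then show ?thesis by (simp add: sum_distrib_right[symmetric])
    qed
    finally show ?thesis .
  qed
  have mean: "expectation (?Q i) = \<tau>" if i: "i \<in> I" for i
  proof -
    have int: "integrable M (\<lambda>\<omega>. (g i (u j) \<omega>)\<^sup>2)" if j: "j \<in> J" for j
    proof (rule subexponential_moments(1))
      have l: "0 < lam j" "i \<in> {1..n}" using j J i I lam_pos by auto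
      show "(\<integral>\<^sup>+\<omega>. ennreal (exp ((g i (u j) \<omega>)\<^sup>2 / (\<kappa> * lam j))) \<partial>M) \<le> 2"
        using popu[OF j] l by (intro subgaussian) auto
      show "0 < \<kappa> * lam j" using l \<kappa>_pos by simp
      show "(\<lambda>\<omega>. (g i (u j) \<omega>)\<^sup>2) \<in> borel_measurable M" using i by measurable
    qed simp
    have "expectation (?Q i) = (\<Sum>j\<in>J. expectation (\<lambda>\<omega>. (g i (u j) \<omega>)\<^sup>2))"
      using int by (intro Bochner_Integration.integral_sum) auto
    also have "\<dots> = \<tau>" unfolding \<tau>_def using i I by (intro sum.cong refl) (simp add: second_moment subset_iff popu)
    finally show ?thesis .
  qed
  have eq: "(\<Sum>i\<in>I. ?Q i \<omega>) / card I = (\<Sum>j\<in>J. smp I \<omega> (u j))" for \<omega>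
    unfolding qf_def sum_divide_distrib[symmetric] by (subst sum.swap) (simp add: power2_eq_square)
  show ?thesis
    using subexponential_deviation[OF fin(1) I(2) ind _ psi _ mean t] \<kappa>_pos tau
    unfolding eq by (simp add: sum_nonneg)
qed

text \<open>For weights \<open>z\<close> on observations and \<open>w\<close> on directions the
  bilinear sum is a linear statistic along the single vector \<open>lincomb_fun J w u\<close>.
  Independence of the rows and the one-dimensional moment generating function therefore give the
  hypothesis of \<open>tail_operator_bound\<close>.\<close>

lemma tail_event:
  fixes \<theta> :: real
  assumes J: "J \<subseteq> {..<d}" and th: "\<And>j. j \<in> J \<Longrightarrow> lam j \<le> \<theta>" "(\<Sum>j\<in>J. lam j) \<le> n * \<theta>" "0 < \<theta>"
  shows "\<exists>N\<in>events. prob N \<le> exp (- real n) \<and>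
    (\<forall>\<omega>\<in>space M - N. \<forall>c. smp {1..n} \<omega> (lincomb_fun J c u) \<le> 256 * \<kappa> * \<theta> * (\<Sum>j\<in>J. (c j)\<^sup>2))"
proof -
  have fJ: "finite J" by (rule finite_subset[OF J]) simp
  have "\<exists>N\<in>events. prob N \<le> exp (- real (card {1..n})) \<and>
    (\<forall>\<omega>\<in>space M - N. \<forall>c. (\<Sum>i\<in>{1..n}. (\<Sum>j\<in>J. c j * g i (u j) \<omega>)\<^sup>2) / card {1..n} \<le> 256 * \<kappa> * \<theta> * (\<Sum>j\<in>J. (c j)\<^sup>2))"
  proof (rule tail_operator_bound[where lam = lam])
    fix z w
    let ?v = "lincomb_fun J w u"
    have "(\<Sum>j\<in>J. w j * (\<Sum>i\<in>{1..n}. z i * g i (u j) \<omega>)) = (\<Sum>i\<in>{1..n}. z i * g i ?v \<omega>)" for \<omega>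
      unfolding ip_lincomb_right sum_distrib_left by (subst sum.swap) (simp add: mult.left_commute)
    then have "(\<integral>\<^sup>+\<omega>. ennreal (exp (\<Sum>j\<in>J. w j * (\<Sum>i\<in>{1..n}. z i * g i (u j) \<omega>))) \<partial>M)
        = (\<integral>\<^sup>+\<omega>. ennreal (exp (\<Sum>i\<in>{1..n}. z i * g i ?v \<omega>)) \<partial>M)" by simp
    also have "\<dots> \<le> ennreal (exp (\<Sum>i\<in>{1..n}. (z i)\<^sup>2 * (\<kappa> * pop ?v)))"
      by (intro nn_integral_exp_sum_le indep_linear mgf_linear) auto
    also have "(\<Sum>i\<in>{1..n}. (z i)\<^sup>2 * (\<kappa> * pop ?v)) = \<kappa> * (\<Sum>i\<in>{1..n}. (z i)\<^sup>2) * pop ?v"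
      unfolding sum_distrib_right[symmetric] by (simp only: mult_ac)
    also have "\<dots> = (\<Sum>j\<in>J. \<kappa> * (\<Sum>i\<in>{1..n}. (z i)\<^sup>2) * lam j * (w j)\<^sup>2)"
      unfolding pop_lincomb[OF J] sum_distrib_left[of "\<kappa> * _"] by (simp only: mult.assoc)
    finally show "(\<integral>\<^sup>+\<omega>. ennreal (exp (\<Sum>j\<in>J. w j * (\<Sum>i\<in>{1..n}. z i * g i (u j) \<omega>))) \<partial>M)
        \<le> ennreal (exp (\<Sum>j\<in>J. \<kappa> * (\<Sum>i\<in>{1..n}. (z i)\<^sup>2) * lam j * (w j)\<^sup>2))" .
  qed (use n_pos fJ g_meas th J lam_pos \<kappa>_pos in \<open>auto simp: less_imp_le\<close>)
  then show ?thesis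
    unfolding qf_def ip_lincomb_right by (simp add: power2_eq_square)
qed

text \<open>Markov's inequality for the mean of
  \<open>exp ((|e i| / \<sigma>) powr \<alpha>)\<close> replaces a bound on the largest noise
  variable, which would bring in ln n. On the event each square is compared with its exponential
  excess over \<open>Lg\<close>, and the excesses are summed.\<close>

lemma noise_event:
  assumes "0 < \<eta>" "\<eta> < 1"
  defines "Lg \<equiv> ln (2 / \<eta>) + 2 / \<alpha>"
  shows "\<exists>N\<in>events. prob N \<le> \<eta> \<and>
    (\<forall>\<omega>\<in>space M - N. (\<Sum>i=1..n. (e i \<omega>)\<^sup>2) / n \<le> 2 * \<sigma>\<^sup>2 * Lg powr (2 / \<alpha>))"
proof -
  let ?E = "\<lambda>i \<omega>. (\<bar>e i \<omega>\<bar> / \<sigma>) powr \<alpha>"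
  let ?Z = "\<lambda>\<omega>. (\<Sum>i=1..n. exp (?E i \<omega>)) / n"
  have [measurable]: "i \<in> {1..n} \<Longrightarrow> e i \<in> borel_measurable M" for i by (rule e_meas)
  have Em[measurable]: "i \<in> {1..n} \<Longrightarrow> ?E i \<in> borel_measurable M" for i by measurable
  have Zm[measurable]: "?Z \<in> borel_measurable M"
    by (intro borel_measurable_divide borel_measurable_sum borel_measurable_exp[THEN measurable_compose[rotated]] Em) auto
  let ?N = "{\<omega>\<in>space M. 2 / \<eta> \<le> ?Z \<omega>}"
  have int: "integrable M (\<lambda>\<omega>. exp (?E i \<omega>))" "expectation (\<lambda>\<omega>. exp (?E i \<omega>)) \<le> 2" if "i \<in> {1..n}" for i
    using integrable_exp_of_nn_integral_le[of "?E i" 2] noise[OF that] Em[OF that] by auto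
  have "expectation ?Z = (\<Sum>i=1..n. expectation (\<lambda>\<omega>. exp (?E i \<omega>))) / n"
    using int by (simp add: Bochner_Integration.integral_sum)
  also have "\<dots> \<le> (\<Sum>i=1..n. 2) / n" using int by (intro divide_right_mono sum_mono) auto
  also have "\<dots> = 2" using n_pos by simp
  finally have EZ: "expectation ?Z \<le> 2" .
  have Zi: "integrable M ?Z"
    by (intro Bochner_Integration.integrable_divide_zero impI Bochner_Integration.integrable_sum int(1))
  have "prob ?N \<le> expectation ?Z / (2 / \<eta>)"
    using Zi assms by (intro integral_Markov_inequality_measure[where A = "{}"]) (auto intro!: AE_I2 divide_nonneg_nonneg sum_nonneg)
  also have "\<dots> \<le> 2 / (2 / \<eta>)" using EZ assms by (intro divide_right_mono) auto
  finally have pN: "prob ?N \<le> \<eta>" by simp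
  have a: "0 < 2 / \<alpha>" using \<alpha>_pos by simp
  have ln0: "0 < ln (2 / \<eta>)" using assms by simp
  \<comment> \<open>The summand \<open>2 / \<alpha>\<close> makes \<open>Lg\<close> at least the
    exponent of the power, as \<open>powr_le_exp_excess\<close> demands; the summand
    \<open>ln (2 / \<eta>)\<close> makes \<open>exp (- Lg)\<close> cancel the Markov
    threshold.\<close>
  have Lg: "0 < Lg" "2 / \<alpha> \<le> Lg" unfolding Lg_def using add_pos_pos[OF ln0 a] ln0 by linarith+
  have good: "(\<Sum>i=1..n. (e i \<omega>)\<^sup>2) / n \<le> 2 * \<sigma>\<^sup>2 * Lg powr (2 / \<alpha>)" if w: "\<omega> \<in> space M - ?N" for \<omega>
  proof -
    have "\<not> 2 / \<eta> \<le> ?Z \<omega>" using w by blast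
    then have Zl: "?Z \<omega> \<le> 2 / \<eta>" by linarith
    have e2: "(e i \<omega>)\<^sup>2 = \<sigma>\<^sup>2 * ?E i \<omega> powr (2 / \<alpha>)" for i
    proof -
      have "?E i \<omega> powr (2 / \<alpha>) = (\<bar>e i \<omega>\<bar> / \<sigma>) powr 2" using \<alpha>_pos by (simp add: powr_powr)
      also have "\<dots> = (\<bar>e i \<omega>\<bar> / \<sigma>)\<^sup>2" using \<sigma>_pos by (simp add: powr_numeral)
      finally show ?thesis using \<sigma>_pos by (simp add: power_divide)
    qed
    have "(\<Sum>i=1..n. (e i \<omega>)\<^sup>2) \<le> (\<Sum>i=1..n. \<sigma>\<^sup>2 * (Lg powr (2 / \<alpha>) * (1 + exp (?E i \<omega> - Lg))))"
      unfolding e2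
      by (intro sum_mono mult_left_mono powr_le_exp_excess)
        (simp_all only: Lg less_imp_le[OF a] powr_ge_zero zero_le_power2)
    also have "\<dots> = \<sigma>\<^sup>2 * Lg powr (2 / \<alpha>) * (real n + exp (- Lg) * (\<Sum>i=1..n. exp (?E i \<omega>)))"
      by (simp add: sum_distrib_left[symmetric] sum.distrib exp_diff exp_minus field_simps sum_divide_distrib[symmetric])
    finally have "(\<Sum>i=1..n. (e i \<omega>)\<^sup>2) / n
        \<le> \<sigma>\<^sup>2 * Lg powr (2 / \<alpha>) * (n + exp (- Lg) * (\<Sum>i=1..n. exp (?E i \<omega>))) / n"
      by (intro divide_right_mono) auto
    also have "\<dots> = \<sigma>\<^sup>2 * Lg powr (2 / \<alpha>) * (1 + exp (- Lg) * ?Z \<omega>)"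
      using n_pos by (simp add: field_simps)
    also have "\<dots> \<le> \<sigma>\<^sup>2 * Lg powr (2 / \<alpha>) * (1 + 1)"
    proof (intro mult_left_mono add_left_mono)
      have "exp (- Lg) \<le> exp (- ln (2 / \<eta>))" using a by (simp add: Lg_def)
      also have "\<dots> = \<eta> / 2" using assms by (simp add: exp_minus)
      finally have "exp (- Lg) * ?Z \<omega> \<le> \<eta> / 2 * (2 / \<eta>)"
        using Zl assms by (intro mult_mono) (auto intro!: divide_nonneg_nonneg sum_nonneg)
      then show "exp (- Lg) * ?Z \<omega> \<le> 1" using assms by simp
    qed auto
    finally show ?thesis by simp
  qed
  show ?thesis by (intro bexI[of _ ?N] conjI ballI pN good) measurable
qed

text \<open>A Paley-Zygmund argument: the normalised square has mean 1 and second moment at most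
  \<open>4 * \<kappa>\<^sup>2\<close>, so it cannot stay below 1/2 with probability close to
  one.\<close>

lemma small_ball:
  assumes i: "i \<in> {1..n}" and p: "0 < pop v"
  shows "1 / (16 * \<kappa>\<^sup>2) \<le> prob {\<omega>\<in>space M. pop v / 2 \<le> (g i v \<omega>)\<^sup>2}"
proof -
  let ?Q = "\<lambda>\<omega>. (g i v \<omega>)\<^sup>2 / pop v"
  have [measurable]: "g i v \<in> borel_measurable M" by (rule g_meas[OF i])
  have "(\<integral>\<^sup>+\<omega>. ennreal (exp (?Q \<omega> / \<kappa>)) \<partial>M) \<le> 2"
    using subgaussian[OF i p order.refl] by (simp add: mult.commute)
  note mom = subexponential_moments[OF _ _ this \<kappa>_pos]
  have Q1: "integrable M ?Q" and Q2: "integrable M (\<lambda>\<omega>. (?Q \<omega>)\<^sup>2)" "expectation (\<lambda>\<omega>. (?Q \<omega>)\<^sup>2) \<le> 4 * \<kappa>\<^sup>2"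
    using mom(1,6,7) p by auto
  have EQ: "expectation ?Q = 1" using second_moment[OF i, of v] p by simp
  let ?A = "{\<omega>\<in>space M. pop v / 2 \<le> (g i v \<omega>)\<^sup>2}"
  have A: "?A \<in> events" by measurable
  let ?a = "1 / (8 * \<kappa>\<^sup>2)"
  \<comment> \<open>On the event this is Young's inequality, with \<open>?a\<close> chosen so that
    the middle term has mean at most 1/4; off the event \<open>?Q\<close> is below half its mean. A
    quarter is left for the probability.\<close>
  have pt: "?Q \<omega> \<le> 1/2 + ?a / 2 * (?Q \<omega>)\<^sup>2 + 4 * \<kappa>\<^sup>2 * indicator ?A \<omega>" if "\<omega> \<in> space M" for \<omega>
  proof (cases "\<omega> \<in> ?A")
    case True
    have "0 \<le> (?Q \<omega> - 8 * \<kappa>\<^sup>2)\<^sup>2 / (16 * \<kappa>\<^sup>2)" by simp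
    also have "\<dots> = ?a / 2 * (?Q \<omega>)\<^sup>2 - ?Q \<omega> + 4 * \<kappa>\<^sup>2"
      using \<kappa>_pos unfolding power2_diff by (simp add: add_divide_distrib diff_divide_distrib power2_eq_square)
    finally show ?thesis using True by simp
  next
    case False
    then have "(g i v \<omega>)\<^sup>2 < pop v / 2" using that by auto
    then have "?Q \<omega> \<le> 1/2" using p by (simp add: divide_le_eq)
    moreover have "0 \<le> ?a / 2 * (?Q \<omega>)\<^sup>2" by (intro mult_nonneg_nonneg) auto
    moreover have "indicator ?A \<omega> = (0 :: real)" using False by simp
    ultimately show ?thesis by (simp only: mult_zero_right add_0_right add_increasing2)
  qed
  have ind: "integrable M (indicator ?A :: 'w \<Rightarrow> real)"
    using A by (simp add: integrable_indicator_iff emeasure_eq_measure)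
  have iG: "integrable M (\<lambda>\<omega>. 1/2 + ?a / 2 * (?Q \<omega>)\<^sup>2 + 4 * \<kappa>\<^sup>2 * indicator ?A \<omega>)"
    by (intro Bochner_Integration.integrable_add Bochner_Integration.integrable_mult_right Q2(1) ind) simp
  have "1 = expectation ?Q" by (rule EQ[symmetric])
  also have "\<dots> \<le> expectation (\<lambda>\<omega>. 1/2 + ?a / 2 * (?Q \<omega>)\<^sup>2 + 4 * \<kappa>\<^sup>2 * indicator ?A \<omega>)"
    by (rule integral_mono[OF Q1 iG pt])
  also have "\<dots> = 1/2 + ?a / 2 * expectation (\<lambda>\<omega>. (?Q \<omega>)\<^sup>2) + 4 * \<kappa>\<^sup>2 * prob ?A"
  proof -
    have i1: "integrable M (\<lambda>\<omega>. 1/2 + ?a / 2 * (?Q \<omega>)\<^sup>2)" "integrable M (\<lambda>\<omega>. ?a / 2 * (?Q \<omega>)\<^sup>2)"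
      by (intro Bochner_Integration.integrable_add Bochner_Integration.integrable_mult_right Q2(1); simp)+
    have "expectation (\<lambda>\<omega>. 1/2 + ?a / 2 * (?Q \<omega>)\<^sup>2 + 4 * \<kappa>\<^sup>2 * indicator ?A \<omega>)
        = expectation (\<lambda>\<omega>. 1/2 + ?a / 2 * (?Q \<omega>)\<^sup>2) + expectation (\<lambda>\<omega>. 4 * \<kappa>\<^sup>2 * indicator ?A \<omega>)"
      by (intro Bochner_Integration.integral_add i1 Bochner_Integration.integrable_mult_right ind)
    also have "expectation (\<lambda>\<omega>. 1/2 + ?a / 2 * (?Q \<omega>)\<^sup>2) = expectation (\<lambda>\<omega>. 1/2) + expectation (\<lambda>\<omega>. ?a / 2 * (?Q \<omega>)\<^sup>2)"
      by (intro Bochner_Integration.integral_add i1) simp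
    also have "expectation (\<lambda>\<omega>. ?a / 2 * (?Q \<omega>)\<^sup>2) = ?a / 2 * expectation (\<lambda>\<omega>. (?Q \<omega>)\<^sup>2)"
      by (rule integral_mult_right_zero)
    also have "expectation (\<lambda>\<omega>. 4 * \<kappa>\<^sup>2 * indicator ?A \<omega>) = 4 * \<kappa>\<^sup>2 * prob ?A"
      using A by (subst integral_mult_right_zero) (simp add: Int_absorb1)
    finally show ?thesis by (simp add: prob_space)
  qed
  also have "\<dots> \<le> 1/2 + ?a / 2 * (4 * \<kappa>\<^sup>2) + 4 * \<kappa>\<^sup>2 * prob ?A"
    using Q2(2) by (intro add_right_mono add_left_mono mult_left_mono) auto
  finally have *: "1 \<le> 1/2 + ?a / 2 * (4 * \<kappa>\<^sup>2) + 4 * \<kappa>\<^sup>2 * prob ?A" .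
  have "1 / (16 * k) \<le> q" if "0 < k" "1 \<le> 1/2 + 1 / (8 * k) / 2 * (4 * k) + 4 * k * q" for k q :: real
    using that by (simp add: field_simps)
  from this[OF _ *] show ?thesis using \<kappa>_pos by simp
qed

lemma small_ball_all:
  assumes p: "0 < pop v"
  shows "(1 / (16 * \<kappa>\<^sup>2)) ^ n \<le> prob {\<omega>\<in>space M. \<forall>i\<in>{1..n}. pop v / 2 \<le> (g i v \<omega>)\<^sup>2}"
proof -
  let ?Z = "\<lambda>i \<omega>. (g i v \<omega>)\<^sup>2"
  have ind: "indep_vars (\<lambda>_. borel) ?Z {1..n}"
    using indep_vars_compose2[OF x_indep, of "\<lambda>i z. (ip {..<d} (vec_index z) v)\<^sup>2" "\<lambda>_. borel"] by simp
  have "(1 / (16 * \<kappa>\<^sup>2)) ^ n = (\<Prod>i\<in>{1..n}. 1 / (16 * \<kappa>\<^sup>2))" by simp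
  also have "\<dots> \<le> (\<Prod>i\<in>{1..n}. prob {\<omega>\<in>space M. pop v / 2 \<le> ?Z i \<omega>})"
  proof (intro prod_mono conjI)
    fix i assume "i \<in> {1..n}"
    then show "1 / (16 * \<kappa>\<^sup>2) \<le> prob {\<omega>\<in>space M. pop v / 2 \<le> ?Z i \<omega>}" by (rule small_ball[OF _ p])
  qed simp
  also have "\<dots> = (\<Prod>i\<in>{1..n}. prob (?Z i -` {pop v / 2..} \<inter> space M))"
    by (intro prod.cong refl arg_cong[where f = prob]) auto
  also have "\<dots> = prob (\<Inter>i\<in>{1..n}. ?Z i -` {pop v / 2..} \<inter> space M)"
    using n_pos by (intro indep_varsD_finite[OF ind, symmetric]) auto
  also have "(\<Inter>i\<in>{1..n}. ?Z i -` {pop v / 2..} \<inter> space M) = {\<omega>\<in>space M. \<forall>i\<in>{1..n}. pop v / 2 \<le> ?Z i \<omega>}"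
    using n_pos by auto
  finally show ?thesis .
qed

end

section \<open>Deviations on the hold-out blocks and isometry on the head\<close>

text \<open>The estimation error at breakpoint \<open>i\<close> as a function of training design and
  noise; the responses are rebuilt inside, so that the two sources of randomness can be frozen
  separately.\<close>

definition fit_error ::
  "nat \<Rightarrow> (real mat \<Rightarrow> real mat) \<Rightarrow> nat \<Rightarrow> (nat \<Rightarrow> real) \<Rightarrow> nat set
     \<Rightarrow> (nat \<Rightarrow> real Matrix.vec) \<Rightarrow> (nat \<Rightarrow> real) \<Rightarrow> nat \<Rightarrow> nat \<Rightarrow> real" where
  "fit_error d U k b I xx ee i j = (let y = (\<lambda>i. ip {..<d} (vec_index (xx i)) b + ee i) in
     fit_coord d U k I xx y (breakpoint (min k d) (coeff_at d U I xx y) i) j - b j)"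

lemma sample_cov_cong:
  assumes "finite I" "\<And>i. i \<in> I \<Longrightarrow> xx i = xx' i"
  shows "sample_cov d I xx = sample_cov d I xx'"
proof -
  have "map xx (sorted_list_of_set I) = map xx' (sorted_list_of_set I)" using assms by auto
  then show ?thesis unfolding sample_cov_def design_mat_def by (simp only:)
qed

lemma fit_error_cong:
  assumes I: "finite I" and x: "\<And>i. i \<in> I \<Longrightarrow> xx i = xx' i" and e: "\<And>i. i \<in> I \<Longrightarrow> ee i = ee' i"
  shows "fit_error d U k b I xx ee = fit_error d U k b I xx' ee'"
proof -
  let ?y = "\<lambda>i. ip {..<d} (vec_index (xx i)) b + ee i" and ?y' = "\<lambda>i. ip {..<d} (vec_index (xx' i)) b + ee' i"
  have S: "sample_cov d I xx = sample_cov d I xx'" by (rule sample_cov_cong[OF I]) (rule x)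
  have sc: "eig_scale d U I xx a = eig_scale d U I xx' a" for a
    unfolding eig_scale_def qf_def S using x by simp
  have c: "coeff_at d U I xx ?y = coeff_at d U I xx' ?y'"
    unfolding coeff_at_def S sc using x e by (intro ext arg_cong2[where f = "(/)"] sum.cong refl) auto
  have f: "fit_coord d U k I xx ?y t j = fit_coord d U k I xx' ?y' t j" for t j
    unfolding fit_coord_def coeff_at_def[symmetric] by (simp only: c S sc)
  show ?thesis unfolding fit_error_def Let_def c f ..
qed

text \<open>Failure of the deviation bound for the hold-out form, or for its cross term with the
  noise, at one test vector. The second threshold contains the noise energy of the block, which is
  treated as given.\<close>

definition cv_deviates ::
  "nat \<Rightarrow> (nat \<Rightarrow> nat \<Rightarrow> real) \<Rightarrow> (nat \<Rightarrow> real) \<Rightarrow> real \<Rightarrow> real \<Rightarrow> nat set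
    \<Rightarrow> (nat \<Rightarrow> real) \<Rightarrow> (nat \<Rightarrow> real Matrix.vec) \<Rightarrow> (nat \<Rightarrow> real) \<Rightarrow> bool" where
  "cv_deviates d u lam \<kappa> t B v xx ee \<longleftrightarrow>
     36 * \<kappa> * sqrt (t / card B) * popS d u lam v
       < \<bar>qf B {..<d} (\<lambda>i. vec_index (xx i)) v v - popS d u lam v\<bar>
     \<or> 2 * sqrt (\<kappa> * popS d u lam v * t) * sqrt (\<Sum>i\<in>B. (ee i)\<^sup>2)
       < \<bar>\<Sum>i\<in>B. ee i * ip {..<d} (vec_index (xx i)) v\<bar>"

lemma cv_deviates_cong:
  assumes "\<And>i. i \<in> B \<Longrightarrow> xx i = xx' i" "\<And>i. i \<in> B \<Longrightarrow> ee i = ee' i"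
  shows "cv_deviates d u lam \<kappa> t B v xx ee \<longleftrightarrow> cv_deviates d u lam \<kappa> t B v xx' ee'"
  using assms unfolding cv_deviates_def qf_def by simp

lemma measurable_cv_deviates:
  assumes fin: "finite B"
    and X: "\<And>i. i \<in> B \<Longrightarrow> (\<lambda>z. X z i) \<in> N \<rightarrow>\<^sub>M borel_vec d"
    and E: "\<And>i. i \<in> B \<Longrightarrow> (\<lambda>z. E z i) \<in> borel_measurable N"
    and v: "\<And>j. j < d \<Longrightarrow> (\<lambda>z. v z j) \<in> borel_measurable N"
  shows "Measurable.pred N (\<lambda>z. cv_deviates d u lam \<kappa> t B (v z) (X z) (E z))"
proof -
  have ipc[measurable]: "(\<lambda>z. ip {..<d} w (v z)) \<in> borel_measurable N" for w
    unfolding ip_def using v by (intro borel_measurable_sum borel_measurable_times) auto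
  have ipX[measurable]: "(\<lambda>z. ip {..<d} (vec_index (X z i)) (v z)) \<in> borel_measurable N" if i: "i \<in> B" for i
    unfolding ip_def
  proof (intro borel_measurable_sum borel_measurable_times)
    fix j assume j: "j \<in> {..<d}"
    show "(\<lambda>z. X z i $ j) \<in> borel_measurable N"
      using measurable_compose[OF X[OF i] measurable_vec_index] j by auto
    show "(\<lambda>z. v z j) \<in> borel_measurable N" using v j by auto
  qed
  note [measurable] = E
  have [measurable]: "(\<lambda>z. popS d u lam (v z)) \<in> borel_measurable N"
    unfolding popS_def by measurable
  have [measurable]: "(\<lambda>z. qf B {..<d} (\<lambda>i. vec_index (X z i)) (v z) (v z)) \<in> borel_measurable N"
    unfolding qf_def using ipX by (intro borel_measurable_divide borel_measurable_sum borel_measurable_times) auto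
  have [measurable]: "(\<lambda>z. \<Sum>i\<in>B. E z i * ip {..<d} (vec_index (X z i)) (v z)) \<in> borel_measurable N"
    using ipX E by (intro borel_measurable_sum borel_measurable_times) auto
  have [measurable]: "(\<lambda>z. \<Sum>i\<in>B. (E z i)\<^sup>2) \<in> borel_measurable N"
    using E by (intro borel_measurable_sum borel_measurable_power) auto
  show ?thesis unfolding cv_deviates_def by measurable
qed

lemma measurable_fit_error:
  assumes rule: "eigen_rule d U s" and fin: "finite I"
    and X: "\<And>i. i \<in> I \<Longrightarrow> (\<lambda>z. X z i) \<in> N \<rightarrow>\<^sub>M borel_vec d"
    and E: "\<And>i. i \<in> I \<Longrightarrow> (\<lambda>z. E z i) \<in> borel_measurable N" and j: "j < d"
  shows "(\<lambda>z. fit_error d U k b I (X z) (E z) i j) \<in> borel_measurable N"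
proof -
  have Y: "(\<lambda>z. ip {..<d} (vec_index (X z i)) b + E z i) \<in> borel_measurable N" if "i \<in> I" for i
    using measurable_compose[OF X[OF that] measurable_ip_vec] E[OF that] by (intro borel_measurable_add) auto
  show ?thesis
    unfolding fit_error_def Let_def
    by (intro borel_measurable_diff borel_measurable_const measurable_fit_coord[OF rule fin X Y j]
        measurable_breakpoint[OF rule fin X Y])
qed

context random_design
begin

lemma cv_deviates_prob:
  assumes "B \<subseteq> {1..n}" "B \<noteq> {}" "0 < t" "t \<le> real (card B)"
  shows "prob {\<omega>\<in>space M. cv_deviates d u lam \<kappa> t B v (\<lambda>i. x i \<omega>) ee} \<le> 4 * exp (- t)"
proof -
  let ?A = "{\<omega>\<in>space M. 36 * \<kappa> * sqrt (t / card B) * pop v < \<bar>smp B \<omega> v - pop v\<bar>}"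
  let ?A' = "{\<omega>\<in>space M. 2 * sqrt (\<kappa> * pop v * t) * sqrt (\<Sum>i\<in>B. (ee i)\<^sup>2) < \<bar>\<Sum>i\<in>B. ee i * g i v \<omega>\<bar>}"
  have gB: "i \<in> B \<Longrightarrow> g i v \<in> borel_measurable M" for i using g_meas assms(1) by auto
  have gen: "{\<omega>\<in>space M. c < \<bar>f \<omega>\<bar>} \<in> events" if [measurable]: "f \<in> borel_measurable M" for f :: "'w \<Rightarrow> real" and c
    by measurable
  have m: "?A \<in> events" "?A' \<in> events"
  proof (rule_tac [!] gen)
    show "(\<lambda>\<omega>. smp B \<omega> v - pop v) \<in> borel_measurable M"
      unfolding qf_def
      by (intro borel_measurable_diff borel_measurable_divide borel_measurable_sum borel_measurable_times borel_measurable_const gB)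
    show "(\<lambda>\<omega>. \<Sum>i\<in>B. ee i * g i v \<omega>) \<in> borel_measurable M"
      by (intro borel_measurable_sum borel_measurable_times borel_measurable_const gB)
  qed
  have eq: "{\<omega>\<in>space M. cv_deviates d u lam \<kappa> t B v (\<lambda>i. x i \<omega>) ee} = ?A \<union> ?A'"
    unfolding cv_deviates_def by blast
  have "prob {\<omega>\<in>space M. cv_deviates d u lam \<kappa> t B v (\<lambda>i. x i \<omega>) ee} \<le> prob ?A + prob ?A'"
    unfolding eq by (rule measure_Un_le[OF m])
  also have "\<dots> \<le> 2 * exp (- t) + 2 * exp (- t)"
    using assms by (intro add_mono quadratic_deviation linear_deviation) auto
  finally show ?thesis by simp
qed

text \<open>Training design \<open>xi\<close> and hold-out design \<open>xb\<close> are separate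
  arguments, although one family is finally inserted for both: one is frozen while the other is
  integrated.\<close>

definition cv_fails :: "(real mat \<Rightarrow> real mat) \<Rightarrow> nat \<Rightarrow> (nat \<Rightarrow> real) \<Rightarrow> real \<Rightarrow> nat set \<Rightarrow> nat set
    \<Rightarrow> (nat \<Rightarrow> real Matrix.vec) \<Rightarrow> (nat \<Rightarrow> real Matrix.vec) \<Rightarrow> (nat \<Rightarrow> real) \<Rightarrow> bool" where
  "cv_fails U k b t I B xi xb ee \<longleftrightarrow> (\<exists>i\<in>{..min k d}. \<exists>i'\<in>{..min k d}.
     cv_deviates d u lam \<kappa> t B (\<lambda>j. fit_error d U k b I xi ee i j + fit_error d U k b I xi ee i' j) xb ee)"

lemma cv_fails_cong:
  assumes "finite I" "\<And>i. i \<in> I \<Longrightarrow> xi i = xi' i" "\<And>i. i \<in> B \<Longrightarrow> xb i = xb' i"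
    "\<And>i. i \<in> I \<union> B \<Longrightarrow> ee i = ee' i"
  shows "cv_fails U k b t I B xi xb ee \<longleftrightarrow> cv_fails U k b t I B xi' xb' ee'"
proof -
  have f: "fit_error d U k b I xi ee = fit_error d U k b I xi' ee'"
    by (rule fit_error_cong[OF assms(1)]) (use assms(2,4) in auto)
  have c: "cv_deviates d u lam \<kappa> t B v xb ee \<longleftrightarrow> cv_deviates d u lam \<kappa> t B v xb' ee'" for v
    using assms by (intro cv_deviates_cong) auto
  show ?thesis unfolding cv_fails_def f c ..
qed

lemma measurable_cv_fails:
  assumes rule: "eigen_rule d U s" and fin: "finite I" "finite B"
    and XI: "\<And>i. i \<in> I \<Longrightarrow> (\<lambda>z. XI z i) \<in> N \<rightarrow>\<^sub>M borel_vec d"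
    and XB: "\<And>i. i \<in> B \<Longrightarrow> (\<lambda>z. XB z i) \<in> N \<rightarrow>\<^sub>M borel_vec d"
    and E: "\<And>i. i \<in> I \<union> B \<Longrightarrow> (\<lambda>z. E z i) \<in> borel_measurable N"
  shows "Measurable.pred N (\<lambda>z. cv_fails U k b t I B (XI z) (XB z) (E z))"
proof -
  have fe: "(\<lambda>z. fit_error d U k b I (XI z) (E z) i j) \<in> borel_measurable N" if "j < d" for i j
    using E by (intro measurable_fit_error[OF rule fin(1) XI _ that]) auto
  have "Measurable.pred N (\<lambda>z. cv_deviates d u lam \<kappa> t B
      (\<lambda>j. fit_error d U k b I (XI z) (E z) i j + fit_error d U k b I (XI z) (E z) i' j) (XB z) (E z))" for i i'
    using E by (intro measurable_cv_deviates[OF fin(2) XB] borel_measurable_add fe) auto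
  then show ?thesis unfolding cv_fails_def by (intro pred_intros_finite) auto
qed

text \<open>
  The hold-out block is independent of the training design and of the noise, so after freezing
  those two the vectors to be tested are deterministic.
\<close>

lemma fold_event:
  assumes rule: "eigen_rule d U s" and I: "I \<subseteq> {1..n}" and B: "B \<subseteq> {1..n}" "B \<noteq> {}" and IB: "I \<inter> B = {}"
    and t: "0 < t" "t \<le> real (card B)"
  shows "\<exists>N\<in>events. prob N \<le> (real (min k d) + 1)\<^sup>2 * (4 * exp (- t)) \<and>
    (\<forall>\<omega>\<in>space M - N. \<not> cv_fails U k b t I B (\<lambda>i. x i \<omega>) (\<lambda>i. x i \<omega>) (\<lambda>i. e i \<omega>))"
proof -
  let ?p = "(real (min k d) + 1)\<^sup>2 * (4 * exp (- t))"
  have fin: "finite I" "finite B" by (rule finite_subset[OF I], simp, rule finite_subset[OF B(1)], simp)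
  have xm: "i \<in> {1..n} \<Longrightarrow> x i \<in> M \<rightarrow>\<^sub>M borel_vec d" for i by (rule x_meas)
  \<comment> \<open>Only the hold-out design is random here, so the test vectors are constants and a
    union over the ordered pairs of breakpoints suffices.\<close>
  have frozen: "prob {\<omega>\<in>space M. cv_fails U k b t I B xi (\<lambda>i. x i \<omega>) ee} \<le> ?p" for xi ee
  proof -
    let ?v = "\<lambda>i i' j. fit_error d U k b I xi ee i j + fit_error d U k b I xi ee i' j"
    let ?A = "\<lambda>i i'. {\<omega>\<in>space M. cv_deviates d u lam \<kappa> t B (?v i i') (\<lambda>i. x i \<omega>) ee}"
    have mA: "?A i i' \<in> events" for i i'
    proof -
      have "Measurable.pred M (\<lambda>\<omega>. cv_deviates d u lam \<kappa> t B (?v i i') (\<lambda>i. x i \<omega>) ee)"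
        using B xm by (intro measurable_cv_deviates[OF fin(2)]) auto
      then show ?thesis unfolding pred_def .
    qed
    have eq: "{\<omega>\<in>space M. cv_fails U k b t I B xi (\<lambda>i. x i \<omega>) ee} = (\<Union>q\<in>{..min k d} \<times> {..min k d}. ?A (fst q) (snd q))"
      unfolding cv_fails_def by force
    have "prob {\<omega>\<in>space M. cv_fails U k b t I B xi (\<lambda>i. x i \<omega>) ee} \<le> (\<Sum>q\<in>{..min k d} \<times> {..min k d}. prob (?A (fst q) (snd q)))"
      unfolding eq using mA by (intro finite_measure_subadditive_finite) auto
    also have "\<dots> \<le> (\<Sum>q\<in>{..min k d} \<times> {..min k d}. 4 * exp (- t))"
      using B t by (intro sum_mono cv_deviates_prob) auto
    also have "\<dots> = ?p" by (simp add: card_cartesian_product power2_eq_square algebra_simps)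
    finally show ?thesis .
  qed
  \<comment> \<open>The training design is integrated with the noise still fixed; rows with indices
    in \<open>I\<close> and in \<open>B\<close> are independent.\<close>
  have noise_frozen: "prob {\<omega>\<in>space M. cv_fails U k b t I B (\<lambda>i. x i \<omega>) (\<lambda>i. x i \<omega>) ee} \<le> ?p" for ee
  proof -
    let ?N1 = "PiM I (\<lambda>_. borel_vec d)" and ?N2 = "PiM B (\<lambda>_. borel_vec d)"
    let ?X = "\<lambda>\<omega>. \<lambda>i\<in>I. x i \<omega>" and ?Y = "\<lambda>\<omega>. \<lambda>i\<in>B. x i \<omega>"
    let ?Bad = "{z\<in>space (?N1 \<Otimes>\<^sub>M ?N2). cv_fails U k b t I B (fst z) (snd z) ee}"
    have ind: "indep_var ?N1 ?X ?N2 ?Y" by (rule indep_var_restrict[OF x_indep IB I B(1)])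
    have "Measurable.pred (?N1 \<Otimes>\<^sub>M ?N2) (\<lambda>z. cv_fails U k b t I B (fst z) (snd z) ee)"
      by (intro measurable_cv_fails[OF rule fin])
        (auto intro!: measurable_compose[OF measurable_fst measurable_component_singleton]
          measurable_compose[OF measurable_snd measurable_component_singleton])
    then have Bm: "?Bad \<in> sets (?N1 \<Otimes>\<^sub>M ?N2)" unfolding pred_def .
    have mX: "?X \<in> M \<rightarrow>\<^sub>M ?N1" and mY: "?Y \<in> M \<rightarrow>\<^sub>M ?N2"
      using ind by (auto dest: indep_var_rv1 indep_var_rv2)
    have pB: "prob {\<omega>\<in>space M. (?X \<omega>, ?Y \<omega>) \<in> ?Bad} \<le> ?p"
    proof (rule prob_le_by_indep_sections[OF mX mY _ Bm])
      show "prob ((\<lambda>\<omega>. (?X \<omega>, ?Y \<omega>)) -` (A \<times> A') \<inter> space M) = prob (?X -` A \<inter> space M) * prob (?Y -` A' \<inter> space M)"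
        if "A \<in> sets ?N1" "A' \<in> sets ?N2" for A A'
        by (rule indep_varD[OF ind that])
      fix a assume a: "a \<in> space ?N1"
      have mem: "(a, ?Y \<omega>) \<in> space (?N1 \<Otimes>\<^sub>M ?N2)" if "\<omega> \<in> space M" for \<omega>
        unfolding space_pair_measure using a measurable_space[OF mY that] by (rule SigmaI)
      have c: "cv_fails U k b t I B a (?Y \<omega>) ee \<longleftrightarrow> cv_fails U k b t I B a (\<lambda>i. x i \<omega>) ee" for \<omega>
        by (intro cv_fails_cong[OF fin(1)]) auto
      have "{\<omega>\<in>space M. (a, ?Y \<omega>) \<in> ?Bad} = {\<omega>\<in>space M. cv_fails U k b t I B a (\<lambda>i. x i \<omega>) ee}"
        by (intro Collect_cong conj_cong refl) (simp only: mem_Collect_eq mem fst_conv snd_conv c simp_thms)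
      then show "prob {\<omega>\<in>space M. (a, ?Y \<omega>) \<in> ?Bad} \<le> ?p" using frozen by simp
    qed simp
    have eq: "{\<omega>\<in>space M. (?X \<omega>, ?Y \<omega>) \<in> ?Bad} = {\<omega>\<in>space M. cv_fails U k b t I B (\<lambda>i. x i \<omega>) (\<lambda>i. x i \<omega>) ee}"
    proof -
      have mem: "(?X \<omega>, ?Y \<omega>) \<in> space (?N1 \<Otimes>\<^sub>M ?N2)" if "\<omega> \<in> space M" for \<omega>
        unfolding space_pair_measure using measurable_space[OF mX that] measurable_space[OF mY that] by (rule SigmaI)
      have c: "cv_fails U k b t I B (?X \<omega>) (?Y \<omega>) ee \<longleftrightarrow> cv_fails U k b t I B (\<lambda>i. x i \<omega>) (\<lambda>i. x i \<omega>) ee" for \<omega>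
        by (intro cv_fails_cong[OF fin(1)]) auto
      show ?thesis
        by (intro Collect_cong conj_cong refl) (simp only: mem_Collect_eq mem fst_conv snd_conv c simp_thms)
    qed
    show ?thesis using pB unfolding eq .
  qed
  let ?N1 = "PiM {1..n} (\<lambda>_. borel :: real measure)" and ?N2 = "PiM {1..n} (\<lambda>_. borel_vec d)"
  let ?X = "\<lambda>\<omega>. \<lambda>i\<in>{1..n}. e i \<omega>" and ?Y = "\<lambda>\<omega>. \<lambda>i\<in>{1..n}. x i \<omega>"
  let ?Bad = "{z\<in>space (?N1 \<Otimes>\<^sub>M ?N2). cv_fails U k b t I B (snd z) (snd z) (fst z)}"
  let ?N = "{\<omega>\<in>space M. cv_fails U k b t I B (\<lambda>i. x i \<omega>) (\<lambda>i. x i \<omega>) (\<lambda>i. e i \<omega>)}"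
  have IBn: "i \<in> I \<Longrightarrow> i \<in> {1..n}" "i \<in> B \<Longrightarrow> i \<in> {1..n}" for i using I B by auto
  have "Measurable.pred (?N1 \<Otimes>\<^sub>M ?N2) (\<lambda>z. cv_fails U k b t I B (snd z) (snd z) (fst z))"
    using IBn by (intro measurable_cv_fails[OF rule fin])
      (auto intro!: measurable_compose[OF measurable_fst measurable_component_singleton]
        measurable_compose[OF measurable_snd measurable_component_singleton])
  then have Bm: "?Bad \<in> sets (?N1 \<Otimes>\<^sub>M ?N2)" unfolding pred_def .
  have mX: "?X \<in> M \<rightarrow>\<^sub>M ?N1" by (intro measurable_restrict e_meas)
  have mY: "?Y \<in> M \<rightarrow>\<^sub>M ?N2" by (intro measurable_restrict x_meas)
  have cong: "cv_fails U k b t I B (?Y \<omega>) (?Y \<omega>) ee \<longleftrightarrow> cv_fails U k b t I B (\<lambda>i. x i \<omega>) (\<lambda>i. x i \<omega>) ee" for \<omega> ee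
    using IBn by (intro cv_fails_cong[OF fin(1)]) auto
  have cong': "cv_fails U k b t I B xx xx (?X \<omega>) \<longleftrightarrow> cv_fails U k b t I B xx xx (\<lambda>i. e i \<omega>)" for \<omega> xx
    using IBn by (intro cv_fails_cong[OF fin(1)]) auto
  \<comment> \<open>Last, the noise is integrated, by its independence of the whole design.\<close>
  have pB: "prob {\<omega>\<in>space M. (?X \<omega>, ?Y \<omega>) \<in> ?Bad} \<le> ?p"
  proof (rule prob_le_by_indep_sections[OF mX mY e_x_indep Bm])
    fix a assume a: "a \<in> space ?N1"
    have mem: "(a, ?Y \<omega>) \<in> space (?N1 \<Otimes>\<^sub>M ?N2)" if "\<omega> \<in> space M" for \<omega>
      unfolding space_pair_measure using a measurable_space[OF mY that] by (rule SigmaI)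
    have "{\<omega>\<in>space M. (a, ?Y \<omega>) \<in> ?Bad} = {\<omega>\<in>space M. cv_fails U k b t I B (\<lambda>i. x i \<omega>) (\<lambda>i. x i \<omega>) a}"
      by (intro Collect_cong conj_cong refl) (simp only: mem_Collect_eq mem fst_conv snd_conv cong simp_thms)
    then show "prob {\<omega>\<in>space M. (a, ?Y \<omega>) \<in> ?Bad} \<le> ?p" using noise_frozen by simp
  qed simp_all
  have eq: "{\<omega>\<in>space M. (?X \<omega>, ?Y \<omega>) \<in> ?Bad} = ?N"
  proof -
    have mem: "(?X \<omega>, ?Y \<omega>) \<in> space (?N1 \<Otimes>\<^sub>M ?N2)" if "\<omega> \<in> space M" for \<omega>
      unfolding space_pair_measure using measurable_space[OF mX that] measurable_space[OF mY that] by (rule SigmaI)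
    show ?thesis
      by (intro Collect_cong conj_cong refl) (simp only: mem_Collect_eq mem fst_conv snd_conv cong cong' simp_thms)
  qed
  have pN: "prob ?N \<le> ?p" using pB unfolding eq .
  have "Measurable.pred M (\<lambda>\<omega>. cv_fails U k b t I B (\<lambda>i. x i \<omega>) (\<lambda>i. x i \<omega>) (\<lambda>i. e i \<omega>))"
  proof (rule measurable_cv_fails[OF rule fin])
    show "i \<in> I \<Longrightarrow> x i \<in> M \<rightarrow>\<^sub>M borel_vec d" "i \<in> B \<Longrightarrow> x i \<in> M \<rightarrow>\<^sub>M borel_vec d" for i
      by (intro xm IBn; assumption)+
    show "e i \<in> borel_measurable M" if "i \<in> I \<union> B" for i
      using that I B by (intro e_meas) auto
  qed
  then have "?N \<in> events" unfolding pred_def .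
  with pN show ?thesis by (intro bexI[of _ ?N]) auto
qed

text \<open>Polarisation: tests at sums of pairs of whitened eigenvectors control every entry of the
  whitened Gram matrix up to \<open>3 * \<rho>\<close>, and Cauchy-Schwarz passes from the entries
  to the form at the cost of the factor \<open>p\<close>.\<close>

lemma head_isometry:
  assumes p: "p \<le> d" and "0 \<le> \<rho>"
    and dev: "\<And>j j'. j < p \<Longrightarrow> j' < p \<Longrightarrow> \<bar>smp I \<omega> (\<lambda>i. u j i / sqrt (lam j) + u j' i / sqrt (lam j'))
        - pop (\<lambda>i. u j i / sqrt (lam j) + u j' i / sqrt (lam j'))\<bar>
      \<le> \<rho> * pop (\<lambda>i. u j i / sqrt (lam j) + u j' i / sqrt (lam j'))"
  shows "\<bar>smp I \<omega> (lincomb_fun {..<p} c u) - (\<Sum>j<p. lam j * (c j)\<^sup>2)\<bar> \<le> 3 * \<rho> * p * (\<Sum>j<p. lam j * (c j)\<^sup>2)"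
proof -
  let ?q = "qf I {..<d} (\<lambda>i. vec_index (x i \<omega>))"
  let ?a = "\<lambda>j i. u j i / sqrt (lam j)"
  have l: "0 < lam j" if "j < p" for j using that p lam_pos by simp
  have ua: "u j = (\<lambda>i. sqrt (lam j) * ?a j i)" if "j < p" for j using l[OF that] by auto
  have ipu: "ip {..<d} (u i) (?a j) = (if i = j then 1 / sqrt (lam j) else 0)" if "i < d" "j < p" for i j
  proof -
    have "ip {..<d} (u i) (?a j) = 1 / sqrt (lam j) * ip {..<d} (u i) (u j)"
      using ip_scale_right[of "{..<d}" "u i" "1 / sqrt (lam j)" "u j"] by simp
    then show ?thesis using orthonormal_onD[OF u_orthonormal, of i j] that p by simp
  qed
  have pop1: "pop (?a j) = 1" if j: "j < p" for j
  proof -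
    have "pop (?a j) = (\<Sum>i<d. if i = j then 1 else 0)"
      unfolding popS_def using l[OF j] by (intro sum.cong refl) (simp add: ipu[OF _ j] power_divide)
    then show ?thesis using j p by simp
  qed
  have pop2: "pop (\<lambda>i. ?a j i + ?a j' i) = 2" if j: "j < p" "j' < p" "j \<noteq> j'" for j j'
  proof -
    have "pop (\<lambda>i. ?a j i + ?a j' i) = (\<Sum>i<d. (if i = j then 1 else 0) + (if i = j' then 1 else 0))"
      unfolding popS_def ip_add_right using l[OF j(1)] l[OF j(2)] j(3)
      by (intro sum.cong refl) (auto simp: ipu[OF _ j(1)] ipu[OF _ j(2)] power_divide)
    then show ?thesis using j p by (simp add: sum.distrib)
  qed
  \<comment> \<open>The pair with \<open>j = j'\<close> tests twice the vector, so both forms carry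
    a factor 4.\<close>
  have diag: "\<bar>?q (?a j) (?a j) - 1\<bar> \<le> \<rho>" if j: "j < p" for j
  proof -
    have "\<bar>4 * ?q (?a j) (?a j) - 4 * 1\<bar> \<le> \<rho> * (4 * 1)"
      using dev[OF j j] unfolding qf_eq_wsq popS_eq_wsq wsq_double pop1[OF j, unfolded popS_eq_wsq] .
    then have "4 * \<bar>?q (?a j) (?a j) - 1\<bar> \<le> \<rho> * (4 * 1)"
      by (simp only: right_diff_distrib[symmetric] abs_mult abs_numeral)
    then show ?thesis by simp
  qed
  have entry: "\<bar>?q (?a j) (?a j') - (if j = j' then 1 else 0)\<bar> \<le> 3 * \<rho>" if j: "j < p" "j' < p" for j j'
  proof (cases "j = j'")
    case True
    then show ?thesis using diag[OF j(1)] \<open>0 \<le> \<rho>\<close> by simp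
  next
    case False
    have ex: "smp I \<omega> (\<lambda>i. ?a j i + ?a j' i) = ?q (?a j) (?a j) + 2 * ?q (?a j) (?a j') + ?q (?a j') (?a j')"
      unfolding qf_add_left qf_add_right by (simp add: qf_commute[of I "{..<d}" _ "?a j'" "?a j"])
    \<comment> \<open>The sum of two distinct whitened directions has population form 2, so the
      cross entry is off by at most half of \<open>(2 + 1 + 1) * \<rho>\<close>.\<close>
    have gen: "\<bar>b\<bar> \<le> 3 * \<rho>" if "\<bar>(A + 2 * b + C) - 2\<bar> \<le> \<rho> * 2" "\<bar>A - 1\<bar> \<le> \<rho>" "\<bar>C - 1\<bar> \<le> \<rho>" for A b C :: real
      using that \<open>0 \<le> \<rho>\<close> by linarith
    have "\<bar>?q (?a j) (?a j')\<bar> \<le> 3 * \<rho>"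
      by (rule gen[OF _ diag[OF j(1)] diag[OF j(2)]]) (use dev[OF j] in \<open>simp only: pop2[OF j False] ex\<close>)
    then show ?thesis using False by simp
  qed
  define \<gamma> where "\<gamma> j = sqrt (lam j) * c j" for j
  have wa: "lincomb_fun {..<p} c u = lincomb_fun {..<p} \<gamma> ?a"
    unfolding lincomb_fun_def using l by (intro ext sum.cong refl) (auto simp: \<gamma>_def less_imp_neq[symmetric])
  have g2: "(\<Sum>j<p. (\<gamma> j)\<^sup>2) = (\<Sum>j<p. lam j * (c j)\<^sup>2)"
    using l by (intro sum.cong refl) (simp add: \<gamma>_def power_mult_distrib less_imp_le)
  have "smp I \<omega> (lincomb_fun {..<p} c u) - (\<Sum>j<p. (\<gamma> j)\<^sup>2)
      = (\<Sum>j<p. \<Sum>j'<p. \<gamma> j * \<gamma> j' * (?q (?a j) (?a j') - (if j = j' then 1 else 0)))"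
  proof -
    have "(\<Sum>j<p. \<Sum>j'<p. \<gamma> j * \<gamma> j' * (if j = j' then 1 else 0)) = (\<Sum>j<p. \<Sum>j'<p. if j' = j then \<gamma> j * \<gamma> j else 0)"
      by (intro sum.cong refl) auto
    also have "\<dots> = (\<Sum>j<p. (\<gamma> j)\<^sup>2)" by (simp add: power2_eq_square)
    finally have 1: "(\<Sum>j<p. \<Sum>j'<p. \<gamma> j * \<gamma> j' * (if j = j' then 1 else 0)) = (\<Sum>j<p. (\<gamma> j)\<^sup>2)" .
    have 2: "smp I \<omega> (lincomb_fun {..<p} c u) = (\<Sum>j<p. \<Sum>j'<p. \<gamma> j * \<gamma> j' * ?q (?a j) (?a j'))"
      unfolding wa qf_lincomb_left qf_lincomb_right sum_distrib_left mult.assoc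
      by (intro sum.cong refl arg_cong2[where f = "(*)"] qf_commute)
    show ?thesis unfolding 1[symmetric] 2 right_diff_distrib sum_subtractf ..
  qed
  also have "\<bar>\<dots>\<bar> \<le> (\<Sum>j<p. \<Sum>j'<p. \<bar>\<gamma> j\<bar> * \<bar>\<gamma> j'\<bar> * (3 * \<rho>))"
  proof (intro order.trans[OF sum_abs] sum_mono)
    fix j j' assume "j \<in> {..<p}" "j' \<in> {..<p}"
    then show "\<bar>\<gamma> j * \<gamma> j' * (?q (?a j) (?a j') - (if j = j' then 1 else 0))\<bar> \<le> \<bar>\<gamma> j\<bar> * \<bar>\<gamma> j'\<bar> * (3 * \<rho>)"
      unfolding abs_mult using entry by (intro mult_left_mono) auto
  qed
  also have "(\<Sum>j<p. \<Sum>j'<p. \<bar>\<gamma> j\<bar> * \<bar>\<gamma> j'\<bar> * (3 * \<rho>)) = 3 * \<rho> * (\<Sum>j<p. \<bar>\<gamma> j\<bar> * 1)\<^sup>2"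
    by (simp add: power2_eq_square sum_product sum_distrib_right[symmetric])
  also have "\<dots> \<le> 3 * \<rho> * ((\<Sum>j<p. \<bar>\<gamma> j\<bar>\<^sup>2) * (\<Sum>j<p. 1\<^sup>2))"
    using \<open>0 \<le> \<rho>\<close> by (intro mult_left_mono Cauchy_Schwarz_ineq_sum) auto
  finally show ?thesis unfolding g2[symmetric] by (simp add: mult_ac)
qed

end

section \<open>The event on which all training sets satisfy the spectral comparison\<close>

context random_design
begin

text \<open>The second moment along an eigenvector equals its population form and is at most
  \<kappa> times that form.\<close>

lemma one_le_kappa: "1 \<le> \<kappa>"
proof -
  have i: "1 \<in> {1..n}" using n_pos by simp
  have "pop (u 0) = (\<Sum>j<d. if j = 0 then lam j else 0)"
    unfolding popS_def using d_pos by (intro sum.cong refl) (simp add: orthonormal_onD[OF u_orthonormal])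
  then have p: "0 < pop (u 0)" using d_pos lam_pos[of 0] by simp
  have k: "0 < \<kappa> * pop (u 0)" using \<kappa>_pos p by simp
  have "expectation (\<lambda>\<omega>. (g 1 (u 0) \<omega>)\<^sup>2) \<le> \<kappa> * pop (u 0)"
    using g_meas[OF i] by (intro subexponential_moments(5)[OF _ _ subgaussian[OF i p order.refl] k]) auto
  then have "1 * pop (u 0) \<le> \<kappa> * pop (u 0)" using second_moment[OF i] by simp
  then show ?thesis using p by (simp only: mult_le_cancel_right_pos)
qed

text \<open>Head tests and trace are repeated for each fold; the tail operator bound is proved once
  for the full sample and inherited by training sets that hold a quarter of it, which gives
  \<open>1024 = 4 * 256\<close>. The number 216 is \<open>2 * 3 * 36\<close>: isometry within 1/2,
  entrywise loss 3, deviation constant 36.\<close>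

lemma design_event:
  fixes I :: "nat \<Rightarrow> nat set" and L k p :: nat and t \<rho> :: real
  assumes I: "\<And>l. l \<in> {1..L} \<Longrightarrow> I l \<subseteq> {1..n}" "\<And>l. l \<in> {1..L} \<Longrightarrow> n \<le> 4 * card (I l)"
    and k: "0 < k" and p: "p = min (8 * k) d"
    and t: "0 < t" "\<And>l. l \<in> {1..L} \<Longrightarrow> t \<le> real (card (I l))"
    and small: "\<And>l. l \<in> {1..L} \<Longrightarrow> 216 * \<kappa> * p * sqrt (t / card (I l)) \<le> 1"
    and kn: "16 * (1024 * \<kappa>) * k \<le> n"
  shows "\<exists>N\<in>events. prob N \<le> L * ((real p)\<^sup>2 + 1) * (2 * exp (- t)) + exp (- real n) \<and>
    (\<forall>\<omega>\<in>space M - N. \<forall>l\<in>{1..L}. \<forall>R w mu.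
      sample_spectrum {..<d} (I l) (\<lambda>i. vec_index (x i \<omega>)) R w mu \<longrightarrow>
      spectral_comparison d (I l) (\<lambda>i. vec_index (x i \<omega>)) R w mu u lam n k p (1024 * \<kappa>))"
proof -
  have p0: "0 < p" "p \<le> d" using p k d_pos by auto
  have Ine: "I l \<noteq> {}" "finite (I l)" if "l \<in> {1..L}" for l
    using I(2)[OF that] n_pos finite_subset[OF I(1)[OF that]] by auto
  let ?r = "\<lambda>l. 36 * \<kappa> * sqrt (t / card (I l))"
  have r0: "0 \<le> ?r l" for l using \<kappa>_pos t(1) by simp
  let ?v = "\<lambda>q i. u (fst q) i / sqrt (lam (fst q)) + u (snd q) i / sqrt (lam (snd q))"
  let ?P = "{..<p} \<times> {..<p}"
  define A where "A l q = {\<omega>\<in>space M. ?r l * pop (?v q) < \<bar>smp (I l) \<omega> (?v q) - pop (?v q)\<bar>}" for l q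
  let ?\<tau> = "\<Sum>j=p..<d. lam j"
  define T where "T l = {\<omega>\<in>space M. 36 * (\<kappa> * ?\<tau>) * sqrt (t / card (I l)) \<le> \<bar>(\<Sum>j=p..<d. smp (I l) \<omega> (u j)) - ?\<tau>\<bar>}" for l
  let ?th = "lam p + ?\<tau> / n"
  have smpm: "(\<lambda>\<omega>. smp J \<omega> v) \<in> borel_measurable M" if "J \<subseteq> {1..n}" for J v
    unfolding qf_def
    by (intro borel_measurable_divide borel_measurable_sum borel_measurable_times borel_measurable_const g_meas;
      erule subsetD[OF that])
  have lt: "{\<omega>\<in>space M. c < \<bar>f \<omega> - c'\<bar>} \<in> events"
    if [measurable]: "f \<in> borel_measurable M" for f :: "'w \<Rightarrow> real" and c c'
    by measurable
  have le: "{\<omega>\<in>space M. c \<le> \<bar>f \<omega> - c'\<bar>} \<in> events"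
    if [measurable]: "f \<in> borel_measurable M" for f :: "'w \<Rightarrow> real" and c c'
    by measurable
  have mA: "A l q \<in> events" if "l \<in> {1..L}" for l q
    unfolding A_def by (rule lt[OF smpm[OF I(1)[OF that]]])
  have mT: "T l \<in> events" if "l \<in> {1..L}" for l
    unfolding T_def by (rule le[OF borel_measurable_sum[OF smpm[OF I(1)[OF that]]]])
  define TE where "TE l = (if p < d then T l else {})" for l
  have mTE: "TE l \<in> events" if "l \<in> {1..L}" for l using mT[OF that] by (simp add: TE_def)
  have pTE: "prob (TE l) \<le> 2 * exp (- t)" if l: "l \<in> {1..L}" for l
  proof (cases "p < d")
    case True
    then have "prob (T l) \<le> 2 * exp (- t)"
      using I(1)[OF l] Ine[OF l] t(1) t(2)[OF l] unfolding T_def by (intro trace_deviation) auto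
    then show ?thesis using True by (simp add: TE_def)
  qed (simp add: TE_def)
  \<comment> \<open>For \<open>p = d\<close> there is no tail and the empty event serves.\<close>
  obtain N0 where N0: "N0 \<in> events" "prob N0 \<le> exp (- real n)"
    "p < d \<Longrightarrow> \<omega> \<in> space M - N0 \<Longrightarrow>
      smp {1..n} \<omega> (lincomb_fun {p..<d} c u) \<le> 256 * \<kappa> * ?th * (\<Sum>j=p..<d. (c j)\<^sup>2)" for \<omega> c
  proof (cases "p < d")
    case True
    have lp: "0 < lam p" using lam_pos True by simp
    have tau0: "0 \<le> ?\<tau>" using lam_pos by (intro sum_nonneg) (auto simp: less_imp_le)
    have h: "lam j \<le> ?th" if "j \<in> {p..<d}" for j
    proof -
      have "lam j \<le> lam p" using that by (intro lam_antimono) auto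
      then show ?thesis using tau0 by (simp add: add_increasing2)
    qed
    have h': "?\<tau> \<le> n * ?th"
    proof -
      have "t \<le> N * (l + t / N)" if "0 < N" "0 < l" for t N l :: real
      proof -
        have "N * (l + t / N) = N * l + t" using that by (simp add: distrib_left)
        moreover have "0 < N * l" using that by simp
        ultimately show ?thesis by linarith
      qed
      then show ?thesis using n_pos lp by simp
    qed
    have h'': "0 < ?th" using lp tau0 by (simp add: add_pos_nonneg)
    have sub: "{p..<d} \<subseteq> {..<d}" by auto
    obtain N where N: "N \<in> events" "prob N \<le> exp (- real n)"
      "\<forall>\<omega>\<in>space M - N. \<forall>c. smp {1..n} \<omega> (lincomb_fun {p..<d} c u) \<le> 256 * \<kappa> * ?th * (\<Sum>j=p..<d. (c j)\<^sup>2)"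
      using tail_event[OF sub h h' h''] by blast
    show ?thesis by (rule that[OF N(1,2)]) (use N(3) in blast)
  next
    case False
    then show ?thesis using that[of "{}"] by simp
  qed
  define NL where "NL l = (\<Union>q\<in>?P. A l q) \<union> TE l" for l
  let ?N = "(\<Union>l\<in>{1..L}. NL l) \<union> N0"
  have mNL: "NL l \<in> events" if "l \<in> {1..L}" for l
    unfolding NL_def using mA[OF that] mTE[OF that] by (intro sets.Un sets.finite_UN) auto
  have pNL: "prob (NL l) \<le> ((real p)\<^sup>2 + 1) * (2 * exp (- t))" if l: "l \<in> {1..L}" for l
  proof -
    have "prob (NL l) \<le> prob (\<Union>q\<in>?P. A l q) + prob (TE l)"
      unfolding NL_def using mA[OF l] mTE[OF l] by (intro measure_Un_le sets.finite_UN) auto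
    also have "prob (\<Union>q\<in>?P. A l q) \<le> (\<Sum>q\<in>?P. prob (A l q))"
      using mA[OF l] by (intro finite_measure_subadditive_finite) auto
    also have "\<dots> \<le> (\<Sum>q\<in>?P. 2 * exp (- t))"
      using I(1)[OF l] Ine[OF l] t(1) t(2)[OF l] unfolding A_def by (intro sum_mono quadratic_deviation) auto
    finally have "prob (NL l) \<le> (\<Sum>q\<in>?P. 2 * exp (- t)) + 2 * exp (- t)" using pTE[OF l] by simp
    then show ?thesis by (simp add: card_cartesian_product power2_eq_square algebra_simps)
  qed
  have mN: "?N \<in> events" using mNL N0(1) by (intro sets.Un sets.finite_UN) auto
  have "prob ?N \<le> prob (\<Union>l\<in>{1..L}. NL l) + prob N0"
    using mNL N0(1) by (intro measure_Un_le sets.finite_UN) auto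
  also have "prob (\<Union>l\<in>{1..L}. NL l) \<le> (\<Sum>l\<in>{1..L}. prob (NL l))"
    using mNL by (intro finite_measure_subadditive_finite) auto
  also have "\<dots> \<le> (\<Sum>l\<in>{1..L}. ((real p)\<^sup>2 + 1) * (2 * exp (- t)))" by (intro sum_mono pNL)
  finally have pN: "prob ?N \<le> L * ((real p)\<^sup>2 + 1) * (2 * exp (- t)) + exp (- real n)"
    using N0(2) by (simp add: mult.assoc)
  have good: "spectral_comparison d (I l) (\<lambda>i. vec_index (x i \<omega>)) R w mu u lam n k p (1024 * \<kappa>)"
    if w: "\<omega> \<in> space M - ?N" and l: "l \<in> {1..L}"
      and sp: "sample_spectrum {..<d} (I l) (\<lambda>i. vec_index (x i \<omega>)) R w mu" for \<omega> l R w mu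
  proof -
    interpret S: sample_spectrum "{..<d}" "I l" "\<lambda>i. vec_index (x i \<omega>)" R w mu by (rule sp)
    have wl: "\<omega> \<in> space M - NL l" "\<omega> \<in> space M - N0" using w l by auto
    have dev: "\<bar>smp (I l) \<omega> (?v (j, j')) - pop (?v (j, j'))\<bar> \<le> ?r l * pop (?v (j, j'))" if "j < p" "j' < p" for j j'
    proof -
      have "\<omega> \<notin> A l (j, j')" using wl(1) that unfolding NL_def by auto
      then show ?thesis using wl(1) unfolding A_def by simp
    qed
    have iso: "\<bar>smp (I l) \<omega> (lincomb_fun {..<p} c u) - (\<Sum>j<p. lam j * (c j)\<^sup>2)\<bar> \<le> (\<Sum>j<p. lam j * (c j)\<^sup>2) / 2" for c
    proof -
      have "\<bar>smp (I l) \<omega> (lincomb_fun {..<p} c u) - (\<Sum>j<p. lam j * (c j)\<^sup>2)\<bar> \<le> 3 * ?r l * p * (\<Sum>j<p. lam j * (c j)\<^sup>2)"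
        using dev by (intro head_isometry p0(2) r0) simp
      also have "\<dots> \<le> 1/2 * (\<Sum>j<p. lam j * (c j)\<^sup>2)"
      proof (intro mult_right_mono sum_nonneg mult_nonneg_nonneg)
        show "3 * ?r l * p \<le> 1/2" using small[OF l] by (simp add: mult_ac)
        show "0 \<le> lam j" if "j \<in> {..<p}" for j using that p0 lam_pos[of j] by simp
      qed auto
      finally show ?thesis by simp
    qed
    show ?thesis
    proof unfold_locales
      fix c :: "nat \<Rightarrow> real"
      show "(\<Sum>j<p. lam j * (c j)\<^sup>2) / 2 \<le> smp (I l) \<omega> (lincomb_fun {..<p} c u)"
        and "smp (I l) \<omega> (lincomb_fun {..<p} c u) \<le> 3 / 2 * (\<Sum>j<p. lam j * (c j)\<^sup>2)"
        using iso[of c] unfolding abs_le_iff by linarith+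
      assume pd: "p < d"
      have "smp (I l) \<omega> (lincomb_fun {p..<d} c u) \<le> 4 * smp {1..n} \<omega> (lincomb_fun {p..<d} c u)"
        using I(1)[OF l] I(2)[OF l] Ine[OF l] by (intro qf_mono_sample) auto
      also have "\<dots> \<le> 4 * (256 * \<kappa> * ?th * (\<Sum>j=p..<d. (c j)\<^sup>2))"
        using N0(3)[OF pd wl(2)] by (intro mult_left_mono) auto
      finally show "smp (I l) \<omega> (lincomb_fun {p..<d} c u) \<le> 1024 * \<kappa> * ?th * (\<Sum>j=p..<d. (c j)\<^sup>2)" by simp
    next
      assume pd: "p < d"
      have tau0: "0 \<le> ?\<tau>" using lam_pos by (intro sum_nonneg) (auto simp: less_imp_le)
      have "\<omega> \<notin> T l" using wl(1) pd unfolding NL_def TE_def by auto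
      then have "\<bar>(\<Sum>j=p..<d. smp (I l) \<omega> (u j)) - ?\<tau>\<bar> \<le> 36 * (\<kappa> * ?\<tau>) * sqrt (t / card (I l))" using wl(1) unfolding T_def by auto
      also have "\<dots> = ?r l * ?\<tau>" by simp
      also have "\<dots> \<le> 1/2 * ?\<tau>"
      proof (rule mult_right_mono[OF _ tau0])
        have "?r l * 1 \<le> ?r l * p" using r0 p0 by (intro mult_left_mono) auto
        also have "6 * (?r l * p) \<le> 1" using small[OF l] by (simp add: mult_ac)
        finally show "?r l \<le> 1/2" using r0[of l] by simp
      qed
      finally show "?\<tau> / 2 \<le> (\<Sum>j=p..<d. smp (I l) \<omega> (u j))" unfolding abs_le_iff by linarith
    next
      show "card (I l) \<le> n" using card_mono[OF _ I(1)[OF l]] by simp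
      show "1 \<le> 1024 * \<kappa>" using one_le_kappa by simp
    qed (use u_orthonormal u_complete lam_pos lam_antimono p k d_pos kn in auto)
  qed
  show ?thesis using mN pN good by (intro bexI[of _ ?N]) auto
qed

end

section \<open>From the model to coordinates\<close>

lemma indep_vars_subset_distr_eq:
  assumes "prob_space M" "distr M N (x i) = distr M N (x 0)" "x i \<in> M \<rightarrow>\<^sub>M N" "x 0 \<in> M \<rightarrow>\<^sub>M N"
  shows "f \<in> borel_measurable N \<Longrightarrow> (\<integral>\<^sup>+\<omega>. f (x i \<omega>) \<partial>M) = (\<integral>\<^sup>+\<omega>. f (x 0 \<omega>) \<partial>M)"
    and "h \<in> borel_measurable N \<Longrightarrow> (\<integral>\<omega>. (h (x i \<omega>) :: real) \<partial>M) = (\<integral>\<omega>. h (x 0 \<omega>) \<partial>M)"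
proof -
  show "(\<integral>\<^sup>+\<omega>. f (x i \<omega>) \<partial>M) = (\<integral>\<^sup>+\<omega>. f (x 0 \<omega>) \<partial>M)" if "f \<in> borel_measurable N"
    using nn_integral_distr[OF assms(3), of f] nn_integral_distr[OF assms(4), of f] that assms(2) by simp
  show "(\<integral>\<omega>. (h (x i \<omega>) :: real) \<partial>M) = (\<integral>\<omega>. h (x 0 \<omega>) \<partial>M)" if "h \<in> borel_measurable N"
    using integral_distr[OF assms(3), of h] integral_distr[OF assms(4), of h] that assms(2) by simp
qed

text \<open>Each Orlicz bound is used at twice its scale, hence \<open>4 * K\<^sup>2\<close> and
  \<open>2 * \<sigma>\<close>. Covariance and whitening are given for the observation with index 0;
  equality of laws transports the moment bounds to the others.\<close>

lemma random_design_of_model: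
  fixes M :: "'w measure"
  assumes model: "random_design_model M n d \<beta> x e y"
    and S: "S = covariance_mat M d (x 0)"
    and \<sigma>: "0 < \<sigma>" "vec_psi_norm M \<alpha> n (\<lambda>\<omega>. stack {1..n} (\<lambda>i. e i \<omega>)) \<le> ennreal \<sigma>" "0 < \<alpha>"
    and W: "is_inv_sqrt_mat d S W"
    and K: "0 < K" "vec_psi_norm M 2 d (\<lambda>\<omega>. W *\<^sub>v x 0 \<omega>) \<le> ennreal K"
    and rule: "eigen_rule d U s" and "0 < n" "0 < d"
  shows "random_design M n d x e (4 * K\<^sup>2) (eigvec d U S) (\<lambda>a. (s S a)\<^sup>2) (2 * \<sigma>) \<alpha>"
    and "entry_form d S v v = popS d (eigvec d U S) (\<lambda>a. (s S a)\<^sup>2) v"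
proof -
  interpret prob_space M using model by (simp add: random_design_model_def)
  have xi: "indep_vars (\<lambda>_. borel_vec d) x {0..n}"
    and xd: "i \<in> {0..n} \<Longrightarrow> distr M (borel_vec d) (x i) = distr M (borel_vec d) (x 0)"
    and x2: "j < d \<Longrightarrow> integrable M (\<lambda>\<omega>. (x 0 \<omega> $ j)\<^sup>2)"
    and x1: "j < d \<Longrightarrow> expectation (\<lambda>\<omega>. x 0 \<omega> $ j) = 0"
    and ei: "indep_vars (\<lambda>_. borel) e {0..n}"
    and xe: "indep_set
       (sets (vimage_algebra (space M) (\<lambda>\<omega>. \<lambda>i\<in>{0..n}. x i \<omega>) (PiM {0..n} (\<lambda>_. borel_vec d))))
       (sets (vimage_algebra (space M) (\<lambda>\<omega>. \<lambda>i\<in>{0..n}. e i \<omega>) (PiM {0..n} (\<lambda>_. borel))))" for i j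
    using model unfolding random_design_model_def by blast+
  have xm: "x i \<in> M \<rightarrow>\<^sub>M borel_vec d" if "i \<in> {0..n}" for i using xi that by (auto simp: indep_vars_def2)
  have em: "e i \<in> borel_measurable M" if "i \<in> {0..n}" for i using ei that by (auto simp: indep_vars_def2)
  have x0m: "x 0 \<in> M \<rightarrow>\<^sub>M borel_vec d" by (rule xm) simp
  have xj[measurable]: "(\<lambda>\<omega>. x 0 \<omega> $ j) \<in> borel_measurable M" if "j < d" for j
    using measurable_compose[OF x0m measurable_vec_index[OF that]] .
  have xc: "x 0 \<omega> \<in> carrier_vec d" if "\<omega> \<in> space M" for \<omega>
    using measurable_space[OF x0m that] by (simp add: space_borel_vec)
  have Sc: "S \<in> carrier_mat d d" by (simp add: S covariance_mat_def)
  have Si: "S $$ (a, b) = expectation (\<lambda>\<omega>. x 0 \<omega> $ a * x 0 \<omega> $ b)" if "a < d" "b < d" for a b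
    using that by (simp add: S covariance_mat_def)
  have xint: "integrable M (\<lambda>\<omega>. x 0 \<omega> $ j)" if j: "j < d" for j
    by (rule square_integrable_imp_integrable[OF xj[OF j] x2[OF j]])
  have xxint: "integrable M (\<lambda>\<omega>. x 0 \<omega> $ a * x 0 \<omega> $ b)" if ab: "a < d" "b < d" for a b
  proof (rule Bochner_Integration.integrable_bound[where f = "\<lambda>\<omega>. (x 0 \<omega> $ a)\<^sup>2 + (x 0 \<omega> $ b)\<^sup>2"])
    show "AE \<omega> in M. norm (x 0 \<omega> $ a * x 0 \<omega> $ b) \<le> norm ((x 0 \<omega> $ a)\<^sup>2 + (x 0 \<omega> $ b)\<^sup>2)"
    proof (rule AE_I2)
      fix \<omega>
      have "\<bar>p * q\<bar> \<le> p\<^sup>2 + q\<^sup>2" for p q :: real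
      proof -
        have "0 \<le> (\<bar>p\<bar> - \<bar>q\<bar>)\<^sup>2" by simp
        then have "2 * (\<bar>p\<bar> * \<bar>q\<bar>) \<le> p\<^sup>2 + q\<^sup>2" by (simp add: power2_diff mult.assoc)
        moreover have "0 \<le> \<bar>p\<bar> * \<bar>q\<bar>" by simp
        ultimately show ?thesis unfolding abs_mult by linarith
      qed
      then show "norm (x 0 \<omega> $ a * x 0 \<omega> $ b) \<le> norm ((x 0 \<omega> $ a)\<^sup>2 + (x 0 \<omega> $ b)\<^sup>2)" by simp
    qed
  qed (use ab x2 in auto)
  have mean0: "expectation (\<lambda>\<omega>. ip {..<d} (vec_index (x 0 \<omega>)) v) = 0" for v
  proof -
    have "expectation (\<lambda>\<omega>. ip {..<d} (vec_index (x 0 \<omega>)) v) = (\<Sum>j<d. expectation (\<lambda>\<omega>. x 0 \<omega> $ j * v j))"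
      unfolding ip_def using xint by (intro Bochner_Integration.integral_sum) auto
    also have "\<dots> = 0" using x1 by (intro sum.neutral) auto
    finally show ?thesis .
  qed
  have second0: "expectation (\<lambda>\<omega>. (ip {..<d} (vec_index (x 0 \<omega>)) v)\<^sup>2) = entry_form d S v v" for v
  proof -
    have "expectation (\<lambda>\<omega>. (ip {..<d} (vec_index (x 0 \<omega>)) v)\<^sup>2)
        = expectation (\<lambda>\<omega>. \<Sum>a<d. \<Sum>b<d. v a * v b * (x 0 \<omega> $ a * x 0 \<omega> $ b))"
      unfolding ip_def power2_eq_square sum_product by (simp only: mult_ac)
    also have "\<dots> = (\<Sum>a<d. \<Sum>b<d. expectation (\<lambda>\<omega>. v a * v b * (x 0 \<omega> $ a * x 0 \<omega> $ b)))"
      using xxint by (subst Bochner_Integration.integral_sum) (auto intro!: sum.cong Bochner_Integration.integral_sum Bochner_Integration.integrable_sum)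
    also have "\<dots> = entry_form d S v v"
      unfolding entry_form_def using Si by (intro sum.cong refl) simp
    finally show ?thesis .
  qed
  have sym: "S\<^sup>T = S"
    by (rule eq_matI) (use Sc Si in \<open>auto simp: mult.commute\<close>)
  have psd: "psd_mat d S"
    unfolding psd_mat_def using Sc sym mult_mat_vec_form[OF Sc] second0[symmetric] by (auto intro!: integral_nonneg_AE)
  have Wc: "W \<in> carrier_mat d d" "W\<^sup>T = W" and WWS: "W * W * S = 1\<^sub>m d"
    using W by (auto simp: is_inv_sqrt_mat_def psd_mat_def)
  have det: "Determinant.det S \<noteq> 0"
  proof
    assume "Determinant.det S = 0"
    then have "Determinant.det (W * W * S) = 0" using Wc Sc by (subst det_mult[of _ d]) auto
    then show False by (simp add: WWS)
  qed
  have rank: "vec_space.rank d S = d" using vec_space.det_rank_iff[OF Sc] det by blast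
  have dec: "is_eigen_decomp d S (U S) (s S)" using rule psd by (auto simp: eigen_rule_def)
  note form = eigen_decomp_form[where U = U and s = s and S = S, OF dec Sc, unfolded rank]
  let ?u = "eigvec d U S" and ?lam = "\<lambda>a. (s S a)\<^sup>2"
  show pop_eq: "entry_form d S v v = popS d ?u ?lam v" for v
    unfolding form(2) popS_def by (simp add: power2_eq_square)
  have Uc: "U S \<in> carrier_mat d d" and UU: "(U S)\<^sup>T * U S = 1\<^sub>m d"
    using dec by (auto simp: is_eigen_decomp_def Let_def rank)
  have UU': "U S * (U S)\<^sup>T = 1\<^sub>m d"
    using mat_mult_left_right_inverse[of "(U S)\<^sup>T" d "U S"] Uc UU by simp
  have complete: "v i = lincomb_fun {..<d} (\<lambda>j. ip {..<d} (?u j) v) ?u i" if i: "i < d" for i and v :: "nat \<Rightarrow> real"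
  proof -
    have delta: "(\<Sum>a<d. ?u a i * ?u a j) = (if i = j then 1 else 0)" if j: "j < d" for j
    proof -
      have "(\<Sum>a<d. ?u a i * ?u a j) = (U S * (U S)\<^sup>T) $$ (i, j)"
        using Uc i j by (simp add: eigvec_def rank scalar_prod_def lessThan_atLeast0)
      then show ?thesis using i j by (simp add: UU')
    qed
    have "lincomb_fun {..<d} (\<lambda>j. ip {..<d} (?u j) v) ?u i = (\<Sum>a<d. \<Sum>j<d. v j * (?u a i * ?u a j))"
      unfolding lincomb_fun_def ip_def sum_distrib_right by (intro sum.cong refl) simp
    also have "\<dots> = (\<Sum>j<d. v j * (\<Sum>a<d. ?u a i * ?u a j))"
      unfolding sum_distrib_left by (rule sum.swap)
    also have "\<dots> = (\<Sum>j<d. if j = i then v j else 0)"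
      by (intro sum.cong refl) (auto simp: delta)
    finally show ?thesis using i by simp
  qed
  have subg0: "(\<integral>\<^sup>+\<omega>. ennreal (exp ((ip {..<d} (vec_index (x 0 \<omega>)) v)\<^sup>2 / (4 * K\<^sup>2 * q))) \<partial>M) \<le> 2"
    if q: "0 < q" "popS d ?u ?lam v \<le> q" for v q
  proof -
    define p where "p = popS d ?u ?lam v"
    have p0: "0 \<le> p" unfolding p_def popS_def by (intro sum_nonneg) auto
    define vv where "vv = Matrix.vec d v"
    have vv: "vv \<in> carrier_vec d" "\<And>j. j < d \<Longrightarrow> vv $ j = v j" by (auto simp: vv_def)
    \<comment> \<open>\<open>z\<close> plays the part of the square root of \<open>S\<close> applied
      to \<open>v\<close>: its inner product with the whitened observation is that of
      \<open>v\<close> with the observation, and its squared norm is the population form of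
      \<open>v\<close>.\<close>
    define z where "z = W *\<^sub>v (S *\<^sub>v vv)"
    have zc: "z \<in> carrier_vec d" using Wc Sc vv by (simp add: z_def)
    have ipv: "ip {..<d} w v = ip {..<d} w (vec_index vv)" for w
      unfolding ip_def using vv by (intro sum.cong) auto
    have WWSv: "W *\<^sub>v (W *\<^sub>v (S *\<^sub>v vv)) = vv"
    proof -
      have "W *\<^sub>v (W *\<^sub>v (S *\<^sub>v vv)) = (W * W * S) *\<^sub>v vv"
        using Wc Sc vv by (simp add: assoc_mult_mat_vec[of _ d d _ d])
      then show ?thesis using vv by (simp add: WWS)
    qed
    have Wsym: "a \<bullet> (W *\<^sub>v b) = (W *\<^sub>v a) \<bullet> b" if "a \<in> carrier_vec d" "b \<in> carrier_vec d" for a b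
    proof -
      have "(W\<^sup>T *\<^sub>v a) \<bullet> b = a \<bullet> (W *\<^sub>v b)"
        using that Wc transpose_vec_mult_scalar[of W d d b a] by (simp add: comm_scalar_prod[of _ d])
      then show ?thesis using Wc by simp
    qed
    have zx: "z \<bullet> (W *\<^sub>v x 0 \<omega>) = ip {..<d} (vec_index (x 0 \<omega>)) v" if "\<omega> \<in> space M" for \<omega>
    proof -
      have "z \<bullet> (W *\<^sub>v x 0 \<omega>) = vv \<bullet> x 0 \<omega>"
        using Wsym[OF zc xc[OF that]] WWSv by (simp add: z_def)
      also have "\<dots> = ip {..<d} (vec_index (x 0 \<omega>)) v"
        unfolding scalar_prod_eq_ip[OF xc[OF that]] ipv by (rule ip_commute)
      finally show ?thesis .
    qed
    have zz: "z \<bullet> z = p"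
    proof -
      have "z \<bullet> z = (W *\<^sub>v z) \<bullet> (S *\<^sub>v vv)"
        using Wsym[OF zc, of "S *\<^sub>v vv"] Sc vv by (simp add: z_def)
      also have "\<dots> = vv \<bullet> (S *\<^sub>v vv)" by (simp add: z_def WWSv)
      also have "\<dots> = entry_form d S v v"
        unfolding mult_mat_vec_form[OF Sc vv(1) vv(1)] entry_form_def using vv by simp
      finally show ?thesis by (simp add: pop_eq p_def)
    qed
    have gm[measurable]: "(\<lambda>\<omega>. ip {..<d} (vec_index (x 0 \<omega>)) v) \<in> borel_measurable M"
      using measurable_compose[OF x0m measurable_ip_vec] .
    show ?thesis
    proof (cases "p = 0")
      case True
      have "(\<Sum>i\<in>{0..<d}. (z $ i)\<^sup>2) = 0" using zz zc True by (simp add: scalar_prod_def power2_eq_square)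
      then have "z $ i = 0" if "i < d" for i using that by (subst (asm) sum_nonneg_eq_0_iff) auto
      then have "z \<bullet> (W *\<^sub>v x 0 \<omega>) = 0" if "\<omega> \<in> space M" for \<omega>
        using Wc xc[OF that] zc by (simp add: scalar_prod_def)
      then have "(\<integral>\<^sup>+\<omega>. ennreal (exp ((ip {..<d} (vec_index (x 0 \<omega>)) v)\<^sup>2 / (4 * K\<^sup>2 * q))) \<partial>M) = (\<integral>\<^sup>+\<omega>. 1 \<partial>M)"
        using zx by (intro nn_integral_cong) simp
      then show ?thesis by (simp add: emeasure_space_1)
    next
      case False
      then have pp: "0 < p" using p0 by simp
      let ?w = "(1 / sqrt p) \<cdot>\<^sub>v z"
      have wc: "?w \<in> carrier_vec d" using zc by simp
      have wn: "l2norm ?w = 1"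
      proof -
        have "?w \<bullet> ?w = 1 / sqrt p * (z \<bullet> ?w)" by (rule smult_scalar_prod_distrib[OF zc wc])
        also have "z \<bullet> ?w = 1 / sqrt p * (z \<bullet> z)" by (rule scalar_prod_smult_distrib[OF zc zc])
        also have "1 / sqrt p * (1 / sqrt p * (z \<bullet> z)) = 1"
        proof -
          have "1 / sqrt a * (1 / sqrt a * a) = 1" if "0 < a" for a :: real using that by simp
          then show ?thesis unfolding zz using pp by blast
        qed
        finally have "?w \<bullet> ?w = 1" .
        then show ?thesis unfolding l2norm_def by (simp only: real_sqrt_one)
      qed
      let ?Z = "\<lambda>\<omega>. ?w \<bullet> (W *\<^sub>v x 0 \<omega>)"
      have Zeq: "?Z \<omega> = ip {..<d} (vec_index (x 0 \<omega>)) v / sqrt p" if "\<omega> \<in> space M" for \<omega>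
        using zx[OF that] zc Wc xc[OF that] by simp
      have Zm: "?Z \<in> borel_measurable M"
        by (subst measurable_cong[OF Zeq]) (assumption, measurable)
      have "psi_norm M 2 ?Z \<le> ennreal K"
        using psi_norm_le_vec_psi_norm[OF wc wn] K(2) by (rule order.trans)
      then have "(\<integral>\<^sup>+\<omega>. ennreal (exp ((\<bar>?Z \<omega>\<bar> / (2 * K)) powr 2)) \<partial>M) \<le> 2"
        using K(1) by (intro psi_norm_exp_moment Zm prob_space_axioms) auto
      moreover have "(\<integral>\<^sup>+\<omega>. ennreal (exp ((ip {..<d} (vec_index (x 0 \<omega>)) v)\<^sup>2 / (4 * K\<^sup>2 * q))) \<partial>M)
          \<le> (\<integral>\<^sup>+\<omega>. ennreal (exp ((\<bar>?Z \<omega>\<bar> / (2 * K)) powr 2)) \<partial>M)"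
      proof (rule nn_integral_mono)
        fix \<omega> assume w: "\<omega> \<in> space M"
        let ?i = "ip {..<d} (vec_index (x 0 \<omega>)) v"
        have "(\<bar>?Z \<omega>\<bar> / (2 * K)) powr 2 = (\<bar>?Z \<omega>\<bar> / (2 * K))\<^sup>2"
          using K(1) by (simp add: powr_numeral)
        also have "\<dots> = ?i\<^sup>2 / (4 * K\<^sup>2 * p)"
          using pp unfolding Zeq[OF w] by (simp add: power_divide power_mult_distrib mult_ac)
        also have "?i\<^sup>2 / (4 * K\<^sup>2 * q) \<le> ?i\<^sup>2 / (4 * K\<^sup>2 * p)"
          using q pp K(1) by (intro divide_left_mono mult_left_mono mult_pos_pos) (auto simp: p_def)
        finally show "ennreal (exp (?i\<^sup>2 / (4 * K\<^sup>2 * q))) \<le> ennreal (exp ((\<bar>?Z \<omega>\<bar> / (2 * K)) powr 2))"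
          by (simp add: ennreal_leI)
      qed
      ultimately show ?thesis by (rule order.trans[rotated])
    qed
  qed
  have st: "stack {1..n} z \<in> carrier_vec n" "j < n \<Longrightarrow> stack {1..n} z $ j = z (Suc j)" for z :: "nat \<Rightarrow> real" and j
  proof -
    have "sorted_list_of_set {1..n} = [1..<Suc n]" by (simp add: atLeastAtMostSuc_conv flip: atLeastLessThanSuc_atLeastAtMost del: upt_Suc)
    then show "stack {1..n} z \<in> carrier_vec n" "j < n \<Longrightarrow> stack {1..n} z $ j = z (Suc j)"
      by (auto simp: stack_def vec_of_list_index intro!: carrier_vecI simp del: upt_Suc)
  qed
  have noise: "(\<integral>\<^sup>+\<omega>. ennreal (exp ((\<bar>e i \<omega>\<bar> / (2 * \<sigma>)) powr \<alpha>)) \<partial>M) \<le> 2" if i: "i \<in> {1..n}" for i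
  proof -
    \<comment> \<open>Coordinate vectors pick out single noise variables; the entries of
      \<open>stack\<close> are numbered from 0, the observations from 1.\<close>
    have i': "i - 1 < n" "Suc (i - 1) = i" using i by auto
    have uv: "unit_vec n (i - 1) \<bullet> stack {1..n} (\<lambda>i. e i \<omega>) = e i \<omega>" for \<omega>
      using st i' by (simp add: scalar_prod_left_unit)
    have "l2norm (unit_vec n (i - 1)) = 1" using i' by (simp add: l2norm_def)
    then have "psi_norm M \<alpha> (\<lambda>\<omega>. unit_vec n (i - 1) \<bullet> stack {1..n} (\<lambda>i. e i \<omega>)) \<le> ennreal \<sigma>"
      using psi_norm_le_vec_psi_norm[of "unit_vec n (i - 1)" n M \<alpha> "\<lambda>\<omega>. stack {1..n} (\<lambda>i. e i \<omega>)"] \<sigma>(2)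
      by (auto intro: order.trans)
    then show ?thesis
      unfolding uv using \<sigma> i em by (intro psi_norm_exp_moment prob_space_axioms) auto
  qed
  \<comment> \<open>The model states independence for the indices 0 to \<open>n\<close>; events
    about the indices 1 to \<open>n\<close> are pulled back along the restriction of
    families.\<close>
  have xe_prod: "prob ((\<lambda>\<omega>. (\<lambda>i\<in>{1..n}. e i \<omega>, \<lambda>i\<in>{1..n}. x i \<omega>)) -` (A \<times> A') \<inter> space M)
        = prob ((\<lambda>\<omega>. \<lambda>i\<in>{1..n}. e i \<omega>) -` A \<inter> space M) * prob ((\<lambda>\<omega>. \<lambda>i\<in>{1..n}. x i \<omega>) -` A' \<inter> space M)"
    if A: "A \<in> sets (PiM {1..n} (\<lambda>_. borel))" and A': "A' \<in> sets (PiM {1..n} (\<lambda>_. borel_vec d))" for A A'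
  proof -
    let ?E = "(\<lambda>\<omega>. \<lambda>i\<in>{1..n}. e i \<omega>) -` A \<inter> space M" and ?X = "(\<lambda>\<omega>. \<lambda>i\<in>{1..n}. x i \<omega>) -` A' \<inter> space M"
    have sub: "(\<lambda>f. restrict f {1..n}) \<in> PiM {0..n} N \<rightarrow>\<^sub>M PiM {1..n} N" for N :: "nat \<Rightarrow> 'c measure"
      by (rule measurable_restrict_subset) auto
    have E: "?E \<in> sets (vimage_algebra (space M) (\<lambda>\<omega>. \<lambda>i\<in>{0..n}. e i \<omega>) (PiM {0..n} (\<lambda>_. borel)))"
    proof -
      have "(\<lambda>f. restrict f {1..n}) -` A \<inter> space (PiM {0..n} (\<lambda>_. borel)) \<in> sets (PiM {0..n} (\<lambda>_. borel))"
        by (rule measurable_sets[OF sub A])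
      then have "(\<lambda>\<omega>. \<lambda>i\<in>{0..n}. e i \<omega>) -` ((\<lambda>f. restrict f {1..n}) -` A \<inter> space (PiM {0..n} (\<lambda>_. borel))) \<inter> space M
          \<in> sets (vimage_algebra (space M) (\<lambda>\<omega>. \<lambda>i\<in>{0..n}. e i \<omega>) (PiM {0..n} (\<lambda>_. borel)))"
        by (rule in_vimage_algebra)
      also have "(\<lambda>\<omega>. \<lambda>i\<in>{0..n}. e i \<omega>) -` ((\<lambda>f. restrict f {1..n}) -` A \<inter> space (PiM {0..n} (\<lambda>_. borel))) \<inter> space M = ?E"
        by (auto simp: space_PiM Int_absorb1 restrict_restrict cong: restrict_cong)
      finally show ?thesis .
    qed
    have X: "?X \<in> sets (vimage_algebra (space M) (\<lambda>\<omega>. \<lambda>i\<in>{0..n}. x i \<omega>) (PiM {0..n} (\<lambda>_. borel_vec d)))"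
    proof -
      have "(\<lambda>f. restrict f {1..n}) -` A' \<inter> space (PiM {0..n} (\<lambda>_. borel_vec d)) \<in> sets (PiM {0..n} (\<lambda>_. borel_vec d))"
        by (rule measurable_sets[OF sub A'])
      then have "(\<lambda>\<omega>. \<lambda>i\<in>{0..n}. x i \<omega>) -` ((\<lambda>f. restrict f {1..n}) -` A' \<inter> space (PiM {0..n} (\<lambda>_. borel_vec d))) \<inter> space M
          \<in> sets (vimage_algebra (space M) (\<lambda>\<omega>. \<lambda>i\<in>{0..n}. x i \<omega>) (PiM {0..n} (\<lambda>_. borel_vec d)))"
        by (rule in_vimage_algebra)
      also have "(\<lambda>\<omega>. \<lambda>i\<in>{0..n}. x i \<omega>) -` ((\<lambda>f. restrict f {1..n}) -` A' \<inter> space (PiM {0..n} (\<lambda>_. borel_vec d))) \<inter> space M = ?X"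
        using measurable_space[OF xm] by (auto simp: space_PiM Int_absorb1 restrict_restrict cong: restrict_cong)
      finally show ?thesis .
    qed
    have "prob (?X \<inter> ?E) = prob ?X * prob ?E" using xe X E unfolding indep_sets2_eq by blast
    moreover have "(\<lambda>\<omega>. (\<lambda>i\<in>{1..n}. e i \<omega>, \<lambda>i\<in>{1..n}. x i \<omega>)) -` (A \<times> A') \<inter> space M = ?X \<inter> ?E" by blast
    ultimately show ?thesis by (simp only: mult.commute)
  qed
  show "random_design M n d x e (4 * K\<^sup>2) ?u ?lam (2 * \<sigma>) \<alpha>"
  proof unfold_locales
    show "indep_vars (\<lambda>_. borel_vec d) x {1..n}" by (rule indep_vars_subset[OF xi]) auto
    show "e i \<in> borel_measurable M" if "i \<in> {1..n}" for i using em that by auto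
    show "orthonormal_on {..<d} ?u {..<d}" by (rule form(1))
    show "0 < ?lam j" if "j < d" for j using form(3)[OF that] by simp
    show "?lam j \<le> ?lam i" if "i \<le> j" "j < d" for i j
      using form(4)[OF that] form(3)[OF that(2)] by (intro power_mono) auto
    fix i assume "i \<in> {1..n}"
    then have i: "i \<in> {0..n}" by auto
    note tr = indep_vars_subset_distr_eq[OF prob_space_axioms xd[OF i] xm[OF i] x0m]
    show "(\<integral>\<^sup>+\<omega>. ennreal (exp ((ip {..<d} (vec_index (x i \<omega>)) v)\<^sup>2 / (4 * K\<^sup>2 * q))) \<partial>M) \<le> 2"
      if "0 < q" "popS d ?u ?lam v \<le> q" for q v
      using subg0[OF that] by (subst tr(1)) auto
    show "expectation (\<lambda>\<omega>. ip {..<d} (vec_index (x i \<omega>)) v) = 0" for v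
      using mean0 by (subst tr(2)) auto
    show "expectation (\<lambda>\<omega>. (ip {..<d} (vec_index (x i \<omega>)) v)\<^sup>2) = popS d ?u ?lam v" for v
      using second0 pop_eq by (subst tr(2)) auto
  next
    show "0 < n" "0 < d" by fact+
    show "0 < 4 * K\<^sup>2" "0 < 2 * \<sigma>" "0 < \<alpha>" using K(1) \<sigma>(1,3) by simp_all
    show "v i = lincomb_fun {..<d} (\<lambda>j. ip {..<d} (?u j) v) ?u i" if "i < d" for i and v :: "nat \<Rightarrow> real"
      by (rule complete[OF that])
    show "(\<integral>\<^sup>+\<omega>. ennreal (exp ((\<bar>e i \<omega>\<bar> / (2 * \<sigma>)) powr \<alpha>)) \<partial>M) \<le> 2" if "i \<in> {1..n}" for i
      by (rule noise[OF that])
    show "prob ((\<lambda>\<omega>. (\<lambda>i\<in>{1..n}. e i \<omega>, \<lambda>i\<in>{1..n}. x i \<omega>)) -` (A \<times> A') \<inter> space M)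
        = prob ((\<lambda>\<omega>. \<lambda>i\<in>{1..n}. e i \<omega>) -` A \<inter> space M) * prob ((\<lambda>\<omega>. \<lambda>i\<in>{1..n}. x i \<omega>) -` A' \<inter> space M)"
      if "A \<in> sets (PiM {1..n} (\<lambda>_. borel))" "A' \<in> sets (PiM {1..n} (\<lambda>_. borel_vec d))" for A A'
      by (rule xe_prod[OF that])
  qed
qed

section \<open>Regret of cross-validation on the good event\<close>

definition fit_gap ::
  "nat \<Rightarrow> (real mat \<Rightarrow> real mat) \<Rightarrow> nat \<Rightarrow> (nat \<Rightarrow> real) \<Rightarrow> nat set
     \<Rightarrow> (nat \<Rightarrow> real Matrix.vec) \<Rightarrow> (nat \<Rightarrow> real) \<Rightarrow> real \<Rightarrow> nat \<Rightarrow> real" where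
  "fit_gap d U k b I xx ee t j =
     fit_coord d U k I xx (\<lambda>i. ip {..<d} (vec_index (xx i)) b + ee i) t j - b j"

lemma fit_error_eq_gap: "\<exists>\<tau>\<ge>0. fit_error d U k b I xx ee i = fit_gap d U k b I xx ee \<tau>"
  unfolding fit_error_def fit_gap_def Let_def by (rule exI, rule conjI[OF breakpoint_nonneg refl])

lemma fit_coord_eq_coeff_at:
  "fit_coord d U k I x y t j = (\<Sum>a<min k d. soft t (coeff_at d U I x y a) / eig_scale d U I x a
     * eigvec d U (sample_cov d I x) a j)"
  by (simp only: fit_coord_def coeff_at_def)

text \<open>The fit is linear in the thresholded coefficients, and subtracting the target commutes
  with convex combinations, so the interpolation of coefficients passes to the errors.\<close>

lemma fit_gap_path:
  assumes "0 \<le> t"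
  shows "\<exists>i\<le>min k d. \<exists>i'\<le>min k d. \<exists>c. 0 \<le> c \<and> c \<le> 1 \<and>
    fit_gap d U k b I xx ee t = (\<lambda>j. (1 - c) * fit_error d U k b I xx ee i j + c * fit_error d U k b I xx ee i' j)"
proof -
  let ?y = "\<lambda>i. ip {..<d} (vec_index (xx i)) b + ee i"
  let ?z = "coeff_at d U I xx ?y" and ?m = "min k d"
  let ?f = "\<lambda>\<tau> j. fit_coord d U k I xx ?y \<tau> j"
  obtain i i' c where i: "i \<le> ?m" "i' \<le> ?m" and c: "0 \<le> c" "c \<le> 1"
    and h: "\<And>a. a < ?m \<Longrightarrow> soft t (?z a) = (1 - c) * soft (breakpoint ?m ?z i) (?z a) + c * soft (breakpoint ?m ?z i') (?z a)"
    using soft_path_interpolation[OF assms, of ?m ?z] by blast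
  have gen: "((1 - c) * p + c * q) / e * v = (1 - c) * (p / e * v) + c * (q / e * v)" for p q e v :: real
    by (simp add: add_divide_distrib distrib_right)
  have f: "?f t j = (1 - c) * ?f (breakpoint ?m ?z i) j + c * ?f (breakpoint ?m ?z i') j" for j
    unfolding fit_coord_eq_coeff_at sum_distrib_left sum.distrib[symmetric]
    by (intro sum.cong refl) (simp only: h lessThan_iff gen)
  have lin: "(1 - c) * p + c * q - w = (1 - c) * (p - w) + c * (q - w)" for p q w :: real
    by (simp add: algebra_simps)
  have "fit_gap d U k b I xx ee t = (\<lambda>j. (1 - c) * fit_error d U k b I xx ee i j + c * fit_error d U k b I xx ee i' j)"
    unfolding fit_gap_def fit_error_def Let_def by (rule ext) (simp only: f lin)
  then show ?thesis using i c by blast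
qed

context random_design
begin

text \<open>The radius is demanded at all thresholds because breakpoints are thresholds too;
  relative deviations at pairs of breakpoints then become absolute ones along the whole
  path.\<close>

lemma fold_control:
  assumes ok: "\<not> cv_fails U k b t0 I B xx xx ee" and t: "0 \<le> t" and t0: "0 \<le> t0"
    and R: "\<And>\<tau>. 0 \<le> \<tau> \<Longrightarrow> pop (fit_gap d U k b I xx ee \<tau>) \<le> R"
  shows "\<bar>qf B {..<d} (\<lambda>i. vec_index (xx i)) (fit_gap d U k b I xx ee t) (fit_gap d U k b I xx ee t)
      - pop (fit_gap d U k b I xx ee t)\<bar> \<le> 2 * (36 * \<kappa> * sqrt (t0 / card B) * R)" (is ?quadratic)
    and "\<bar>\<Sum>i\<in>B. ee i * ip {..<d} (vec_index (xx i)) (fit_gap d U k b I xx ee t)\<bar>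
      \<le> 2 * sqrt (\<kappa> * R * t0) * sqrt (\<Sum>i\<in>B. (ee i)\<^sup>2)" (is ?linear)
proof -
  let ?e = "fit_error d U k b I xx ee"
  obtain i i' c where i: "i \<le> min k d" "i' \<le> min k d" and c: "0 \<le> c" "c \<le> 1"
    and eq: "fit_gap d U k b I xx ee t = (\<lambda>j. (1 - c) * ?e i j + c * ?e i' j)"
    using fit_gap_path[OF t] by blast
  have eR: "pop (?e j) \<le> R" for j using fit_error_eq_gap[of d U k b I xx ee j] R by auto
  have nd: "\<not> cv_deviates d u lam \<kappa> t0 B (\<lambda>j. v j + w j) xx ee" if vw: "v \<in> {?e i, ?e i'}" "w \<in> {?e i, ?e i'}" for v w
  proof -
    obtain a a' where "v = ?e a" "a \<le> min k d" "w = ?e a'" "a' \<le> min k d" using vw i by blast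
    then show ?thesis using ok unfolding cv_fails_def by auto
  qed
  show ?quadratic
    unfolding eq qf_eq_wsq popS_eq_wsq
  proof (rule path_deviation_le[OF _ _ c])
    show "\<bar>wsq {..<d} B (\<lambda>_. 1 / card B) (\<lambda>i. vec_index (xx i)) (\<lambda>j. v j + w j) - wsq {..<d} {..<d} lam u (\<lambda>j. v j + w j)\<bar>
        \<le> 36 * \<kappa> * sqrt (t0 / card B) * wsq {..<d} {..<d} lam u (\<lambda>j. v j + w j)"
      if "v \<in> {?e i, ?e i'}" "w \<in> {?e i, ?e i'}" for v w
      using nd[OF that] unfolding cv_deviates_def qf_eq_wsq popS_eq_wsq by linarith
    show "0 \<le> 36 * \<kappa> * sqrt (t0 / card B)" using t0 \<kappa>_pos by simp
  qed (use eR lam_pos in \<open>auto simp: popS_eq_wsq less_imp_le\<close>)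
  show ?linear
    unfolding eq
  proof (rule path_linear_le[OF c])
    fix v assume v: "v \<in> {?e i, ?e i'}"
    have pv: "pop v \<le> R" using v eR by auto
    have "\<bar>\<Sum>i\<in>B. ee i * ip {..<d} (vec_index (xx i)) (\<lambda>j. v j + v j)\<bar>
        \<le> 2 * sqrt (\<kappa> * pop (\<lambda>j. v j + v j) * t0) * sqrt (\<Sum>i\<in>B. (ee i)\<^sup>2)"
      using nd[OF v v] unfolding cv_deviates_def by linarith
    also have "pop (\<lambda>j. v j + v j) = 4 * pop v" unfolding popS_eq_wsq by (rule wsq_double)
    also have "2 * sqrt (\<kappa> * (4 * pop v) * t0) * sqrt (\<Sum>i\<in>B. (ee i)\<^sup>2)
        \<le> 2 * (2 * sqrt (\<kappa> * R * t0)) * sqrt (\<Sum>i\<in>B. (ee i)\<^sup>2)"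
    proof (intro mult_right_mono mult_left_mono)
      have "sqrt (\<kappa> * (4 * pop v) * t0) \<le> sqrt (2\<^sup>2 * (\<kappa> * R * t0))"
        using pv t0 \<kappa>_pos by (intro real_sqrt_le_mono) (simp add: mult_left_mono mult_right_mono mult.assoc)
      then show "sqrt (\<kappa> * (4 * pop v) * t0) \<le> 2 * sqrt (\<kappa> * R * t0)" by (simp add: real_sqrt_mult)
    qed (auto intro: sum_nonneg)
    finally show "\<bar>\<Sum>i\<in>B. ee i * ip {..<d} (vec_index (xx i)) (\<lambda>j. v j + v j)\<bar>
        \<le> 2 * (2 * sqrt (\<kappa> * R * t0) * sqrt (\<Sum>i\<in>B. (ee i)\<^sup>2))" by (simp only: mult.assoc)
  qed
qed

lemma regret_bound:
  fixes L k :: nat and I B :: "nat \<Rightarrow> nat set" and ee b :: "nat \<Rightarrow> real"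
    and U :: "real mat \<Rightarrow> real mat" and xx :: "nat \<Rightarrow> real Matrix.vec" and t0 R \<tau> \<tau>' :: real
  defines "D \<equiv> \<lambda>l \<tau>. fit_gap d U k b (I l) xx ee \<tau>"
  assumes L: "0 < L" and disj: "disjoint_family_on B {1..L}" and cover: "(\<Union>l\<in>{1..L}. B l) = {1..n}"
    and big: "\<And>l. l \<in> {1..L} \<Longrightarrow> n \<le> 2 * L * card (B l)"
    and R: "\<And>l \<tau>. l \<in> {1..L} \<Longrightarrow> 0 \<le> \<tau> \<Longrightarrow> pop (D l \<tau>) \<le> R"
    and E: "(\<Sum>i=1..n. (ee i)\<^sup>2) / n \<le> R" and t0: "0 < t0"
    and ok: "\<And>l. l \<in> {1..L} \<Longrightarrow> t0 \<le> real (card (B l)) \<Longrightarrow> \<not> cv_fails U k b t0 (I l) (B l) xx xx ee"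
    and \<tau>: "0 \<le> \<tau>" "0 \<le> \<tau>'"
    and opt: "fold_avg L (\<lambda>l. (\<Sum>i\<in>B l. (ee i - ip {..<d} (vec_index (xx i)) (D l \<tau>))\<^sup>2) / card (B l))
      \<le> fold_avg L (\<lambda>l. (\<Sum>i\<in>B l. (ee i - ip {..<d} (vec_index (xx i)) (D l \<tau>'))\<^sup>2) / card (B l))"
  shows "fold_avg L (\<lambda>l. pop (D l \<tau>)) \<le> fold_avg L (\<lambda>l. pop (D l \<tau>')) + 300 * \<kappa> * R * sqrt (L * t0 / n)"
proof -
  have l1: "1 \<in> {1..L}" using L by simp
  have R0: "0 \<le> R" using R[OF l1 \<tau>(1)] pop_nonneg order.trans by blast
  have k1: "1 \<le> \<kappa>" by (rule one_le_kappa)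
  have cB: "0 < card (B l)" if "l \<in> {1..L}" for l using big[OF that] n_pos by (cases "card (B l) = 0") auto
  have bigr: "real n \<le> 2 * L * real (card (B l))" if "l \<in> {1..L}" for l
    using big[OF that] by (simp only: of_nat_le_iff[symmetric, where 'a = real] of_nat_mult of_nat_numeral)
  have frac: "t0 / card (B l) \<le> 2 * (L * t0 / n)" if l: "l \<in> {1..L}" for l
  proof -
    have "t0 * real n \<le> t0 * (2 * L * real (card (B l)))" using bigr[OF l] t0 by (intro mult_left_mono) auto
    then show ?thesis using cB[OF l] n_pos by (simp add: divide_simps mult_ac)
  qed
  show ?thesis
  proof (cases "\<forall>l\<in>{1..L}. t0 \<le> real (card (B l))")
    case False
    then obtain l where l: "l \<in> {1..L}" "real (card (B l)) < t0" by auto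
    have "1 \<le> t0 / card (B l)" using l cB[OF l(1)] by simp
    then have "1 / 4 \<le> L * t0 / n" using frac[OF l(1)] by linarith
    then have "sqrt ((1/2)\<^sup>2) \<le> sqrt (L * t0 / n)" by (intro real_sqrt_le_mono) (simp add: power2_eq_square)
    then have h: "1/2 \<le> sqrt (L * t0 / n)" by simp
    have "fold_avg L (\<lambda>l. pop (D l \<tau>)) \<le> fold_avg L (\<lambda>l. R)" by (intro fold_avg_mono R \<tau>)
    also have "\<dots> = 300 * 1 * R * (1 / 300)" using L by (simp add: fold_avg_const)
    also have "\<dots> \<le> 300 * \<kappa> * R * sqrt (L * t0 / n)"
      using h k1 R0 by (intro mult_mono) auto
    finally have "fold_avg L (\<lambda>l. pop (D l \<tau>)) \<le> 300 * \<kappa> * R * sqrt (L * t0 / n)" .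
    moreover have "0 \<le> fold_avg L (\<lambda>l. pop (D l \<tau>'))" unfolding fold_avg_def by (intro mult_nonneg_nonneg sum_nonneg pop_nonneg) simp
    ultimately show ?thesis by linarith
  next
    case True
    define q where "q = sqrt (2 * (L * t0 / n))"
    define S where "S l = (\<Sum>i\<in>B l. (ee i)\<^sup>2) / card (B l)" for l
    define al where "al l = 2 * (36 * \<kappa> * sqrt (t0 / card (B l)) * R)" for l
    define bl where "bl l = 2 * sqrt (\<kappa> * R * t0) * sqrt (\<Sum>i\<in>B l. (ee i)\<^sup>2) / card (B l)" for l
    let ?A = "\<lambda>\<tau> l. qf (B l) {..<d} (\<lambda>i. vec_index (xx i)) (D l \<tau>) (D l \<tau>)"
    let ?C = "\<lambda>\<tau> l. (\<Sum>i\<in>B l. ee i * ip {..<d} (vec_index (xx i)) (D l \<tau>)) / card (B l)"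
    have split: "(\<Sum>i\<in>B l. (ee i - ip {..<d} (vec_index (xx i)) (D l \<tau>))\<^sup>2) / card (B l) = S l - 2 * ?C \<tau> l + ?A \<tau> l" for l \<tau>
    proof -
      have sq: "(p - z)\<^sup>2 = p\<^sup>2 - 2 * (p * z) + z * z" for p z :: real
        by (simp add: power2_eq_square algebra_simps)
      show ?thesis
        unfolding S_def qf_def sq sum.distrib sum_subtractf sum_distrib_left[symmetric] add_divide_distrib diff_divide_distrib
        by simp
    qed
    have okl: "\<not> cv_fails U k b t0 (I l) (B l) xx xx ee" if "l \<in> {1..L}" for l using ok that True by auto
    have quad: "\<bar>?A \<tau> l - pop (D l \<tau>)\<bar> \<le> al l" if "l \<in> {1..L}" "0 \<le> \<tau>" for l \<tau>
      unfolding D_def al_def using R[OF that(1), unfolded D_def] by (intro fold_control(1)[OF okl[OF that(1)] that(2) less_imp_le[OF t0]])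
    have lin: "\<bar>?C \<tau> l\<bar> \<le> bl l" if "l \<in> {1..L}" "0 \<le> \<tau>" for l \<tau>
    proof -
      have "\<bar>\<Sum>i\<in>B l. ee i * ip {..<d} (vec_index (xx i)) (D l \<tau>)\<bar> \<le> 2 * sqrt (\<kappa> * R * t0) * sqrt (\<Sum>i\<in>B l. (ee i)\<^sup>2)"
        unfolding D_def using R[OF that(1), unfolded D_def] by (intro fold_control(2)[OF okl[OF that(1)] that(2) less_imp_le[OF t0]])
      then show ?thesis unfolding bl_def abs_divide by (simp add: divide_right_mono)
    qed
    have "fold_avg L (\<lambda>l. pop (D l \<tau>)) \<le> fold_avg L (\<lambda>l. pop (D l \<tau>')) + fold_avg L (\<lambda>l. 2 * al l + 4 * bl l)"
      using opt unfolding split by (rule cv_basic_inequality) (intro quad lin \<tau>; assumption)+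
    also have "fold_avg L (\<lambda>l. 2 * al l + 4 * bl l) \<le> fold_avg L (\<lambda>l. 144 * \<kappa> * R * q + 8 * sqrt (\<kappa> * R) * q * sqrt (S l))"
    proof (rule fold_avg_mono, rule add_mono)
      fix l assume l: "l \<in> {1..L}"
      have sq: "sqrt (t0 / card (B l)) \<le> q" unfolding q_def by (intro real_sqrt_le_mono frac l)
      have "2 * al l = 144 * \<kappa> * R * sqrt (t0 / card (B l))" by (simp add: al_def)
      also have "\<dots> \<le> 144 * \<kappa> * R * q" using sq k1 R0 by (intro mult_left_mono) auto
      finally show "2 * al l \<le> 144 * \<kappa> * R * q" .
      have "4 * bl l = 8 * sqrt (\<kappa> * R) * sqrt (t0 / card (B l)) * sqrt (S l)"
        using cB[OF l] unfolding bl_def S_def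
        by (simp add: real_sqrt_mult real_sqrt_divide)
      also have "\<dots> \<le> 8 * sqrt (\<kappa> * R) * q * sqrt (S l)"
        using sq k1 R0 by (intro mult_left_mono mult_right_mono) (auto simp: S_def intro!: divide_nonneg_nonneg sum_nonneg)
      finally show "4 * bl l \<le> 8 * sqrt (\<kappa> * R) * q * sqrt (S l)" .
    qed
    also have "\<dots> = 144 * \<kappa> * R * q + 8 * sqrt (\<kappa> * R) * q * fold_avg L (\<lambda>l. sqrt (S l))"
      unfolding fold_avg_add fold_avg_cmult fold_avg_const[OF L] ..
    \<comment> \<open>Only the total noise energy is controlled, not that of each block. Concavity
      of the square root puts the fold average under the root, where the blocks add up to the full
      sample.\<close>
    also have "8 * sqrt (\<kappa> * R) * q * fold_avg L (\<lambda>l. sqrt (S l)) \<le> 8 * sqrt (\<kappa> * R) * q * sqrt (2 * R)"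
    proof (rule mult_left_mono)
      have S0: "0 \<le> S l" for l by (simp add: S_def sum_nonneg)
      have "fold_avg L S \<le> fold_avg L (\<lambda>l. 2 * real L / n * (\<Sum>i\<in>B l. (ee i)\<^sup>2))"
      proof (rule fold_avg_mono)
        fix l assume l: "l \<in> {1..L}"
        have "1 / card (B l) \<le> 2 * real L / n" using bigr[OF l] cB[OF l] n_pos by (simp add: divide_simps mult_ac)
        then have "1 / card (B l) * (\<Sum>i\<in>B l. (ee i)\<^sup>2) \<le> 2 * real L / n * (\<Sum>i\<in>B l. (ee i)\<^sup>2)"
          by (intro mult_right_mono sum_nonneg) auto
        then show "S l \<le> 2 * real L / n * (\<Sum>i\<in>B l. (ee i)\<^sup>2)" by (simp add: S_def)
      qed
      also have "\<dots> = 2 / n * (\<Sum>l=1..L. \<Sum>i\<in>B l. (ee i)\<^sup>2)"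
        unfolding fold_avg_cmult using L by (simp add: fold_avg_def)
      also have "(\<Sum>l=1..L. \<Sum>i\<in>B l. (ee i)\<^sup>2) = (\<Sum>i=1..n. (ee i)\<^sup>2)"
      proof -
        have "finite (B l)" if "l \<in> {1..L}" for l using cB[OF that] by (simp add: card_gt_0_iff)
        then show ?thesis unfolding cover[symmetric]
          using disj by (intro sum.UNION_disjoint[symmetric]) (auto simp: disjoint_family_on_def)
      qed
      finally have "fold_avg L S \<le> 2 * R" using E by simp
      then have "sqrt (fold_avg L S) \<le> sqrt (2 * R)" by simp
      moreover have "fold_avg L (\<lambda>l. sqrt (S l)) \<le> sqrt (fold_avg L S)" by (rule fold_avg_sqrt_le) (rule S0)
      ultimately show "fold_avg L (\<lambda>l. sqrt (S l)) \<le> sqrt (2 * R)" by linarith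
      show "0 \<le> 8 * sqrt (\<kappa> * R) * q" using k1 R0 t0 by (simp add: q_def)
    qed
    also have "8 * sqrt (\<kappa> * R) * q * sqrt (2 * R) \<le> 16 * \<kappa> * R * q"
    proof -
      have "sqrt (\<kappa> * R) * sqrt (2 * R) \<le> 2 * (\<kappa> * R)"
      proof (rule power2_le_imp_le)
        have "(sqrt (\<kappa> * R) * sqrt (2 * R))\<^sup>2 = (\<kappa> * R) * (2 * R)"
          unfolding power_mult_distrib using k1 R0 by simp
        also have "\<dots> = 2 * \<kappa> * R\<^sup>2" by (simp add: power2_eq_square)
        also have "\<dots> \<le> 4 * \<kappa>\<^sup>2 * R\<^sup>2"
        proof (intro mult_right_mono)
          have "1 * \<kappa> \<le> \<kappa> * \<kappa>" using k1 by (intro mult_right_mono) auto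
          then show "2 * \<kappa> \<le> 4 * \<kappa>\<^sup>2" unfolding power2_eq_square using k1 by linarith
        qed simp
        finally show "(sqrt (\<kappa> * R) * sqrt (2 * R))\<^sup>2 \<le> (2 * (\<kappa> * R))\<^sup>2" by (simp add: power_mult_distrib)
      qed (use k1 R0 in simp)
      then have "8 * q * (sqrt (\<kappa> * R) * sqrt (2 * R)) \<le> 8 * q * (2 * (\<kappa> * R))"
        using t0 by (intro mult_left_mono) (auto simp: q_def)
      then show ?thesis by (simp add: mult_ac)
    qed
    finally have "fold_avg L (\<lambda>l. pop (D l \<tau>)) \<le> fold_avg L (\<lambda>l. pop (D l \<tau>')) + 160 * \<kappa> * R * q" by (simp add: mult_ac)
    also have "160 * \<kappa> * R * q \<le> 300 * \<kappa> * R * sqrt (L * t0 / n)"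
    proof -
      have "sqrt 2 \<le> (15/8 :: real)" by (rule real_le_lsqrt) (auto simp: power2_eq_square)
      then have "q \<le> 15/8 * sqrt (L * t0 / n)" unfolding q_def real_sqrt_mult[of 2] using t0 by (intro mult_right_mono) auto
      then have "160 * \<kappa> * R * q \<le> 160 * \<kappa> * R * (15/8 * sqrt (L * t0 / n))" using k1 R0 by (intro mult_left_mono) auto
      then show ?thesis by simp
    qed
    finally show ?thesis by simp
  qed
qed

text \<open>Bessel's inequality bounds the fitted energy by the mean squared response on
  \<open>I\<close>, which is at most \<open>F\<close> times that of the full sample; the comparison
  constant \<open>\<kappa>0\<close> carries this to the population form. No threshold remains on the
  right.\<close>

lemma fit_gap_energy:
  assumes rule: "eigen_rule d U s" and I: "I \<subseteq> {1..n}" "I \<noteq> {}" and F: "real n \<le> F * real (card I)"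
    and k0: "0 \<le> \<kappa>0" and t: "0 \<le> t"
    and cmp: "\<And>m c. m \<le> min k d \<Longrightarrow> m \<le> vec_space.rank d (sample_cov d I (\<lambda>i. x i \<omega>)) \<Longrightarrow>
      pop (lincomb_fun {..<m} c (eigvec d U (sample_cov d I (\<lambda>i. x i \<omega>))))
        \<le> \<kappa>0 * smp I \<omega> (lincomb_fun {..<m} c (eigvec d U (sample_cov d I (\<lambda>i. x i \<omega>))))"
  shows "pop (fit_gap d U k b I (\<lambda>i. x i \<omega>) ee t)
    \<le> 2 * pop b + 4 * \<kappa>0 * F * (smp {1..n} \<omega> b + (\<Sum>i=1..n. (ee i)\<^sup>2) / n)"
proof -
  let ?xx = "\<lambda>i. x i \<omega>" and ?S = "sample_cov d I (\<lambda>i. x i \<omega>)" and ?y = "\<lambda>i. g i b \<omega> + ee i"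
  let ?R = "vec_space.rank d ?S" and ?w = "eigvec d U ?S"
  have fI: "finite I" by (rule finite_subset[OF I(1)]) simp
  have spec: "sample_spectrum {..<d} I (\<lambda>i. vec_index (?xx i)) ?R ?w (\<lambda>a. (s ?S a)\<^sup>2)"
    by (rule sample_spectrum_of_rule[OF rule fI I(2)])
  interpret S: sample_spectrum "{..<d}" I "\<lambda>i. vec_index (?xx i)" ?R ?w "\<lambda>a. (s ?S a)\<^sup>2" by (rule spec)
  have s0: "0 < s ?S a" if "a < ?R" for a
    using eig_scale_eq[OF rule fI I(2) that] S.mu_pos[OF that]
    by (metis eig_scale_def less_eq_real_def power2_eq_square power2_less_0 qf_self_nonneg real_sqrt_ge_0_iff mult_zero_left)
  define m where "m = min k ?R"
  have m: "m \<le> min k d" "m \<le> ?R" using rank_le_dim[OF rule fI, of ?xx] by (auto simp: m_def)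
  let ?v = "\<lambda>a. soft t (whitened_coeff d U s I ?xx ?y a)"
  define f where "f = lincomb_fun {..<m} (\<lambda>a. ?v a / sqrt ((s ?S a)\<^sup>2)) ?w"
  have fj: "fit_coord d U k I ?xx ?y t j = f j" if j: "j < d" for j
  proof -
    have "fit_coord d U k I ?xx ?y t j = lincomb_fun {..<m} (\<lambda>a. ?v a / s ?S a) ?w j"
      unfolding trunc_nct_eq_fit_coord[OF rule fI I(2) j, symmetric] trunc_nct_eq_lincomb(2)[OF rule fI j] m_def ..
    also have "\<dots> = f j"
      unfolding f_def lincomb_fun_def using s0 m by (intro sum.cong refl) (auto simp: less_imp_le)
    finally show ?thesis .
  qed
  have "smp I \<omega> f \<le> (\<Sum>i\<in>I. (?y i)\<^sup>2) / card I"
    unfolding f_def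
  proof (rule S.fitted_energy_le[OF m(2)])
    fix a assume "a < m"
    then have "sqrt ((s ?S a)\<^sup>2) = s ?S a" using s0 m by (simp add: less_imp_le)
    then show "\<bar>?v a\<bar> \<le> \<bar>(\<Sum>i\<in>I. ?y i * ip {..<d} (vec_index (?xx i)) (?w a)) / card I / sqrt ((s ?S a)\<^sup>2)\<bar>"
      using abs_soft_le[OF t] by (simp only: whitened_coeff_def)
  qed
  also have "\<dots> \<le> F * (2 * smp {1..n} \<omega> b + 2 * ((\<Sum>i=1..n. (ee i)\<^sup>2) / n))"
  proof -
    have c: "0 < real (card I)" using S.card_I_pos by simp
    have "(\<Sum>i\<in>I. (?y i)\<^sup>2) \<le> (\<Sum>i=1..n. (?y i)\<^sup>2)" using I by (intro sum_mono2) auto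
    also have "\<dots> \<le> (\<Sum>i=1..n. 2 * (g i b \<omega>)\<^sup>2 + 2 * (ee i)\<^sup>2)"
    proof (rule sum_mono)
      fix i
      show "(?y i)\<^sup>2 \<le> 2 * (g i b \<omega>)\<^sup>2 + 2 * (ee i)\<^sup>2"
        using zero_le_power2[of "g i b \<omega> - ee i"] by (simp add: power2_sum power2_diff)
    qed
    also have "\<dots> = real n * (2 * smp {1..n} \<omega> b + 2 * ((\<Sum>i=1..n. (ee i)\<^sup>2) / n))"
      using n_pos by (simp add: qf_def sum.distrib sum_distrib_left[symmetric] power2_eq_square distrib_left)
    also have "\<dots> \<le> F * real (card I) * (2 * smp {1..n} \<omega> b + 2 * ((\<Sum>i=1..n. (ee i)\<^sup>2) / n))"
      using F by (intro mult_right_mono add_nonneg_nonneg mult_nonneg_nonneg qf_self_nonneg divide_nonneg_nonneg sum_nonneg) auto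
    finally show ?thesis using c by (simp add: divide_le_eq mult_ac)
  qed
  finally have smpf: "smp I \<omega> f \<le> F * (2 * smp {1..n} \<omega> b + 2 * ((\<Sum>i=1..n. (ee i)\<^sup>2) / n))" .
  have "pop f \<le> \<kappa>0 * smp I \<omega> f" unfolding f_def by (rule cmp[OF m])
  also have "\<dots> \<le> \<kappa>0 * (F * (2 * smp {1..n} \<omega> b + 2 * ((\<Sum>i=1..n. (ee i)\<^sup>2) / n)))"
    by (rule mult_left_mono[OF smpf k0])
  finally have pf: "pop f \<le> \<kappa>0 * (F * (2 * smp {1..n} \<omega> b + 2 * ((\<Sum>i=1..n. (ee i)\<^sup>2) / n)))" .
  have "pop (fit_gap d U k b I ?xx ee t) = pop (\<lambda>j. f j + (-1) * b j)"
    unfolding popS_def ip_def by (intro sum.cong refl arg_cong2[where f = "(*)"] arg_cong[where f = "\<lambda>z. z\<^sup>2"]) (simp add: fit_gap_def fj)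
  also have "\<dots> \<le> 2 * pop f + 2 * pop (\<lambda>j. (-1) * b j)"
    unfolding popS_eq_wsq by (rule wsq_add_le) (use lam_pos in \<open>auto simp: less_imp_le\<close>)
  also have "pop (\<lambda>j. (-1) * b j) = pop b" unfolding popS_def ip_scale_right by simp
  finally have gap: "pop (fit_gap d U k b I ?xx ee t) \<le> 2 * pop f + 2 * pop b" .
  have "P \<le> 2 * pb + 4 * q * F' * (a + b')" if "P \<le> 2 * pf' + 2 * pb" "pf' \<le> q * (F' * (2 * a + 2 * b'))" for P pf' pb q F' a b' :: real
  proof -
    have "q * (F' * (2 * a + 2 * b')) = 2 * q * F' * (a + b')" by (simp add: algebra_simps)
    moreover have "4 * q * F' * (a + b') = 2 * (2 * q * F' * (a + b'))" by simp
    ultimately show ?thesis using that by linarith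
  qed
  from this[OF gap pf] show ?thesis .
qed

end

section \<open>Choice of the constants and logarithmic bookkeeping\<close>

text \<open>Since \<open>ln (1 / \<epsilon>) \<ge> 1\<close>, the truncation level is at most
  \<open>\<epsilon> powr (- 2 / 3)\<close>. Hence \<open>p * \<epsilon>\<close> is of order
  \<open>\<epsilon> powr (1/3)\<close>, small by the choice of \<open>c\<close>. Moreover
  \<open>p\<close> is at most of order \<open>n powr (1/3)\<close>, so for large \<open>n\<close> it
  also absorbs the part of the logarithm that comes from \<open>L \<le> n\<close> and is not covered
  by \<epsilon>.\<close>

lemma large_sample_numeric:
  fixes \<kappa> :: real
  assumes "1 \<le> \<kappa>"
  shows "\<exists>n0 c. 0 < n0 \<and> 0 < c \<and> (\<forall>n d L \<delta>. n0 \<le> n \<longrightarrow> 0 < d \<longrightarrow> 0 < L \<longrightarrow> L \<le> n \<longrightarrow> 0 < \<delta> \<longrightarrow> \<delta> < 1 \<longrightarrow>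
    sqrt (ln (real d / \<delta>) / real n) \<le> c \<longrightarrow>
    (let k = min (trunc_level (sqrt (ln (real d / \<delta>) / real n))) d in
      0 < k \<and> 16 * (1024 * \<kappa>) * real k \<le> real n \<and> exp (- real n) \<le> \<delta> / 8 \<and>
      (\<forall>m. n \<le> 4 * m \<longrightarrow> 216 * \<kappa> * real (min (8 * k) d) * sqrt (ln (16 * real L * (real d)\<^sup>2 / \<delta>) / real m) \<le> 1)))"
proof -
  \<comment> \<open>The two parts of the logarithm are allotted \<open>a / 2\<close> and
    \<open>a / 4\<close>; with the factors 4 and 8 in front of them they add up to
    \<open>4 * a = 1 / (216 * \<kappa>)\<^sup>2\<close>.\<close>
  define a where "a = 1 / (4 * (216 * \<kappa>)\<^sup>2)"
  have a: "0 < a" using assms by (simp add: a_def)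
  have "((\<lambda>n::nat. (16 * real n powr (1/3))\<^sup>2 * ln (16 * real n) / real n) \<longlongrightarrow> 0) sequentially" by real_asymp
  then have e1: "\<forall>\<^sub>F n in sequentially. (16 * real n powr (1/3))\<^sup>2 * ln (16 * real n) / real n < a / 2"
    using a by (intro order_tendstoD(2)) auto
  have "((\<lambda>n::nat. 16 * real n powr (1/3) / real n) \<longlongrightarrow> 0) sequentially" by real_asymp
  then have e2: "\<forall>\<^sub>F n in sequentially. 16 * real n powr (1/3) / real n < 1 / (16 * (1024 * \<kappa>))"
    using assms by (intro order_tendstoD(2)) auto
  obtain n0 where n0: "\<And>n. n0 \<le> n \<Longrightarrow> (16 * real n powr (1/3))\<^sup>2 * ln (16 * real n) / real n < a / 2"
    "\<And>n. n0 \<le> n \<Longrightarrow> 16 * real n powr (1/3) / real n < 1 / (16 * (1024 * \<kappa>))"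
    using eventually_conj[OF e1 e2] unfolding eventually_sequentially by auto
  \<comment> \<open>The entry \<open>exp (-1)\<close> gives
    \<open>ln (1 / \<epsilon>) \<ge> 1\<close>; the other one makes
    \<open>64 * \<epsilon> powr (2/3) \<le> a / 4\<close>.\<close>
  define c where "c = min (exp (-1)) ((a / 256) powr (3/2))"
  have c0: "0 < c" using a by (simp add: c_def)
  have main: "let k = min (trunc_level (sqrt (ln (real d / \<delta>) / real n))) d in
      0 < k \<and> 16 * (1024 * \<kappa>) * real k \<le> real n \<and> exp (- real n) \<le> \<delta> / 8 \<and>
      (\<forall>m. n \<le> 4 * m \<longrightarrow> 216 * \<kappa> * real (min (8 * k) d) * sqrt (ln (16 * real L * (real d)\<^sup>2 / \<delta>) / real m) \<le> 1)"
    if n: "max n0 6 \<le> n" and d: "0 < d" and L: "0 < L" "L \<le> n" and \<delta>: "0 < \<delta>" "\<delta> < 1"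
      and small: "sqrt (ln (real d / \<delta>) / real n) \<le> c" for n d L :: nat and \<delta> :: real
  proof -
    have npos: "0 < real n" "6 \<le> real n" "n0 \<le> n" using n by auto
    have d1: "1 \<le> real d" using d by simp
    define X where "X = ln (real d / \<delta>)"
    define \<epsilon> where "\<epsilon> = sqrt (X / real n)"
    have "1 < real d / \<delta>" using d1 \<delta> by (simp add: less_divide_eq)
    then have X: "0 < X" by (simp add: X_def)
    have Xeq: "X = ln (real d) - ln \<delta>" unfolding X_def using d1 \<delta> by (simp add: ln_div)
    have eps: "0 < \<epsilon>" "\<epsilon> \<le> c" "\<epsilon>\<^sup>2 = X / real n"
      using X npos small by (auto simp: \<epsilon>_def X_def)
    have epse: "\<epsilon> \<le> exp (-1)" using eps(2) by (simp add: c_def)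
    have e_half: "exp (-1) \<le> (1/2 :: real)"
      using exp_ge_add_one_self[of "1::real"] by (simp add: exp_minus inverse_eq_divide)
    define z where "z = \<epsilon> * ln (1 / \<epsilon>)"
    have "1 \<le> ln (1 / \<epsilon>)"
    proof -
      have "ln \<epsilon> \<le> ln (exp (-1))" using epse eps(1) by (subst ln_le_cancel_iff) auto
      then show ?thesis using eps(1) by (simp add: ln_div)
    qed
    then have z1: "\<epsilon> \<le> z" using eps(1) by (simp add: z_def)
    have z2: "z \<le> 1"
    proof -
      have "ln (1 / \<epsilon>) \<le> 1 / \<epsilon>" using ln_le_minus_one[of "1 / \<epsilon>"] eps(1) by simp
      then have "\<epsilon> * ln (1 / \<epsilon>) \<le> \<epsilon> * (1 / \<epsilon>)" using eps(1) by (intro mult_left_mono) auto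
      then show ?thesis using eps(1) by (simp add: z_def)
    qed
    have z0: "0 < z" using z1 eps(1) by simp
    define k where "k = trunc_level \<epsilon>"
    have keq: "k = nat \<lfloor>z powr (- 2 / 3)\<rfloor>" by (simp add: k_def trunc_level_def z_def)
    have "1 \<le> z powr (- 2 / 3)" using powr_mono2'[of "- 2 / 3" z 1] z0 z2 by simp
    then have k1: "1 \<le> k" unfolding keq by (simp add: le_nat_floor)
    have "real k \<le> z powr (- 2 / 3)" unfolding keq by (simp add: of_nat_floor)
    also have "\<dots> \<le> \<epsilon> powr (- 2 / 3)" by (rule powr_mono2') (use eps(1) z1 in auto)
    finally have kle: "real k \<le> \<epsilon> powr (- 2 / 3)" .
    define k0 where "k0 = min k d"
    define p where "p = min (8 * k0) d"
    have k0: "0 < k0" "k0 \<le> p" using k1 d by (auto simp: k0_def p_def)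
    have pk: "real p \<le> 8 * real k" by (simp add: p_def k0_def min_le_iff_disj)
    have pe: "(real p)\<^sup>2 * \<epsilon>\<^sup>2 \<le> a / 4"
    proof -
      have "real p * \<epsilon> \<le> 8 * \<epsilon> powr (- 2 / 3) * \<epsilon> powr 1"
        using pk kle eps(1) by (intro mult_mono) auto
      also have "\<dots> = 8 * \<epsilon> powr (1/3)" unfolding mult.assoc powr_add[symmetric] by simp
      finally have "(real p * \<epsilon>)\<^sup>2 \<le> (8 * \<epsilon> powr (1/3))\<^sup>2" using eps(1) by (intro power_mono) auto
      also have "\<dots> = 64 * \<epsilon> powr (2/3)" using eps(1) by (simp add: power_mult_distrib power2_eq_square powr_add[symmetric])
      also have "\<dots> \<le> 64 * ((a / 256) powr (3/2)) powr (2/3)"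
        using eps(1,2) by (intro mult_left_mono powr_mono2) (auto simp: c_def)
      also have "\<dots> = a / 4" using a by (simp add: powr_powr)
      finally show ?thesis by (simp add: power_mult_distrib)
    qed
    \<comment> \<open>For \<open>d = 1\<close> and \<delta> near one, \<epsilon> can be arbitrarily
      small, but then \<open>p \<le> 1\<close>. For \<open>d \<ge> 2\<close> the term
      \<open>ln d\<close> keeps \<open>\<epsilon>\<^sup>2\<close> above
      \<open>1 / (2 * n)\<close>.\<close>
    have pn: "real p \<le> 16 * real n powr (1/3)"
    proof (cases "d = 1")
      case True
      have "1 \<le> real n powr (1/3)" using npos by (intro ge_one_powr_ge_zero) auto
      moreover have "real p \<le> 1" using True by (simp add: p_def)
      ultimately show ?thesis by linarith
    next
      case False
      then have d2: "2 \<le> real d" using d by linarith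
      have "1/2 \<le> ln (2 :: real)" using ln2_ge_two_thirds by simp
      also have "\<dots> \<le> ln (real d)" using d2 by simp
      also have "\<dots> \<le> X" unfolding Xeq using \<delta> by simp
      finally have "1 / (2 * real n) \<le> \<epsilon>\<^sup>2" unfolding eps(3) using npos by (simp add: divide_simps)
      then have "(\<epsilon>\<^sup>2) powr (- 1 / 3) \<le> (1 / (2 * real n)) powr (- 1 / 3)"
        using npos by (intro powr_mono2') auto
      moreover have "\<epsilon> powr (- 2 / 3) = (\<epsilon>\<^sup>2) powr (- 1 / 3)"
      proof -
        have "(\<epsilon>\<^sup>2) powr (- 1 / 3) = (\<epsilon> powr 2) powr (- 1 / 3)" using eps(1) by simp
        also have "\<dots> = \<epsilon> powr (2 * (- 1 / 3))" by (rule powr_powr)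
        finally show ?thesis by simp
      qed
      ultimately have "\<epsilon> powr (- 2 / 3) \<le> (1 / (2 * real n)) powr (- 1 / 3)" by (simp only:)
      also have "\<dots> = 2 powr (1/3) * real n powr (1/3)"
        using npos by (simp add: powr_minus powr_divide powr_mult)
      also have "\<dots> \<le> 2 * real n powr (1/3)"
        using powr_mono[of "1/3" 1 "2::real"] by (intro mult_right_mono) auto
      finally show ?thesis using pk kle by linarith
    qed
    have c1: "16 * (1024 * \<kappa>) * real k0 \<le> real n"
    proof -
      have "real k0 \<le> real p" using k0(2) by simp
      also have "\<dots> \<le> 16 * real n powr (1/3)" by (rule pn)
      also have "\<dots> = 16 * real n powr (1/3) / real n * real n" using npos by simp
      also have "\<dots> \<le> 1 / (16 * (1024 * \<kappa>)) * real n" using n0(2)[OF npos(3)] npos by (intro mult_right_mono) auto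
      finally have "16 * (1024 * \<kappa>) * real k0 \<le> 16 * (1024 * \<kappa>) * (1 / (16 * (1024 * \<kappa>)) * real n)"
        using assms by (intro mult_left_mono) auto
      then show ?thesis using assms by simp
    qed
    \<comment> \<open>\<open>\<epsilon> \<le> 1/2\<close> forces \<delta> to be at least
      \<open>exp (- n / 2)\<close>; the other half of the exponent supplies the factor 1/8, as
      \<open>n \<ge> 6\<close>.\<close>
    have c2: "exp (- real n) \<le> \<delta> / 8"
    proof -
      have "\<epsilon>\<^sup>2 \<le> (1/2)\<^sup>2" using eps(1) epse e_half by (intro power_mono) auto
      then have "X / real n \<le> 1/4" unfolding eps(3) by (simp add: power2_eq_square)
      then have "X \<le> real n / 4" using npos by (simp add: divide_simps)
      moreover have "- ln \<delta> \<le> X" unfolding Xeq using d1 by simp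
      ultimately have "- real n / 2 \<le> ln \<delta>" using npos by linarith
      then have "exp (- real n / 2) \<le> exp (ln \<delta>)" by (simp only: exp_le_cancel_iff)
      then have d': "exp (- real n / 2) \<le> \<delta>" using \<delta> by simp
      have "exp (- real n / 2) \<le> exp (- 3)" using npos by simp
      also have "\<dots> = exp (-1) ^ 3" by (simp flip: exp_of_nat_mult)
      also have "\<dots> \<le> (1/2) ^ 3" using e_half by (intro power_mono) auto
      finally have e8: "exp (- real n / 2) \<le> 1/8" by (simp add: power3_eq_cube)
      have "exp (- real n) = exp (- real n / 2) * exp (- real n / 2)" by (simp flip: exp_add)
      also have "\<dots> \<le> \<delta> * (1/8)" using d' e8 \<delta> by (intro mult_mono) auto
      finally show ?thesis by simp
    qed
    have c3: "216 * \<kappa> * real p * sqrt (ln (16 * real L * (real d)\<^sup>2 / \<delta>) / real m) \<le> 1" if m: "n \<le> 4 * m" for m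
    proof -
      let ?T = "ln (16 * real L * (real d)\<^sup>2 / \<delta>)"
      have mr: "real n \<le> 4 * real m" using m by (simp only: of_nat_le_iff[symmetric, where 'a = real] of_nat_mult of_nat_numeral)
      then have m0: "0 < real m" using npos by linarith
      have Teq: "?T = ln (16 * real L) + (2 * ln (real d) - ln \<delta>)"
        using L d1 \<delta> by (simp add: ln_div ln_mult ln_realpow)
      have "1 \<le> 16 * real L * (real d)\<^sup>2 / \<delta>"
      proof -
        have "1 * 1 \<le> (16 * real L) * (real d)\<^sup>2" using L d1 by (intro mult_mono one_le_power) auto
        then show ?thesis using \<delta> by (simp add: le_divide_eq)
      qed
      then have T0: "0 \<le> ?T" by simp
      have T1: "?T \<le> ln (16 * real n) + 2 * X"
      proof -
        have "ln (16 * real L) \<le> ln (16 * real n)" using L npos by (subst ln_le_cancel_iff) auto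
        moreover have "ln \<delta> \<le> 0" using \<delta> by simp
        ultimately show ?thesis unfolding Teq Xeq right_diff_distrib by linarith
      qed
      have "(real p)\<^sup>2 * (?T / real m) \<le> (real p)\<^sup>2 * (4 * (ln (16 * real n) + 2 * X) / real n)"
      proof (rule mult_left_mono)
        have "?T / real m \<le> ?T / (real n / 4)" using mr m0 T0 npos by (intro divide_left_mono) auto
        also have "\<dots> \<le> (ln (16 * real n) + 2 * X) / (real n / 4)" using T1 npos by (intro divide_right_mono) auto
        finally show "?T / real m \<le> 4 * (ln (16 * real n) + 2 * X) / real n" by (simp add: mult.commute)
      qed simp
      also have "\<dots> = 4 * ((real p)\<^sup>2 * (ln (16 * real n) / real n)) + 8 * ((real p)\<^sup>2 * \<epsilon>\<^sup>2)"
      proof -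
        have "P * (4 * (l + 2 * Y) / N) = 4 * (P * (l / N)) + 8 * (P * (Y / N))" for P l Y N :: real
          by (cases "N = 0") (simp_all add: field_simps)
        then show ?thesis unfolding eps(3) .
      qed
      also have "\<dots> \<le> 4 * (a / 2) + 8 * (a / 4)"
      proof (intro add_mono mult_left_mono)
        have "(real p)\<^sup>2 * (ln (16 * real n) / real n) \<le> (16 * real n powr (1/3))\<^sup>2 * (ln (16 * real n) / real n)"
          using pn npos by (intro mult_right_mono power_mono) auto
        also have "\<dots> = (16 * real n powr (1/3))\<^sup>2 * ln (16 * real n) / real n" by (simp only: times_divide_eq_right)
        also have "\<dots> \<le> a / 2" by (rule less_imp_le[OF n0(1)[OF npos(3)]])
        finally show "(real p)\<^sup>2 * (ln (16 * real n) / real n) \<le> a / 2" .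
        show "(real p)\<^sup>2 * \<epsilon>\<^sup>2 \<le> a / 4" by (rule pe)
      qed auto
      also have "\<dots> = 1 / (216 * \<kappa>)\<^sup>2" by (simp add: a_def)
      finally have "(216 * \<kappa>)\<^sup>2 * ((real p)\<^sup>2 * (?T / real m)) \<le> (216 * \<kappa>)\<^sup>2 * (1 / (216 * \<kappa>)\<^sup>2)"
        by (intro mult_left_mono) auto
      then have le1: "(216 * \<kappa>)\<^sup>2 * ((real p)\<^sup>2 * (?T / real m)) \<le> 1" using assms by simp
      have sq: "(216 * \<kappa> * real p * sqrt (?T / real m))\<^sup>2 = (216 * \<kappa>)\<^sup>2 * ((real p)\<^sup>2 * (?T / real m))"
        using T0 by (simp only: power_mult_distrib mult.assoc) simp
      have "(216 * \<kappa> * real p * sqrt (?T / real m))\<^sup>2 \<le> 1\<^sup>2" unfolding sq one_power2 by (rule le1)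
      then show ?thesis by (rule power2_le_imp_le) simp
    qed
    have e: "\<epsilon> = sqrt (ln (real d / \<delta>) / real n)" by (simp add: \<epsilon>_def X_def)
    show ?thesis
      unfolding Let_def e[symmetric] k_def[symmetric] k0_def[symmetric] p_def[symmetric]
      using k0(1) c1 c2 c3 by blast
  qed
  show ?thesis
    using main c0 by (intro exI[of _ "max n0 6"] exI[of _ c]) auto
qed

text \<open>The bound on the root reads \<open>ln d - ln \<delta> \<le> q / 2\<close>, and the
  right-hand side is below \<open>ln 2\<close>; so \<open>ln d\<close> must vanish and
  \<open>- ln \<delta>\<close> is small.\<close>

lemma small_sample_numeric:
  fixes n d :: nat and q \<delta> :: real
  assumes q: "0 < q" "q \<le> 1" and n: "0 < n" "n \<le> n0" and d: "0 < d" and \<delta>: "0 < \<delta>" "\<delta> < 1"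
    and small: "sqrt (ln (real d / \<delta>) / real n) \<le> sqrt (q / (2 * real n0))"
  shows "d = 1" "1 - q / 2 \<le> \<delta>"
proof -
  have d1: "1 \<le> real d" using d by simp
  have n': "0 < real n" "real n \<le> real n0" using n by auto
  have X: "ln (real d / \<delta>) = ln (real d) - ln \<delta>" using d1 \<delta> by (simp add: ln_div)
  have "ln (real d / \<delta>) / real n \<le> q / (2 * real n0)" using small by simp
  also have "\<dots> \<le> q / (2 * real n)" using q n' by (intro divide_left_mono) auto
  finally have "real n * ((ln (real d) - ln \<delta>) / real n) \<le> real n * (q / (2 * real n))"
    unfolding X using n' by (intro mult_left_mono) auto
  then have le: "ln (real d) - ln \<delta> \<le> q / 2" using n' by simp
  have ld: "ln \<delta> \<le> 0" using \<delta> by simp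
  show "d = 1"
  proof (rule ccontr)
    assume "d \<noteq> 1"
    then have "2 \<le> real d" using d by linarith
    then have "ln 2 \<le> ln (real d)" by simp
    then show False using le ld q ln2_ge_two_thirds by linarith
  qed
  then have "- (q / 2) \<le> ln \<delta>" using le by simp
  then have "1 - q / 2 \<le> 1 + ln \<delta>" by linarith
  also have "\<dots> \<le> \<delta>" using ln_le_minus_one[OF \<delta>(1)] by simp
  finally show "1 - q / 2 \<le> \<delta>" .
qed

text \<open>For \<open>L \<ge> 2\<close> the quantity \<open>L * r / \<delta>\<close> is at least 2,
  so constants are absorbed by its powers: \<open>512 = 2 ^ 9\<close> by nine factors, the remaining
  \<open>L * r\<^sup>2 / \<delta>\<close> by two.\<close>

lemma log_union_bound:
  fixes L k r :: nat and \<delta> :: real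
  assumes L: "2 \<le> L" and r: "0 < r" and k: "k \<le> 3 * r" and \<delta>: "0 < \<delta>" "\<delta> < 1"
  shows "0 < ln (32 * real L * (real k + 1)\<^sup>2 / \<delta>)"
    and "ln (32 * real L * (real k + 1)\<^sup>2 / \<delta>) \<le> 11 * ln (real L * real r / \<delta>)"
    and "1 \<le> real L * ln (real L * real r / \<delta>)"
proof -
  let ?x = "real L * real r / \<delta>"
  have L2: "2 \<le> real L" and r1: "1 \<le> real r" using L r by auto
  have Lr: "2 \<le> real L * real r" using mult_mono[OF L2 r1] by simp
  then have x2: "2 \<le> ?x" using \<delta> by (simp add: le_divide_eq)
  have "1 * 1 < 32 * real L * (real k + 1)\<^sup>2"
    using L2 by (intro mult_less_le_imp_less one_le_power) auto
  then show "0 < ln (32 * real L * (real k + 1)\<^sup>2 / \<delta>)" using \<delta> by (intro ln_gt_zero) (simp add: less_divide_eq)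
  have kr: "real k \<le> 3 * real r" using k by (simp only: of_nat_le_iff[symmetric, where 'a = real] of_nat_mult of_nat_numeral)
  have "(real k + 1)\<^sup>2 \<le> (4 * real r)\<^sup>2" using kr r1 by (intro power_mono) auto
  then have "32 * real L * (real k + 1)\<^sup>2 \<le> 32 * real L * (16 * (real r)\<^sup>2)" by (intro mult_left_mono) (auto simp: power_mult_distrib)
  then have "32 * real L * (real k + 1)\<^sup>2 / \<delta> \<le> 32 * real L * (16 * (real r)\<^sup>2) / \<delta>" using \<delta> by (intro divide_right_mono) auto
  also have "\<dots> = 2 ^ 9 * (real L * (real r)\<^sup>2 / \<delta>)" by simp
  also have "\<dots> \<le> ?x ^ 9 * ?x\<^sup>2"
  proof (intro mult_mono power_mono x2)
    have "real L * (real r)\<^sup>2 * (1 / \<delta>) * 1 \<le> real L * (real r)\<^sup>2 * (1 / \<delta>) * (real L * (1 / \<delta>))"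
    proof (rule mult_left_mono)
      have "1 * 1 \<le> real L * (1 / \<delta>)" using L2 \<delta> by (intro mult_mono) (auto simp: le_divide_eq)
      then show "1 \<le> real L * (1 / \<delta>)" by simp
    qed (use \<delta> in simp)
    moreover have "(l * p / D)\<^sup>2 = l * p\<^sup>2 * (1 / D) * (l * (1 / D))" for l p D :: real
      by (cases "D = 0") (simp_all add: power2_eq_square field_simps)
    ultimately show "real L * (real r)\<^sup>2 / \<delta> \<le> ?x\<^sup>2" by simp
  qed (use \<delta> x2 in auto)
  also have "\<dots> = ?x ^ 11" by (simp flip: power_add)
  finally have "ln (32 * real L * (real k + 1)\<^sup>2 / \<delta>) \<le> ln (?x ^ 11)"
    using \<delta> L2 x2 by (subst ln_le_cancel_iff) (auto intro!: divide_pos_pos mult_pos_pos zero_less_power)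
  also have "\<dots> = 11 * ln ?x" using x2 by (simp add: ln_realpow)
  finally show "ln (32 * real L * (real k + 1)\<^sup>2 / \<delta>) \<le> 11 * ln ?x" .
  have "1/2 \<le> ln (2::real)" using ln2_ge_two_thirds by simp
  also have "\<dots> \<le> ln ?x" using x2 by (subst ln_le_cancel_iff) auto
  finally have "2 * (1/2) \<le> real L * ln ?x" using L2 by (intro mult_mono) auto
  then show "1 \<le> real L * ln ?x" by simp
qed

text \<open>\<open>ln (2 / \<delta>)\<close> is at least 1/2, so the additive
  \<open>2 / \<alpha>\<close> becomes part of a multiplicative constant.\<close>

lemma log_shift_le:
  fixes b \<delta> \<alpha> c :: real
  assumes "0 < \<delta>" "\<delta> < 1" "0 < \<alpha>" "0 \<le> a" "x \<le> a * ln (2 / \<delta>)" "0 \<le> x"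
  shows "(x + 2 / \<alpha>) powr (2 / \<alpha>) \<le> (a + 4 / \<alpha>) powr (2 / \<alpha>) * ln (2 / \<delta>) powr (2 / \<alpha>)"
proof -
  have "ln 2 \<le> ln (2 / \<delta>)" using assms by (subst ln_le_cancel_iff) (auto simp: le_divide_eq)
  then have h: "1/2 \<le> ln (2 / \<delta>)" using ln2_ge_two_thirds by linarith
  have "4 / \<alpha> * (1/2) \<le> 4 / \<alpha> * ln (2 / \<delta>)" using assms h by (intro mult_left_mono) auto
  then have "x + 2 / \<alpha> \<le> (a + 4 / \<alpha>) * ln (2 / \<delta>)" using assms(5) by (simp add: distrib_right)
  then have "(x + 2 / \<alpha>) powr (2 / \<alpha>) \<le> ((a + 4 / \<alpha>) * ln (2 / \<delta>)) powr (2 / \<alpha>)"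
    using assms by (intro powr_mono2) auto
  also have "\<dots> = (a + 4 / \<alpha>) powr (2 / \<alpha>) * ln (2 / \<delta>) powr (2 / \<alpha>)"
    using assms h by (intro powr_mult)
  finally show ?thesis .
qed

section \<open>The good events for large and for bounded samples\<close>

context random_design
begin

text \<open>Shares of \<delta>: \<open>1/4 + 1/8\<close> for the design, 1/8 each for the sample
  form at \<open>b\<close>, the noise energy and the hold-out blocks. The factor \<open>10^6\<close>
  dominates \<open>2 + 24 * (12 + 32 * 1024 * \<kappa>)\<close>, which collects the comparison
  constant and the response energy.\<close>

lemma large_sample_event:
  fixes L k :: nat and B :: "nat \<Rightarrow> nat set" and \<delta> :: real
  defines "E \<equiv> 2 * \<sigma>\<^sup>2 * (ln (16 / \<delta>) + 2 / \<alpha>) powr (2 / \<alpha>)"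
    and "t0 \<equiv> ln (32 * real L * (real (min k d) + 1)\<^sup>2 / \<delta>)"
  assumes rule: "eigen_rule d U s" and L: "0 < L"
    and B: "\<And>l. l \<in> {1..L} \<Longrightarrow> B l \<subseteq> {1..n}" "\<And>l. l \<in> {1..L} \<Longrightarrow> B l \<noteq> {}"
      "\<And>l. l \<in> {1..L} \<Longrightarrow> n \<le> 4 * card ({1..n} - B l)"
    and \<delta>: "0 < \<delta>" "\<delta> < 1" and k: "0 < min k d"
    and kn: "16 * (1024 * \<kappa>) * real (min k d) \<le> real n" and en: "exp (- real n) \<le> \<delta> / 8"
    and small: "\<And>m. n \<le> 4 * m \<Longrightarrow>
      216 * \<kappa> * real (min (8 * min k d) d) * sqrt (ln (16 * real L * (real d)\<^sup>2 / \<delta>) / real m) \<le> 1"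
  shows "\<exists>N\<in>events. prob N \<le> \<delta> \<and> (\<forall>\<omega>\<in>space M - N.
    (\<forall>l\<in>{1..L}. \<forall>t\<ge>0. pop (fit_gap d U k b ({1..n} - B l) (\<lambda>i. x i \<omega>) (\<lambda>i. e i \<omega>) t) \<le> 10^6 * \<kappa> * (pop b + E)) \<and>
    (\<Sum>i=1..n. (e i \<omega>)\<^sup>2) / n \<le> E \<and>
    min k d \<le> 3 * vec_space.rank d (sample_cov d {1..n} (\<lambda>i. x i \<omega>)) \<and>
    (\<forall>l\<in>{1..L}. t0 \<le> real (card (B l)) \<longrightarrow>
      \<not> cv_fails U k b t0 ({1..n} - B l) (B l) (\<lambda>i. x i \<omega>) (\<lambda>i. x i \<omega>) (\<lambda>i. e i \<omega>)))"
proof -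
  let ?k = "min k d" and ?I = "\<lambda>l. {1..n} - B l"
  define p where "p = min (8 * ?k) d"
  \<comment> \<open>At this level a union over \<open>L\<close> folds with at most
    \<open>2 * (real d)\<^sup>2\<close> two-sided tests each costs
    \<open>\<delta> / 4\<close>.\<close>
  define t1 where "t1 = ln (16 * real L * (real d)\<^sup>2 / \<delta>)"
  have k1: "1 \<le> \<kappa>" by (rule one_le_kappa)
  have d1: "1 \<le> real d" "1 \<le> real L" using d_pos L by auto
  have p1: "1 \<le> real p" "real p \<le> real d" using k d_pos by (auto simp: p_def)
  have dL: "1 \<le> real L * (real d)\<^sup>2" using mult_mono[of 1 "real L" 1 "(real d)\<^sup>2"] d1 by simp
  have "1 < 16 * real L * (real d)\<^sup>2 / \<delta>" using dL \<delta> by (simp add: less_divide_eq)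
  then have t1: "0 < t1" and et1: "exp (- t1) = \<delta> / (16 * real L * (real d)\<^sup>2)"
    using \<delta> d1 by (auto simp: t1_def exp_minus)
  have sq: "216 * \<kappa> * p * sqrt (t1 / m) \<le> 1" if "n \<le> 4 * m" for m :: nat
    using small[OF that] by (simp add: t1_def p_def)
  have kp: "1 \<le> \<kappa> * p" using mult_mono[of 1 \<kappa> 1 "real p"] k1 p1 by simp
  have sq': "sqrt (t1 / m) \<le> 1 / 216 \<and> 36 * \<kappa> * sqrt (t1 / m) \<le> 1/2" if "n \<le> 4 * m" for m :: nat
  proof -
    have s0: "0 \<le> sqrt (t1 / m)" using t1 by simp
    have a: "\<kappa> * 1 * sqrt (t1 / m) \<le> \<kappa> * real p * sqrt (t1 / m)" using s0 k1 p1 by (intro mult_right_mono mult_left_mono) auto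
    have b: "1 * sqrt (t1 / m) \<le> \<kappa> * sqrt (t1 / m)" using s0 k1 by (intro mult_right_mono) auto
    have c: "216 * (\<kappa> * real p * sqrt (t1 / m)) \<le> 1" using sq[OF that] by (simp only: mult.assoc)
    show ?thesis using a b c s0 by simp
  qed
  have t1m: "t1 \<le> real m" if m: "n \<le> 4 * m" for m :: nat
  proof -
    have m0: "0 < real m" using m n_pos by (cases m) auto
    have "sqrt (t1 / m) \<le> 1" using sq'[OF m] by linarith
    then have "t1 / m \<le> 1" by (simp only: real_sqrt_le_1_iff)
    then show ?thesis using m0 by (simp only: divide_le_eq_1_pos)
  qed
  have n4: "n \<le> 4 * n" by simp
  obtain N1 where N1: "N1 \<in> events" "prob N1 \<le> real L * ((real p)\<^sup>2 + 1) * (2 * exp (- t1)) + exp (- real n)"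
    and cmp: "\<And>\<omega> l R w mu. \<omega> \<in> space M - N1 \<Longrightarrow> l \<in> {1..L} \<Longrightarrow>
      sample_spectrum {..<d} (?I l) (\<lambda>i. vec_index (x i \<omega>)) R w mu \<Longrightarrow>
      spectral_comparison d (?I l) (\<lambda>i. vec_index (x i \<omega>)) R w mu u lam n ?k p (1024 * \<kappa>)"
  proof -
    have "\<exists>N\<in>events. prob N \<le> real L * ((real p)\<^sup>2 + 1) * (2 * exp (- t1)) + exp (- real n) \<and>
      (\<forall>\<omega>\<in>space M - N. \<forall>l\<in>{1..L}. \<forall>R w mu.
        sample_spectrum {..<d} (?I l) (\<lambda>i. vec_index (x i \<omega>)) R w mu \<longrightarrow>
        spectral_comparison d (?I l) (\<lambda>i. vec_index (x i \<omega>)) R w mu u lam n ?k p (1024 * \<kappa>))"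
    proof (rule design_event[where I = ?I and L = L and k = ?k and p = p and t = t1])
      show "?I l \<subseteq> {1..n}" for l by blast
      show "n \<le> 4 * card (?I l)" if "l \<in> {1..L}" for l by (rule B(3)[OF that])
      show "t1 \<le> real (card (?I l))" if "l \<in> {1..L}" for l by (rule t1m[OF B(3)[OF that]])
      show "216 * \<kappa> * p * sqrt (t1 / card (?I l)) \<le> 1" if "l \<in> {1..L}" for l by (rule sq[OF B(3)[OF that]])
      show "p = min (8 * ?k) d" by (rule p_def)
      show "0 < ?k" by (rule k)
      show "0 < t1" by (rule t1)
      show "16 * (1024 * \<kappa>) * ?k \<le> n" by (rule kn)
    qed
    then show ?thesis
    proof (elim bexE conjE)
      fix N
      assume N: "N \<in> events" "prob N \<le> real L * ((real p)\<^sup>2 + 1) * (2 * exp (- t1)) + exp (- real n)"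
        and c: "\<forall>\<omega>\<in>space M - N. \<forall>l\<in>{1..L}. \<forall>R w mu.
          sample_spectrum {..<d} (?I l) (\<lambda>i. vec_index (x i \<omega>)) R w mu \<longrightarrow>
          spectral_comparison d (?I l) (\<lambda>i. vec_index (x i \<omega>)) R w mu u lam n ?k p (1024 * \<kappa>)"
      show ?thesis
      proof (rule that[OF N])
        fix \<omega> l R w mu
        assume "\<omega> \<in> space M - N" "l \<in> {1..L}" "sample_spectrum {..<d} (?I l) (\<lambda>i. vec_index (x i \<omega>)) R w mu"
        then show "spectral_comparison d (?I l) (\<lambda>i. vec_index (x i \<omega>)) R w mu u lam n ?k p (1024 * \<kappa>)"
          by (rule bspec[OF bspec[OF c], THEN spec, THEN spec, THEN spec, THEN mp])
      qed
    qed
  qed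
  have pN1: "prob N1 \<le> \<delta> / 4 + \<delta> / 8"
  proof -
    have "(real p)\<^sup>2 \<le> (real d)\<^sup>2" using p1 by (intro power_mono) auto
    moreover have "1 \<le> (real d)\<^sup>2" using d1 by simp
    ultimately have pd: "(real p)\<^sup>2 + 1 \<le> 2 * (real d)\<^sup>2" by linarith
    have "real L * ((real p)\<^sup>2 + 1) * (2 * exp (- t1)) \<le> real L * (2 * (real d)\<^sup>2) * (2 * exp (- t1))"
      by (intro mult_right_mono mult_left_mono pd) auto
    also have "\<dots> = \<delta> / 4" unfolding et1 using d1 by simp
    finally show ?thesis using N1(2) en by linarith
  qed
  let ?N2 = "{\<omega>\<in>space M. 36 * \<kappa> * sqrt (t1 / card {1..n}) * pop b < \<bar>smp {1..n} \<omega> b - pop b\<bar>}"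
  have N2: "?N2 \<in> events"
  proof -
    have gen: "{\<omega>\<in>space M. c < \<bar>f \<omega> - c'\<bar>} \<in> events" if [measurable]: "f \<in> borel_measurable M" for f :: "'w \<Rightarrow> real" and c c'
      by measurable
    show ?thesis
      by (rule gen) (unfold qf_def, intro borel_measurable_divide borel_measurable_sum borel_measurable_times borel_measurable_const g_meas)
  qed
  have pN2: "prob ?N2 \<le> \<delta> / 8"
  proof -
    have "prob ?N2 \<le> 2 * exp (- t1)"
      using n_pos t1 t1m[OF n4] by (intro quadratic_deviation) auto
    also have "\<dots> \<le> \<delta> / 8"
    proof -
      have "\<delta> / (16 * (real L * (real d)\<^sup>2)) \<le> \<delta> / (16 * 1)" using dL \<delta> by (intro divide_left_mono mult_left_mono) auto
      then show ?thesis unfolding et1 by (simp add: mult.assoc)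
    qed
    finally show ?thesis .
  qed
  obtain N3 where N3: "N3 \<in> events" "prob N3 \<le> \<delta> / 8"
    and noiseE: "\<And>\<omega>. \<omega> \<in> space M - N3 \<Longrightarrow> (\<Sum>i=1..n. (e i \<omega>)\<^sup>2) / n \<le> E"
  proof -
    have h: "2 / (\<delta> / 8) = 16 / \<delta>" by simp
    show ?thesis using noise_event[of "\<delta> / 8", unfolded h] \<delta> that unfolding E_def by auto
  qed
  have kk: "0 < (real ?k + 1)\<^sup>2" by (intro zero_less_power) simp
  \<comment> \<open>With \<open>(min k d + 1)\<^sup>2\<close> pairs and the bound
    \<open>4 * exp (- t0)\<close> for each, one fold costs
    \<open>\<delta> / (8 * L)\<close>.\<close>
  have et0: "exp (- t0) = \<delta> / (32 * real L * (real ?k + 1)\<^sup>2)"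
    unfolding t0_def using \<delta> d1 kk by (subst exp_minus, subst exp_ln) (auto intro!: divide_pos_pos mult_pos_pos)
  have t0: "0 < t0"
  proof -
    have "1 * 1 < 32 * real L * (real ?k + 1)\<^sup>2" using d1 by (intro mult_less_le_imp_less one_le_power) auto
    then show ?thesis unfolding t0_def using \<delta> by (intro ln_gt_zero) (simp add: less_divide_eq)
  qed
  have "\<forall>l\<in>{1..L}. \<exists>N. N \<in> events \<and> prob N \<le> \<delta> / (8 * L) \<and> (t0 \<le> real (card (B l)) \<longrightarrow>
    (\<forall>\<omega>\<in>space M - N. \<not> cv_fails U k b t0 (?I l) (B l) (\<lambda>i. x i \<omega>) (\<lambda>i. x i \<omega>) (\<lambda>i. e i \<omega>)))"
  proof
    fix l assume l: "l \<in> {1..L}"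
    show "\<exists>N. N \<in> events \<and> prob N \<le> \<delta> / (8 * L) \<and> (t0 \<le> real (card (B l)) \<longrightarrow>
      (\<forall>\<omega>\<in>space M - N. \<not> cv_fails U k b t0 (?I l) (B l) (\<lambda>i. x i \<omega>) (\<lambda>i. x i \<omega>) (\<lambda>i. e i \<omega>)))"
    proof (cases "t0 \<le> real (card (B l))")
      case True
      obtain N where N: "N \<in> events" "prob N \<le> (real ?k + 1)\<^sup>2 * (4 * exp (- t0))"
        "\<forall>\<omega>\<in>space M - N. \<not> cv_fails U k b t0 (?I l) (B l) (\<lambda>i. x i \<omega>) (\<lambda>i. x i \<omega>) (\<lambda>i. e i \<omega>)"
      proof -
        have I: "?I l \<subseteq> {1..n}" "?I l \<inter> B l = {}" by blast+
        show ?thesis using fold_event[OF rule I(1) B(1)[OF l] B(2)[OF l] I(2) t0 True, where k = k and b = b] that by blast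
      qed
      have "(real ?k + 1)\<^sup>2 * (4 * exp (- t0)) = \<delta> / (8 * L)" unfolding et0 using d1 kk by (simp add: field_simps)
      then show ?thesis using N by (intro exI[of _ N]) auto
    next
      \<comment> \<open>Nothing is claimed for a block shorter than \<open>t0\<close>, so the empty
        event serves.\<close>
      case False
      then show ?thesis using \<delta> by (intro exI[of _ "{}"]) auto
    qed
  qed
  from bchoice[OF this] obtain NF where NF: "\<And>l. l \<in> {1..L} \<Longrightarrow> NF l \<in> events" "\<And>l. l \<in> {1..L} \<Longrightarrow> prob (NF l) \<le> \<delta> / (8 * L)"
    "\<And>l \<omega>. l \<in> {1..L} \<Longrightarrow> t0 \<le> real (card (B l)) \<Longrightarrow> \<omega> \<in> space M - NF l \<Longrightarrow>
      \<not> cv_fails U k b t0 (?I l) (B l) (\<lambda>i. x i \<omega>) (\<lambda>i. x i \<omega>) (\<lambda>i. e i \<omega>)"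
    by blast
  let ?NF = "\<Union>l\<in>{1..L}. NF l"
  have mNF: "?NF \<in> events" using NF(1) by (intro sets.finite_UN) auto
  have pNF: "prob ?NF \<le> \<delta> / 8"
  proof -
    have "prob ?NF \<le> (\<Sum>l\<in>{1..L}. prob (NF l))" using NF(1) by (intro finite_measure_subadditive_finite) auto
    also have "\<dots> \<le> (\<Sum>l\<in>{1..L}. \<delta> / (8 * L))" by (intro sum_mono NF(2))
    also have "\<dots> = \<delta> / 8" using d1 by simp
    finally show ?thesis .
  qed
  let ?N = "(N1 \<union> ?N2) \<union> (N3 \<union> ?NF)"
  have m12: "N1 \<union> ?N2 \<in> events" by (rule sets.Un[OF N1(1) N2])
  have m34: "N3 \<union> ?NF \<in> events" by (rule sets.Un[OF N3(1) mNF])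
  have mN: "?N \<in> events" by (rule sets.Un[OF m12 m34])
  have pN: "prob ?N \<le> \<delta>"
  proof -
    have sum: "a \<le> \<delta>"
      if "a \<le> p + q" "p \<le> p1 + p2" "q \<le> q1 + q2" "p1 \<le> \<delta> / 4 + \<delta> / 8" "p2 \<le> \<delta> / 8" "q1 \<le> \<delta> / 8" "q2 \<le> \<delta> / 8"
      for a p q p1 p2 q1 q2 :: real
      using that \<delta> by linarith
    show ?thesis
      by (rule sum[OF measure_Un_le[OF m12 m34] measure_Un_le[OF N1(1) N2] measure_Un_le[OF N3(1) mNF] pN1 pN2 N3(2) pNF])
  qed
  have E0: "0 \<le> E" by (simp add: E_def)
  have Ine: "?I l \<noteq> {}" "finite (?I l)" if "l \<in> {1..L}" for l
  proof
    assume "?I l = {}"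
    then have "card (?I l) = 0" by (simp only: card.empty)
    then show False using B(3)[OF that] n_pos by linarith
  qed simp
  have good: "pop (fit_gap d U k b (?I l) (\<lambda>i. x i \<omega>) (\<lambda>i. e i \<omega>) t) \<le> 10^6 * \<kappa> * (pop b + E)"
    if w: "\<omega> \<in> space M - ?N" and l: "l \<in> {1..L}" and t: "0 \<le> t" for \<omega> l t
  proof -
    let ?S = "sample_cov d (?I l) (\<lambda>i. x i \<omega>)"
    have w1: "\<omega> \<in> space M - N1" "\<omega> \<in> space M - N3" "\<omega> \<in> space M" "\<omega> \<notin> ?N2" using w by auto
    interpret C: spectral_comparison d "?I l" "\<lambda>i. vec_index (x i \<omega>)" "vec_space.rank d ?S" "eigvec d U ?S"
      "\<lambda>a. (s ?S a)\<^sup>2" u lam n ?k p "1024 * \<kappa>"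
      by (rule cmp[OF w1(1) l sample_spectrum_of_rule[OF rule Ine(2)[OF l] Ine(1)[OF l]]])
    have F: "real n \<le> 4 * real (card (?I l))" using B(3)[OF l] by linarith
    let ?K = "12 + 32 * (1024 * \<kappa>)"
    have "pop (fit_gap d U k b (?I l) (\<lambda>i. x i \<omega>) (\<lambda>i. e i \<omega>) t)
        \<le> 2 * pop b + 4 * ?K * 4 * (smp {1..n} \<omega> b + (\<Sum>i=1..n. (e i \<omega>)\<^sup>2) / n)"
      by (rule fit_gap_energy[OF rule _ Ine(1)[OF l] F _ t C.comparison]) (use k1 in auto)
    also have "\<dots> \<le> 2 * pop b + 4 * ?K * 4 * (3/2 * pop b + E)"
    proof (intro add_left_mono mult_left_mono add_mono noiseE[OF w1(2)])
      have "\<bar>smp {1..n} \<omega> b - pop b\<bar> \<le> 36 * \<kappa> * sqrt (t1 / card {1..n}) * pop b" using w1(3,4) by simp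
      also have "\<dots> \<le> 1/2 * pop b" using sq'[OF n4] by (intro mult_right_mono pop_nonneg) auto
      finally show "smp {1..n} \<omega> b \<le> 3/2 * pop b" by linarith
    qed (use k1 in auto)
    also have "\<dots> \<le> 10^6 * \<kappa> * (pop b + E)"
    proof -
      have "3/2 * pop b + E \<le> 3/2 * (pop b + E)" using E0 by simp
      then have "4 * ?K * 4 * (3/2 * pop b + E) \<le> 4 * ?K * 4 * (3/2 * (pop b + E))"
        by (rule mult_left_mono) (use k1 in simp)
      moreover have "2 * pop b \<le> 2 * (pop b + E)" using E0 by simp
      moreover have "4 * K * 4 * (3/2 * z) = 24 * K * z" for K z :: real by simp
      ultimately have "2 * pop b + 4 * ?K * 4 * (3/2 * pop b + E) \<le> 2 * (pop b + E) + 24 * ?K * (pop b + E)"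
        by (metis add_mono)
      also have "\<dots> = (2 + 24 * ?K) * (pop b + E)" by (rule distrib_right[symmetric])
      also have "\<dots> \<le> 10^6 * \<kappa> * (pop b + E)"
        using k1 pop_nonneg[of b] E0 by (intro mult_right_mono) auto
      finally show ?thesis .
    qed
    finally show ?thesis .
  qed
  \<comment> \<open>The head isometry on the first training set bounds its rank from below, and the
    full sample has at least that rank.\<close>
  have rank: "?k \<le> 3 * vec_space.rank d (sample_cov d {1..n} (\<lambda>i. x i \<omega>))" if w: "\<omega> \<in> space M - ?N" for \<omega>
  proof -
    have l: "1 \<in> {1..L}" using L by simp
    let ?S = "sample_cov d (?I 1) (\<lambda>i. x i \<omega>)"
    have w1: "\<omega> \<in> space M - N1" using w by auto
    interpret C: spectral_comparison d "?I 1" "\<lambda>i. vec_index (x i \<omega>)" "vec_space.rank d ?S" "eigvec d U ?S"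
      "\<lambda>a. (s ?S a)\<^sup>2" u lam n ?k p "1024 * \<kappa>"
      by (rule cmp[OF w1 l sample_spectrum_of_rule[OF rule Ine(2)[OF l] Ine(1)[OF l]]])
    have "vec_space.rank d ?S \<le> vec_space.rank d (sample_cov d {1..n} (\<lambda>i. x i \<omega>))"
      using n_pos by (intro C.rank_mono[OF sample_spectrum_of_rule[OF rule]]) auto
    moreover have "?k \<le> p" by (simp add: p_def)
    ultimately show ?thesis using C.rank_ge by linarith
  qed
  show ?thesis
  proof (rule bexI[OF _ mN], intro conjI ballI allI impI)
    fix \<omega> assume w: "\<omega> \<in> space M - ?N"
    have w': "\<omega> \<in> space M - N3" "l \<in> {1..L} \<Longrightarrow> \<omega> \<in> space M - NF l" for l using w by blast+
    show "(\<Sum>i=1..n. (e i \<omega>)\<^sup>2) / n \<le> E" by (rule noiseE[OF w'(1)])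
    show "\<not> cv_fails U k b t0 (?I l) (B l) (\<lambda>i. x i \<omega>) (\<lambda>i. x i \<omega>) (\<lambda>i. e i \<omega>)"
      if "l \<in> {1..L}" "t0 \<le> real (card (B l))" for l
      by (rule NF(3)[OF that w'(2)[OF that(1)]])
  qed (rule pN good rank; assumption)+
qed

text \<open>In dimension one every error is a multiple of \<open>b\<close>, so a lower bound on the
  squares of all observations along \<open>b\<close> compares the two forms on every training set,
  with constant 2. It holds with probability at least \<open>q\<close>; the response energy and the
  noise take \<open>q / 4\<close> each, which leaves at least \<open>q / 2\<close>.\<close>

lemma small_sample_event:
  assumes rule: "eigen_rule d U s" and d: "d = 1" and b: "0 < pop b"
    and q: "0 < q" "q \<le> 1" "q \<le> (1 / (16 * \<kappa>\<^sup>2)) ^ n"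
  defines "E \<equiv> 2 * \<sigma>\<^sup>2 * (ln (8 / q) + 2 / \<alpha>) powr (2 / \<alpha>)"
  shows "\<exists>N\<in>events. prob N \<le> 1 - q / 2 \<and> (\<forall>\<omega>\<in>space M - N.
    (\<forall>I t. I \<subseteq> {1..n} \<longrightarrow> I \<noteq> {} \<longrightarrow> 0 \<le> t \<longrightarrow>
      pop (fit_gap d U k b I (\<lambda>i. x i \<omega>) (\<lambda>i. e i \<omega>) t) \<le> 2 * pop b + 8 * real n * (4 / q * pop b + E)) \<and>
    0 < vec_space.rank d (sample_cov d {1..n} (\<lambda>i. x i \<omega>)))"
proof -
  let ?A = "{\<omega>\<in>space M. \<forall>i\<in>{1..n}. pop b / 2 \<le> (g i b \<omega>)\<^sup>2}"
  have gm: "i \<in> {1..n} \<Longrightarrow> g i b \<in> borel_measurable M" for i by (rule g_meas)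
  have gen: "{\<omega>\<in>space M. c \<le> f \<omega>} \<in> events"
    if [measurable]: "f \<in> borel_measurable M" for f :: "'w \<Rightarrow> real" and c
    by measurable
  have A: "?A \<in> events"
  proof (rule sets.sets_Collect_finite_All)
    show "{\<omega>\<in>space M. pop b / 2 \<le> (g i b \<omega>)\<^sup>2} \<in> events" if "i \<in> {1..n}" for i
      by (rule gen[OF borel_measurable_power[OF g_meas[OF that]]])
  qed simp
  have pA: "q \<le> prob ?A" by (rule order.trans[OF q(3) small_ball_all[OF b]])
  have smpm: "(\<lambda>\<omega>. smp {1..n} \<omega> b) \<in> borel_measurable M"
    unfolding qf_def by (intro borel_measurable_divide borel_measurable_sum borel_measurable_times borel_measurable_const gm)
  let ?N2 = "{\<omega>\<in>space M. 4 / q * pop b \<le> smp {1..n} \<omega> b}"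
  have N2: "?N2 \<in> events" by (rule gen[OF smpm])
  have pN2: "prob ?N2 \<le> q / 4"
  proof -
    have int: "integrable M (\<lambda>\<omega>. (g i b \<omega>)\<^sup>2)" if "i \<in> {1..n}" for i
    proof (rule ccontr)
      assume "\<not> integrable M (\<lambda>\<omega>. (g i b \<omega>)\<^sup>2)"
      then have "expectation (\<lambda>\<omega>. (g i b \<omega>)\<^sup>2) = 0" by (rule not_integrable_integral_eq)
      then show False using second_moment[OF that, of b] b by linarith
    qed
    have eq: "smp {1..n} \<omega> b = (\<Sum>i=1..n. (g i b \<omega>)\<^sup>2) / n" for \<omega> by (simp add: qf_def power2_eq_square)
    have "expectation (\<lambda>\<omega>. smp {1..n} \<omega> b) = (\<Sum>i=1..n. expectation (\<lambda>\<omega>. (g i b \<omega>)\<^sup>2)) / n"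
      unfolding eq using int by (simp add: Bochner_Integration.integral_sum)
    also have "\<dots> = pop b" using n_pos by (simp add: second_moment)
    finally have e: "expectation (\<lambda>\<omega>. smp {1..n} \<omega> b) = pop b" .
    have "integrable M (\<lambda>\<omega>. smp {1..n} \<omega> b)" unfolding eq
      by (intro Bochner_Integration.integrable_divide_zero impI Bochner_Integration.integrable_sum int)
    then have "prob ?N2 \<le> expectation (\<lambda>\<omega>. smp {1..n} \<omega> b) / (4 / q * pop b)"
      using q b by (intro integral_Markov_inequality_measure[where A = "{}"]) (auto intro!: AE_I2 qf_self_nonneg)
    also have "\<dots> = q / 4" unfolding e using b by simp
    finally show ?thesis .
  qed
  obtain N3 where N3: "N3 \<in> events" "prob N3 \<le> q / 4"
    and noiseE: "\<And>\<omega>. \<omega> \<in> space M - N3 \<Longrightarrow> (\<Sum>i=1..n. (e i \<omega>)\<^sup>2) / n \<le> E"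
  proof -
    have h: "2 / (q / 4) = 8 / q" by simp
    show ?thesis using noise_event[of "q / 4", unfolded h] q that unfolding E_def by auto
  qed
  let ?N = "(space M - ?A) \<union> (?N2 \<union> N3)"
  have m1: "space M - ?A \<in> events" by (rule sets.compl_sets[OF A])
  have m2: "?N2 \<union> N3 \<in> events" by (rule sets.Un[OF N2 N3(1)])
  have mN: "?N \<in> events" by (rule sets.Un[OF m1 m2])
  have sum: "a \<le> 1 - q / 2"
    if "a \<le> p + p'" "p' \<le> p1 + p2" "p = 1 - pa" "q \<le> pa" "p1 \<le> q / 4" "p2 \<le> q / 4" for a p p' p1 p2 pa :: real
    using that by linarith
  have pN: "prob ?N \<le> 1 - q / 2"
    by (rule sum[OF measure_Un_le[OF m1 m2] measure_Un_le[OF N2 N3(1)] prob_compl[OF A] pA pN2 N3(2)])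
  have b0: "b 0 \<noteq> 0"
  proof
    assume "b 0 = 0"
    then have "pop b = 0" by (simp add: popS_def ip_def d)
    then show False using b by simp
  qed
  have lower: "pop b / 2 \<le> smp I \<omega> b" if w: "\<omega> \<in> ?A" and I: "I \<subseteq> {1..n}" "I \<noteq> {}" for \<omega> I
  proof -
    have fI: "finite I" by (rule finite_subset[OF I(1)]) simp
    have c: "0 < real (card I)" using I fI by (simp add: card_gt_0_iff)
    have "(\<Sum>i\<in>I. pop b / 2) \<le> (\<Sum>i\<in>I. (g i b \<omega>)\<^sup>2)" using w I by (intro sum_mono) auto
    then show ?thesis using c by (simp add: qf_def power2_eq_square le_divide_eq mult.commute)
  qed
  have out: "\<omega> \<in> A'" "\<omega> \<in> S - N3'" "\<omega> \<in> S" "\<omega> \<notin> N2'" if "\<omega> \<in> S - ((S - A') \<union> (N2' \<union> N3'))"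
    for \<omega> and S A' N2' N3' :: "'w set"
    using that by blast+
  have bound: "pop (fit_gap d U k b I (\<lambda>i. x i \<omega>) (\<lambda>i. e i \<omega>) t) \<le> 2 * pop b + 8 * real n * (4 / q * pop b + E)"
    if w: "\<omega> \<in> space M - ?N" and I: "I \<subseteq> {1..n}" "I \<noteq> {}" and t: "0 \<le> t" for \<omega> I t
  proof -
    note wA = out[OF w]
    have fI: "finite I" by (rule finite_subset[OF I(1)]) simp
    have cmp: "pop v \<le> 2 * smp I \<omega> v" for v
    proof -
      define a where "a = v 0 / b 0"
      have ipv: "ip {..<d} w v = a * ip {..<d} w b" for w using b0 by (simp add: ip_def d a_def)
      have "pop v = a\<^sup>2 * pop b" unfolding popS_def ipv sum_distrib_left by (intro sum.cong refl) (simp add: power_mult_distrib)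
      also have "\<dots> \<le> a\<^sup>2 * (2 * smp I \<omega> b)" using lower[OF wA(1) I] by (intro mult_left_mono) auto
      also have "\<dots> = 2 * smp I \<omega> v" unfolding qf_def ipv by (simp add: sum_distrib_left power2_eq_square mult_ac)
      finally show ?thesis .
    qed
    have "1 \<le> card I" using I fI by (simp add: Suc_le_eq card_gt_0_iff)
    then have "real n * 1 \<le> real n * real (card I)" by (intro mult_left_mono) auto
    then have F: "real n \<le> real n * real (card I)" by simp
    have "pop (fit_gap d U k b I (\<lambda>i. x i \<omega>) (\<lambda>i. e i \<omega>) t)
        \<le> 2 * pop b + 4 * 2 * real n * (smp {1..n} \<omega> b + (\<Sum>i=1..n. (e i \<omega>)\<^sup>2) / n)"
      by (rule fit_gap_energy[OF rule I F _ t cmp]) simp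
    also have "\<dots> \<le> 2 * pop b + 4 * 2 * real n * (4 / q * pop b + E)"
      using wA(3,4) by (intro add_left_mono mult_left_mono add_mono noiseE[OF wA(2)]) auto
    finally show ?thesis by simp
  qed
  have rank: "0 < vec_space.rank d (sample_cov d {1..n} (\<lambda>i. x i \<omega>))" if w: "\<omega> \<in> space M - ?N" for \<omega>
  proof (rule ccontr)
    let ?S = "sample_cov d {1..n} (\<lambda>i. x i \<omega>)"
    assume "\<not> 0 < vec_space.rank d ?S"
    then have r: "vec_space.rank d ?S = 0" by simp
    interpret S: sample_spectrum "{..<d}" "{1..n}" "\<lambda>i. vec_index (x i \<omega>)" "vec_space.rank d ?S" "eigvec d U ?S" "\<lambda>a. (s ?S a)\<^sup>2"
      using n_pos by (intro sample_spectrum_of_rule[OF rule]) auto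
    have "smp {1..n} \<omega> b = 0" unfolding S.spectral r by simp
    moreover have "pop b / 2 \<le> smp {1..n} \<omega> b" by (rule lower[OF out(1)[OF w]]) (use n_pos in auto)
    ultimately show False using b by simp
  qed
  show ?thesis
    by (rule bexI[OF _ mN], intro conjI ballI allI impI pN; (rule bound rank; assumption))
qed

end

section \<open>Blocks, estimators and the passage to the stated quantities\<close>

lemma cv_blocks_subset: "cv_blocks n L B \<Longrightarrow> l \<in> {1..L} \<Longrightarrow> B l \<subseteq> {1..n}"
  unfolding cv_blocks_def by blast

lemma cv_blocks_sizes:
  assumes B: "cv_blocks n L B"
  shows "L \<le> n" and "l \<in> {1..L} \<Longrightarrow> n \<le> 2 * L * card (B l)"
    and "l \<in> {1..L} \<Longrightarrow> 2 \<le> L \<Longrightarrow> {1..n} - B l \<noteq> {}"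
    and "l \<in> {1..L} \<Longrightarrow> 2 \<le> L \<Longrightarrow> 4 \<le> n \<Longrightarrow> n \<le> 4 * card ({1..n} - B l)"
proof -
  have disj: "disjoint_family_on B {1..L}" and cover: "(\<Union>l\<in>{1..L}. B l) = {1..n}"
    and card: "\<And>l. l \<in> {1..L} \<Longrightarrow> B l \<noteq> {}" "\<And>l. l \<in> {1..L} \<Longrightarrow> n div L \<le> card (B l)"
      "\<And>l. l \<in> {1..L} \<Longrightarrow> card (B l) \<le> n div L + 1"
    using B unfolding cv_blocks_def by blast+
  have fin: "finite (B l)" if "l \<in> {1..L}" for l
    by (rule finite_subset[OF cv_blocks_subset[OF B that]]) simp
  have pos: "1 \<le> card (B l)" if "l \<in> {1..L}" for l using card(1)[OF that] fin[OF that] by (simp add: Suc_le_eq card_gt_0_iff)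
  have "L = (\<Sum>l\<in>{1..L}. 1)" by simp
  also have "\<dots> \<le> (\<Sum>l\<in>{1..L}. card (B l))" by (intro sum_mono pos)
  also have "\<dots> = card (\<Union>l\<in>{1..L}. B l)"
    using fin disj by (intro card_UN_disjoint[symmetric]) (auto simp: disjoint_family_on_def)
  also have "\<dots> = n" unfolding cover by simp
  finally show "L \<le> n" .
  show "n \<le> 2 * L * card (B l)" if l: "l \<in> {1..L}"
  proof -
    have "n < L + L * (n div L)" using l by (intro dividend_less_times_div) auto
    also have "\<dots> \<le> L * card (B l) + L * card (B l)"
      by (rule add_mono[OF mult_le_mono2[OF pos[OF l], of L, unfolded mult_1_right] mult_le_mono2[OF card(2)[OF l]]])
    finally show ?thesis by simp
  qed
  show "{1..n} - B l \<noteq> {}" if l: "l \<in> {1..L}" and L: "2 \<le> L"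
  proof -
    define l' where "l' = (if l = 1 then 2 else 1 :: nat)"
    have l': "l' \<in> {1..L}" "l' \<noteq> l" using L by (auto simp: l'_def)
    obtain i where "i \<in> B l'" using card(1)[OF l'(1)] by blast
    moreover have "B l' \<inter> B l = {}" using disj l l' by (auto simp: disjoint_family_on_def)
    ultimately show ?thesis using cv_blocks_subset[OF B l'(1)] by blast
  qed
  \<comment> \<open>A block has at most \<open>n / 2 + 1\<close> elements, which is at most
    \<open>3 * n / 4\<close> for \<open>n \<ge> 4\<close>.\<close>
  show "n \<le> 4 * card ({1..n} - B l)" if l: "l \<in> {1..L}" and L: "2 \<le> L" and n: "4 \<le> n"
  proof -
    have "card ({1..n} - B l) = n - card (B l)"
      using card_Diff_subset[OF fin[OF l] cv_blocks_subset[OF B l]] by simp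
    moreover have "n div L \<le> n div 2" using L by (intro div_le_mono2) auto
    ultimately show ?thesis using card(3)[OF l] n by linarith
  qed
qed

lemma trunc_nct_minus_coord:
  assumes rule: "eigen_rule d U s" and I: "finite I" "I \<noteq> {}" and \<beta>: "\<beta> \<in> carrier_vec d"
    and y: "\<And>i. i \<in> I \<Longrightarrow> y i = xx i \<bullet> \<beta> + ee i" and j: "j < d"
  shows "trunc_nct d U s k I xx y t $ j - \<beta> $ j = fit_gap d U k (vec_index \<beta>) I xx ee t j"
proof -
  have "fit_coord d U k I xx y t j = fit_coord d U k I xx (\<lambda>i. ip {..<d} (vec_index (xx i)) (vec_index \<beta>) + ee i) t j"
    unfolding fit_coord_def using y by (simp add: scalar_prod_eq_ip[OF \<beta>])
  then show ?thesis unfolding fit_gap_def trunc_nct_eq_fit_coord[OF rule I j] by simp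
qed

lemma pred_error_trunc_nct:
  assumes rule: "eigen_rule d U s" and I: "finite I" "I \<noteq> {}" and \<beta>: "\<beta> \<in> carrier_vec d"
    and y: "\<And>i. i \<in> I \<Longrightarrow> y i = xx i \<bullet> \<beta> + ee i"
    and S: "S \<in> carrier_mat d d" "\<And>v. entry_form d S v v = popS d u lam v"
  shows "pred_error S \<beta> (trunc_nct d U s k I xx y t) = popS d u lam (fit_gap d U k (vec_index \<beta>) I xx ee t)"
proof -
  let ?b = "trunc_nct d U s k I xx y t"
  have b: "?b \<in> carrier_vec d" by (rule trunc_nct_eq_lincomb(1)[OF rule I(1)])
  then have c: "?b - \<beta> \<in> carrier_vec d" using \<beta> by simp
  have "pred_error S \<beta> ?b = popS d u lam (vec_index (?b - \<beta>))"
    unfolding pred_error_def mult_mat_vec_form[OF S(1) c c] S(2) ..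
  also have "\<dots> = popS d u lam (fit_gap d U k (vec_index \<beta>) I xx ee t)"
    unfolding popS_def ip_def using trunc_nct_minus_coord[OF rule I \<beta> y] b \<beta>
    by (intro sum.cong refl arg_cong2[where f = "(*)"] arg_cong[where f = "\<lambda>z. z\<^sup>2"]) auto
  finally show ?thesis .
qed

text \<open>Meant for \<open>L = 1\<close>, where the only block is the whole sample and the
  training set is empty: all whitened coefficients are 0, so the threshold has no effect.\<close>

lemma trunc_nct_no_data:
  assumes rule: "eigen_rule d U s"
  shows "trunc_nct d U s k {} xx y t = trunc_nct d U s k {} xx y t'"
proof (rule eq_vecI)
  have c: "trunc_nct d U s k {} xx y t \<in> carrier_vec d" for t
    by (rule trunc_nct_eq_lincomb(1)[OF rule]) simp
  show "dim_vec (trunc_nct d U s k {} xx y t) = dim_vec (trunc_nct d U s k {} xx y t')"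
    using c[of t] c[of t'] by simp
  fix j assume "j < dim_vec (trunc_nct d U s k {} xx y t')"
  then have j: "j < d" using c[of t'] by simp
  show "trunc_nct d U s k {} xx y t $ j = trunc_nct d U s k {} xx y t' $ j"
    unfolding trunc_nct_eq_lincomb(2)[OF rule finite.emptyI j] by (simp add: whitened_coeff_def soft_def)
qed

context random_design
begin

text \<open>Hold-out residuals are the noise minus the inner product of the observation with the
  estimation error; this brings the stated losses into the shape of
  \<open>regret_bound\<close>.\<close>

lemma cv_regret:
  fixes L :: nat and B :: "nat \<Rightarrow> nat set" and \<beta> :: "real Matrix.vec" and t0 R \<tau> \<tau>' :: real
  assumes rule: "eigen_rule d U s" and \<beta>: "\<beta> \<in> carrier_vec d"
    and S: "S \<in> carrier_mat d d" "\<And>v. entry_form d S v v = pop v"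
    and L: "2 \<le> L" and B: "cv_blocks n L B" and w: "\<omega> \<in> space M"
    and y: "\<And>i. i \<in> {1..n} \<Longrightarrow> yy i = x i \<omega> \<bullet> \<beta> + e i \<omega>"
    and bh: "\<And>l t. bh l t = trunc_nct d U s k ({1..n} - B l) (\<lambda>i. x i \<omega>) yy t"
    and \<tau>: "0 \<le> \<tau>" "0 \<le> \<tau>'"
    and opt: "fold_avg L (\<lambda>l. cv_loss (B l) (\<lambda>i. x i \<omega>) yy (bh l \<tau>))
      \<le> fold_avg L (\<lambda>l. cv_loss (B l) (\<lambda>i. x i \<omega>) yy (bh l \<tau>'))"
    and R: "\<And>l \<tau>. l \<in> {1..L} \<Longrightarrow> 0 \<le> \<tau> \<Longrightarrow>
      pop (fit_gap d U k (vec_index \<beta>) ({1..n} - B l) (\<lambda>i. x i \<omega>) (\<lambda>i. e i \<omega>) \<tau>) \<le> R"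
    and E: "(\<Sum>i=1..n. (e i \<omega>)\<^sup>2) / n \<le> R" and t0: "0 < t0"
    and ok: "\<And>l. l \<in> {1..L} \<Longrightarrow> t0 \<le> real (card (B l)) \<Longrightarrow>
      \<not> cv_fails U k (vec_index \<beta>) t0 ({1..n} - B l) (B l) (\<lambda>i. x i \<omega>) (\<lambda>i. x i \<omega>) (\<lambda>i. e i \<omega>)"
  shows "fold_avg L (\<lambda>l. pred_error S \<beta> (bh l \<tau>))
    \<le> fold_avg L (\<lambda>l. pred_error S \<beta> (bh l \<tau>')) + 300 * \<kappa> * R * sqrt (L * t0 / n)"
proof -
  let ?I = "\<lambda>l. {1..n} - B l"
  let ?D = "\<lambda>l \<tau>. fit_gap d U k (vec_index \<beta>) (?I l) (\<lambda>i. x i \<omega>) (\<lambda>i. e i \<omega>) \<tau>"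
  have y': "yy i = x i \<omega> \<bullet> \<beta> + e i \<omega>" if "i \<in> ?I l" for i l using y that by auto
  have Ine: "finite (?I l)" "?I l \<noteq> {}" if "l \<in> {1..L}" for l using cv_blocks_sizes(3)[OF B that L] by auto
  have pe: "pred_error S \<beta> (bh l \<tau>) = pop (?D l \<tau>)" if "l \<in> {1..L}" for l \<tau>
    unfolding bh by (rule pred_error_trunc_nct[OF rule Ine[OF that] \<beta> y' S]) auto
  have loss: "cv_loss (B l) (\<lambda>i. x i \<omega>) yy (bh l \<tau>)
      = (\<Sum>i\<in>B l. (e i \<omega> - ip {..<d} (vec_index (x i \<omega>)) (?D l \<tau>))\<^sup>2) / card (B l)" if l: "l \<in> {1..L}" for l \<tau>
  proof -
    have "yy i - x i \<omega> \<bullet> bh l \<tau> = e i \<omega> - ip {..<d} (vec_index (x i \<omega>)) (?D l \<tau>)" if i: "i \<in> B l" for i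
    proof -
      have i': "i \<in> {1..n}" using cv_blocks_subset[OF B l] i by auto
      have b: "bh l \<tau> \<in> carrier_vec d" unfolding bh by (rule trunc_nct_eq_lincomb(1)[OF rule Ine(1)[OF l]])
      have "ip {..<d} (vec_index (x i \<omega>)) (?D l \<tau>)
          = ip {..<d} (vec_index (x i \<omega>)) (\<lambda>j. bh l \<tau> $ j - \<beta> $ j)"
        unfolding ip_def bh
        by (intro sum.cong refl arg_cong2[where f = "(*)"] trunc_nct_minus_coord[OF rule Ine[OF l] \<beta> y', symmetric]) auto
      also have "\<dots> = x i \<omega> \<bullet> bh l \<tau> - x i \<omega> \<bullet> \<beta>"
        unfolding ip_diff_right scalar_prod_eq_ip[OF b] scalar_prod_eq_ip[OF \<beta>] ..
      finally show ?thesis using y[OF i'] by simp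
    qed
    then show ?thesis unfolding cv_loss_def by simp
  qed
  have cg: "fold_avg L f = fold_avg L f'" if "\<And>l. l \<in> {1..L} \<Longrightarrow> f l = f' l" for f f'
    unfolding fold_avg_def using that by (intro arg_cong2[where f = "(*)"] sum.cong refl) auto
  have e1: "fold_avg L (\<lambda>l. cv_loss (B l) (\<lambda>i. x i \<omega>) yy (bh l \<tau>))
      = fold_avg L (\<lambda>l. (\<Sum>i\<in>B l. (e i \<omega> - ip {..<d} (vec_index (x i \<omega>)) (?D l \<tau>))\<^sup>2) / card (B l))" for \<tau>
    by (rule cg) (rule loss)
  have e2: "fold_avg L (\<lambda>l. pred_error S \<beta> (bh l \<tau>)) = fold_avg L (\<lambda>l. pop (?D l \<tau>))" for \<tau>
    by (rule cg) (rule pe)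
  have "fold_avg L (\<lambda>l. pop (?D l \<tau>)) \<le> fold_avg L (\<lambda>l. pop (?D l \<tau>')) + 300 * \<kappa> * R * sqrt (L * t0 / n)"
  proof (rule regret_bound[where I = ?I and B = B and xx = "\<lambda>i. x i \<omega>" and ee = "\<lambda>i. e i \<omega>" and U = U
      and k = k and b = "vec_index \<beta>" and L = L and R = R and \<tau> = \<tau> and \<tau>' = \<tau>'])
    show "disjoint_family_on B {1..L}" "(\<Union>l\<in>{1..L}. B l) = {1..n}" using B by (simp_all add: cv_blocks_def)
    show "n \<le> 2 * L * card (B l)" if "l \<in> {1..L}" for l by (rule cv_blocks_sizes(2)[OF B that])
    show "fold_avg L (\<lambda>l. (\<Sum>i\<in>B l. (e i \<omega> - ip {..<d} (vec_index (x i \<omega>)) (?D l \<tau>))\<^sup>2) / card (B l))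
      \<le> fold_avg L (\<lambda>l. (\<Sum>i\<in>B l. (e i \<omega> - ip {..<d} (vec_index (x i \<omega>)) (?D l \<tau>'))\<^sup>2) / card (B l))"
      using opt unfolding e1 .
    show "0 < L" using L by simp
    show "pop (?D l \<tau>) \<le> R" if "l \<in> {1..L}" "0 \<le> \<tau>" for l \<tau> by (rule R[OF that])
    show "\<not> cv_fails U k (vec_index \<beta>) t0 (?I l) (B l) (\<lambda>i. x i \<omega>) (\<lambda>i. x i \<omega>) (\<lambda>i. e i \<omega>)"
      if "l \<in> {1..L}" "t0 \<le> real (card (B l))" for l by (rule ok[OF that])
  qed (rule \<tau> E t0)+
  then show ?thesis unfolding e2 .
qed

end

lemma regret_conclusion:
  fixes a a' C C0 G V s w :: real
  assumes "a \<le> a' + C0 * G * s" "0 \<le> a'" "1 \<le> C" "C0 \<le> C" "0 \<le> G" "G \<le> V" "0 \<le> s" "0 \<le> w"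
  shows "a \<le> C * (a' + V * (s + w))"
proof -
  have C: "0 \<le> C" and V: "0 \<le> V" using assms(3,5,6) by linarith+
  have "C0 * G * s \<le> C * V * s" by (rule mult_right_mono[OF mult_mono[OF assms(4,6) C assms(5)] assms(7)])
  moreover have "0 \<le> C * V * w" by (rule mult_nonneg_nonneg[OF mult_nonneg_nonneg[OF C V] assms(8)])
  moreover have "1 * a' \<le> C * a'" by (rule mult_right_mono[OF assms(3,2)])
  moreover have "C * (a' + V * (s + w)) = C * a' + C * V * s + C * V * w" by (simp add: algebra_simps)
  ultimately show ?thesis using assms(1) by linarith
qed

theorem theorem6p1:
  fixes \<alpha> K :: real
  assumes "0 < \<alpha>" and "\<alpha> \<le> 2" and "0 < K"
  shows "\<exists>c>0. \<exists>C>0. \<forall>(M :: 'w measure) (n :: nat) (d :: nat) (\<beta> :: real vec)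
      (x :: nat \<Rightarrow> 'w \<Rightarrow> real vec) (e :: nat \<Rightarrow> 'w \<Rightarrow> real) (y :: nat \<Rightarrow> 'w \<Rightarrow> real)
      (S :: real mat) (W :: real mat) (\<sigma> :: real) (\<delta> :: real) (eps :: real) (L :: nat)
      (B :: nat \<Rightarrow> nat set) (U :: real mat \<Rightarrow> real mat) (s :: real mat \<Rightarrow> nat \<Rightarrow> real)
      (bhat :: nat \<Rightarrow> 'w \<Rightarrow> real \<Rightarrow> real vec) (r :: 'w \<Rightarrow> nat)
      (\<tau>cv :: 'w \<Rightarrow> real) (\<tau>oracle :: 'w \<Rightarrow> real).
    random_design_model M n d \<beta> x e y \<longrightarrow>
    S = covariance_mat M d (x 0) \<longrightarrow>
    \<beta> \<bullet> (S *\<^sub>v \<beta>) > 0 \<longrightarrow>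
    0 < \<sigma> \<longrightarrow>
    vec_psi_norm M \<alpha> n (\<lambda>\<omega>. stack {1..n} (\<lambda>i. e i \<omega>)) \<le> ennreal \<sigma> \<longrightarrow>
    is_inv_sqrt_mat d S W \<longrightarrow>
    vec_psi_norm M 2 d (\<lambda>\<omega>. W *\<^sub>v x 0 \<omega>) \<le> ennreal K \<longrightarrow>
    convex_decay d S \<longrightarrow>
    eff_rank S \<le> real n \<longrightarrow>
    0 < \<delta> \<longrightarrow> \<delta> < 1 \<longrightarrow>
    eps = sqrt (ln (real d / \<delta>) / real n) \<longrightarrow>
    eps \<le> c \<longrightarrow>
    cv_blocks n L B \<longrightarrow>
    eigen_rule d U s \<longrightarrow>
    (\<forall>l \<omega> t. bhat l \<omega> t =
       trunc_nct d U s (trunc_level eps) ({1..n} - B l) (\<lambda>i. x i \<omega>) (\<lambda>i. y i \<omega>) t) \<longrightarrow>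
    (\<forall>\<omega>. r \<omega> = vec_space.rank d (sample_cov d {1..n} (\<lambda>i. x i \<omega>))) \<longrightarrow>
    (\<forall>\<omega>\<in>space M. is_arg_min
       (\<lambda>t. fold_avg L (\<lambda>l. cv_loss (B l) (\<lambda>i. x i \<omega>) (\<lambda>i. y i \<omega>) (bhat l \<omega> t)))
       (\<lambda>t. 0 \<le> t) (\<tau>cv \<omega>)) \<longrightarrow>
    (\<forall>\<omega>\<in>space M. is_arg_min
       (\<lambda>t. fold_avg L (\<lambda>l. fresh_risk M x y (bhat l \<omega> t)))
       (\<lambda>t. 0 \<le> t) (\<tau>oracle \<omega>)) \<longrightarrow>
    (\<exists>A\<in>sets M. measure M A \<ge> 1 - \<delta> \<and> (\<forall>\<omega>\<in>A.
       fold_avg L (\<lambda>l. pred_error S \<beta> (bhat l \<omega> (\<tau>cv \<omega>)))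
       \<le> C * (fold_avg L (\<lambda>l. pred_error S \<beta> (bhat l \<omega> (\<tau>oracle \<omega>)))
            + (spectral_norm S * (l2norm \<beta>)\<^sup>2
                 + \<sigma>\<^sup>2 * ln (2 * real (r \<omega>) / \<delta>) powr (2 / \<alpha>))
              * (sqrt (real L * ln (real L * real (r \<omega>) / \<delta>) / real n)
                 + real L * ln (real L * real (r \<omega>) / \<delta>) powr (2 / \<alpha>) / real n))))"
proof -
  \<comment> \<open>The constants are fixed before the model, while
    \<open>1 \<le> 4 * K\<^sup>2\<close> becomes known only through a model that satisfies the
    hypotheses. The maximum bridges this and later collapses to
    \<open>4 * K\<^sup>2\<close>.\<close>
  define \<kappa>' where "\<kappa>' = max 1 (4 * K\<^sup>2)"
  have k1: "1 \<le> \<kappa>'" by (simp add: \<kappa>'_def)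
  obtain n1 c1 where c1: "0 < (c1 :: real)" and num: "\<And>n d L \<delta>. n1 \<le> n \<Longrightarrow> 0 < d \<Longrightarrow> 0 < L \<Longrightarrow> L \<le> n \<Longrightarrow> 0 < \<delta> \<Longrightarrow> \<delta> < 1 \<Longrightarrow>
    sqrt (ln (real d / \<delta>) / real n) \<le> c1 \<Longrightarrow>
    (let k = min (trunc_level (sqrt (ln (real d / \<delta>) / real n))) d in
      0 < k \<and> 16 * (1024 * \<kappa>') * real k \<le> real n \<and> exp (- real n) \<le> \<delta> / 8 \<and>
      (\<forall>m. n \<le> 4 * m \<longrightarrow> 216 * \<kappa>' * real (min (8 * k) d) * sqrt (ln (16 * real L * (real d)\<^sup>2 / \<delta>) / real m) \<le> 1))"
    using large_sample_numeric[OF k1] by blast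
  define n0 where "n0 = max n1 4"
  \<comment> \<open>A lower bound, uniform over \<open>n \<le> n0\<close>, for the probability that
    all observations have a large square along the target.\<close>
  define q where "q = (1 / (16 * \<kappa>'\<^sup>2)) ^ n0"
  have base: "0 < 1 / (16 * \<kappa>'\<^sup>2)" "1 / (16 * \<kappa>'\<^sup>2) \<le> 1"
  proof -
    have "1 \<le> \<kappa>'\<^sup>2" using k1 by simp
    then have k16: "0 < 16 * \<kappa>'\<^sup>2" "1 \<le> 16 * \<kappa>'\<^sup>2" by linarith+
    show "0 < 1 / (16 * \<kappa>'\<^sup>2)" using k16(1) by simp
    show "1 / (16 * \<kappa>'\<^sup>2) \<le> 1" using k16 by (simp only: divide_le_eq_1_pos)
  qed
  have q: "0 < q" "q \<le> 1" unfolding q_def by (rule zero_less_power[OF base(1)]) (rule power_le_one[OF less_imp_le[OF base(1)] base(2)])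
  have n0: "4 \<le> n0" "n1 \<le> n0" by (auto simp: n0_def)
  define c where "c = min c1 (sqrt (q / (2 * real n0)))"
  have c0: "0 < c" using c1 q n0 by (simp add: c_def)
  \<comment> \<open>\<open>eL\<close> and \<open>eS\<close> compare the noise bounds of the two
    events with \<open>\<sigma>\<^sup>2 * ln (2 / \<delta>) powr (2 / \<alpha>)\<close>.\<close>
  define eL where "eL = 8 * (4 + 4 / \<alpha>) powr (2 / \<alpha>)"
  define eS where "eS = 8 * (2 * ln (8 / q) + 4 / \<alpha>) powr (2 / \<alpha>)"
  \<comment> \<open>\<open>1200 = 300 * 4\<close>, where 4 bounds the root of the factor 11 from
    \<open>log_union_bound\<close>.\<close>
  define CL where "CL = 1200 * \<kappa>' * (10^6 * \<kappa>' * (1 + eL))"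
  define CS where "CS = (2 + 8 * real n0 * (4 / q + eS)) * sqrt (real n0)"
  define C where "C = 1 + CL + CS"
  have e0: "0 \<le> eL" "0 \<le> eS" by (auto simp: eL_def eS_def)
  have C0: "0 \<le> CL" "0 \<le> CS" using k1 e0 q by (auto simp: CL_def CS_def intro!: mult_nonneg_nonneg add_nonneg_nonneg)
  have C1: "1 \<le> C" "CL \<le> C" "CS \<le> C" using C0 by (auto simp: C_def)
  have Cpos: "0 < C" using C1(1) by linarith
  show ?thesis
  proof (rule exI[of _ c], rule conjI[OF c0], rule exI[of _ C], rule conjI[OF Cpos], intro allI impI)
    fix M :: "'w measure" and n d :: nat and \<beta> :: "real vec" and x :: "nat \<Rightarrow> 'w \<Rightarrow> real vec"
      and e y :: "nat \<Rightarrow> 'w \<Rightarrow> real" and S W :: "real mat" and \<sigma> \<delta> eps :: real and L :: nat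
      and B :: "nat \<Rightarrow> nat set" and U :: "real mat \<Rightarrow> real mat" and s :: "real mat \<Rightarrow> nat \<Rightarrow> real"
      and bhat :: "nat \<Rightarrow> 'w \<Rightarrow> real \<Rightarrow> real vec" and r :: "'w \<Rightarrow> nat" and \<tau>cv \<tau>or :: "'w \<Rightarrow> real"
    assume model: "random_design_model M n d \<beta> x e y"
      and S: "S = covariance_mat M d (x 0)" and \<beta>pos: "\<beta> \<bullet> (S *\<^sub>v \<beta>) > 0" and \<sigma>: "0 < \<sigma>"
      and noise: "vec_psi_norm M \<alpha> n (\<lambda>\<omega>. stack {1..n} (\<lambda>i. e i \<omega>)) \<le> ennreal \<sigma>"
      and W: "is_inv_sqrt_mat d S W" and Kx: "vec_psi_norm M 2 d (\<lambda>\<omega>. W *\<^sub>v x 0 \<omega>) \<le> ennreal K"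
      and "convex_decay d S" and "eff_rank S \<le> real n"
      and \<delta>: "0 < \<delta>" "\<delta> < 1" and eps: "eps = sqrt (ln (real d / \<delta>) / real n)" and epsc: "eps \<le> c"
      and B: "cv_blocks n L B" and rule: "eigen_rule d U s"
      and bhat: "\<forall>l \<omega> t. bhat l \<omega> t =
        trunc_nct d U s (trunc_level eps) ({1..n} - B l) (\<lambda>i. x i \<omega>) (\<lambda>i. y i \<omega>) t"
      and r: "\<forall>\<omega>. r \<omega> = vec_space.rank d (sample_cov d {1..n} (\<lambda>i. x i \<omega>))"
      and cv: "\<forall>\<omega>\<in>space M. is_arg_min
        (\<lambda>t. fold_avg L (\<lambda>l. cv_loss (B l) (\<lambda>i. x i \<omega>) (\<lambda>i. y i \<omega>) (bhat l \<omega> t))) (\<lambda>t. 0 \<le> t) (\<tau>cv \<omega>)"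
      and orc: "\<forall>\<omega>\<in>space M. is_arg_min
        (\<lambda>t. fold_avg L (\<lambda>l. fresh_risk M x y (bhat l \<omega> t))) (\<lambda>t. 0 \<le> t) (\<tau>or \<omega>)"
    let ?avg = "\<lambda>\<omega> t. fold_avg L (\<lambda>l. pred_error S \<beta> (bhat l \<omega> t))"
    let ?V = "\<lambda>\<omega>. spectral_norm S * (l2norm \<beta>)\<^sup>2 + \<sigma>\<^sup>2 * ln (2 * real (r \<omega>) / \<delta>) powr (2 / \<alpha>)"
    let ?s = "\<lambda>\<omega>. sqrt (real L * ln (real L * real (r \<omega>) / \<delta>) / real n)"
    let ?w = "\<lambda>\<omega>. real L * ln (real L * real (r \<omega>) / \<delta>) powr (2 / \<alpha>) / real n"
    let ?goal = "\<lambda>\<omega>. ?avg \<omega> (\<tau>cv \<omega>) \<le> C * (?avg \<omega> (\<tau>or \<omega>) + ?V \<omega> * (?s \<omega> + ?w \<omega>))"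
    interpret P: prob_space M using model by (simp add: random_design_model_def)
    have \<beta>c: "\<beta> \<in> carrier_vec d" using model by (simp add: random_design_model_def)
    have Sc: "S \<in> carrier_mat d d" by (simp add: S covariance_mat_def)
    have ymod: "y i \<omega> = x i \<omega> \<bullet> \<beta> + e i \<omega>" if "i \<in> {1..n}" "\<omega> \<in> space M" for i \<omega>
      using model that unfolding random_design_model_def by auto
    have \<tau>0: "0 \<le> \<tau>cv \<omega>" "0 \<le> \<tau>or \<omega>" if "\<omega> \<in> space M" for \<omega>
      using cv orc that by (auto simp: is_arg_min_def)
    \<comment> \<open>Minimality of \<open>\<tau>cv\<close>, with the oracle threshold as the
      competitor.\<close>
    have opt: "fold_avg L (\<lambda>l. cv_loss (B l) (\<lambda>i. x i \<omega>) (\<lambda>i. y i \<omega>) (bhat l \<omega> (\<tau>cv \<omega>)))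
      \<le> fold_avg L (\<lambda>l. cv_loss (B l) (\<lambda>i. x i \<omega>) (\<lambda>i. y i \<omega>) (bhat l \<omega> (\<tau>or \<omega>)))" if "\<omega> \<in> space M" for \<omega>
      using cv \<tau>0(2)[OF that] that unfolding is_arg_min_def by (meson not_le)
    have dpos: "0 < d" using \<beta>pos \<beta>c Sc by (cases "d = 0") (auto simp: scalar_prod_def)
    have event: "\<exists>A\<in>sets M. measure M A \<ge> 1 - \<delta> \<and> (\<forall>\<omega>\<in>A. ?goal \<omega>)"
      if N: "N \<in> P.events" "P.prob N \<le> \<delta>" "\<And>\<omega>. \<omega> \<in> space M - N \<Longrightarrow> ?goal \<omega>" for N
    proof (rule bexI[of _ "space M - N"], intro conjI ballI)
      show "1 - \<delta> \<le> measure M (space M - N)" using P.prob_compl[OF N(1)] N(2) by linarith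
      show "space M - N \<in> sets M" by (rule sets.compl_sets[OF N(1)])
    qed (rule N(3))
    \<comment> \<open>For \<open>L = 0\<close> all fold averages are 0 by division by zero.\<close>
    show "\<exists>A\<in>sets M. measure M A \<ge> 1 - \<delta> \<and> (\<forall>\<omega>\<in>A. ?goal \<omega>)"
    proof (cases "L = 0")
      case True
      show ?thesis by (rule event[of "{}"]) (use True \<delta> in \<open>auto simp: fold_avg_def\<close>)
    next
      case L0: False
      then have npos: "0 < n" using cv_blocks_sizes(1)[OF B] by linarith
      let ?u = "eigvec d U S" and ?lam = "\<lambda>a. (s S a)\<^sup>2"
      note rd = random_design_of_model[OF model S \<sigma> noise assms(1) W assms(3) Kx rule npos dpos]
      interpret random_design M n d x e "4 * K\<^sup>2" ?u ?lam "2 * \<sigma>" \<alpha> by (rule rd(1))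
      note form = rd(2)
      have kk: "\<kappa>' = 4 * K\<^sup>2" unfolding \<kappa>'_def by (rule max_absorb2[OF one_le_kappa])
      define b where "b = vec_index \<beta>"
      have popb: "pop b = \<beta> \<bullet> (S *\<^sub>v \<beta>)" unfolding b_def mult_mat_vec_form[OF Sc \<beta>c \<beta>c] by (rule form[symmetric])
      have popb0: "0 < pop b" using popb \<beta>pos by simp
      have popS: "pop b \<le> spectral_norm S * (l2norm \<beta>)\<^sup>2"
        unfolding popb by (rule quadratic_form_le_spectral_norm[OF Sc \<beta>c])
      have pe0: "0 \<le> pred_error S \<beta> (bhat l \<omega> t)" for l \<omega> t
      proof -
        have "bhat l \<omega> t \<in> carrier_vec d" unfolding bhat[rule_format] by (rule trunc_nct_eq_lincomb(1)[OF rule]) simp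
        then have c: "bhat l \<omega> t - \<beta> \<in> carrier_vec d" using \<beta>c by simp
        show ?thesis unfolding pred_error_def mult_mat_vec_form[OF Sc c c] form by (rule pop_nonneg)
      qed
      have avg0: "0 \<le> ?avg \<omega> t" for \<omega> t
        unfolding fold_avg_def by (intro mult_nonneg_nonneg sum_nonneg pe0) simp
      \<comment> \<open>For \<open>r \<omega> = 0\<close> the value is 0, by the convention for
        \<open>ln 0\<close>.\<close>
      have ln0: "0 \<le> ln (real L * real (r \<omega>) / \<delta>)" for \<omega>
      proof (cases "r \<omega> = 0")
        case False
        have "1 * 1 \<le> real L * real (r \<omega>)" using L0 False by (intro mult_mono) auto
        then have "1 \<le> real L * real (r \<omega>) / \<delta>" using \<delta> by (simp add: le_divide_eq)
        then show ?thesis by simp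
      qed simp
      have s0: "0 \<le> ?s \<omega>" and w0: "0 \<le> ?w \<omega>" for \<omega>
        by (intro real_sqrt_ge_zero divide_nonneg_nonneg mult_nonneg_nonneg ln0; simp)+
      define H where "H = \<sigma>\<^sup>2 * ln (2 / \<delta>) powr (2 / \<alpha>)"
      have H0: "0 \<le> H" by (simp add: H_def)
      have half: "1/2 \<le> ln (2 / \<delta>)"
      proof -
        have "ln 2 \<le> ln (2 / \<delta>)" using \<delta> by (subst ln_le_cancel_iff) (auto simp: le_divide_eq)
        then show ?thesis using ln2_ge_two_thirds by linarith
      qed
      \<comment> \<open>A positive rank only enlarges the logarithm, and positivity holds on either
        good event.\<close>
      have GV: "pop b + H \<le> ?V \<omega>" if "0 < r \<omega>" for \<omega>
      proof -
        have "1 \<le> real (r \<omega>)" using that by simp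
        then have "2 / \<delta> \<le> 2 * real (r \<omega>) / \<delta>" using \<delta> by (intro divide_right_mono) auto
        then have "ln (2 / \<delta>) \<le> ln (2 * real (r \<omega>) / \<delta>)"
          using \<delta> that by (subst ln_le_cancel_iff) auto
        moreover have "0 \<le> ln (2 / \<delta>)" using half by linarith
        ultimately have "ln (2 / \<delta>) powr (2 / \<alpha>) \<le> ln (2 * real (r \<omega>) / \<delta>) powr (2 / \<alpha>)"
          using assms(1) by (intro powr_mono2) auto
        then have "H \<le> \<sigma>\<^sup>2 * ln (2 * real (r \<omega>) / \<delta>) powr (2 / \<alpha>)" unfolding H_def by (intro mult_left_mono) auto
        then show ?thesis using popS by linarith
      qed
      have scale: "2 * (2 * a)\<^sup>2 * (p * p') = 8 * p * (a\<^sup>2 * p')" for a p p' :: real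
        by (simp add: power2_eq_square)
      have G0: "0 \<le> pop b + H" using popb0 H0 by simp
      show ?thesis
      proof (cases "L = 1")
        case True
        have B1: "{1..n} - B 1 = {}" using B unfolding cv_blocks_def True by auto
        have "bhat l \<omega> (\<tau>cv \<omega>) = bhat l \<omega> (\<tau>or \<omega>)" if "l \<in> {1..L}" for l \<omega>
        proof -
          have l: "l = 1" using that True by simp
          show ?thesis unfolding bhat[rule_format] l B1 by (rule trunc_nct_no_data[OF rule])
        qed
        then have "?avg \<omega> (\<tau>cv \<omega>) = ?avg \<omega> (\<tau>or \<omega>)" for \<omega>
          unfolding fold_avg_def by (intro arg_cong2[where f = "(*)"] sum.cong refl) simp
        moreover have "?avg \<omega> (\<tau>or \<omega>) \<le> C * (?avg \<omega> (\<tau>or \<omega>) + ?V \<omega> * (?s \<omega> + ?w \<omega>))" for \<omega>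
        proof -
          have "0 \<le> spectral_norm S * (l2norm \<beta>)\<^sup>2" using popS popb0 by linarith
          then have V: "0 \<le> ?V \<omega>" by simp
          have step: "?avg \<omega> (\<tau>or \<omega>) \<le> ?avg \<omega> (\<tau>or \<omega>) + CL * 0 * ?s \<omega>" by simp
          show ?thesis by (rule regret_conclusion[OF step avg0 C1(1,2) order.refl V s0 w0])
        qed
        ultimately have all: "?goal \<omega>" for \<omega> by (simp only:)
        show ?thesis by (rule event[of "{}"]) (use \<delta> in simp, use \<delta> in simp, rule all)
      next
        case False
        then have L2: "2 \<le> L" using L0 by linarith
        have Ln: "L \<le> n" by (rule cv_blocks_sizes(1)[OF B])
        let ?k = "trunc_level eps"
        show ?thesis
        proof (cases "n0 \<le> n")
          case True
          define E where "E = 2 * (2 * \<sigma>)\<^sup>2 * (ln (16 / \<delta>) + 2 / \<alpha>) powr (2 / \<alpha>)"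
          define R where "R = 10^6 * \<kappa>' * (pop b + E)"
          have E0: "0 \<le> E" by (simp add: E_def)
          have EH: "E \<le> eL * H"
          proof -
            \<comment> \<open>\<open>\<delta> ^ 4 \<le> \<delta>\<close> allows 16 to be written as
              the fourth power of 2, so that only \<open>ln (2 / \<delta>)\<close> appears.\<close>
            have d4: "\<delta> ^ 4 \<le> \<delta>" using power_decreasing[of 1 4 \<delta>] \<delta> by simp
            have "16 / \<delta> \<le> 16 / \<delta> ^ 4" using \<delta> by (intro divide_left_mono[OF d4]) auto
            also have "\<dots> = (2 / \<delta>) ^ 4" by (simp add: power_divide)
            finally have "ln (16 / \<delta>) \<le> ln ((2 / \<delta>) ^ 4)" using \<delta> by (subst ln_le_cancel_iff) auto
            also have "\<dots> = 4 * ln (2 / \<delta>)" using \<delta> by (simp add: ln_realpow)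
            finally have l: "ln (16 / \<delta>) \<le> 4 * ln (2 / \<delta>)" .
            have l0: "0 \<le> ln (16 / \<delta>)" using \<delta> by (simp add: le_divide_eq)
            have "E \<le> 2 * (2 * \<sigma>)\<^sup>2 * ((4 + 4 / \<alpha>) powr (2 / \<alpha>) * ln (2 / \<delta>) powr (2 / \<alpha>))"
              unfolding E_def by (rule mult_left_mono[OF log_shift_le[OF \<delta> assms(1) _ l l0]]) auto
            also have "\<dots> = eL * H" unfolding eL_def H_def by (rule scale)
            finally show ?thesis .
          qed
          have num': "0 < min ?k d" "16 * (1024 * (4 * K\<^sup>2)) * real (min ?k d) \<le> real n" "exp (- real n) \<le> \<delta> / 8"
            "\<And>m. n \<le> 4 * m \<Longrightarrow> 216 * (4 * K\<^sup>2) * real (min (8 * min ?k d) d) * sqrt (ln (16 * real L * (real d)\<^sup>2 / \<delta>) / real m) \<le> 1"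
          proof -
            have h: "n1 \<le> n" "0 < L" "sqrt (ln (real d / \<delta>) / real n) \<le> c1"
              using True n0 L0 epsc unfolding eps c_def by simp_all
            note nm = num[OF h(1) dpos h(2) Ln \<delta> h(3), unfolded Let_def, folded eps, unfolded kk]
            show "0 < min ?k d" "16 * (1024 * (4 * K\<^sup>2)) * real (min ?k d) \<le> real n" "exp (- real n) \<le> \<delta> / 8"
              "\<And>m. n \<le> 4 * m \<Longrightarrow> 216 * (4 * K\<^sup>2) * real (min (8 * min ?k d) d) * sqrt (ln (16 * real L * (real d)\<^sup>2 / \<delta>) / real m) \<le> 1"
              using nm by blast+
          qed
          let ?t0 = "ln (32 * real L * (real (min ?k d) + 1)\<^sup>2 / \<delta>)"
          have n4: "4 \<le> n" using True n0 by linarith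
          obtain N where N: "N \<in> sets M" "measure M N \<le> \<delta>"
            and ev: "\<And>\<omega>. \<omega> \<in> space M - N \<Longrightarrow>
              (\<forall>l\<in>{1..L}. \<forall>t\<ge>0. pop (fit_gap d U ?k b ({1..n} - B l) (\<lambda>i. x i \<omega>) (\<lambda>i. e i \<omega>) t) \<le> R) \<and>
              (\<Sum>i=1..n. (e i \<omega>)\<^sup>2) / n \<le> E \<and>
              min ?k d \<le> 3 * vec_space.rank d (sample_cov d {1..n} (\<lambda>i. x i \<omega>)) \<and>
              (\<forall>l\<in>{1..L}. ?t0 \<le> real (card (B l)) \<longrightarrow>
                \<not> cv_fails U ?k b ?t0 ({1..n} - B l) (B l) (\<lambda>i. x i \<omega>) (\<lambda>i. x i \<omega>) (\<lambda>i. e i \<omega>))"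
          proof -
            have Bne: "B l \<noteq> {}" if "l \<in> {1..L}" for l using B that by (simp add: cv_blocks_def)
            have L1: "0 < L" using L0 by simp
            have R_eq: "R = 10^6 * (4 * K\<^sup>2) * (pop b + E)" by (simp only: R_def kk)
            have ex: "\<exists>N\<in>sets M. measure M N \<le> \<delta> \<and> (\<forall>\<omega>\<in>space M - N.
              (\<forall>l\<in>{1..L}. \<forall>t\<ge>0. pop (fit_gap d U ?k b ({1..n} - B l) (\<lambda>i. x i \<omega>) (\<lambda>i. e i \<omega>) t) \<le> R) \<and>
              (\<Sum>i=1..n. (e i \<omega>)\<^sup>2) / n \<le> E \<and>
              min ?k d \<le> 3 * vec_space.rank d (sample_cov d {1..n} (\<lambda>i. x i \<omega>)) \<and>
              (\<forall>l\<in>{1..L}. ?t0 \<le> real (card (B l)) \<longrightarrow>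
                \<not> cv_fails U ?k b ?t0 ({1..n} - B l) (B l) (\<lambda>i. x i \<omega>) (\<lambda>i. x i \<omega>) (\<lambda>i. e i \<omega>)))"
              unfolding R_eq E_def
              by (rule large_sample_event[OF rule L1 _ _ _ \<delta> num'(1,2,3)], rule cv_blocks_subset[OF B], assumption,
                  rule Bne, assumption, rule cv_blocks_sizes(4)[OF B _ L2 n4], assumption, rule num'(4), assumption)
            show ?thesis
              by (rule bexE[OF ex], erule conjE, rule that, assumption, assumption, erule bspec, assumption)
          qed
          show ?thesis
          proof (rule event[OF N])
            fix \<omega> assume w: "\<omega> \<in> space M - N"
            note ew = ev[OF w]
            have wM: "\<omega> \<in> space M" using w by simp
            have kr: "min ?k d \<le> 3 * r \<omega>" using ew unfolding r[rule_format] by simp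
            then have r0: "0 < r \<omega>" using num'(1) by linarith
            note lub = log_union_bound[OF L2 r0 kr \<delta>]
            have RG: "R \<le> 10^6 * \<kappa>' * (1 + eL) * (pop b + H)"
            proof -
              have "(1 + eL) * (pop b + H) = pop b + H + eL * pop b + eL * H" by (simp add: algebra_simps)
              then have "pop b + E \<le> (1 + eL) * (pop b + H)"
                using EH mult_nonneg_nonneg[OF e0(1) less_imp_le[OF popb0]] H0 by linarith
              then have "10^6 * \<kappa>' * (pop b + E) \<le> 10^6 * \<kappa>' * ((1 + eL) * (pop b + H))"
                using k1 by (intro mult_left_mono) auto
              then show ?thesis unfolding R_def by (simp only: mult.assoc)
            qed
            have ER: "(\<Sum>i=1..n. (e i \<omega>)\<^sup>2) / n \<le> R"
            proof -
              have "1 * (pop b + E) \<le> 10^6 * \<kappa>' * (pop b + E)" using k1 popb0 E0 by (intro mult_right_mono) auto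
              then have "pop b + E \<le> R" unfolding R_def mult_1 .
              then have "E \<le> R" using popb0 by linarith
              then show ?thesis using ew by linarith
            qed
            have reg: "?avg \<omega> (\<tau>cv \<omega>) \<le> ?avg \<omega> (\<tau>or \<omega>) + 300 * (4 * K\<^sup>2) * R * sqrt (L * ?t0 / n)"
            proof (rule cv_regret[where bh = "\<lambda>l t. bhat l \<omega> t" and yy = "\<lambda>i. y i \<omega>" and k = ?k, OF rule \<beta>c Sc form L2 B wM])
              show "y i \<omega> = x i \<omega> \<bullet> \<beta> + e i \<omega>" if "i \<in> {1..n}" for i by (rule ymod[OF that wM])
              show "bhat l \<omega> t = trunc_nct d U s ?k ({1..n} - B l) (\<lambda>i. x i \<omega>) (\<lambda>i. y i \<omega>) t" for l t
                by (rule bhat[rule_format])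
              show "pop (fit_gap d U ?k (vec_index \<beta>) ({1..n} - B l) (\<lambda>i. x i \<omega>) (\<lambda>i. e i \<omega>) t) \<le> R"
                if "l \<in> {1..L}" "0 \<le> t" for l t using ew that unfolding b_def by blast
              show "\<not> cv_fails U ?k (vec_index \<beta>) ?t0 ({1..n} - B l) (B l) (\<lambda>i. x i \<omega>) (\<lambda>i. x i \<omega>) (\<lambda>i. e i \<omega>)"
                if "l \<in> {1..L}" "?t0 \<le> real (card (B l))" for l using ew that unfolding b_def by blast
            qed (rule \<tau>0[OF wM] opt[OF wM] ER lub(1))+
            have step: "?avg \<omega> (\<tau>cv \<omega>) \<le> ?avg \<omega> (\<tau>or \<omega>) + CL * (pop b + H) * ?s \<omega>"
            proof -
              have "300 * (4 * K\<^sup>2) * R * sqrt (L * ?t0 / n)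
                  \<le> 300 * \<kappa>' * (10^6 * \<kappa>' * (1 + eL) * (pop b + H)) * (4 * ?s \<omega>)"
                unfolding kk[symmetric]
              proof (rule mult_mono[OF mult_left_mono[OF RG]])
                \<comment> \<open>11 is rounded up to 16, which has an integer root.\<close>
                have "L * ?t0 / n \<le> 16 * (real L * ln (real L * real (r \<omega>) / \<delta>) / real n)"
                proof -
                  have "L * ?t0 \<le> L * (16 * ln (real L * real (r \<omega>) / \<delta>))"
                    using lub(2) ln0[of \<omega>] by (intro mult_left_mono) auto
                  then have "L * ?t0 / n \<le> L * (16 * ln (real L * real (r \<omega>) / \<delta>)) / n" by (intro divide_right_mono) auto
                  moreover have "L * (16 * z) / n = 16 * (L * z / n)" for z :: real by simp
                  ultimately show ?thesis by (simp only:)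
                qed
                then have "sqrt (L * ?t0 / n) \<le> sqrt (4\<^sup>2 * (real L * ln (real L * real (r \<omega>) / \<delta>) / real n))"
                  by (intro real_sqrt_le_mono) simp
                moreover have "sqrt (4\<^sup>2 * z) = 4 * sqrt z" for z :: real by (simp add: real_sqrt_mult)
                ultimately show "sqrt (L * ?t0 / n) \<le> 4 * ?s \<omega>" by (simp only:)
                show "0 \<le> sqrt (L * ?t0 / n)" using lub(1) by simp
                show "0 \<le> 300 * \<kappa>'" using k1 by simp
                show "0 \<le> 300 * \<kappa>' * (10^6 * \<kappa>' * (1 + eL) * (pop b + H))"
                  using k1 e0(1) G0 by (intro mult_nonneg_nonneg) auto
              qed
              also have "\<dots> = CL * (pop b + H) * ?s \<omega>"
              proof -
                have "300 * k * (m * k * c * g) * (4 * z) = 1200 * k * (m * k * c) * g * z" for k m c g z :: real by simp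
                then show ?thesis unfolding CL_def .
              qed
              finally show ?thesis using reg by linarith
            qed
            show "?goal \<omega>" by (rule regret_conclusion[OF step avg0 C1(1,2) G0 GV[OF r0] s0 w0])
          qed
        next
          case False
          then have nn: "n \<le> n0" by simp
          have "sqrt (ln (real d / \<delta>) / real n) \<le> sqrt (q / (2 * real n0))" using epsc eps by (simp add: c_def)
          note small = small_sample_numeric[OF q npos nn dpos \<delta> this]
          define E where "E = 2 * (2 * \<sigma>)\<^sup>2 * (ln (8 / q) + 2 / \<alpha>) powr (2 / \<alpha>)"
          have EH: "E \<le> eS * H"
          proof -
            have l0: "0 \<le> ln (8 / q)" using q by (simp add: le_divide_eq)
            have "2 * ln (8 / q) * (1/2) \<le> 2 * ln (8 / q) * ln (2 / \<delta>)" using half l0 by (intro mult_left_mono) auto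
            then have l: "ln (8 / q) \<le> 2 * ln (8 / q) * ln (2 / \<delta>)" by simp
            have "E \<le> 2 * (2 * \<sigma>)\<^sup>2 * ((2 * ln (8 / q) + 4 / \<alpha>) powr (2 / \<alpha>) * ln (2 / \<delta>) powr (2 / \<alpha>))"
              unfolding E_def using l0 by (intro mult_left_mono log_shift_le[OF \<delta> assms(1) _ l]) auto
            also have "\<dots> = eS * H" unfolding eS_def H_def by (rule scale)
            finally show ?thesis .
          qed
          have qn: "q \<le> (1 / (16 * (4 * K\<^sup>2)\<^sup>2)) ^ n"
            unfolding q_def kk[symmetric] using base nn by (intro power_decreasing) auto
          obtain N where N: "N \<in> sets M" "measure M N \<le> 1 - q / 2"
            and ev: "\<And>\<omega>. \<omega> \<in> space M - N \<Longrightarrow> (\<forall>I t. I \<subseteq> {1..n} \<longrightarrow> I \<noteq> {} \<longrightarrow> 0 \<le> t \<longrightarrow>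
              pop (fit_gap d U ?k b I (\<lambda>i. x i \<omega>) (\<lambda>i. e i \<omega>) t) \<le> 2 * pop b + 8 * real n * (4 / q * pop b + E)) \<and>
              0 < vec_space.rank d (sample_cov d {1..n} (\<lambda>i. x i \<omega>))"
            by (rule bexE[OF small_sample_event[OF rule small(1) popb0 q qn, where k = ?k, folded E_def]],
                erule conjE, rule that, assumption, assumption, erule bspec, assumption)
          \<comment> \<open>Since \<open>1 - q / 2 \<le> \<delta>\<close>, an event of probability
            \<open>q / 2\<close> is all that has to be provided.\<close>
          show ?thesis
          proof (rule event[OF N(1) order.trans[OF N(2) small(2)]])
            fix \<omega> assume w: "\<omega> \<in> space M - N"
            note ew = ev[OF w]
            have wM: "\<omega> \<in> space M" using w by simp
            have r0: "0 < r \<omega>" using ew unfolding r[rule_format] by simp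
            let ?R = "2 * pop b + 8 * real n * (4 / q * pop b + E)"
            have "?avg \<omega> (\<tau>cv \<omega>) \<le> fold_avg L (\<lambda>l. ?R)"
            proof (rule fold_avg_mono)
              fix l assume l: "l \<in> {1..L}"
              have I: "finite ({1..n} - B l)" "{1..n} - B l \<noteq> {}"
                by simp (rule cv_blocks_sizes(3)[OF B l L2])
              have "pred_error S \<beta> (bhat l \<omega> (\<tau>cv \<omega>))
                  = pop (fit_gap d U ?k b ({1..n} - B l) (\<lambda>i. x i \<omega>) (\<lambda>i. e i \<omega>) (\<tau>cv \<omega>))"
                unfolding bhat[rule_format] b_def
                by (rule pred_error_trunc_nct[OF rule I \<beta>c _ Sc form]) (use ymod[OF _ wM] in auto)
              also have "\<dots> \<le> ?R"
                by (rule ew[THEN conjunct1, rule_format, OF _ I(2) \<tau>0(1)[OF wM]]) blast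
              finally show "pred_error S \<beta> (bhat l \<omega> (\<tau>cv \<omega>)) \<le> ?R" .
            qed
            also have "\<dots> = ?R" using L0 by (simp add: fold_avg_const)
            also have "\<dots> \<le> (2 + 8 * real n0 * (4 / q + eS)) * (pop b + H)"
            proof -
              have q4: "0 \<le> 4 / q" using q by simp
              have "(a + eS) * (pop b + H) = a * pop b + a * H + eS * pop b + eS * H" for a by (simp add: algebra_simps)
              from this[of "4 / q"] have le: "4 / q * pop b + E \<le> (4 / q + eS) * (pop b + H)"
                using EH mult_nonneg_nonneg[OF e0(2) less_imp_le[OF popb0]] mult_nonneg_nonneg[OF q4 H0] by linarith
              have "0 \<le> E" by (simp add: E_def)
              then have nonneg: "0 \<le> 4 / q * pop b + E"
                using mult_nonneg_nonneg[OF q4 less_imp_le[OF popb0]] by linarith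
              have s1: "8 * real n * (4 / q * pop b + E) \<le> 8 * real n0 * ((4 / q + eS) * (pop b + H))"
                by (rule mult_mono[OF _ le _ nonneg]) (use nn in auto)
              have s2: "2 * pop b \<le> 2 * (pop b + H)" using H0 by simp
              have eq: "(2 + 8 * N * a) * g = 2 * g + 8 * N * (a * g)" for N a g :: real by (simp add: algebra_simps)
              show ?thesis unfolding eq by (rule add_mono[OF s2 s1])
            qed
            \<comment> \<open>For \<open>n \<le> n0\<close> the rate \<open>?s \<omega>\<close> is
              at least \<open>1 / sqrt n0\<close>, because
              \<open>L * ln (L * r / \<delta>) \<ge> 1\<close> for \<open>L \<ge> 2\<close>; a
              bounded multiple of \<open>pop b + H\<close> is thus already of the required
              order.\<close>
            also have "\<dots> \<le> (2 + 8 * real n0 * (4 / q + eS)) * (pop b + H) * (sqrt (real n0) * ?s \<omega>)"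
            proof -
              have kr: "0 \<le> 3 * r \<omega>" by simp
              have "1 \<le> real L * ln (real L * real (r \<omega>) / \<delta>)" by (rule log_union_bound(3)[OF L2 r0 kr \<delta>])
              then have "1 / real n \<le> real L * ln (real L * real (r \<omega>) / \<delta>) / real n" by (intro divide_right_mono) auto
              then have "real n0 * (1 / real n) \<le> real n0 * (real L * ln (real L * real (r \<omega>) / \<delta>) / real n)" by (intro mult_left_mono) auto
              moreover have "1 \<le> real n0 * (1 / real n)" using nn npos by (simp add: le_divide_eq)
              ultimately have "sqrt 1 \<le> sqrt (real n0 * (real L * ln (real L * real (r \<omega>) / \<delta>) / real n))"
                by (intro real_sqrt_le_mono) linarith
              then have h: "1 \<le> sqrt (real n0) * ?s \<omega>" by (simp only: real_sqrt_mult real_sqrt_one)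
              have "0 \<le> (2 + 8 * real n0 * (4 / q + eS)) * (pop b + H)" using G0 e0 q by (intro mult_nonneg_nonneg) auto
              from mult_left_mono[OF h this] show ?thesis by (simp only: mult_1_right)
            qed
            also have "\<dots> = CS * (pop b + H) * ?s \<omega>"
            proof -
              have "a * g * (p * z) = a * p * g * z" for a g p z :: real by simp
              then show ?thesis unfolding CS_def .
            qed
            finally have fin: "?avg \<omega> (\<tau>cv \<omega>) \<le> CS * (pop b + H) * ?s \<omega>" .
            have step: "?avg \<omega> (\<tau>cv \<omega>) \<le> ?avg \<omega> (\<tau>or \<omega>) + CS * (pop b + H) * ?s \<omega>"
              using fin avg0[of \<omega> "\<tau>or \<omega>"] by linarith
            show "?goal \<omega>" by (rule regret_conclusion[OF step avg0 C1(1,3) G0 GV[OF r0] s0 w0])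
          qed
        qed
      qed
    qed
  qed
qed

end
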